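(* Let $\Omega\Subset \mathbb C^N$ be an irreducible bounded symmetric domain of classical type and of rank $\ge 2$ such that $\Omega\not\cong D^{\mathrm{IV}}_n$ for any $n\ge 3$. Then, for some $\alpha\in(0,1)$, there is a family of holomorphic isometries $F_{\zeta}:(\Delta,g_\Delta)\to (\Omega,g_\Omega)$, indexed by $\zeta\in\mathbb C$ with $\alpha<|\zeta|<1$, such that $F_\zeta$ and $F_{\zeta'}$ are incongruent to each other provided that $|\zeta|\neq |\zeta'|$. In particular, there exists a real $1$-parameter family of mutually incongruent holomorphic isometries $\widetilde F_t:(\Delta,g_\Delta)\to (\Omega,g_\Omega)$, $t\in \mathbb R$.
   Context: $\Delta\subset\mathbb C$ is the open unit disk. The irreducible bounded symmetric domains of classical type are, up to biholomorphism ($\cong$), $D^{\mathrm I}_{p,q}=\{Z\in M(p,q;\mathbb C): {\bf I_q}-\overline Z^TZ>0\}$ ($p,q\ge1$), $D^{\mathrm{II}}_m=\{Z\in D^{\mathrm I}_{m,m}:Z=-Z^T\}$ ($m\ge2$), $D^{\mathrm{III}}_m=\{Z\in D^{\mathrm I}_{m,m}:Z=Z^T\}$ ($m\ge1$), and $D^{\mathrm{IV}}_n=\{z\in\mathbb C^n:\sum_j|z_j|^2<2,\ \sum_j|z_j|^2<1+|\frac12\sum_j z_j^2|^2\}$ ($n\ge3$). For an irreducible bounded symmetric domain $D$, $g_D$ denotes the canonical Kähler–Einstein metric, normalized so that minimal disks (the totally geodesic holomorphic disks of most negative curvature) have constant Gaussian curvature $-2$; for $D=\Delta$ the Kähler form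 of $g_\Delta$ is $-\sqrt{-1}\,\partial\overline\partial\log(1-|z|^2)$. A holomorphic map $F:\Delta\to\Omega$ is a holomorphic isometry $(\Delta,g_\Delta)\to(\Omega,g_\Omega)$ if $F^*g_\Omega=g_\Delta$. Two such isometries $F_1,F_2$ are congruent if $F_1=\Psi\circ F_2\circ\phi$ for some $\phi\in\mathrm{Aut}(\Delta)$, $\Psi\in\mathrm{Aut}(\Omega)$, and incongruent otherwise; a family is mutually incongruent if members with distinct parameters are incongruent. *)

theory Defs
  imports "HOL-Analysis.Analysis"
begin

text \<open>The analysis library treats holomorphy for functions of one variable only. The class below
  provides the complex scalar multiplication that is common to the complex plane, to
  \<^typ>\<open>complex^'n\<close> and to the matrix spaces \<^typ>\<open>complex^'q^'p\<close>.\<close>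

class complex_normed = real_normed_vector +
  fixes scaleC :: "complex \<Rightarrow> 'a \<Rightarrow> 'a"  (infixr "*\<^sub>C" 75)
  assumes scaleC_add_right: "a *\<^sub>C (x + y) = a *\<^sub>C x + a *\<^sub>C y"
    and scaleC_add_left: "(a + b) *\<^sub>C x = a *\<^sub>C x + b *\<^sub>C x"
    and scaleC_scaleC: "a *\<^sub>C (b *\<^sub>C x) = (a * b) *\<^sub>C x"
    and scaleC_of_real: "complex_of_real r *\<^sub>C x = r *\<^sub>R x"

instantiation complex :: complex_normed
begin

definition scaleC_complex_def: "(a::complex) *\<^sub>C (x::complex) = a * x"

instance
  by standard (simp_all add: scaleC_complex_def algebra_simps scaleR_conv_of_real)

end

instantiation vec :: (complex_normed, finite) complex_normed
begin

definition scaleC_vec_def: "(a::complex) *\<^sub>C (x::'a^'b) = (\<chi> i. a *\<^sub>C (x $ i))"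

instance
  by standard
    (simp_all add: scaleC_vec_def vec_eq_iff scaleC_add_right scaleC_add_left scaleC_scaleC
      scaleC_of_real)

end

lemma scaleC_eq_vector_scalar_mult: "a *\<^sub>C (x::complex^'n) = a *s x"
  by (simp add: scaleC_vec_def scaleC_complex_def vec_eq_iff)

text \<open>Derivatives are taken within \<open>S\<close>, so that the notion also makes sense for a relatively open
  subset \<open>S\<close> of a complex linear subspace, such as the skew-symmetric matrices.\<close>

definition holomorphic_map_on ::
    "('a::complex_normed \<Rightarrow> 'b::complex_normed) \<Rightarrow> 'a set \<Rightarrow> bool" where
  "holomorphic_map_on f S \<longleftrightarrow>
     (\<forall>x\<in>S. \<exists>D. (f has_derivative D) (at x within S) \<and> (\<forall>v. D (\<i> *\<^sub>C v) = \<i> *\<^sub>C D v))"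

definition biholomorphism ::
    "('a::complex_normed \<Rightarrow> 'b::complex_normed) \<Rightarrow> 'a set \<Rightarrow> 'b set \<Rightarrow> bool" where
  "biholomorphism f S T \<longleftrightarrow>
     bij_betw f S T \<and> holomorphic_map_on f S \<and> holomorphic_map_on (inv_into S f) T"

definition biholomorphic ::
    "'a::complex_normed set \<Rightarrow> 'b::complex_normed set \<Rightarrow> bool"  (infix "\<cong>\<^sub>h" 50) where
  "S \<cong>\<^sub>h T \<longleftrightarrow> (\<exists>f. biholomorphism f S T)"

definition Aut :: "'a::complex_normed set \<Rightarrow> ('a \<Rightarrow> 'a) set" where
  "Aut S = {f. biholomorphism f S S}"

definition herm :: "complex^'n^'n \<Rightarrow> complex^'n \<Rightarrow> complex^'n \<Rightarrow> complex" where
  "herm A u v = (\<Sum>i\<in>UNIV. \<Sum>j\<in>UNIV. A $ i $ j * u $ i * cnj (v $ j))"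

definition pos_def :: "complex^'n^'n \<Rightarrow> bool" where
  "pos_def A \<longleftrightarrow>
     (\<forall>i j. A $ j $ i = cnj (A $ i $ j)) \<and> (\<forall>v. v \<noteq> 0 \<longrightarrow> 0 < Re (herm A v v))"

definition adjoint_mat :: "complex^'q^'p \<Rightarrow> complex^'p^'q" where
  "adjoint_mat Z = (\<chi> i j. cnj (Z $ j $ i))"

text \<open>\<^typ>\<open>complex^'q^'p\<close> is the space of \<open>p \<times> q\<close> matrices.\<close>

definition D_I :: "(complex^'q^'p) set" where
  "D_I = {Z. pos_def (mat 1 - adjoint_mat Z ** Z)}"

definition D_II :: "(complex^'m^'m) set" where
  "D_II = {Z \<in> D_I. Z = - transpose Z}"

definition D_III :: "(complex^'m^'m) set" where
  "D_III = {Z \<in> D_I. Z = transpose Z}"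

definition D_IV :: "(complex^'n) set" where
  "D_IV = {z. (\<Sum>j\<in>UNIV. (cmod (z $ j))\<^sup>2) < 2 \<and>
              (\<Sum>j\<in>UNIV. (cmod (z $ j))\<^sup>2) < 1 + (cmod (1/2 * (\<Sum>j\<in>UNIV. (z $ j)\<^sup>2)))\<^sup>2}"

text \<open>Biholomorphic domains have the same dimension. Hence a domain in \<^typ>\<open>complex^'n\<close> is
  biholomorphic to a domain of type IV of some dimension if and only if it is biholomorphic to
  \<open>D_IV :: (complex^'n) set\<close>; this suffices to exclude type IV in every dimension.\<close>

abbreviation unit_disk :: "complex set"  ("\<Delta>") where
  "\<Delta> \<equiv> ball 0 1"

fun Ck_on :: "nat \<Rightarrow> 'a::real_normed_vector set \<Rightarrow> ('a \<Rightarrow> 'b::real_normed_vector) \<Rightarrow> bool" where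
  "Ck_on 0 S f \<longleftrightarrow> continuous_on S f"
| "Ck_on (Suc k) S f \<longleftrightarrow>
     (\<forall>x\<in>S. f differentiable at x) \<and> (\<forall>v. Ck_on k S (\<lambda>x. frechet_derivative f (at x) v))"

definition smooth_on :: "'a::real_normed_vector set \<Rightarrow> ('a \<Rightarrow> 'b::real_normed_vector) \<Rightarrow> bool" where
  "smooth_on S f \<longleftrightarrow> (\<forall>k. Ck_on k S f)"

text \<open>The Wirtinger derivatives: \<open>\<partial>/\<partial>z\<^sub>i\<close> and its conjugate in the direction \<open>v = axis i 1\<close> of
  \<^typ>\<open>complex^'n\<close>, or \<open>\<partial>/\<partial>z\<close> and its conjugate for \<open>v = 1\<close> in \<^typ>\<open>complex\<close>.\<close>

definition wirtinger :: "'a::complex_normed \<Rightarrow> ('a \<Rightarrow> complex) \<Rightarrow> 'a \<Rightarrow> complex" where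
  "wirtinger v f x =
     (frechet_derivative f (at x) v - \<i> * frechet_derivative f (at x) (\<i> *\<^sub>C v)) / 2"

definition wirtinger_bar :: "'a::complex_normed \<Rightarrow> ('a \<Rightarrow> complex) \<Rightarrow> 'a \<Rightarrow> complex" where
  "wirtinger_bar v f x =
     (frechet_derivative f (at x) v + \<i> * frechet_derivative f (at x) (\<i> *\<^sub>C v)) / 2"

definition ddbar ::
    "('a::complex_normed \<Rightarrow> real) \<Rightarrow> 'a \<Rightarrow> 'a \<Rightarrow> 'a \<Rightarrow> complex" where
  "ddbar f x u v = wirtinger u (wirtinger_bar v (\<lambda>y. complex_of_real (f y))) x"

definition cderiv :: "(complex \<Rightarrow> 'a::complex_normed) \<Rightarrow> complex \<Rightarrow> 'a" where
  "cderiv f z = frechet_derivative f (at z) 1"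

text \<open>A Hermitian metric \<open>g\<close> on an open subset of \<^typ>\<open>complex^'n\<close> is given by its coefficient
  matrix: \<open>g x $ i $ j\<close> is the coefficient of \<open>dz\<^sub>i \<otimes> d\<zeta>\<^sub>j\<close>, where \<open>\<zeta>\<^sub>j\<close> is the conjugate of \<open>z\<^sub>j\<close>. The
  associated form is \<open>\<i> \<Sum> g\<^sub>i\<^sub>j dz\<^sub>i \<and> d\<zeta>\<^sub>j\<close> and the Riemannian metric is \<open>2 Re (\<Sum> g\<^sub>i\<^sub>j dz\<^sub>i \<otimes> d\<zeta>\<^sub>j)\<close>. In one
  variable, \<open>h\<close> thus stands for the Riemannian metric \<open>2 h |dz|\<^sup>2\<close>.\<close>

definition hermitian_metric_on :: "(complex^'n) set \<Rightarrow> (complex^'n \<Rightarrow> complex^'n^'n) \<Rightarrow> bool" where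
  "hermitian_metric_on \<Omega> g \<longleftrightarrow>
     (\<forall>x\<in>\<Omega>. pos_def (g x)) \<and> (\<forall>i j. smooth_on \<Omega> (\<lambda>x. g x $ i $ j))"

text \<open>The Kaehler condition says that the associated form is closed.\<close>

definition kaehler_on :: "(complex^'n) set \<Rightarrow> (complex^'n \<Rightarrow> complex^'n^'n) \<Rightarrow> bool" where
  "kaehler_on \<Omega> g \<longleftrightarrow> hermitian_metric_on \<Omega> g \<and>
     (\<forall>x\<in>\<Omega>. \<forall>i j k. wirtinger (axis k 1) (\<lambda>y. g y $ i $ j) x =
                    wirtinger (axis i 1) (\<lambda>y. g y $ k $ j) x)"

definition ricci :: "(complex^'n \<Rightarrow> complex^'n^'n) \<Rightarrow> complex^'n \<Rightarrow> complex^'n^'n" where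
  "ricci g x = (\<chi> i j. - ddbar (\<lambda>y. ln (Re (det (g y)))) x (axis i 1) (axis j 1))"

definition kaehler_einstein_on :: "(complex^'n) set \<Rightarrow> (complex^'n \<Rightarrow> complex^'n^'n) \<Rightarrow> bool" where
  "kaehler_einstein_on \<Omega> g \<longleftrightarrow> kaehler_on \<Omega> g \<and> (\<exists>c::real. \<forall>x\<in>\<Omega>. ricci g x = c *\<^sub>R g x)"

definition Aut_invariant :: "(complex^'n) set \<Rightarrow> (complex^'n \<Rightarrow> complex^'n^'n) \<Rightarrow> bool" where
  "Aut_invariant \<Omega> g \<longleftrightarrow>
     (\<forall>\<Psi>\<in>Aut \<Omega>. \<forall>x\<in>\<Omega>. \<forall>u v.
        herm (g (\<Psi> x)) (frechet_derivative \<Psi> (at x) u) (frechet_derivative \<Psi> (at x) v) =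
        herm (g x) u v)"

text \<open>For a Kaehler metric the only Christoffel symbols are
  \<open>\<Gamma>\<^sup>k\<^sub>i\<^sub>j = \<Sum>\<^sub>l g\<^sup>k\<^sup>l \<partial>\<^sub>i g\<^sub>j\<^sub>l\<close>, where \<open>\<Sum>\<^sub>l g\<^sup>k\<^sup>l g\<^sub>j\<^sub>l = \<delta>\<^sub>k\<^sub>j\<close>, and their conjugates. Below,
  \<open>christoffel g x u v\<close> is the vector with components \<open>\<Sum>\<^sub>i\<^sub>j \<Gamma>\<^sup>k\<^sub>i\<^sub>j u\<^sub>i v\<^sub>j\<close>.\<close>

definition christoffel ::
    "(complex^'n \<Rightarrow> complex^'n^'n) \<Rightarrow> complex^'n \<Rightarrow> complex^'n \<Rightarrow> complex^'n \<Rightarrow> complex^'n" where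
  "christoffel g x u v =
     (\<chi> k. \<Sum>i\<in>UNIV. \<Sum>j\<in>UNIV. \<Sum>l\<in>UNIV.
        matrix_inv (g x) $ l $ k * wirtinger (axis i 1) (\<lambda>y. g y $ j $ l) x * u $ i * v $ j)"

definition pullback ::
    "(complex \<Rightarrow> complex^'n) \<Rightarrow> (complex^'n \<Rightarrow> complex^'n^'n) \<Rightarrow> complex \<Rightarrow> real" where
  "pullback F g z = Re (herm (g (F z)) (cderiv F z) (cderiv F z))"

text \<open>The Gaussian curvature of the metric \<open>2 h |dz|\<^sup>2\<close>.\<close>

definition gaussian_curvature :: "(complex \<Rightarrow> real) \<Rightarrow> complex \<Rightarrow> real" where
  "gaussian_curvature h z = - Re (ddbar (\<lambda>w. ln (h w)) z 1 1) / h z"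

text \<open>A holomorphic immersion of the disk is totally geodesic if its second fundamental form
  vanishes, that is, if the covariant derivative of the tangent field \<open>f'\<close> is tangential.\<close>

definition totally_geodesic_disk ::
    "(complex^'n) set \<Rightarrow> (complex^'n \<Rightarrow> complex^'n^'n) \<Rightarrow> (complex \<Rightarrow> complex^'n) \<Rightarrow> bool" where
  "totally_geodesic_disk \<Omega> g f \<longleftrightarrow>
     holomorphic_map_on f \<Delta> \<and> f ` \<Delta> \<subseteq> \<Omega> \<and>
     (\<forall>z\<in>\<Delta>. cderiv f z \<noteq> 0 \<and>
        (\<exists>a. cderiv (cderiv f) z + christoffel g (f z) (cderiv f z) (cderiv f z) =
             a *\<^sub>C cderiv f z))"

definition minimal_disk ::
    "(complex^'n) set \<Rightarrow> (complex^'n \<Rightarrow> complex^'n^'n) \<Rightarrow> (complex \<Rightarrow> complex^'n) \<Rightarrow> bool" where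
  "minimal_disk \<Omega> g f \<longleftrightarrow>
     totally_geodesic_disk \<Omega> g f \<and>
     (\<forall>f'. totally_geodesic_disk \<Omega> g f' \<longrightarrow>
        (\<forall>z\<in>\<Delta>. \<forall>w\<in>\<Delta>. gaussian_curvature (pullback f g) z \<le> gaussian_curvature (pullback f' g) w))"

text \<open>On an irreducible bounded symmetric domain the metric is determined uniquely by the following
  conditions: the \<open>Aut \<Omega>\<close>-invariant Kaehler metrics form a single family up to positive constants,
  and the constant is fixed by the curvature of the minimal disks.\<close>

definition canonical_metric :: "(complex^'n) set \<Rightarrow> (complex^'n \<Rightarrow> complex^'n^'n) \<Rightarrow> bool" where
  "canonical_metric \<Omega> g \<longleftrightarrow>
     kaehler_einstein_on \<Omega> g \<and> Aut_invariant \<Omega> g \<and>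
     (\<exists>f. minimal_disk \<Omega> g f) \<and>
     (\<forall>f. minimal_disk \<Omega> g f \<longrightarrow> (\<forall>z\<in>\<Delta>. gaussian_curvature (pullback f g) z = -2))"

definition geodesic ::
    "(complex^'n) set \<Rightarrow> (complex^'n \<Rightarrow> complex^'n^'n) \<Rightarrow> (real \<Rightarrow> complex^'n) \<Rightarrow> bool" where
  "geodesic \<Omega> g c \<longleftrightarrow> range c \<subseteq> \<Omega> \<and>
     (\<exists>c' c''. \<forall>t. (c has_vector_derivative c' t) (at t) \<and>
                   (c' has_vector_derivative c'' t) (at t) \<and>
                   c'' t + christoffel g (c t) (c' t) (c' t) = 0)"

text \<open>A totally geodesic isometric immersion of the Euclidean space \<open>V\<close>: it maps the affine lines of
  \<open>V\<close> to geodesics and, by polarization of the second condition, preserves inner products. The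
  Euclidean space is a real subspace of \<^typ>\<open>complex^'n\<close>, which is no restriction of its
  dimension: an immersed submanifold of \<open>\<Omega>\<close> has at most this real dimension.\<close>

definition flat_on ::
    "(complex^'n) set \<Rightarrow> (complex^'n \<Rightarrow> complex^'n^'n) \<Rightarrow> (complex^'n) set \<Rightarrow>
     (complex^'n \<Rightarrow> complex^'n) \<Rightarrow> bool" where
  "flat_on \<Omega> g V \<phi> \<longleftrightarrow>
     subspace V \<and> \<phi> differentiable_on V \<and>
     (\<forall>u\<in>V. \<forall>v\<in>V.
        geodesic \<Omega> g (\<lambda>t. \<phi> (u + t *\<^sub>R v)) \<and>
        (\<forall>t. let c' = vector_derivative (\<lambda>t. \<phi> (u + t *\<^sub>R v)) (at t)
             in Re (herm (g (\<phi> (u + t *\<^sub>R v))) c' c') = (norm v)\<^sup>2))"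

text \<open>The rank of a symmetric space: the maximal (real) dimension of a flat.\<close>

definition rank_of :: "(complex^'n) set \<Rightarrow> (complex^'n \<Rightarrow> complex^'n^'n) \<Rightarrow> nat" where
  "rank_of \<Omega> g = Max {dim V | V. \<exists>\<phi>. flat_on \<Omega> g V \<phi>}"

definition disk_metric :: "complex \<Rightarrow> real" where
  "disk_metric z = Re (ddbar (\<lambda>w. - ln (1 - (cmod w)\<^sup>2)) z 1 1)"

definition holomorphic_isometry ::
    "(complex^'n) set \<Rightarrow> (complex^'n \<Rightarrow> complex^'n^'n) \<Rightarrow> (complex \<Rightarrow> complex^'n) \<Rightarrow> bool" where
  "holomorphic_isometry \<Omega> g F \<longleftrightarrow>
     holomorphic_map_on F \<Delta> \<and> F ` \<Delta> \<subseteq> \<Omega> \<and> (\<forall>z\<in>\<Delta>. pullback F g z = disk_metric z)"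

text \<open>Maps are compared on the disk only; their values elsewhere are irrelevant.\<close>

definition congruent_maps ::
    "(complex^'n) set \<Rightarrow> (complex \<Rightarrow> complex^'n) \<Rightarrow> (complex \<Rightarrow> complex^'n) \<Rightarrow> bool" where
  "congruent_maps \<Omega> F\<^sub>1 F\<^sub>2 \<longleftrightarrow> (\<exists>\<phi>\<in>Aut \<Delta>. \<exists>\<Psi>\<in>Aut \<Omega>. \<forall>z\<in>\<Delta>. F\<^sub>1 z = \<Psi> (F\<^sub>2 (\<phi> z)))"

end

theory Submission
  imports Defs "HOL-Complex_Analysis.Conformal_Mappings"
begin

text \<open>In matrix coordinates centred at a point, the invariant metric is a multiple of the
  Hilbert--Schmidt inner product because the isotropy group acts irreducibly, and the curvature of
  minimal disks fixes the multiple. If the triple product satisfies the rank one identity, the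
  domain is complex hyperbolic and \<open>cosh\<^sup>2\<close> of the distance from a point is too convex for a flat
  plane to exist. Otherwise the symmetric \<open>2 \<times> 2\<close> matrices embed, compatibly with the triple
  product, and the isometries are \<open>z \<mapsto> [[\<alpha> z, b z], [b z, \<delta> z]]\<close> with \<open>\<alpha>\<^sup>2 + \<delta>\<^sup>2 = 1\<close> and \<open>b\<close> chosen
  such that \<open>det (1 - Z\<^sup>* Z) = 1 - |z|\<^sup>2\<close>. The Schwarz lemma along the disk tangent to the
  image shows that \<open>\<alpha>\<close> is a congruence invariant.\<close>

text \<open>The metric is known only through its axioms and has to be computed first. Invariance
  leaves one constant; it is found by squeezing the minimal disks between the bound
  \<open>gaussian_curvature_ge\<close> and the disk spanned by a tripotent, which attains it. On
  symmetric 2 x 2 matrices \<open>- ln det (1 - Z\<^sup>* Z)\<close> is a potential of the metric,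
  which is why prescribing the determinant gives isometries. It equals
  \<open>1 - |z|\<^sup>2 - 2 |b|\<^sup>2 + |det Z|\<^sup>2\<close> with
  \<open>det Z = \<alpha> \<delta> z\<^sup>2 - b\<^sup>2\<close>. For \<open>b = \<beta> h\<close>
  with \<open>\<beta>\<^sup>2 = - 1/2\<close> and
  \<open>2 h - h\<^sup>2 = 2 \<alpha> \<delta> z\<^sup>2\<close> one gets \<open>det Z = h\<close>,
  and the last two terms cancel. The unit tangent of the image has two singular values whose squares
  add up to 1. They are \<alpha> and \<delta> at the origin, and their product is nowhere larger
  than there. So the largest singular value is minimal at the origin, where it is \<alpha>; the
  Schwarz lemma turns this into a comparison of tangent disks, which automorphisms respect. The
  threshold \<open>sqrt (1/2)\<close> says that \<alpha> is the larger of the two.\<close>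

section \<open>Hermitian inner products of vectors and matrices\<close>

definition cip :: "complex^'n \<Rightarrow> complex^'n \<Rightarrow> complex" where
  "cip u v = (\<Sum>i\<in>UNIV. u $ i * cnj (v $ i))"

definition mip :: "complex^'q^'p \<Rightarrow> complex^'q^'p \<Rightarrow> complex" where
  "mip X Y = (\<Sum>i\<in>UNIV. cip (X $ i) (Y $ i))"

lemma cip_add_left: "cip (u + v) w = cip u w + cip v w"
  by (simp add: cip_def algebra_simps sum.distrib)

lemma cip_add_right: "cip w (u + v) = cip w u + cip w v"
  by (simp add: cip_def algebra_simps sum.distrib)

lemma cip_diff_left: "cip (u - v) w = cip u w - cip v w"
  by (simp add: cip_def algebra_simps sum_subtractf)

lemma cip_diff_right: "cip w (u - v) = cip w u - cip w v"
  by (simp add: cip_def algebra_simps sum_subtractf)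

lemma cip_scaleC_left: "cip (a *\<^sub>C u) v = a * cip u v"
  by (simp add: cip_def scaleC_vec_def scaleC_complex_def sum_distrib_left mult.assoc)

lemma cip_scaleC_right: "cip u (a *\<^sub>C v) = cnj a * cip u v"
  by (simp add: cip_def scaleC_vec_def scaleC_complex_def sum_distrib_left mult_ac)

lemma cip_zero [simp]: "cip 0 v = 0" "cip v 0 = 0"
  by (simp_all add: cip_def)

lemma cip_commute: "cip u v = cnj (cip v u)"
  by (simp add: cip_def mult.commute)

lemma norm_vec_power2: "(norm u)\<^sup>2 = (\<Sum>i\<in>UNIV. (norm (u $ i))\<^sup>2)"
  by (simp add: norm_vec_def L2_set_def sum_nonneg)

lemma cip_self: "cip u u = of_real ((norm u)\<^sup>2)"
  by (simp add: cip_def norm_vec_power2 complex_norm_square del: of_real_power)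

lemma Re_cip: "Re (cip u v) = u \<bullet> v"
  by (simp add: cip_def inner_vec_def inner_complex_def)

lemma scaleR_eq_scaleC: "r *\<^sub>R x = complex_of_real r *\<^sub>C x"
  by (simp add: scaleC_of_real)

lemma scaleC_nth [simp]: "(a *\<^sub>C x) $ i = a *\<^sub>C (x $ i)"
  by (simp add: scaleC_vec_def)

lemma norm_scaleC_vec: "norm (a *\<^sub>C (u::complex^'n)) = cmod a * norm u"
proof -
  have "(norm (a *\<^sub>C u))\<^sup>2 = (cmod a * norm u)\<^sup>2"
    by (simp add: norm_vec_power2 scaleC_complex_def norm_mult power_mult_distrib
        sum_distrib_left)
  then show ?thesis by (simp add: power2_eq_iff_nonneg)
qed

lemma norm_scaleC_mat: "norm (a *\<^sub>C (X::complex^'q^'p)) = cmod a * norm X"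
proof -
  have "(norm (a *\<^sub>C X))\<^sup>2 = (cmod a * norm X)\<^sup>2"
    by (simp add: norm_vec_power2[of X] norm_vec_power2[of "a *\<^sub>C X"] norm_scaleC_vec power_mult_distrib sum_distrib_left)
  then show ?thesis by (simp add: power2_eq_iff_nonneg)
qed

text \<open>A suitable phase on u makes the product real and nonnegative, which reduces the bound to
  the real Cauchy--Schwarz inequality.\<close>

lemma cmod_cip_le: "cmod (cip u v) \<le> norm u * norm v"
proof (cases "cip u v = 0")
  case False
  define a where "a = cnj (cip u v) / cmod (cip u v)"
  have na: "cmod a = 1" using False by (simp add: a_def norm_divide)
  have "cip (a *\<^sub>C u) v = of_real (cmod (cip u v))"
    using False
    by (simp add: cip_scaleC_left a_def mult.commute[of "cnj _"] complex_norm_square[symmetric]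
        power2_eq_square)
  then have "cmod (cip u v) = (a *\<^sub>C u) \<bullet> v"
    by (metis Re_cip Re_complex_of_real)
  also have "\<dots> \<le> norm (a *\<^sub>C u) * norm v" by (rule norm_cauchy_schwarz)
  finally show ?thesis by (simp add: norm_scaleC_vec na)
qed simp

lemma mip_add_left: "mip (X + Y) Z = mip X Z + mip Y Z"
  by (simp add: mip_def cip_add_left sum.distrib)

lemma mip_add_right: "mip Z (X + Y) = mip Z X + mip Z Y"
  by (simp add: mip_def cip_add_right sum.distrib)

lemma mip_diff_left: "mip (X - Y) Z = mip X Z - mip Y Z"
  by (simp add: mip_def cip_diff_left sum_subtractf)

lemma mip_diff_right: "mip Z (X - Y) = mip Z X - mip Z Y"
  by (simp add: mip_def cip_diff_right sum_subtractf)

lemma mip_scaleC_left: "mip (a *\<^sub>C X) Y = a * mip X Y"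
  by (simp add: mip_def cip_scaleC_left sum_distrib_left)

lemma mip_scaleC_right: "mip X (a *\<^sub>C Y) = cnj a * mip X Y"
  by (simp add: mip_def cip_scaleC_right sum_distrib_left)

lemma mip_zero [simp]: "mip 0 X = 0" "mip X 0 = 0"
  by (simp_all add: mip_def)

lemma mip_commute: "mip X Y = cnj (mip Y X)"
  by (simp add: mip_def cip_commute[symmetric])

lemma mip_self: "mip X X = of_real ((norm X)\<^sup>2)"
  by (simp add: mip_def cip_self norm_vec_power2[of X])

lemma Re_mip: "Re (mip X Y) = X \<bullet> Y"
  by (simp add: mip_def Re_cip inner_vec_def[of X])

lemma cmod_mip_le: "cmod (mip X Y) \<le> norm X * norm Y"
proof (cases "mip X Y = 0")
  case False
  define a where "a = cnj (mip X Y) / cmod (mip X Y)"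
  have na: "cmod a = 1" using False by (simp add: a_def norm_divide)
  have "mip (a *\<^sub>C X) Y = of_real (cmod (mip X Y))"
    using False
    by (simp add: mip_scaleC_left a_def mult.commute[of "cnj _"] complex_norm_square[symmetric]
        power2_eq_square)
  then have "cmod (mip X Y) = (a *\<^sub>C X) \<bullet> Y"
    by (metis Re_mip Re_complex_of_real)
  also have "\<dots> \<le> norm (a *\<^sub>C X) * norm Y" by (rule norm_cauchy_schwarz)
  finally show ?thesis by (simp add: norm_scaleC_mat na)
qed simp

lemma adjoint_mat_nth [simp]: "adjoint_mat Z $ i $ j = cnj (Z $ j $ i)"
  by (simp add: adjoint_mat_def)

lemma adjoint_mat_adjoint_mat [simp]: "adjoint_mat (adjoint_mat Z) = Z"
  by (simp add: vec_eq_iff)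

lemma adjoint_mat_mult: "adjoint_mat (A ** B) = adjoint_mat B ** adjoint_mat A"
  by (simp add: vec_eq_iff matrix_matrix_mult_def mult.commute)

lemma adjoint_mat_add: "adjoint_mat (A + B) = adjoint_mat A + adjoint_mat B"
  by (simp add: vec_eq_iff)

lemma adjoint_mat_diff: "adjoint_mat (A - B) = adjoint_mat A - adjoint_mat B"
  by (simp add: vec_eq_iff)

lemma adjoint_mat_uminus: "adjoint_mat (- A) = - adjoint_mat A"
  by (simp add: vec_eq_iff)

lemma adjoint_mat_mat_1 [simp]: "adjoint_mat (mat 1) = mat 1"
  by (simp add: vec_eq_iff mat_def)

lemma adjoint_mat_0 [simp]: "adjoint_mat 0 = 0"
  by (simp add: vec_eq_iff)

lemma adjoint_mat_scaleC: "adjoint_mat (a *\<^sub>C A) = cnj a *\<^sub>C adjoint_mat A"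
  by (simp add: vec_eq_iff scaleC_complex_def)

lemma mat_mult_scaleC_left: "(a *\<^sub>C A) ** B = a *\<^sub>C (A ** (B :: complex^'r^'q))"
  by (simp add: vec_eq_iff matrix_matrix_mult_def scaleC_complex_def sum_distrib_left mult.assoc)

lemma mat_mult_scaleC_right: "A ** (a *\<^sub>C B) = a *\<^sub>C (A ** (B :: complex^'r^'q))"
  by (simp add: vec_eq_iff matrix_matrix_mult_def scaleC_complex_def sum_distrib_left mult_ac)

lemma mat_vec_scaleC_left: "(a *\<^sub>C A) *v v = a *\<^sub>C (A *v (v :: complex^'q))"
  by (simp add: vec_eq_iff matrix_vector_mult_def scaleC_complex_def sum_distrib_left mult.assoc)

lemma mat_vec_scaleC_right: "A *v (a *\<^sub>C v) = a *\<^sub>C (A *v (v :: complex^'q))"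
  by (simp add: vec_eq_iff matrix_vector_mult_def scaleC_complex_def sum_distrib_left mult_ac)

lemma mat_mult_diff_right: "A ** (B - C) = A ** B - A ** (C :: complex^'r^'q)"
  by (simp add: vec_eq_iff matrix_matrix_mult_def algebra_simps sum_subtractf)

lemma mat_mult_diff_left: "(A - B) ** C = A ** C - B ** (C :: complex^'r^'q)"
  by (simp add: vec_eq_iff matrix_matrix_mult_def algebra_simps sum_subtractf)

lemma mat_mult_add_right: "A ** (B + C) = A ** B + A ** (C :: complex^'r^'q)"
  by (simp add: vec_eq_iff matrix_matrix_mult_def algebra_simps sum.distrib)

lemma mat_mult_add_left: "(A + B) ** C = A ** C + B ** (C :: complex^'r^'q)"
  by (simp add: vec_eq_iff matrix_matrix_mult_def algebra_simps sum.distrib)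

lemma mat_mult_uminus_left: "(- A) ** C = - (A ** (C :: complex^'r^'q))"
  by (simp add: vec_eq_iff matrix_matrix_mult_def sum_negf)

lemma mat_mult_uminus_right: "A ** (- C) = - (A ** (C :: complex^'r^'q))"
  by (simp add: vec_eq_iff matrix_matrix_mult_def sum_negf)

lemmas mat_mult_distribs = mat_mult_diff_right mat_mult_diff_left mat_mult_add_right
  mat_mult_add_left mat_mult_uminus_left mat_mult_uminus_right

lemmas adjoint_mat_distribs = adjoint_mat_mult adjoint_mat_add adjoint_mat_diff adjoint_mat_uminus

lemma cip_mat_left: "cip (A *v u) v = cip u (adjoint_mat A *v v)"
proof -
  have "cip (A *v u) v = (\<Sum>i\<in>UNIV. \<Sum>j\<in>UNIV. A $ i $ j * u $ j * cnj (v $ i))"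
    by (simp add: cip_def matrix_vector_mult_def sum_distrib_right)
  also have "\<dots> = (\<Sum>j\<in>UNIV. \<Sum>i\<in>UNIV. A $ i $ j * u $ j * cnj (v $ i))"
    by (rule sum.swap)
  also have "\<dots> = cip u (adjoint_mat A *v v)"
    by (simp add: cip_def matrix_vector_mult_def sum_distrib_left mult_ac)
  finally show ?thesis .
qed

lemma mip_mult_left: "mip (A ** X) Y = mip X (adjoint_mat A ** Y)"
proof -
  have "mip (A ** X) Y = (\<Sum>i\<in>UNIV. \<Sum>j\<in>UNIV. \<Sum>k\<in>UNIV. A $ i $ k * X $ k $ j * cnj (Y $ i $ j))"
    by (simp add: mip_def cip_def matrix_matrix_mult_def sum_distrib_right)
  also have "\<dots> = (\<Sum>i\<in>UNIV. \<Sum>k\<in>UNIV. \<Sum>j\<in>UNIV. A $ i $ k * X $ k $ j * cnj (Y $ i $ j))"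
    by (intro sum.cong refl sum.swap)
  also have "\<dots> = (\<Sum>k\<in>UNIV. \<Sum>i\<in>UNIV. \<Sum>j\<in>UNIV. A $ i $ k * X $ k $ j * cnj (Y $ i $ j))"
    by (rule sum.swap)
  also have "\<dots> = (\<Sum>k\<in>UNIV. \<Sum>j\<in>UNIV. \<Sum>i\<in>UNIV. A $ i $ k * X $ k $ j * cnj (Y $ i $ j))"
    by (intro sum.cong refl sum.swap)
  also have "\<dots> = mip X (adjoint_mat A ** Y)"
    by (simp add: mip_def cip_def matrix_matrix_mult_def sum_distrib_left mult_ac)
  finally show ?thesis .
qed

lemma mip_adjoint: "mip (adjoint_mat X) (adjoint_mat Y) = mip Y X"
  by (simp add: mip_def cip_def mult.commute) (rule sum.swap)

lemma mip_mult_right: "mip (X ** B) Y = mip X (Y ** adjoint_mat B)"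
proof -
  have "mip (X ** B) Y = mip (adjoint_mat Y) (adjoint_mat B ** adjoint_mat X)"
    by (metis mip_adjoint adjoint_mat_mult)
  also have "\<dots> = mip (B ** adjoint_mat Y) (adjoint_mat X)"
    by (simp add: mip_mult_left)
  also have "\<dots> = mip X (Y ** adjoint_mat B)"
    by (metis mip_adjoint adjoint_mat_mult adjoint_mat_adjoint_mat)
  finally show ?thesis .
qed

lemma norm_adjoint_mat [simp]: "norm (adjoint_mat X) = norm X"
proof -
  have "complex_of_real ((norm (adjoint_mat X))\<^sup>2) = of_real ((norm X)\<^sup>2)"
    using mip_adjoint[of X X] unfolding mip_self .
  then show ?thesis by (metis of_real_eq_iff norm_ge_zero power2_eq_iff_nonneg)
qed

lemma matvec_cip: "(A *v v) $ i = cip (A $ i) (\<chi> j. cnj (v $ j))"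
  by (simp add: matrix_vector_mult_def cip_def)

lemma norm_cnj_vec: "norm (\<chi> j. cnj (v $ j)) = norm (v::complex^'n)"
  by (simp add: norm_vec_def)

lemma norm_matvec_le: "norm (A *v v) \<le> norm A * norm (v :: complex^'q)"
proof -
  have "(norm (A *v v))\<^sup>2 = (\<Sum>i\<in>UNIV. (cmod (cip (A $ i) (\<chi> j. cnj (v $ j))))\<^sup>2)"
    by (simp add: norm_vec_power2 matvec_cip)
  also have "\<dots> \<le> (\<Sum>i\<in>UNIV. (norm (A $ i) * norm v)\<^sup>2)"
    by (intro sum_mono power_mono order_trans[OF cmod_cip_le]) (simp_all add: norm_cnj_vec)
  also have "\<dots> = (norm A * norm v)\<^sup>2"
    by (simp add: norm_vec_power2[of A] power_mult_distrib sum_distrib_right)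
  finally show ?thesis by (rule power2_le_imp_le) simp
qed

lemma column_mult: "column j (A ** B) = A *v column j B"
  by (simp add: column_def vec_eq_iff matrix_matrix_mult_def matrix_vector_mult_def)

lemma norm_mat_columns: "(norm (A::complex^'q^'p))\<^sup>2 = (\<Sum>j\<in>UNIV. (norm (column j A))\<^sup>2)"
  unfolding norm_vec_power2 column_def by (simp add: sum.swap[of _ UNIV "UNIV :: 'p set"])

text \<open>Operator bounds turn into bounds of the Hilbert--Schmidt norm column by column.\<close>

lemma norm_mat_mult_op:
  fixes A :: "complex^'q^'p" and B :: "complex^'r^'q"
  assumes "\<And>v. norm (A *v v) \<le> K * norm v"
  shows "norm (A ** B) \<le> K * norm B"
proof -
  \<comment> \<open>Tested on a unit vector, the hypothesis bounds a norm by K.\<close>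
  have K: "0 \<le> K"
    using assms[of "axis undefined 1"] by (simp add: norm_axis_1) (meson norm_ge_zero order_trans)
  have "(norm (A ** B))\<^sup>2 \<le> (\<Sum>j\<in>UNIV. (K * norm (column j B))\<^sup>2)"
    unfolding norm_mat_columns column_mult by (intro sum_mono power_mono assms) simp
  also have "\<dots> = (K * norm B)\<^sup>2"
    by (simp add: norm_mat_columns power_mult_distrib sum_distrib_left)
  finally show ?thesis by (rule power2_le_imp_le) (simp add: K)
qed

lemma norm_mat_mult_le: "norm (A ** B) \<le> norm A * norm (B :: complex^'r^'q)"
  by (rule norm_mat_mult_op) (rule norm_matvec_le)

section \<open>The matrix ball\<close>

text \<open>In \<open>herm\<close> the row index of the matrix goes with the unconjugated vector, so
  in terms of \<open>*v\<close> the matrix acts on the conjugate of v.\<close>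

lemma herm_one_minus: 
  "herm (mat 1 - adjoint_mat Z ** Z) v v =
     of_real ((norm v)\<^sup>2 - (norm (Z *v (\<chi> j. cnj (v $ j))))\<^sup>2)"
proof -
  define w where "w = (\<chi> j. cnj (v $ j))"
  have "herm B v v = cip (B *v w) w" for B
    by (simp add: herm_def cip_def matrix_vector_mult_def w_def sum_distrib_right sum_distrib_left mult_ac)
  then have "herm (mat 1 - adjoint_mat Z ** Z) v v = cip ((mat 1 - adjoint_mat Z ** Z) *v w) w"
    by simp
  also have "\<dots> = cip w w - cip (Z *v w) (Z *v w)"
    by (simp add: cip_mat_left cip_diff_left matrix_vector_mult_diff_rdistrib
        flip: matrix_vector_mul_assoc)
  also have "\<dots> = of_real ((norm v)\<^sup>2 - (norm (Z *v w))\<^sup>2)"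
    by (simp add: cip_self w_def norm_cnj_vec)
  finally show ?thesis by (simp add: w_def)
qed

text \<open>Conjugation is a norm preserving bijection of vectors, so the conjugate in
  \<open>herm_one_minus\<close> disappears and the open unit ball of the operator norm
  remains.\<close>

lemma D_I_iff: "Z \<in> D_I \<longleftrightarrow> (\<forall>w. w \<noteq> 0 \<longrightarrow> norm (Z *v w) < norm w)"
proof -
  have sym: "(mat 1 - adjoint_mat Z ** Z) $ j $ i = cnj ((mat 1 - adjoint_mat Z ** Z) $ i $ j)"
    for i j
    by (simp add: mat_def matrix_matrix_mult_def mult.commute)
  have "Z \<in> D_I \<longleftrightarrow> (\<forall>v. v \<noteq> 0 \<longrightarrow> norm (Z *v (\<chi> j. cnj (v $ j))) < norm v)"
    unfolding D_I_def pos_def_def mem_Collect_eq herm_one_minus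
    using sym by (auto simp: abs_square_less_1 power_strict_mono intro: power2_less_imp_less)
  also have "\<dots> \<longleftrightarrow> (\<forall>w. w \<noteq> 0 \<longrightarrow> norm (Z *v w) < norm w)"
  proof (intro iffI allI impI)
    fix w :: "complex^'a"
    assume *: "\<forall>v. v \<noteq> 0 \<longrightarrow> norm (Z *v (\<chi> j. cnj (v $ j))) < norm v" and "w \<noteq> 0"
    then have "(\<chi> j. cnj (w $ j)) \<noteq> 0" by (simp add: vec_eq_iff)
    with * have "norm (Z *v (\<chi> j. cnj ((\<chi> j. cnj (w $ j)) $ j))) < norm (\<chi> j. cnj (w $ j))"
      by blast
    then show "norm (Z *v w) < norm w" by (simp add: norm_cnj_vec)
  next
    fix v :: "complex^'a"
    assume *: "\<forall>w. w \<noteq> 0 \<longrightarrow> norm (Z *v w) < norm w" and "v \<noteq> 0"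
    then have "(\<chi> j. cnj (v $ j)) \<noteq> 0" by (simp add: vec_eq_iff)
    with * show "norm (Z *v (\<chi> j. cnj (v $ j))) < norm v" by (metis norm_cnj_vec)
  qed
  finally show ?thesis .
qed

lemma D_I_norm_le: "Z \<in> D_I \<Longrightarrow> norm (Z *v w) \<le> norm w"
  by (cases "w = 0") (auto simp: D_I_iff less_imp_le)

lemma zero_in_D_I [simp]: "0 \<in> D_I"
  by (simp add: D_I_iff)

text \<open>The operator norm is at most the Hilbert--Schmidt norm. This provides the room around
  the origin in which short segments stay inside the domain.\<close>

lemma small_in_D_I: "norm Z < 1 \<Longrightarrow> Z \<in> D_I"
  unfolding D_I_iff
  by (metis mult_strict_right_mono mult_1 norm_matvec_le order_le_less_trans zero_less_norm_iff)

lemma bounded_bilinear_mat_mult: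
  "bounded_bilinear ((**) :: complex^'q^'p \<Rightarrow> complex^'r^'q \<Rightarrow> complex^'r^'p)"
proof
  show "\<exists>K. \<forall>(a::complex^'q^'p) (b::complex^'r^'q). norm (a ** b) \<le> norm a * norm b * K"
    using norm_mat_mult_le by (intro exI[of _ 1]) auto
qed (simp_all add: mat_mult_distribs scaleR_eq_scaleC mat_mult_scaleC_left mat_mult_scaleC_right)

lemma bounded_bilinear_mip: "bounded_bilinear (mip :: complex^'q^'p \<Rightarrow> _)"
proof
  show "\<exists>K. \<forall>(a::complex^'q^'p) b. norm (mip a b) \<le> norm a * norm b * K"
    using cmod_mip_le by (intro exI[of _ 1]) auto
qed (simp_all add: mip_add_left mip_add_right scaleR_eq_scaleC mip_scaleC_left mip_scaleC_right
       scaleC_complex_def)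

section \<open>Complex scalar multiplication\<close>

lemma linear_scaleC: "linear (\<lambda>x. a *\<^sub>C (x::'a::complex_normed))"
  by (rule linearI) (simp_all add: scaleC_add_right scaleR_eq_scaleC scaleC_scaleC mult.commute)

lemma scaleC_zero [simp]: "a *\<^sub>C (0::'a::complex_normed) = 0"
  by (metis linear_scaleC linear_0)

lemma scaleC_zero_left [simp]: "0 *\<^sub>C (x::'a::complex_normed) = 0"
  by (metis scaleC_of_real of_real_0 scaleR_zero_left)

lemma scaleC_one [simp]: "1 *\<^sub>C (x::'a::complex_normed) = x"
  by (metis scaleC_of_real of_real_1 scaleR_one)

lemma scaleC_diff_right: "a *\<^sub>C (x - y) = a *\<^sub>C x - a *\<^sub>C (y::'a::complex_normed)"
  using linear_diff[OF linear_scaleC] .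

lemma scaleC_uminus: "a *\<^sub>C (- y) = - (a *\<^sub>C (y::'a::complex_normed))"
  using linear_neg[OF linear_scaleC] .

text \<open>Real linearity covers the real part of a, the hypothesis its imaginary part.\<close>

lemma complex_linear_iff_imaginary:
  fixes D :: "'a::complex_normed \<Rightarrow> 'b::complex_normed"
  assumes "linear D" and "\<And>v. D (\<i> *\<^sub>C v) = \<i> *\<^sub>C D v"
  shows "D (a *\<^sub>C v) = a *\<^sub>C D v"
proof -
  have "D (a *\<^sub>C v) = D (Re a *\<^sub>R v + Im a *\<^sub>R (\<i> *\<^sub>C v))"
    by (subst complex_eq[of a])
      (simp add: scaleC_add_left scaleR_eq_scaleC scaleC_scaleC mult.commute)
  also have "\<dots> = Re a *\<^sub>R D v + Im a *\<^sub>R (\<i> *\<^sub>C D v)"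
    by (simp add: linear_add[OF assms(1)] linear_scale[OF assms(1)] assms(2))
  also have "\<dots> = a *\<^sub>C D v"
    by (subst (3) complex_eq[of a])
      (simp add: scaleC_add_left scaleR_eq_scaleC scaleC_scaleC mult.commute)
  finally show ?thesis .
qed

section \<open>Positive definite matrices and simultaneous elimination\<close>

text \<open>Positivity of the operator \<open>H *v\<close>, whereas \<open>pos_def\<close> concerns
  the transposed matrix; this version composes with products and adjoints.\<close>

definition hpos :: "complex^'n^'n \<Rightarrow> bool" where
  "hpos H \<longleftrightarrow> adjoint_mat H = H \<and> (\<forall>v. v \<noteq> 0 \<longrightarrow> 0 < Re (cip (H *v v) v))"

lemma hpos_diag: 
  assumes "hpos H" shows "H $ k $ k = of_real (Re (H $ k $ k))" "0 < Re (H $ k $ k)"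
proof -
  have "H $ k $ k = cnj (H $ k $ k)"
    using assms by (metis adjoint_mat_nth hpos_def)
  then show "H $ k $ k = of_real (Re (H $ k $ k))"
    by (simp add: complex_eq_iff)
  have "cip (H *v axis k 1) (axis k 1) = H $ k $ k"
    by (simp add: cip_def matrix_vector_mult_def axis_def if_distrib cong: if_cong)
  moreover have "axis k (1::complex) \<noteq> 0" by (simp add: axis_eq_0_iff)
  ultimately show "0 < Re (H $ k $ k)"
    using assms unfolding hpos_def by metis
qed

lemma hpos_congruence:
  assumes "hpos H" and inj: "\<And>v. adjoint_mat E *v v = 0 \<Longrightarrow> v = 0"
  shows "hpos (E ** H ** adjoint_mat E)"
  unfolding hpos_def
proof (intro conjI allI impI)
  show "adjoint_mat (E ** H ** adjoint_mat E) = E ** H ** adjoint_mat E"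
    using assms by (simp add: adjoint_mat_mult hpos_def matrix_mul_assoc)
  fix v :: "complex^'b" assume "v \<noteq> 0"
  then have "adjoint_mat E *v v \<noteq> 0" using inj by blast
  then have "0 < Re (cip (H *v (adjoint_mat E *v v)) (adjoint_mat E *v v))"
    using assms(1) by (simp add: hpos_def)
  also have "cip (H *v (adjoint_mat E *v v)) (adjoint_mat E *v v)
      = cip ((E ** H ** adjoint_mat E) *v v) v"
    by (metis cip_mat_left matrix_vector_mul_assoc)
  finally show "0 < Re (cip ((E ** H ** adjoint_mat E) *v v) v)" .
qed

text \<open>Gauss elimination applied to rows and columns simultaneously.\<close>

lemma hpos_eliminate:
  fixes H :: "complex^'n^'n"
  assumes "hpos H"
  shows "\<exists>S::complex^'n^'n. hpos (S ** H ** adjoint_mat S) \<and>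
    (\<forall>i\<in>T. \<forall>j. (S ** H ** adjoint_mat S) $ i $ j = (if i = j then 1 else 0))"
proof (rule finite_induct[of T])
  show "finite T" by simp
next
  show "\<exists>S::complex^'n^'n. hpos (S ** H ** adjoint_mat S) \<and>
    (\<forall>i\<in>{}. \<forall>j. (S ** H ** adjoint_mat S) $ i $ j = (if i = j then 1 else 0))"
    using assms by (intro exI[of _ "mat 1"]) simp
next
  fix k and T :: "'n set"
  assume "k \<notin> T" and "\<exists>S::complex^'n^'n. hpos (S ** H ** adjoint_mat S) \<and>
    (\<forall>i\<in>T. \<forall>j. (S ** H ** adjoint_mat S) $ i $ j = (if i = j then 1 else 0))"
  then obtain S where hp: "hpos (S ** H ** adjoint_mat S)"
    and T: "\<And>i j. i \<in> T \<Longrightarrow> (S ** H ** adjoint_mat S) $ i $ j = (if i = j then 1 else 0)"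
    by blast
  define M where "M = S ** H ** adjoint_mat S"
  define r where "r = sqrt (Re (M $ k $ k))"
  note dg = hpos_diag[OF hp, of k, folded M_def]
  have Mkk: "M $ k $ k = of_real r * of_real r"
    using dg(2) unfolding r_def of_real_mult[symmetric] by (subst dg(1)) simp
  have r: "r > 0" using dg(2) by (simp add: r_def)
  have sym: "M $ i $ j = cnj (M $ j $ i)" for i j
    using hp unfolding M_def[symmetric] by (metis adjoint_mat_nth hpos_def)
  define c where "c j = M $ j $ k / M $ k $ k" for j
  \<comment> \<open>Left multiplication by E divides row k by the root of the pivot and subtracts
    \<open>c j\<close> times row k from every other row j; the adjoint on the right does the same to
    the columns.\<close>
  define E :: "complex^'n^'n" where
    "E = (\<chi> j i. (if i = j then (if j = k then 1 / of_real r else 1) else 0)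
        + (if i = k then (if j = k then 0 else - c j) else 0))"
  have EX: "(E ** X) $ j $ l = (if j = k then X $ k $ l / of_real r else X $ j $ l - c j * X $ k $ l)"
    for X :: "complex^'n^'n" and j l
    by (simp add: matrix_matrix_mult_def E_def distrib_right sum.distrib if_distrib
        [of "\<lambda>x. x * _"] cong: if_cong)
  have XE: "(X ** adjoint_mat E) $ j $ l =
      (if l = k then X $ j $ k / of_real r else X $ j $ l - cnj (c l) * X $ j $ k)"
    for X :: "complex^'n^'n" and j l
  proof -
    have "X ** adjoint_mat E = adjoint_mat (E ** adjoint_mat X)"
      by (simp add: adjoint_mat_mult)
    then show ?thesis by (simp add: EX)
  qed
  have inj: "v = 0" if "adjoint_mat E *v v = 0" for v
  proof -
    have "(adjoint_mat E *v v) $ i = (if i = k then v $ k / of_real r - (\<Sum>j\<in>UNIV - {k}. cnj (c j) * v $ j) else v $ i)"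
      for i
    proof -
      have "(adjoint_mat E *v v) $ i =
        (\<Sum>j\<in>UNIV. (if i = j then (if j = k then 1 / of_real r else 1) * v $ j else 0)
           + (if i = k then (if j = k then 0 else - cnj (c j) * v $ j) else 0))"
        unfolding matrix_vector_mult_def E_def
        by (auto simp: distrib_right intro!: sum.cong)
      also have "\<dots> = (if i = k then 1 / of_real r else 1) * v $ i +
          (if i = k then (\<Sum>j\<in>UNIV. if j = k then 0 else - cnj (c j) * v $ j) else 0)"
        by (simp add: sum.distrib)
      also have "(\<Sum>j\<in>UNIV. if j = k then 0 else - cnj (c j) * v $ j)
          = (\<Sum>j\<in>UNIV - {k}. - cnj (c j) * v $ j)"
        by (intro sum.mono_neutral_cong_right) auto
      finally show ?thesis by (auto simp: sum_negf)
    qed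
    then have *: "(if i = k then v $ k / of_real r - (\<Sum>j\<in>UNIV - {k}. cnj (c j) * v $ j) else v $ i) = 0"
      for i using that by simp
    have "v $ i = 0" if "i \<noteq> k" for i using *[of i] that by simp
    moreover from this have "v $ k = 0" using *[of k] r by simp
    ultimately show ?thesis by (metis vec_eq_iff zero_index)
  qed
  have eq: "(E ** S) ** H ** adjoint_mat (E ** S) = E ** M ** adjoint_mat E"
    by (simp add: M_def adjoint_mat_mult matrix_mul_assoc)
  have ckk: "M $ k $ k \<noteq> 0" using Mkk r by simp
  have "(E ** M ** adjoint_mat E) $ i $ j = (if i = j then 1 else 0)" if "i \<in> insert k T" for i j
  proof (cases "i = k")
    case True
    have "cnj (c j) = M $ k $ j / M $ k $ k"
      unfolding c_def complex_cnj_divide sym[of k j, symmetric] sym[of k k, symmetric] ..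
    then show ?thesis using True ckk Mkk r
      by (auto simp: XE EX field_simps)
  next
    case False
    \<comment> \<open>A row treated earlier is a row of the identity, so \<open>c i = 0\<close> and
      the present step leaves it alone.\<close>
    have "M $ i $ l = (if i = l then 1 else 0)" for l using False T that unfolding M_def by auto
    moreover from this have "M $ j $ j = 1 \<and> M $ j $ k = 0" if "i = j" using False that by metis
    ultimately show ?thesis using False by (auto simp: XE EX c_def)
  qed
  then show "\<exists>S::complex^'n^'n. hpos (S ** H ** adjoint_mat S) \<and>
    (\<forall>i\<in>insert k T. \<forall>j. (S ** H ** adjoint_mat S) $ i $ j = (if i = j then 1 else 0))"
    using hpos_congruence[OF hp[folded M_def] inj] eq by (intro exI[of _ "E ** S"]) simp
qed

lemma hpos_normalize:
  fixes H :: "complex^'n^'n"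
  assumes "hpos H"
  obtains S :: "complex^'n^'n" where "S ** H ** adjoint_mat S = mat 1"
proof -
  obtain S :: "complex^'n^'n" where "\<forall>i\<in>UNIV. \<forall>j. (S ** H ** adjoint_mat S) $ i $ j = (if i = j then 1 else 0)"
    using hpos_eliminate[OF assms, of UNIV] by blast
  then have "S ** H ** adjoint_mat S = mat 1" by (simp add: vec_eq_iff mat_def)
  with that[of S] show ?thesis by blast
qed

lemma cip_gram: "cip ((adjoint_mat Z ** Z) *v v) v = of_real ((norm (Z *v v))\<^sup>2)"
  by (metis adjoint_mat_adjoint_mat cip_mat_left cip_self matrix_vector_mul_assoc)

lemma hpos_one_minus: "Z \<in> D_I \<Longrightarrow> hpos (mat 1 - adjoint_mat Z ** Z)"
  unfolding hpos_def D_I_iff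
  by (simp add: adjoint_mat_distribs matrix_vector_mult_diff_rdistrib cip_diff_left cip_gram
      power_strict_mono cip_self flip: of_real_power)

text \<open>Moving one factor across the inner product bounds the square of the norm of
  \<open>adjoint_mat Z *v v\<close> by that norm times the norm of v, strictly; one factor
  cancels.\<close>

lemma adjoint_mat_D_I: "Z \<in> D_I \<Longrightarrow> adjoint_mat Z \<in> D_I"
  unfolding D_I_iff[of "adjoint_mat Z"]
proof (intro allI impI)
  fix v :: "complex^'b" assume Z: "Z \<in> D_I" and v: "v \<noteq> 0"
  show "norm (adjoint_mat Z *v v) < norm v"
  proof (cases "adjoint_mat Z *v v = 0")
    case False
    let ?u = "adjoint_mat Z *v v"
    have "(norm ?u)\<^sup>2 = Re (cip (Z *v ?u) v)"
      by (metis cip_mat_left cip_self Re_complex_of_real)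
    also have "\<dots> \<le> norm (Z *v ?u) * norm v"
      using cmod_cip_le complex_Re_le_cmod order_trans by blast
    also have "\<dots> < norm ?u * norm v"
      using Z False v by (intro mult_strict_right_mono) (auto simp: D_I_iff)
    finally show ?thesis using False by (simp add: power2_eq_square)
  qed (use v in simp)
qed

section \<open>Matrix inversion and its derivative\<close>

lemma matrix_inv_right: "invertible A \<Longrightarrow> A ** matrix_inv A = mat 1"
  unfolding invertible_def matrix_inv_def by (rule someI2_ex) auto

lemma matrix_inv_left: "invertible A \<Longrightarrow> matrix_inv A ** A = mat 1"
  unfolding invertible_def matrix_inv_def by (rule someI2_ex) auto

lemma matrix_inv_unique:
  fixes A B :: "complex^'n^'n"
  assumes "A ** B = mat 1" shows "invertible A" "matrix_inv A = B"
proof -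
  show "invertible A" using assms invertible_right_inverse by blast
  then show "matrix_inv A = B"
    by (metis assms matrix_inv_left matrix_mul_assoc matrix_mul_lid matrix_mul_rid)
qed

lemma invertible_iff_ker: "invertible (A::complex^'n^'n) \<longleftrightarrow> (\<forall>x. A *v x = 0 \<longrightarrow> x = 0)"
  by (simp add: invertible_left_inverse matrix_left_invertible_ker)

text \<open>Remainders arrive in this quadratic form twice: for matrix inversion, and when the
  metric is compared with a constant form near the origin of a chart.\<close>

lemma has_derivative_quadratic:
  assumes f': "bounded_linear f'"
    and "e > 0" and bound: "\<And>y. y \<in> s \<Longrightarrow> dist y x < e \<Longrightarrow> norm (f y - f x - f' (y - x)) \<le> C * (norm (y - x))\<^sup>2"
  shows "(f has_derivative f') (at x within s)"
proof (rule has_derivativeI_sandwich[OF \<open>e > 0\<close> f', where H = "\<lambda>y. C * norm (y - x)"])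
  fix y assume "y \<in> s" "y \<noteq> x" "dist y x < e"
  then show "norm (f y - f x - f' (y - x)) / norm (y - x) \<le> C * norm (y - x)"
    using bound[of y] by (simp add: divide_le_eq power2_eq_square mult.assoc)
next
  have "((\<lambda>y. C * norm (y - x)) \<longlongrightarrow> C * norm (x - x)) (at x within s)"
    by (intro tendsto_intros)
  then show "((\<lambda>y. C * norm (y - x)) \<longlongrightarrow> 0) (at x within s)" by simp
qed

text \<open>Matrices near N are uniformly bounded below, hence invertible with uniformly bounded
  inverses. Two applications of the resolvent identity then leave a quadratic remainder.\<close>

lemma has_derivative_matrix_inv:
  fixes N :: "complex^'n^'n"
  assumes "invertible N"
  shows "(matrix_inv has_derivative (\<lambda>H. - (matrix_inv N ** H ** matrix_inv N))) (at N)"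
proof -
  define R where "R = matrix_inv N"
  have RN: "R ** N = mat 1" "N ** R = mat 1"
    using assms by (simp_all add: R_def matrix_inv_left matrix_inv_right)
  \<comment> \<open>N stretches every vector at least by 2 m, so a perturbation smaller than m
    leaves the factor m. The summand 1 keeps the quotient positive.\<close>
  define m where "m = 1 / (2 * (norm R + 1))"
  have m: "m > 0" by (simp add: m_def add_nonneg_pos)
  have two_m: "2 * m = 1 / (norm R + 1)" using norm_ge_zero[of R] by (simp add: m_def divide_simps)
  have inv: "invertible M \<and> norm (matrix_inv M) \<le> 1 / m * norm (mat 1 :: complex^'n^'n)"
    if "dist M N < m" for M
  proof -
    have low: "m * norm v \<le> norm (M *v v)" for v
    proof -
      have "norm v = norm (R *v (N *v v))" by (simp add: matrix_vector_mul_assoc RN)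
      also have "\<dots> \<le> norm R * norm (N *v v)" by (rule norm_matvec_le)
      also have "\<dots> \<le> (norm R + 1) * norm (N *v v)" by (simp add: mult_right_mono)
      finally have "2 * m * norm v \<le> norm (N *v v)"
        using pos_divide_le_eq[of "norm R + 1" "norm v" "norm (N *v v)"] norm_ge_zero[of R]
        unfolding two_m by (simp add: mult.commute)
      also have "N *v v = M *v v - (M - N) *v v" by (simp add: matrix_vector_mult_diff_rdistrib)
      also have "norm \<dots> \<le> norm (M *v v) + norm (M - N) * norm v"
        using norm_triangle_ineq4 norm_matvec_le by (metis add_left_mono order_trans)
      also have "\<dots> \<le> norm (M *v v) + m * norm v"
        using that by (simp add: dist_norm mult_right_mono)
      finally show ?thesis by simp
    qed
    have "x = 0" if "M *v x = 0" for x
    proof -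
      have "m * norm x \<le> 0" using low[of x] that by simp
      then show ?thesis using m by (simp add: mult_le_0_iff)
    qed
    then have "invertible M" by (simp add: invertible_iff_ker)
    moreover have "norm (matrix_inv M *v w) \<le> 1 / m * norm w" for w
      using low[of "matrix_inv M *v w"] m \<open>invertible M\<close>
      by (simp add: matrix_vector_mul_assoc matrix_inv_right field_simps)
    then have "norm (matrix_inv M ** mat 1) \<le> 1 / m * norm (mat 1 :: complex^'n^'n)"
      by (rule norm_mat_mult_op)
    ultimately show ?thesis by simp
  qed
  define K where "K = 1 / m * norm (mat 1 :: complex^'n^'n)"
  show ?thesis unfolding R_def[symmetric]
  proof (rule has_derivative_quadratic[OF _ m, where C = "K * norm R * norm R"])
    interpret bb: bounded_bilinear "(**) :: complex^'n^'n \<Rightarrow> complex^'n^'n \<Rightarrow> _"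
      by (rule bounded_bilinear_mat_mult)
    show "bounded_linear (\<lambda>H. - (R ** H ** R))"
      by (intro bounded_linear_minus bounded_linear_compose[OF bb.bounded_linear_left]
          bb.bounded_linear_right)
    fix M assume "dist M N < m"
    then have iM: "invertible M" and nM: "norm (matrix_inv M) \<le> K" using inv by (auto simp: K_def)
    have 1: "matrix_inv M - R = - (matrix_inv M ** (M - N) ** R)"
      by (simp add: mat_mult_distribs matrix_inv_left[OF iM])
        (simp add: matrix_mul_assoc[symmetric] RN)
    \<comment> \<open>The identity \<open>1\<close> enters once more here and produces the second
      factor \<open>M - N\<close>.\<close>
    have "matrix_inv M - R + R ** (M - N) ** R = (R - matrix_inv M) ** (M - N) ** R"
      by (simp add: 1 mat_mult_diff_left)
    also have "\<dots> = matrix_inv M ** (M - N) ** R ** (M - N) ** R"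
      using 1 by (metis minus_diff_eq add.inverse_inverse)
    also have "norm \<dots> \<le> norm (matrix_inv M) * norm (M - N) * norm R * norm (M - N) * norm R"
      by (intro order_trans[OF norm_mat_mult_le] mult_right_mono order_refl norm_ge_zero)
    also have "\<dots> \<le> K * norm (M - N) * norm R * norm (M - N) * norm R"
      by (intro mult_right_mono nM norm_ge_zero)
    finally show "norm (matrix_inv M - matrix_inv N - - (R ** (M - N) ** R)) \<le> K * norm R * norm R * (norm (M - N))\<^sup>2"
      by (simp add: R_def power2_eq_square mult_ac)
  qed
qed

section \<open>Fractional linear transformations of the matrix ball\<close>

definition frac ::
    "complex^'p^'p \<Rightarrow> complex^'q^'p \<Rightarrow> complex^'p^'q \<Rightarrow> complex^'q^'q \<Rightarrow> complex^'q^'p \<Rightarrow> complex^'q^'p"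
  where "frac A B C D Z = (A ** Z + B) ** matrix_inv (C ** Z + D)"

text \<open>The block matrices with rows \<open>(A, B)\<close> and \<open>(C, D)\<close> that preserve the indefinite form
  \<open>diag(I, -I)\<close>; the last three equations follow from the first three.\<close>

definition pseudo_unitary ::
    "complex^'p^'p \<Rightarrow> complex^'q^'p \<Rightarrow> complex^'p^'q \<Rightarrow> complex^'q^'q \<Rightarrow> bool" where
  "pseudo_unitary A B C D \<longleftrightarrow>
     adjoint_mat A ** A - adjoint_mat C ** C = mat 1 \<and>
     adjoint_mat A ** B = adjoint_mat C ** D \<and>
     adjoint_mat D ** D - adjoint_mat B ** B = mat 1 \<and>
     A ** adjoint_mat A - B ** adjoint_mat B = mat 1 \<and>
     A ** adjoint_mat C = B ** adjoint_mat D \<and>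
     D ** adjoint_mat D - C ** adjoint_mat C = mat 1"

text \<open>With J the indefinite form, the inverse of a J-unitary block matrix is J times its
  adjoint times J; this accounts for the two signs.\<close>

lemma pseudo_unitary_inverse:
  assumes "pseudo_unitary A B C D"
  shows "pseudo_unitary (adjoint_mat A) (- adjoint_mat C) (- adjoint_mat B) (adjoint_mat D)"
  using assms unfolding pseudo_unitary_def
  by (simp add: adjoint_mat_uminus mat_mult_uminus_left mat_mult_uminus_right)

context
  fixes A :: "complex^'p^'p" and B :: "complex^'q^'p" and C D
  assumes pu: "pseudo_unitary A B C D"
begin

text \<open>The block matrix preserves the indefinite form; here the form is evaluated on the block
  column with entries Z and the identity.\<close>

lemma pseudo_unitary_gram:
  "adjoint_mat (C ** Z + D) ** (C ** Z + D) - adjoint_mat (A ** Z + B) ** (A ** Z + B)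
     = mat 1 - adjoint_mat Z ** Z"
proof -
  have 1: "adjoint_mat D ** C = adjoint_mat B ** A"
    using pu unfolding pseudo_unitary_def by (metis adjoint_mat_adjoint_mat adjoint_mat_mult)
  have 2: "adjoint_mat A ** A = mat 1 + adjoint_mat C ** C"
    "adjoint_mat D ** D = mat 1 + adjoint_mat B ** B"
    "adjoint_mat A ** B = adjoint_mat C ** D"
    using pu unfolding pseudo_unitary_def by (auto simp: diff_eq_eq)
  show ?thesis
    by (simp add: adjoint_mat_distribs mat_mult_distribs matrix_mul_assoc[symmetric])
      (simp add: matrix_mul_assoc 1 2 mat_mult_distribs)
qed

lemma pseudo_unitary_norm:
  "(norm ((C ** Z + D) *v v))\<^sup>2 - (norm ((A ** Z + B) *v v))\<^sup>2 = (norm v)\<^sup>2 - (norm (Z *v v))\<^sup>2"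
proof -
  have "complex_of_real ((norm ((C ** Z + D) *v v))\<^sup>2 - (norm ((A ** Z + B) *v v))\<^sup>2)
    = of_real ((norm v)\<^sup>2 - (norm (Z *v v))\<^sup>2)"
    unfolding of_real_diff cip_gram[symmetric] cip_diff_left[symmetric]
      matrix_vector_mult_diff_rdistrib[symmetric] pseudo_unitary_gram
    by (simp add: matrix_vector_mult_diff_rdistrib cip_diff_left cip_self cip_gram)
  then show ?thesis by (metis of_real_eq_iff)
qed

lemma pseudo_unitary_invertible: assumes "Z \<in> D_I" shows "invertible (C ** Z + D)"
  unfolding invertible_iff_ker
proof (intro allI impI)
  fix v assume "(C ** Z + D) *v v = 0"
  then have "(norm v)\<^sup>2 - (norm (Z *v v))\<^sup>2 = - (norm ((A ** Z + B) *v v))\<^sup>2"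
    using pseudo_unitary_norm[of Z v] by simp
  then have "(norm v)\<^sup>2 \<le> (norm (Z *v v))\<^sup>2"
    using zero_le_power2[of "norm ((A ** Z + B) *v v)"] by linarith
  then have "norm v \<le> norm (Z *v v)" by (rule power2_le_imp_le) simp
  then show "v = 0" using assms unfolding D_I_iff by force
qed

lemma frac_in_D_I: assumes "Z \<in> D_I" shows "frac A B C D Z \<in> D_I"
  unfolding D_I_iff
proof (intro allI impI)
  fix w :: "complex^'q" assume w: "w \<noteq> 0"
  define v where "v = matrix_inv (C ** Z + D) *v w"
  have wv: "w = (C ** Z + D) *v v"
    unfolding v_def matrix_vector_mul_assoc
    by (simp add: matrix_inv_right pseudo_unitary_invertible[OF assms])
  have "v \<noteq> 0" using w wv by auto
  then have "norm (Z *v v) < norm v" using assms by (simp add: D_I_iff)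
  then have "(norm ((A ** Z + B) *v v))\<^sup>2 < (norm w)\<^sup>2"
    using pseudo_unitary_norm[of Z v] power_strict_mono[of "norm (Z *v v)" "norm v" 2]
    unfolding wv by simp
  moreover have "frac A B C D Z *v w = (A ** Z + B) *v v"
    by (simp add: frac_def v_def matrix_vector_mul_assoc)
  ultimately show "norm (frac A B C D Z *v w) < norm w"
    using power2_less_imp_less by fastforce
qed

text \<open>The inverse block matrix takes the column with blocks \<open>A ** Z + B\<close> and
  \<open>C ** Z + D\<close> back to Z and the identity. Dividing by the denominator first puts the
  same factor R on both blocks, and it cancels in the quotient.\<close>

lemma frac_inverse:
  assumes "Z \<in> D_I"
  shows "frac (adjoint_mat A) (- adjoint_mat C) (- adjoint_mat B) (adjoint_mat D) (frac A B C D Z) = Z"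
proof -
  define N where "N = C ** Z + D"
  define R where "R = matrix_inv N"
  have N: "invertible N" unfolding N_def by (rule pseudo_unitary_invertible[OF assms])
  have RN: "N ** R = mat 1" "R ** N = mat 1" using N by (simp_all add: R_def matrix_inv_left matrix_inv_right)
  have 1: "adjoint_mat A ** (A ** Z + B) - adjoint_mat C ** N = Z"
  proof -
    have "adjoint_mat A ** (A ** Z + B) - adjoint_mat C ** N
      = (adjoint_mat A ** A - adjoint_mat C ** C) ** Z + (adjoint_mat A ** B - adjoint_mat C ** D)"
      by (simp add: N_def mat_mult_distribs matrix_mul_assoc)
    then show ?thesis using pu unfolding pseudo_unitary_def by simp
  qed
  have 2: "adjoint_mat D ** N - adjoint_mat B ** (A ** Z + B) = mat 1"
  proof -
    have "adjoint_mat B ** A = adjoint_mat D ** C"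
      using pu unfolding pseudo_unitary_def by (metis adjoint_mat_adjoint_mat adjoint_mat_mult)
    moreover have "adjoint_mat D ** N - adjoint_mat B ** (A ** Z + B)
      = (adjoint_mat D ** C - adjoint_mat B ** A) ** Z + (adjoint_mat D ** D - adjoint_mat B ** B)"
      by (simp add: N_def mat_mult_distribs matrix_mul_assoc)
    ultimately show ?thesis using pu unfolding pseudo_unitary_def by simp
  qed
  have "adjoint_mat A ** frac A B C D Z + - adjoint_mat C
      = (adjoint_mat A ** (A ** Z + B) - adjoint_mat C ** N) ** R"
    by (simp add: frac_def N_def[symmetric] R_def[symmetric] mat_mult_distribs
        matrix_mul_assoc[symmetric] RN)
  then have 3: "adjoint_mat A ** frac A B C D Z + - adjoint_mat C = Z ** R" by (simp add: 1)
  have "- adjoint_mat B ** frac A B C D Z + adjoint_mat D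
      = (adjoint_mat D ** N - adjoint_mat B ** (A ** Z + B)) ** R"
    by (simp add: frac_def N_def[symmetric] R_def[symmetric] mat_mult_distribs
        matrix_mul_assoc[symmetric] RN)
  then have 4: "- adjoint_mat B ** frac A B C D Z + adjoint_mat D = R" by (simp add: 2)
  have "matrix_inv R = N" by (rule matrix_inv_unique(2)[OF RN(2)])
  then show ?thesis
    by (simp only: frac_def[of "adjoint_mat A"] 3 4) (simp add: matrix_mul_assoc[symmetric] RN)
qed

lemma has_derivative_frac:
  assumes "Z \<in> D_I"
  shows "(frac A B C D has_derivative
    (\<lambda>X. (A ** X - frac A B C D Z ** C ** X) ** matrix_inv (C ** Z + D))) (at Z)"
proof -
  interpret bb: bounded_bilinear "(**) :: complex^'q^'p \<Rightarrow> complex^'q^'q \<Rightarrow> _"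
    by (rule bounded_bilinear_mat_mult)
  have lin: "bounded_linear ((**) M)" for M :: "complex^'p^'x"
    by (rule bounded_bilinear.bounded_linear_right[OF bounded_bilinear_mat_mult])
  have 1: "((\<lambda>Z. M ** Z + L) has_derivative (\<lambda>X. M ** X)) (at Z)" for M :: "complex^'p^'x" and L
    using has_derivative_add[OF bounded_linear_imp_has_derivative[OF lin[of M]]
        has_derivative_const[of L]] by simp
  have 2: "((\<lambda>Z. matrix_inv (C ** Z + D)) has_derivative
      (\<lambda>X. - (matrix_inv (C ** Z + D) ** (C ** X) ** matrix_inv (C ** Z + D)))) (at Z)"
    using diff_chain_at[OF 1 has_derivative_matrix_inv[OF pseudo_unitary_invertible[OF assms]]]
    by (simp add: o_def)
  show ?thesis
    unfolding frac_def[abs_def]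
    by (rule has_derivative_eq_rhs[OF bb.FDERIV[OF 1 2]])
      (simp add: fun_eq_iff mat_mult_distribs matrix_mul_assoc)
qed

text \<open>A transformation that sends Z to 0 has derivative \<open>A ** X ** adjoint_mat D\<close>
  at Z, where A and D normalize \<open>1 - Z Z\<^sup>*\<close> and \<open>1 - Z\<^sup>* Z\<close>.
  The metric at Z thereby becomes expressible through Z alone.\<close>

lemma pseudo_unitary_zero:
  assumes "Z \<in> D_I" "frac A B C D Z = 0"
  shows "B = - (A ** Z)" "C = - (D ** adjoint_mat Z)"
    and "A ** (mat 1 - Z ** adjoint_mat Z) ** adjoint_mat A = mat 1"
    and "D ** (mat 1 - adjoint_mat Z ** Z) ** adjoint_mat D = mat 1"
    and "matrix_inv (C ** Z + D) = adjoint_mat D"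
proof -
  have N: "invertible (C ** Z + D)" by (rule pseudo_unitary_invertible[OF assms(1)])
  have "(A ** Z + B) ** matrix_inv (C ** Z + D) ** (C ** Z + D) = 0"
    using assms(2) by (simp add: frac_def)
  then have AZ: "A ** Z + B = 0"
    by (simp add: matrix_mul_assoc[symmetric] matrix_inv_left[OF N])
  then show B: "B = - (A ** Z)" by (simp add: eq_neg_iff_add_eq_0 add.commute)
  have 5: "adjoint_mat A ** B = adjoint_mat C ** D" "A ** adjoint_mat C = B ** adjoint_mat D"
    "A ** adjoint_mat A - B ** adjoint_mat B = mat 1" "D ** adjoint_mat D - C ** adjoint_mat C = mat 1"
    using pu by (auto simp: pseudo_unitary_def)
  show 6: "A ** (mat 1 - Z ** adjoint_mat Z) ** adjoint_mat A = mat 1"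
    using 5(3) by (simp add: B adjoint_mat_distribs mat_mult_distribs matrix_mul_assoc)
  then obtain A' where A': "A' ** A = mat 1"
    by (metis matrix_mul_assoc matrix_left_right_inverse)
  have "A ** (adjoint_mat C + Z ** adjoint_mat D) = 0"
    using 5(2) by (simp add: B mat_mult_distribs matrix_mul_assoc)
  then have "A' ** (A ** (adjoint_mat C + Z ** adjoint_mat D)) = 0" by simp
  then have "adjoint_mat C + Z ** adjoint_mat D = 0" by (simp add: matrix_mul_assoc A')
  then have "adjoint_mat (adjoint_mat C + Z ** adjoint_mat D) = 0" by simp
  then show C: "C = - (D ** adjoint_mat Z)"
    by (simp add: adjoint_mat_distribs eq_neg_iff_add_eq_0)
  show 7: "D ** (mat 1 - adjoint_mat Z ** Z) ** adjoint_mat D = mat 1"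
    using 5(4) by (simp add: C adjoint_mat_distribs mat_mult_distribs matrix_mul_assoc)
  show "matrix_inv (C ** Z + D) = adjoint_mat D"
    using 7 by (intro matrix_inv_unique(2)) (simp add: C mat_mult_distribs matrix_mul_assoc)
qed

end

text \<open>P and S may be chosen independently: their Gram matrices are the inverses of
  \<open>1 - Z Z\<^sup>*\<close> and \<open>1 - Z\<^sup>* Z\<close>, and these are intertwined by Z,
  which is the equation \<open>PZ\<close>.\<close>

lemma pseudo_unitary_moebius:
  assumes P: "P ** (mat 1 - Z ** adjoint_mat Z) ** adjoint_mat P = mat 1"
    and S: "S ** (mat 1 - adjoint_mat Z ** Z) ** adjoint_mat S = mat 1"
  shows "pseudo_unitary P (- (P ** Z)) (- (S ** adjoint_mat Z)) S"
proof -
  define Pi where "Pi = adjoint_mat P ** P"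
  define Si where "Si = adjoint_mat S ** S"
  have *: "adjoint_mat X ** X ** H = mat 1 \<and> H ** (adjoint_mat X ** X) = mat 1"
    if "X ** H ** adjoint_mat X = mat 1" for X H :: "complex^'n^'n"
  proof -
    have 1: "adjoint_mat X ** (X ** H) = mat 1" using that matrix_left_right_inverse by blast
    then have "adjoint_mat X ** X ** H = mat 1" by (simp add: matrix_mul_assoc)
    then show ?thesis using matrix_left_right_inverse by blast
  qed
  note 1 = *[OF P, folded Pi_def] and 2 = *[OF S, folded Si_def]
  have Pi: "Pi ** Z ** adjoint_mat Z = Pi - mat 1"
    using 1[THEN conjunct1] by (simp add: mat_mult_diff_right matrix_mul_assoc algebra_simps)
  have Si: "adjoint_mat Z ** Z ** Si = Si - mat 1"
    using 2[THEN conjunct2] by (simp add: mat_mult_diff_left matrix_mul_assoc algebra_simps)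
  have "Pi ** Z ** (mat 1 - adjoint_mat Z ** Z) = Z"
    by (simp add: mat_mult_distribs matrix_mul_assoc Pi)
  then have "Pi ** Z ** (mat 1 - adjoint_mat Z ** Z) ** Si = Z ** Si" by simp
  then have PZ: "Pi ** Z = Z ** Si"
    using 2 by (simp add: matrix_mul_assoc[symmetric])
  have a: "adjoint_mat P ** P - Z ** adjoint_mat S ** S ** adjoint_mat Z = mat 1"
  proof -
    have "Z ** adjoint_mat S ** S ** adjoint_mat Z = Pi ** Z ** adjoint_mat Z"
      unfolding PZ Si_def by (simp add: matrix_mul_assoc)
    then show ?thesis by (simp add: Pi) (simp add: Pi_def)
  qed
  have b: "adjoint_mat S ** S - adjoint_mat Z ** adjoint_mat P ** P ** Z = mat 1"
  proof -
    have "adjoint_mat Z ** adjoint_mat P ** P ** Z = adjoint_mat Z ** (Pi ** Z)"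
      unfolding Pi_def by (simp add: matrix_mul_assoc)
    then show ?thesis by (simp add: PZ matrix_mul_assoc Si) (simp add: Si_def)
  qed
  show ?thesis
    unfolding pseudo_unitary_def
    using P S a b PZ
    by (simp add: Pi_def Si_def adjoint_mat_distribs mat_mult_distribs matrix_mul_assoc)
qed

lemma ex_moebius:
  fixes Z :: "complex^'q^'p"
  assumes "Z \<in> D_I"
  obtains P :: "complex^'p^'p" and S :: "complex^'q^'q"
    where "P ** (mat 1 - Z ** adjoint_mat Z) ** adjoint_mat P = mat 1"
    and "S ** (mat 1 - adjoint_mat Z ** Z) ** adjoint_mat S = mat 1"
proof -
  obtain P :: "complex^'p^'p" where "P ** (mat 1 - Z ** adjoint_mat Z) ** adjoint_mat P = mat 1"
    using hpos_normalize[OF hpos_one_minus[OF adjoint_mat_D_I[OF assms]]]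
    unfolding adjoint_mat_adjoint_mat by blast
  moreover obtain S :: "complex^'q^'q"
    where "S ** (mat 1 - adjoint_mat Z ** Z) ** adjoint_mat S = mat 1"
    using hpos_normalize[OF hpos_one_minus[OF assms]] by blast
  ultimately show ?thesis by (rule that)
qed

lemma frac_moebius_zero [simp]: "frac P (- (P ** Z)) C D Z = 0"
  by (simp add: frac_def)

section \<open>Holomorphic maps and biholomorphisms\<close>

lemma bounded_linear_scaleC_left: "bounded_linear (\<lambda>h. h *\<^sub>C (d::'a::complex_normed))"
proof -
  have "(\<lambda>h. h *\<^sub>C d) = (\<lambda>h. Re h *\<^sub>R d + Im h *\<^sub>R (\<i> *\<^sub>C d))"
  proof
    fix h show "h *\<^sub>C d = Re h *\<^sub>R d + Im h *\<^sub>R (\<i> *\<^sub>C d)"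
      by (subst complex_eq[of h]) (simp add: scaleC_add_left scaleR_eq_scaleC scaleC_scaleC mult.commute)
  qed
  then show ?thesis
    by (simp add: bounded_linear_add bounded_linear_scaleR_const bounded_linear_Re bounded_linear_Im)
qed

lemma holomorphic_map_on_compose:
  assumes f: "holomorphic_map_on f S" "f ` S \<subseteq> T" and g: "holomorphic_map_on g T"
  shows "holomorphic_map_on (\<lambda>x. g (f x)) S"
  unfolding holomorphic_map_on_def
proof
  fix x assume x: "x \<in> S"
  obtain D where D: "(f has_derivative D) (at x within S)" "\<And>v. D (\<i> *\<^sub>C v) = \<i> *\<^sub>C D v"
    using f x unfolding holomorphic_map_on_def by blast
  obtain E where E: "(g has_derivative E) (at (f x) within T)" "\<And>v. E (\<i> *\<^sub>C v) = \<i> *\<^sub>C E v"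
    using f g x unfolding holomorphic_map_on_def by blast
  have "((g \<circ> f) has_derivative (E \<circ> D)) (at x within S)"
    by (rule diff_chain_within[OF D(1) has_derivative_subset[OF E(1) f(2)]])
  then show "\<exists>D. ((\<lambda>x. g (f x)) has_derivative D) (at x within S) \<and> (\<forall>v. D (\<i> *\<^sub>C v) = \<i> *\<^sub>C D v)"
    using D(2) E(2) by (intro exI[of _ "E \<circ> D"]) (simp add: o_def)
qed

lemma holomorphic_map_on_subset:
  "holomorphic_map_on f S \<Longrightarrow> T \<subseteq> S \<Longrightarrow> holomorphic_map_on f T"
  unfolding holomorphic_map_on_def by (meson has_derivative_subset subsetD)

lemma holomorphic_map_on_cong:
  "holomorphic_map_on f S \<Longrightarrow> (\<And>x. x \<in> S \<Longrightarrow> g x = f x) \<Longrightarrow> holomorphic_map_on g S"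
  unfolding holomorphic_map_on_def by (meson has_derivative_transform)

lemma biholomorphismI:
  assumes "holomorphic_map_on f S" "f ` S \<subseteq> T" "holomorphic_map_on h T" "h ` T \<subseteq> S"
    and "\<And>x. x \<in> S \<Longrightarrow> h (f x) = x" "\<And>y. y \<in> T \<Longrightarrow> f (h y) = y"
  shows "biholomorphism f S T"
proof -
  have bij: "bij_betw f S T"
    using assms by (intro bij_betw_byWitness[of _ h]) auto
  have "inv_into S f y = h y" if "y \<in> T" for y
    using assms that bij
    by (metis bij_betw_imp_inj_on image_subset_iff inv_into_f_f)
  then show ?thesis
    unfolding biholomorphism_def using bij assms holomorphic_map_on_cong by metis
qed

text \<open>Replaces \<open>inv_into S f\<close> by an arbitrary two-sided inverse, which is what
  compositions and explicit inverses supply.\<close>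

lemma biholomorphism_iff:
  "biholomorphism f S T \<longleftrightarrow>
     (\<exists>h. holomorphic_map_on f S \<and> f ` S \<subseteq> T \<and> holomorphic_map_on h T \<and> h ` T \<subseteq> S \<and>
        (\<forall>x\<in>S. h (f x) = x) \<and> (\<forall>y\<in>T. f (h y) = y))" (is "_ \<longleftrightarrow> ?R")
proof
  assume f: "biholomorphism f S T"
  have bij: "bij_betw f S T" using f by (simp add: biholomorphism_def)
  have "f ` S \<subseteq> T" "inv_into S f ` T \<subseteq> S"
    using bij_betw_imp_surj_on[OF bij] bij_betw_imp_surj_on[OF bij_betw_inv_into[OF bij]] by simp_all
  then show ?R
    using f bij_betw_inv_into_left[OF bij] bij_betw_inv_into_right[OF bij]
    by (intro exI[of _ "inv_into S f"]) (simp add: biholomorphism_def)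
next
  assume ?R
  then obtain h where "holomorphic_map_on f S" "f ` S \<subseteq> T" "holomorphic_map_on h T" "h ` T \<subseteq> S"
     "\<forall>x\<in>S. h (f x) = x" "\<forall>y\<in>T. f (h y) = y" by blast
  then show "biholomorphism f S T" by (intro biholomorphismI[of f S T h]) simp_all
qed

lemma biholomorphism_compose:
  assumes f: "biholomorphism f S T" and g: "biholomorphism g T U"
  shows "biholomorphism (\<lambda>x. g (f x)) S U"
proof -
  obtain f' where f': "holomorphic_map_on f S" "f ` S \<subseteq> T" "holomorphic_map_on f' T" "f' ` T \<subseteq> S"
    "\<forall>x\<in>S. f' (f x) = x" "\<forall>y\<in>T. f (f' y) = y" using f[unfolded biholomorphism_iff] by blast
  obtain g' where g': "holomorphic_map_on g T" "g ` T \<subseteq> U" "holomorphic_map_on g' U" "g' ` U \<subseteq> T"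
    "\<forall>x\<in>T. g' (g x) = x" "\<forall>y\<in>U. g (g' y) = y" using g[unfolded biholomorphism_iff] by blast
  show ?thesis
  proof (rule biholomorphismI[where h = "\<lambda>y. f' (g' y)"])
    show "holomorphic_map_on (\<lambda>x. g (f x)) S"
      by (rule holomorphic_map_on_compose[OF f'(1,2) g'(1)])
    show "holomorphic_map_on (\<lambda>y. f' (g' y)) U"
      by (rule holomorphic_map_on_compose[OF g'(3,4) f'(3)])
    show "(\<lambda>x. g (f x)) ` S \<subseteq> U" "(\<lambda>y. f' (g' y)) ` U \<subseteq> S"
      using f'(2,4) g'(2,4) by (auto simp: image_subset_iff)
    show "f' (g' (g (f x))) = x" if "x \<in> S" for x
      using that f'(2,5) g'(5) by (simp add: image_subset_iff)
    show "g (f (f' (g' y))) = y" if "y \<in> U" for y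
      using that g'(4,6) f'(6) by (simp add: image_subset_iff)
  qed
qed

lemma biholomorphism_inverse:
  assumes f: "biholomorphism f S T"
  obtains h where "biholomorphism h T S" "\<forall>x\<in>S. h (f x) = x" "\<forall>y\<in>T. f (h y) = y"
proof -
  obtain h where h: "holomorphic_map_on f S" "f ` S \<subseteq> T" "holomorphic_map_on h T" "h ` T \<subseteq> S"
    "\<forall>x\<in>S. h (f x) = x" "\<forall>y\<in>T. f (h y) = y"
    using f[unfolded biholomorphism_iff] by blast
  then have "biholomorphism h T S" unfolding biholomorphism_iff[of h] by blast
  then show ?thesis using h(5,6) by (rule that)
qed

abbreviation fder :: "('a::real_normed_vector \<Rightarrow> 'b::real_normed_vector) \<Rightarrow> 'a \<Rightarrow> 'a \<Rightarrow> 'b" where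
  "fder f x \<equiv> frechet_derivative f (at x)"

lemma holomorphic_map_on_fder:
  assumes "holomorphic_map_on f S" "open S" "x \<in> S"
  shows "(f has_derivative fder f x) (at x)" "fder f x (a *\<^sub>C v) = a *\<^sub>C fder f x v"
proof -
  obtain D where D: "(f has_derivative D) (at x within S)" "\<And>v. D (\<i> *\<^sub>C v) = \<i> *\<^sub>C D v"
    using assms unfolding holomorphic_map_on_def by blast
  have D': "(f has_derivative D) (at x)" using D(1) assms at_within_open by metis
  then have eq: "fder f x = D" using frechet_derivative_at by metis
  show "(f has_derivative fder f x) (at x)" using D' eq by simp
  show "fder f x (a *\<^sub>C v) = a *\<^sub>C fder f x v"
    unfolding eq using complex_linear_iff_imaginary has_derivative_linear[OF D'] D(2) by blast
qed

text \<open>Difference quotients lie in V, and V is closed. Applied to charts, whose values lie in a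
  subspace of matrices.\<close>

lemma has_derivative_image_subspace:
  assumes f: "(f has_derivative D) (at x)" and "open S" "x \<in> S" "f ` S \<subseteq> V"
    and V: "subspace V" "closed V"
  shows "D u \<in> V"
proof -
  have "((\<lambda>t::real. (f (x + t *\<^sub>R u) - f x) /\<^sub>R t) \<longlongrightarrow> D u) (at 0)"
  proof -
    have 1: "((\<lambda>t::real. x + t *\<^sub>R u) has_derivative (\<lambda>t. t *\<^sub>R u)) (at 0)"
      by (auto intro!: derivative_eq_intros)
    have 2: "(f has_derivative D) (at (x + 0 *\<^sub>R u))" using f by simp
    have D: "((\<lambda>t::real. f (x + t *\<^sub>R u)) has_derivative (\<lambda>t. t *\<^sub>R D u)) (at 0)"
      using diff_chain_at[OF 1 2] by (simp add: o_def linear_cmul[OF has_derivative_linear[OF f]])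
    then have "((\<lambda>t. norm (f (x + t *\<^sub>R u) - f x - t *\<^sub>R D u) / \<bar>t\<bar>) \<longlongrightarrow> 0) (at 0)"
      unfolding has_derivative_at by simp
    then have "((\<lambda>t. norm ((f (x + t *\<^sub>R u) - f x) /\<^sub>R t - D u)) \<longlongrightarrow> 0) (at 0)"
    proof (rule Lim_transform_eventually)
      show "\<forall>\<^sub>F t in at 0. norm (f (x + t *\<^sub>R u) - f x - t *\<^sub>R D u) / \<bar>t\<bar>
          = norm ((f (x + t *\<^sub>R u) - f x) /\<^sub>R t - D u)"
        unfolding eventually_at_filter
      proof (intro always_eventually allI impI)
        fix t :: real assume t: "t \<noteq> 0"
        then have "(f (x + t *\<^sub>R u) - f x) /\<^sub>R t - D u = (f (x + t *\<^sub>R u) - f x - t *\<^sub>R D u) /\<^sub>R t"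
          by (simp add: scaleR_diff_right)
        then show "norm (f (x + t *\<^sub>R u) - f x - t *\<^sub>R D u) / \<bar>t\<bar>
          = norm ((f (x + t *\<^sub>R u) - f x) /\<^sub>R t - D u)"
          by (simp add: divide_inverse mult.commute)
      qed
    qed
    from LIM_zero_cancel[OF tendsto_norm_zero_cancel[OF this]] show ?thesis .
  qed
  moreover have "\<forall>\<^sub>F t in at (0::real). (f (x + t *\<^sub>R u) - f x) /\<^sub>R t \<in> V"
  proof -
    have "((\<lambda>t::real. x + t *\<^sub>R u) \<longlongrightarrow> x + 0 *\<^sub>R u) (at 0)" by (intro tendsto_intros)
    then have "\<forall>\<^sub>F t in at (0::real). x + t *\<^sub>R u \<in> S"
      using assms(2,3) by (simp add: topological_tendstoD)
    then show ?thesis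
    proof eventually_elim
      case (elim t)
      then have "f (x + t *\<^sub>R u) \<in> V" "f x \<in> V" using assms(3,4) by auto
      then show ?case by (intro subspace_scale[OF V(1)] subspace_diff[OF V(1)])
    qed
  qed
  ultimately show ?thesis by (intro Lim_in_closed_set[OF V(2)]) auto
qed

text \<open>T may be open only relative to a subspace, so the inverse has a derivative only within
  T. The chain rule is therefore applied within S, and S being open makes the resulting derivative
  of the identity unique.\<close>

lemma biholomorphism_fder_inj:
  assumes f: "biholomorphism f S T" and "open S" "x \<in> S" "fder f x u = 0"
  shows "u = 0"
proof -
  obtain h where h: "holomorphic_map_on f S" "f ` S \<subseteq> T" "holomorphic_map_on h T" "h ` T \<subseteq> S"
    "\<forall>x\<in>S. h (f x) = x" "\<forall>y\<in>T. f (h y) = y" using f[unfolded biholomorphism_iff] by blast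
  obtain K where K: "(h has_derivative K) (at (f x) within T)"
    using h assms(3) unfolding holomorphic_map_on_def by blast
  have fx: "(f has_derivative fder f x) (at x within S)"
    using holomorphic_map_on_fder[OF h(1) assms(2,3)] has_derivative_at_withinI by blast
  have "((h \<circ> f) has_derivative (K \<circ> fder f x)) (at x within S)"
    by (rule diff_chain_within[OF fx has_derivative_subset[OF K h(2)]])
  then have "((\<lambda>x. x) has_derivative (K \<circ> fder f x)) (at x within S)"
    by (rule has_derivative_transform[rotated 2]) (use h(5) assms(3) in auto)
  then have "((\<lambda>x. x) has_derivative (K \<circ> fder f x)) (at x)"
    using at_within_open[OF assms(3,2)] by simp
  then have "K \<circ> fder f x = (\<lambda>x. x)"
    using has_derivative_unique has_derivative_ident by blast
  then have "u = K (fder f x u)" by (metis comp_apply)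
  also have "\<dots> = 0" using assms(4) K has_derivative_linear linear_0 by metis
  finally show ?thesis .
qed

text \<open>Since T need not be open, X must be a direction in which T contains a segment around
  \<open>f x\<close>. Composing with that segment reduces the question to a real variable, where
  derivatives are unique.\<close>

lemma biholomorphism_fder_surj:
  assumes f: "biholomorphism f S T" and "open S" "x \<in> S"
    and e: "e > 0" "\<And>t::real. \<bar>t\<bar> < e \<Longrightarrow> f x + t *\<^sub>R X \<in> T"
  obtains u where "fder f x u = X"
proof -
  obtain h where h: "holomorphic_map_on f S" "f ` S \<subseteq> T" "holomorphic_map_on h T" "h ` T \<subseteq> S"
    "\<forall>x\<in>S. h (f x) = x" "\<forall>y\<in>T. f (h y) = y" using f[unfolded biholomorphism_iff] by blast
  obtain K where K: "(h has_derivative K) (at (f x) within T)"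
    using h assms(3) unfolding holomorphic_map_on_def by blast
  define B where "B = {t::real. \<bar>t\<bar> < e}"
  have B: "open B" "0 \<in> B" using e by (auto simp: B_def open_Collect_less continuous_intros)
  have "((\<lambda>t. f x + t *\<^sub>R X) has_derivative (\<lambda>t. t *\<^sub>R X)) (at 0 within B)"
    by (auto intro!: derivative_eq_intros)
  moreover have "(h has_derivative K) (at (f x + 0 *\<^sub>R X) within (\<lambda>t. f x + t *\<^sub>R X) ` B)"
    using has_derivative_subset[OF K] e by (auto simp: B_def image_subset_iff)
  ultimately have hg: "((\<lambda>t. h (f x + t *\<^sub>R X)) has_derivative (\<lambda>t. K (t *\<^sub>R X))) (at 0 within B)"
    using diff_chain_within[of "\<lambda>t. f x + t *\<^sub>R X"] by (fastforce simp: o_def)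
  have "(f has_derivative fder f x) (at (h (f x + 0 *\<^sub>R X)) within (\<lambda>t. h (f x + t *\<^sub>R X)) ` B)"
    using holomorphic_map_on_fder(1)[OF h(1) assms(2,3)] has_derivative_at_withinI h(5) assms(3) by fastforce
  from diff_chain_within[OF hg this]
  have "((\<lambda>t. f (h (f x + t *\<^sub>R X))) has_derivative (\<lambda>t. fder f x (K (t *\<^sub>R X)))) (at 0 within B)"
    by (simp add: o_def)
  then have "((\<lambda>t. f x + t *\<^sub>R X) has_derivative (\<lambda>t. fder f x (K (t *\<^sub>R X)))) (at 0 within B)"
    by (rule has_derivative_transform[rotated 2]) (use B h(6) e in \<open>auto simp: B_def\<close>)
  then have "((\<lambda>t. f x + t *\<^sub>R X) has_derivative (\<lambda>t. fder f x (K (t *\<^sub>R X)))) (at 0)"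
    using at_within_open[OF B(2,1)] by simp
  moreover have "((\<lambda>t. f x + t *\<^sub>R X) has_derivative (\<lambda>t. t *\<^sub>R X)) (at 0)"
    by (auto intro!: derivative_eq_intros)
  ultimately have "(\<lambda>t. fder f x (K (t *\<^sub>R X))) = (\<lambda>t. t *\<^sub>R X)" by (rule has_derivative_unique)
  from fun_cong[OF this, of 1] have "fder f x (K X) = X" by simp
  then show ?thesis by (rule that)
qed

lemma has_derivative_vecI:
  fixes f :: "'a::real_normed_vector \<Rightarrow> 'b::euclidean_space^'n"
  assumes "\<And>i. ((\<lambda>x. f x $ i) has_derivative (\<lambda>h. D h $ i)) (at x within S)"
  shows "(f has_derivative D) (at x within S)"
  unfolding has_derivative_componentwise_within[of f]
proof
  fix b :: "'b^'n" assume "b \<in> Basis"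
  then obtain i c where "b = axis i c" by (auto simp: Basis_vec_def)
  then show "((\<lambda>x. f x \<bullet> b) has_derivative (\<lambda>x. D x \<bullet> b)) (at x within S)"
    using assms[of i] by (simp add: inner_axis has_derivative_inner_left)
qed

lemma has_derivative_vecD:
  "(f has_derivative D) F \<Longrightarrow> ((\<lambda>x. f x $ i) has_derivative (\<lambda>h. D h $ i)) F"
  by (rule bounded_linear.has_derivative[OF bounded_linear_vec_nth])

lemma holomorphic_map_on_vec:
  fixes f :: "'a::complex_normed \<Rightarrow> 'b::{complex_normed, euclidean_space}^'n"
  shows "holomorphic_map_on f S \<longleftrightarrow> (\<forall>i. holomorphic_map_on (\<lambda>x. f x $ i) S)"
proof (intro iffI allI)
  fix i assume f: "holomorphic_map_on f S"
  show "holomorphic_map_on (\<lambda>x. f x $ i) S"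
    unfolding holomorphic_map_on_def
  proof
    fix x assume "x \<in> S"
    then obtain D where "(f has_derivative D) (at x within S)" "\<forall>v. D (\<i> *\<^sub>C v) = \<i> *\<^sub>C D v"
      using f unfolding holomorphic_map_on_def by blast
    then show "\<exists>D. ((\<lambda>x. f x $ i) has_derivative D) (at x within S) \<and> (\<forall>v. D (\<i> *\<^sub>C v) = \<i> *\<^sub>C D v)"
      using has_derivative_vecD[of f D _ i] by (intro exI[of _ "\<lambda>h. D h $ i"]) simp
  qed
next
  assume f: "\<forall>i. holomorphic_map_on (\<lambda>x. f x $ i) S"
  show "holomorphic_map_on f S"
    unfolding holomorphic_map_on_def
  proof
    fix x assume "x \<in> S"
    then have "\<forall>i. \<exists>D. ((\<lambda>x. f x $ i) has_derivative D) (at x within S) \<and> (\<forall>v. D (\<i> *\<^sub>C v) = \<i> *\<^sub>C D v)"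
      using f unfolding holomorphic_map_on_def by blast
    then obtain D where "\<And>i. ((\<lambda>x. f x $ i) has_derivative D i) (at x within S)"
      "\<And>i v. D i (\<i> *\<^sub>C v) = \<i> *\<^sub>C D i v" by metis
    then show "\<exists>D. (f has_derivative D) (at x within S) \<and> (\<forall>v. D (\<i> *\<^sub>C v) = \<i> *\<^sub>C D v)"
      by (intro exI[of _ "\<lambda>h. \<chi> i. D i h"]) (auto intro!: has_derivative_vecI simp: vec_eq_iff)
  qed
qed

lemma holomorphic_map_on_complex:
  "holomorphic_map_on (f::complex \<Rightarrow> complex) S \<longleftrightarrow> f holomorphic_on S"
proof
  assume f: "holomorphic_map_on f S"
  show "f holomorphic_on S" unfolding holomorphic_on_def
  proof
    fix x assume "x \<in> S"
    then obtain D where D: "(f has_derivative D) (at x within S)" "\<And>v. D (\<i> *\<^sub>C v) = \<i> *\<^sub>C D v"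
      using f unfolding holomorphic_map_on_def by blast
    have "D a = D 1 * a" for a
      using complex_linear_iff_imaginary[OF has_derivative_linear[OF D(1)] D(2), of a 1]
      unfolding scaleC_complex_def by (metis mult.commute mult.right_neutral)
    then have "D = (*) (D 1)" by (rule ext)
    then have "(f has_field_derivative D 1) (at x within S)"
      using D(1) unfolding has_field_derivative_def by metis
    then show "f field_differentiable at x within S"
      unfolding field_differentiable_def by blast
  qed
next
  assume f: "f holomorphic_on S"
  show "holomorphic_map_on f S" unfolding holomorphic_map_on_def
  proof
    fix x assume "x \<in> S"
    then obtain d where "(f has_field_derivative d) (at x within S)"
      using f unfolding holomorphic_on_def field_differentiable_def by blast
    then show "\<exists>D. (f has_derivative D) (at x within S) \<and> (\<forall>v. D (\<i> *\<^sub>C v) = \<i> *\<^sub>C D v)"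
      unfolding has_field_derivative_def
      by (intro exI[of _ "(*) d"]) (simp add: scaleC_complex_def)
  qed
qed

lemma fder_chain:
  fixes f :: "'a::real_normed_vector \<Rightarrow> 'b::real_normed_vector"
    and g :: "'b \<Rightarrow> 'c::real_normed_vector"
  assumes "(f has_derivative D) (at x)" "(g has_derivative E) (at (f x))"
  shows "fder (\<lambda>x. g (f x)) x = (\<lambda>v. E (D v))"
  using frechet_derivative_at[OF diff_chain_at[OF assms], symmetric] by (simp add: o_def)

lemma fder_cong_open:
  fixes f g :: "'a::real_normed_vector \<Rightarrow> 'b::real_normed_vector"
  assumes "open S" "x \<in> S" "\<And>y. y \<in> S \<Longrightarrow> f y = g y"
  shows "fder f x = fder g x"
proof -
  have "(f has_derivative D) (at x) \<longleftrightarrow> (g has_derivative D) (at x)" for D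
    using has_derivative_transform_within_open[OF _ assms(1,2)] assms(3) by metis
  then show ?thesis unfolding frechet_derivative_def by simp
qed

lemma fder_vec_nth:
  assumes "f differentiable (at x)" shows "fder (\<lambda>x. f x $ i) x v = fder f x v $ i"
  using frechet_derivative_at[OF has_derivative_vecD[OF assms[unfolded frechet_derivative_works]], symmetric]
  by simp

section \<open>Holomorphy of the derivative in several variables\<close>

text \<open>Restriction to the complex line through x in direction v turns the derivative into a
  Cauchy integral. As x enters the integrand alone, continuity and differentiability in x follow
  under the integral sign.\<close>

lemma cauchy_fder:
  fixes \<Phi> :: "complex^'n \<Rightarrow> complex"
  assumes hol: "holomorphic_map_on \<Phi> \<Omega>" "open \<Omega>" and \<rho>: "\<rho> > 0"
    and sub: "\<And>\<zeta>. cmod \<zeta> \<le> \<rho> \<Longrightarrow> x + \<zeta> *\<^sub>C v \<in> \<Omega>"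
  shows "fder \<Phi> x v = integral (cbox 0 1)
    (\<lambda>t. \<Phi> (x + (of_real \<rho> * exp (2 * of_real pi * \<i> * of_real t)) *\<^sub>C v) / (of_real \<rho> * exp (2 * of_real pi * \<i> * of_real t)))"
proof -
  define \<phi> where "\<phi> = (\<lambda>\<zeta>. \<Phi> (x + \<zeta> *\<^sub>C v))"
  have d: "(\<phi> has_field_derivative fder \<Phi> (x + \<zeta> *\<^sub>C v) v) (at \<zeta>)" if "x + \<zeta> *\<^sub>C v \<in> \<Omega>" for \<zeta>
  proof -
    note * = holomorphic_map_on_fder[OF hol that]
    have 1: "((\<lambda>\<zeta>. x + \<zeta> *\<^sub>C v) has_derivative (\<lambda>h. h *\<^sub>C v)) (at \<zeta>)"
      using has_derivative_add[OF has_derivative_const[of x] bounded_linear_imp_has_derivative[OF bounded_linear_scaleC_left[of v]]] by simp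
    from diff_chain_at[OF 1 *(1)] show ?thesis
      by (simp add: \<phi>_def o_def *(2) has_field_derivative_def scaleC_complex_def mult.commute[of _ "fder _ _ _"])
  qed
  have "continuous_on (cball 0 \<rho>) \<phi>"
    by (rule continuous_at_imp_continuous_on, rule ballI, rule DERIV_isCont[OF d[OF sub]]) simp
  moreover have "\<phi> holomorphic_on ball 0 \<rho>"
    unfolding holomorphic_on_open[OF open_ball]
  proof
    fix \<zeta> :: complex assume "\<zeta> \<in> ball 0 \<rho>"
    then show "\<exists>f'. (\<phi> has_field_derivative f') (at \<zeta>)" using d[OF sub, of \<zeta>] by (intro exI) simp
  qed
  moreover have "0 \<in> ball (0::complex) \<rho>" using \<rho> by simp
  ultimately have "(\<phi> has_field_derivative (1 / (2 * of_real pi * \<i>) * contour_integral (circlepath 0 \<rho>) (\<lambda>u. \<phi> u / (u - 0)^2))) (at 0)"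
    by (rule Cauchy_derivative_integral_circlepath)
  moreover have "(\<phi> has_field_derivative fder \<Phi> x v) (at 0)" using d[of 0] sub[of 0] \<rho> by simp
  ultimately have "fder \<Phi> x v = 1 / (2 * of_real pi * \<i>) * contour_integral (circlepath 0 \<rho>) (\<lambda>u. \<phi> u / (u - 0)^2)"
    using DERIV_unique by blast
  also have "\<dots> = integral {0..1} (\<lambda>t. 1 / (2 * of_real pi * \<i>) *
      (\<phi> (circlepath 0 \<rho> t) / (circlepath 0 \<rho> t - 0)^2 * vector_derivative (circlepath 0 \<rho>) (at t)))"
    unfolding contour_integral_integral by (simp only: integral_mult_right)
  \<comment> \<open>On the circle \<open>u = \<rho> exp (2 pi \<i> t)\<close> the velocity is
    \<open>2 pi \<i> u\<close>; it cancels the prefactor and one of the two factors u in the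
    denominator.\<close>
  also have "\<dots> = integral {0..1} (\<lambda>t. \<phi> (of_real \<rho> * exp (2 * of_real pi * \<i> * of_real t)) / (of_real \<rho> * exp (2 * of_real pi * \<i> * of_real t)))"
    using \<rho> by (intro integral_cong)
      (simp only: vector_derivative_circlepath, simp add: circlepath power2_eq_square)
  finally show ?thesis by (simp add: \<phi>_def)
qed

text \<open>One radius \<rho> has to serve all points near x0, so that the contour does not depend
  on x. The summand 1 in its denominator covers v = 0.\<close>

lemma cauchy_ball:
  fixes v :: "complex^'n"
  assumes "open \<Omega>" "x0 \<in> \<Omega>"
  obtains r \<rho> where "r > 0" "\<rho> > 0" "ball x0 r \<subseteq> \<Omega>"
    "\<And>x \<zeta>. x \<in> ball x0 r \<Longrightarrow> cmod \<zeta> \<le> \<rho> \<Longrightarrow> x + \<zeta> *\<^sub>C v \<in> \<Omega>"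
proof -
  obtain s where s: "s > 0" "ball x0 s \<subseteq> \<Omega>" using assms open_contains_ball by blast
  define \<rho> where "\<rho> = s / 2 / (norm v + 1)"
  have \<rho>: "\<rho> > 0" using s norm_ge_zero[of v] by (simp add: \<rho>_def add_nonneg_pos)
  have *: "x + \<zeta> *\<^sub>C v \<in> \<Omega>" if "x \<in> ball x0 (s/2)" "cmod \<zeta> \<le> \<rho>" for x \<zeta>
  proof -
    have "norm (\<zeta> *\<^sub>C v) \<le> \<rho> * norm v" using that by (simp add: norm_scaleC_vec mult_right_mono)
    also have "\<dots> \<le> \<rho> * (norm v + 1)" using \<rho> by (simp add: mult_left_mono)
    also have "\<dots> = s/2"
    proof -
      have "norm v + 1 \<noteq> 0" using norm_ge_zero[of v] by linarith
      then show ?thesis unfolding \<rho>_def by (rule nonzero_eq_divide_eq[THEN iffD1]) simp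
    qed
    finally have "dist x0 (x + \<zeta> *\<^sub>C v) < s"
      using that(1) norm_triangle_ineq4[of "x0 - x" "\<zeta> *\<^sub>C v"] by (simp add: dist_norm algebra_simps)
    then show ?thesis using s by auto
  qed
  from \<rho> show ?thesis using that[of "s/2" \<rho>] * s subset_ball[of "s/2" s x0] by auto
qed

lemma continuous_on_circle:
  fixes v :: "'a::complex_normed"
  shows "continuous_on S (\<lambda>p. fst p + (of_real \<rho> * exp (2 * of_real pi * \<i> * of_real (snd p))) *\<^sub>C v)"
  by (intro continuous_intros bounded_linear.continuous_on[OF bounded_linear_scaleC_left])

lemma continuous_on_fder:
  fixes \<Phi> :: "complex^'n \<Rightarrow> complex"
  assumes hol: "holomorphic_map_on \<Phi> \<Omega>" "open \<Omega>"
  shows "continuous_on \<Omega> (\<lambda>x. fder \<Phi> x v)"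
proof (rule continuous_at_imp_continuous_on, rule ballI)
  fix x0 assume "x0 \<in> \<Omega>"
  then obtain r \<rho> where r: "r > 0" "\<rho> > 0" "ball x0 r \<subseteq> \<Omega>"
    "\<And>x \<zeta>. x \<in> ball x0 r \<Longrightarrow> cmod \<zeta> \<le> \<rho> \<Longrightarrow> x + \<zeta> *\<^sub>C v \<in> \<Omega>"
    using cauchy_ball[OF hol(2), of x0 v] by blast
  have cont: "continuous_on \<Omega> \<Phi>"
    using holomorphic_map_on_fder(1)[OF hol] has_derivative_continuous continuous_at_imp_continuous_on by blast
  have "continuous_on (ball x0 r \<times> cbox 0 1) (\<lambda>(x,t). \<Phi> (x + (of_real \<rho> * exp (2 * of_real pi * \<i> * of_real t)) *\<^sub>C v) / (of_real \<rho> * exp (2 * of_real pi * \<i> * of_real t)))"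
    unfolding split_def
    by (intro continuous_intros continuous_on_compose2[OF cont continuous_on_circle])
      (use r in \<open>auto simp: norm_mult\<close>)
  then have "continuous_on (ball x0 r) (\<lambda>x. integral (cbox 0 1) (\<lambda>t. \<Phi> (x + (of_real \<rho> * exp (2 * of_real pi * \<i> * of_real t)) *\<^sub>C v) / (of_real \<rho> * exp (2 * of_real pi * \<i> * of_real t))))"
    by (rule integral_continuous_on_param)
  then have "continuous_on (ball x0 r) (\<lambda>x. fder \<Phi> x v)"
    by (rule continuous_on_eq) (use cauchy_fder[OF hol r(2), of _ v] r(4) in auto)
  then show "isCont (\<lambda>x. fder \<Phi> x v) x0"
    using r(1) by (simp add: continuous_on_eq_continuous_at)
qed

text \<open>The Leibniz rule asks for an integrand whose derivative is continuous as a bounded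
  linear map; \<open>continuous_on_fder\<close> provides this one direction at a time.\<close>

lemma holomorphic_map_on_fder_fder:
  fixes \<Phi> :: "complex^'n \<Rightarrow> complex"
  assumes hol: "holomorphic_map_on \<Phi> \<Omega>" "open \<Omega>"
  shows "holomorphic_map_on (\<lambda>x. fder \<Phi> x v) \<Omega>"
  unfolding holomorphic_map_on_def
proof
  fix x0 assume x0: "x0 \<in> \<Omega>"
  obtain r \<rho> where r: "r > 0" "\<rho> > 0" "ball x0 r \<subseteq> \<Omega>"
    "\<And>x \<zeta>. x \<in> ball x0 r \<Longrightarrow> cmod \<zeta> \<le> \<rho> \<Longrightarrow> x + \<zeta> *\<^sub>C v \<in> \<Omega>"
    using cauchy_ball[OF hol(2) x0, of v] by blast
  have cont: "continuous_on \<Omega> \<Phi>"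
    using holomorphic_map_on_fder(1)[OF hol] has_derivative_continuous continuous_at_imp_continuous_on by blast
  define c where "c t = of_real \<rho> * exp (2 * of_real pi * \<i> * of_real t)" for t
  have c: "cmod (c t) = \<rho>" "c t \<noteq> 0" for t using r(2) by (auto simp: c_def norm_mult)
  have in\<Omega>: "x + c t *\<^sub>C v \<in> \<Omega>" if "x \<in> ball x0 r" for x t using r(4) that c(1) by simp
  define fx where "fx x t = Blinfun (\<lambda>u. fder \<Phi> (x + c t *\<^sub>C v) u / c t)" for x t
  have fx: "blinfun_apply (fx x t) = (\<lambda>u. fder \<Phi> (x + c t *\<^sub>C v) u / c t)" if "x \<in> ball x0 r" for x t
    unfolding fx_def
    by (intro bounded_linear_Blinfun_apply bounded_linear_divide bounded_linear_compose[OF bounded_linear_divide]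
       has_derivative_bounded_linear[OF holomorphic_map_on_fder(1)[OF hol in\<Omega>[OF that]]])
  have cont_c: "continuous_on S (\<lambda>p. c (snd p))" for S :: "((complex^'n) \<times> real) set"
    unfolding c_def by (intro continuous_intros)
  have cont_fx: "continuous_on (ball x0 r \<times> cbox 0 1) (\<lambda>(x, t). fx x t)"
    unfolding split_def
  proof (rule continuous_on_blinfun_componentwise)
    fix b :: "complex^'n"
    have "continuous_on (ball x0 r \<times> cbox 0 1) (\<lambda>p. fder \<Phi> (fst p + c (snd p) *\<^sub>C v) b / c (snd p))"
      using in\<Omega> c(2)
      by (intro continuous_on_divide cont_c continuous_on_compose2[OF continuous_on_fder[OF hol]
          continuous_on_circle[of _ \<rho> v, folded c_def]]) auto
    then show "continuous_on (ball x0 r \<times> cbox 0 1) (\<lambda>p. blinfun_apply (fx (fst p) (snd p)) b)"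
      by (rule continuous_on_eq) (auto simp: fx)
  qed
  have der: "((\<lambda>x. \<Phi> (x + c t *\<^sub>C v) / c t) has_derivative blinfun_apply (fx x t)) (at x within ball x0 r)"
    if "x \<in> ball x0 r" for x t
  proof -
    have 1: "((\<lambda>x. x + c t *\<^sub>C v) has_derivative (\<lambda>h. h)) (at x)" 
      by (auto intro!: derivative_eq_intros)
    have "((\<lambda>x. \<Phi> (x + c t *\<^sub>C v)) has_derivative fder \<Phi> (x + c t *\<^sub>C v)) (at x)"
      using diff_chain_at[OF 1 holomorphic_map_on_fder(1)[OF hol in\<Omega>[OF that]]] by (simp add: o_def)
    from bounded_linear.has_derivative[OF bounded_linear_divide[of "c t"] this]
    show ?thesis unfolding fx[OF that] by (rule has_derivative_at_withinI)
  qed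
  have int: "(\<lambda>t. \<Phi> (x + c t *\<^sub>C v) / c t) integrable_on cbox 0 1" if "x \<in> ball x0 r" for x
  proof (rule integrable_continuous)
    have "continuous_on (cbox 0 1) (\<lambda>t::real. \<Phi> (fst (x, t) + (of_real \<rho> * exp (2 * of_real pi * \<i> * of_real (snd (x, t)))) *\<^sub>C v))"
      by (rule continuous_on_compose2[OF cont]; (rule continuous_on_compose2[OF continuous_on_circle[of UNIV]])?)
        (use in\<Omega>[OF that] in \<open>auto simp: c_def intro!: continuous_intros\<close>)
    then show "continuous_on (cbox 0 1) (\<lambda>t. \<Phi> (x + c t *\<^sub>C v) / c t)"
      using c(2) by (intro continuous_on_divide) (auto simp: c_def intro!: continuous_intros)
  qed
  have "((\<lambda>x. integral (cbox 0 1) (\<lambda>t. \<Phi> (x + c t *\<^sub>C v) / c t)) has_derivative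
      blinfun_apply (integral (cbox 0 1) (fx x0))) (at x0 within ball x0 r)"
    using r(1) by (intro leibniz_rule[OF der int cont_fx]) auto
  then have D: "((\<lambda>x. fder \<Phi> x v) has_derivative blinfun_apply (integral (cbox 0 1) (fx x0))) (at x0 within ball x0 r)"
    by (rule has_derivative_transform[rotated 2])
      (use cauchy_fder[OF hol r(2), of _ v] r(1,4) in \<open>auto simp: c_def\<close>)
  have x0r: "x0 \<in> ball x0 r" using r(1) by simp
  have "fx x0 integrable_on cbox 0 1"
  proof (rule integrable_continuous)
    have "continuous_on (cbox 0 1) (\<lambda>t. (\<lambda>(x,t). fx x t) (x0, t))"
      by (rule continuous_on_compose2[OF cont_fx]) (use r(1) in \<open>auto intro!: continuous_intros\<close>)
    then show "continuous_on (cbox 0 1) (fx x0)" by simp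
  qed
  then have app: "blinfun_apply (integral (cbox 0 1) (fx x0)) u = integral (cbox 0 1) (\<lambda>t. blinfun_apply (fx x0 t) u)" for u
    by (rule blinfun_apply_integral)
  have "blinfun_apply (integral (cbox 0 1) (fx x0)) (\<i> *\<^sub>C u) = \<i> *\<^sub>C blinfun_apply (integral (cbox 0 1) (fx x0)) u" for u
    unfolding app fx[OF x0r] scaleC_complex_def
    by (simp add: holomorphic_map_on_fder(2)[OF hol in\<Omega>[OF x0r]] scaleC_complex_def
        flip: integral_mult_right times_divide_eq_right)
  then show "\<exists>D. ((\<lambda>x. fder \<Phi> x v) has_derivative D) (at x0 within \<Omega>) \<and> (\<forall>v. D (\<i> *\<^sub>C v) = \<i> *\<^sub>C D v)"
    using D x0r has_derivative_at_withinI at_within_open[OF x0r open_ball] by metis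
qed

lemma holomorphic_map_on_fder_mat:
  fixes \<Phi> :: "complex^'n \<Rightarrow> complex^'q^'p"
  assumes hol: "holomorphic_map_on \<Phi> \<Omega>" "open \<Omega>"
  shows "holomorphic_map_on (\<lambda>x. fder \<Phi> x v) \<Omega>"
  unfolding holomorphic_map_on_vec
proof (intro allI)
  fix i j
  have h1: "holomorphic_map_on (\<lambda>x. \<Phi> x $ i) \<Omega>" using hol by (simp add: holomorphic_map_on_vec[of \<Phi>])
  then have h2: "holomorphic_map_on (\<lambda>x. \<Phi> x $ i $ j) \<Omega>" by (simp add: holomorphic_map_on_vec[of "\<lambda>x. \<Phi> x $ i"])
  have "fder \<Phi> x v $ i $ j = fder (\<lambda>x. \<Phi> x $ i $ j) x v" if "x \<in> \<Omega>" for x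
    using holomorphic_map_on_fder(1)[OF hol that] holomorphic_map_on_fder(1)[OF h1 hol(2) that]
    by (simp add: fder_vec_nth differentiable_def exI)
  then show "holomorphic_map_on (\<lambda>x. fder \<Phi> x v $ i $ j) \<Omega>"
    using holomorphic_map_on_cong[OF holomorphic_map_on_fder_fder[OF h2 hol(2), of v]] by simp
qed

section \<open>Derivatives along complex and real curves\<close>

lemma holomorphic_cderiv:
  assumes "holomorphic_map_on f S" "open S" "z \<in> S"
  shows "(f has_derivative (\<lambda>h. h *\<^sub>C cderiv f z)) (at z)"
proof -
  note * = holomorphic_map_on_fder[OF assms]
  have "fder f z h = h *\<^sub>C cderiv f z" for h
    using *(2)[of h 1] by (simp add: cderiv_def scaleC_complex_def)
  then have "fder f z = (\<lambda>h. h *\<^sub>C cderiv f z)" ..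
  with *(1) show ?thesis by simp
qed

lemma cderiv_eqI: "(f has_derivative (\<lambda>h. h *\<^sub>C d)) (at z) \<Longrightarrow> cderiv f z = d"
  unfolding cderiv_def by (drule frechet_derivative_at) (metis scaleC_one)

lemma holomorphic_map_on_cderiv_vec:
  fixes f :: "complex \<Rightarrow> complex^'n"
  assumes "holomorphic_map_on f S" "open S"
  shows "holomorphic_map_on (cderiv f) S"
  unfolding holomorphic_map_on_vec
proof
  fix i
  have h: "(\<lambda>z. f z $ i) holomorphic_on S"
    using assms(1) unfolding holomorphic_map_on_vec holomorphic_map_on_complex by blast
  have "cderiv f z $ i = deriv (\<lambda>z. f z $ i) z" if "z \<in> S" for z
    using has_derivative_vecD[OF holomorphic_cderiv[OF assms that], of i]
    by (intro DERIV_imp_deriv[symmetric])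
      (simp add: has_field_derivative_def scaleC_complex_def mult.commute[of _ "cderiv _ _ $ _"])
  then show "holomorphic_map_on (\<lambda>x. cderiv f x $ i) S"
    using holomorphic_map_on_cong[of "deriv (\<lambda>z. f z $ i)" S] holomorphic_deriv[OF h assms(2)]
    by (simp add: holomorphic_map_on_complex)
qed

lemma holomorphic_map_on_cderiv_mat:
  fixes f :: "complex \<Rightarrow> complex^'q^'p"
  assumes "holomorphic_map_on f S" "open S"
  shows "holomorphic_map_on (cderiv f) S"
  unfolding holomorphic_map_on_vec[of "cderiv f"]
proof
  fix i
  have h: "holomorphic_map_on (\<lambda>z. f z $ i) S"
    using assms(1) unfolding holomorphic_map_on_vec[of f] by blast
  have "cderiv f z $ i = cderiv (\<lambda>z. f z $ i) z" if "z \<in> S" for z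
    using has_derivative_vecD[OF holomorphic_cderiv[OF assms that], of i]
    by (intro cderiv_eqI[symmetric]) simp
  then show "holomorphic_map_on (\<lambda>x. cderiv f x $ i) S"
    using holomorphic_map_on_cong[OF holomorphic_map_on_cderiv_vec[OF h assms(2)]] by simp
qed

text \<open>Product rule for a linear map applied to a vector when both move. The map is controlled
  only for each fixed vector, as for \<open>fder \<Phi> y v\<close>; expansion in a finite basis
  bridges the gap.\<close>

lemma has_derivative_apply:
  fixes A :: "'a::real_normed_vector \<Rightarrow> 'b::euclidean_space \<Rightarrow> 'c::real_normed_vector"
  assumes A: "\<And>v. ((\<lambda>y. A y v) has_derivative B v) (at (f w))"
    and lin: "\<And>y. y \<in> T \<Longrightarrow> linear (A y)" and T: "open T" "f w \<in> T"
    and f: "(f has_derivative F) (at w)" and g: "(g has_derivative G) (at w)"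
  shows "((\<lambda>w. A (f w) (g w)) has_derivative (\<lambda>h. B (g w) (F h) + A (f w) (G h))) (at w)"
proof -
  have rep: "A y v = (\<Sum>b\<in>Basis. (v \<bullet> b) *\<^sub>R A y b)" if "y \<in> T" for y v
    using linear_sum[OF lin[OF that], of "\<lambda>b. (v \<bullet> b) *\<^sub>R b" Basis]
    by (simp add: euclidean_representation linear_cmul[OF lin[OF that]])
  \<comment> \<open>B inherits linearity in v from A because derivatives are unique.\<close>
  have repB: "B v k = (\<Sum>b\<in>Basis. (v \<bullet> b) *\<^sub>R B b k)" for v k
  proof -
    have "((\<lambda>y. \<Sum>b\<in>Basis. (v \<bullet> b) *\<^sub>R A y b) has_derivative (\<lambda>k. \<Sum>b\<in>Basis. (v \<bullet> b) *\<^sub>R B b k)) (at (f w))"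
      by (intro has_derivative_sum has_derivative_scaleR_right A)
    then have "((\<lambda>y. A y v) has_derivative (\<lambda>k. \<Sum>b\<in>Basis. (v \<bullet> b) *\<^sub>R B b k)) (at (f w))"
      by (rule has_derivative_transform_within_open[OF _ T]) (simp add: rep)
    from has_derivative_unique[OF A this] show ?thesis by (rule fun_cong)
  qed
  have Af: "((\<lambda>w. A (f w) b) has_derivative (\<lambda>h. B b (F h))) (at w)" for b
    using diff_chain_at[OF f A[of b]] by (simp add: o_def)
  have gb: "((\<lambda>w. g w \<bullet> b) has_derivative (\<lambda>h. G h \<bullet> b)) (at w)" for b
    by (rule has_derivative_inner_left[OF g])
  have "((\<lambda>w. \<Sum>b\<in>Basis. (g w \<bullet> b) *\<^sub>R A (f w) b) has_derivative
      (\<lambda>h. \<Sum>b\<in>Basis. (g w \<bullet> b) *\<^sub>R B b (F h) + (G h \<bullet> b) *\<^sub>R A (f w) b)) (at w)"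
    by (intro has_derivative_sum has_derivative_scaleR[OF gb Af])
  also have "(\<lambda>h. \<Sum>b\<in>Basis. (g w \<bullet> b) *\<^sub>R B b (F h) + (G h \<bullet> b) *\<^sub>R A (f w) b)
      = (\<lambda>h. B (g w) (F h) + A (f w) (G h))"
    by (simp add: sum.distrib repB[symmetric] rep[OF T(2), symmetric])
  finally have D: "((\<lambda>w. \<Sum>b\<in>Basis. (g w \<bullet> b) *\<^sub>R A (f w) b) has_derivative
      (\<lambda>h. B (g w) (F h) + A (f w) (G h))) (at w)" .
  have "\<forall>\<^sub>F w' in at w. f w' \<in> T"
    using has_derivative_continuous[OF f] T by (simp add: continuous_at topological_tendstoD)
  then have "\<forall>\<^sub>F w' in at w. (\<Sum>b\<in>Basis. (g w' \<bullet> b) *\<^sub>R A (f w') b) = A (f w') (g w')"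
    by eventually_elim (simp add: rep[symmetric])
  then show ?thesis
    by (rule has_derivative_transform_eventually[OF D]) (simp_all add: rep[OF T(2), symmetric])
qed

section \<open>Second derivatives along lines and the operator \<open>ddbar\<close>\<close>

text \<open>A relation rather than an iterated derivative operator, so that whatever first
  derivative the calculus rules produce can serve as the witness.\<close>

definition has2 :: "(real \<Rightarrow> real) \<Rightarrow> real \<Rightarrow> bool" where
  "has2 q a \<longleftrightarrow> (\<exists>q'. (\<forall>\<^sub>F t in nhds 0. (q has_real_derivative q' t) (at t)) \<and> (q' has_real_derivative a) (at 0))"

text \<open>The first derivative vanishes at the minimum 0. If the second were negative, the first
  would be negative just to the right, and the mean value theorem would push q below its
  minimum.\<close>

lemma has2_nonneg:
  assumes "has2 q a" and nn: "\<forall>\<^sub>F t in nhds 0. q t \<ge> 0" and "q 0 = 0"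
  shows "a \<ge> 0"
proof (rule ccontr)
  assume a: "\<not> a \<ge> 0"
  obtain q' where q': "\<forall>\<^sub>F t in nhds 0. (q has_real_derivative q' t) (at t)" "(q' has_real_derivative a) (at 0)"
    using assms(1) unfolding has2_def by blast
  obtain e where e: "e > 0" "\<And>t. \<bar>t\<bar> < e \<Longrightarrow> (q has_real_derivative q' t) (at t) \<and> q t \<ge> 0"
    using eventually_conj[OF q'(1) nn] unfolding eventually_nhds_metric by (auto simp: dist_real_def)
  have q0: "q' 0 = 0"
    using DERIV_local_min[of q "q' 0" 0 e] e assms(3) by auto
  obtain d where d: "d > 0" "\<And>h. 0 < h \<Longrightarrow> h < d \<Longrightarrow> q' h < 0"
    using DERIV_neg_dec_right[OF q'(2)] a q0 by (auto simp: not_le)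
  define h where "h = min d e / 2"
  have h: "0 < h" "h < d" "h < e" using d e by (auto simp: h_def)
  obtain z where z: "0 < z" "z < h" "q h - q 0 = (h - 0) * q' z"
    using MVT2[of 0 h q q'] h e by fastforce
  then have "q h < 0" using d(2)[of z] h assms(3) by (simp add: mult_pos_neg)
  then show False using e(2)[of h] h by simp
qed

lemma has2_diff: "has2 q a \<Longrightarrow> has2 p b \<Longrightarrow> has2 (\<lambda>t. q t - p t) (a - b)"
proof -
  assume "has2 q a" "has2 p b"
  then obtain q' p' where 1: "\<forall>\<^sub>F t in nhds 0. (q has_real_derivative q' t) (at t)" "(q' has_real_derivative a) (at 0)"
    "\<forall>\<^sub>F t in nhds 0. (p has_real_derivative p' t) (at t)" "(p' has_real_derivative b) (at 0)"
    unfolding has2_def by blast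
  from 1(1,3) have "\<forall>\<^sub>F t in nhds 0. ((\<lambda>t. q t - p t) has_real_derivative (q' t - p' t)) (at t)"
    by eventually_elim (rule DERIV_diff)
  moreover have "((\<lambda>t. q' t - p' t) has_real_derivative (a - b)) (at 0)" using 1 DERIV_diff by blast
  ultimately show ?thesis unfolding has2_def by (intro exI[of _ "\<lambda>t. q' t - p' t"] conjI)
qed

text \<open>Comparison of functions that touch at 0: it converts an upper barrier for the metric
  into a curvature bound.\<close>

lemma has2_mono:
  assumes "has2 q a" "has2 p b" "\<forall>\<^sub>F t in nhds 0. q t \<le> p t" "q 0 = p 0"
  shows "a \<le> b"
proof -
  have "\<forall>\<^sub>F t in nhds 0. 0 \<le> p t - q t" using assms(3) by eventually_elim simp
  then show ?thesis using has2_nonneg[OF has2_diff[OF assms(2,1)]] assms(4) by simp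
qed

lemma has2_unique: "has2 q a \<Longrightarrow> has2 q b \<Longrightarrow> a = b"
  using has2_mono[of q a q b] has2_mono[of q b q a] by simp

text \<open>Regularity is asked for one direction at a time, which is the form in which
  \<open>ddbar\<close> reads off second derivatives.\<close>

definition c2at :: "(complex \<Rightarrow> 'b::real_normed_vector) \<Rightarrow> complex \<Rightarrow> bool" where
  "c2at u z \<longleftrightarrow> (\<forall>\<^sub>F w in nhds z. u differentiable at w) \<and> (\<forall>v. (\<lambda>w. fder u w v) differentiable (at z))"

lemma differentiable_cong_ev:
  assumes "f differentiable (at x)" "\<forall>\<^sub>F y in nhds x. f y = g y"
  shows "g differentiable (at x)"
proof -
  have "\<forall>\<^sub>F y in at x. f y = g y" "f x = g x"
    using assms(2) eventually_nhds_x_imp_x[OF assms(2)] by (auto simp: eventually_at_filter elim: eventually_mono)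
  then show ?thesis
    using assms(1) has_derivative_transform_eventually unfolding differentiable_def by blast
qed

lemma c2at_D: "c2at u z \<Longrightarrow> u differentiable (at z)"
  unfolding c2at_def using eventually_nhds_x_imp_x by blast

lemma c2at_I:
  assumes "\<forall>\<^sub>F w in nhds z. (u has_derivative D w) (at w)" "\<And>v. (\<lambda>w. D w v) differentiable (at z)"
  shows "c2at u z"
proof -
  have "\<forall>\<^sub>F w in nhds z. D w v = fder u w v" for v
    using assms(1) by eventually_elim (simp add: frechet_derivative_at[symmetric])
  then have "(\<lambda>w. fder u w v) differentiable (at z)" for v
    by (rule differentiable_cong_ev[OF assms(2)[of v]])
  moreover have "\<forall>\<^sub>F w in nhds z. u differentiable at w"
    using assms(1) by eventually_elim (auto simp: differentiable_def)
  ultimately show ?thesis unfolding c2at_def by blast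
qed

lemma c2at_has_derivative:
  "c2at u z \<Longrightarrow> \<forall>\<^sub>F w in nhds z. (u has_derivative fder u w) (at w)"
  unfolding c2at_def by (auto elim: eventually_mono simp: frechet_derivative_works)

lemma c2at_const: "c2at (\<lambda>z. c) z"
  by (rule c2at_I[where D = "\<lambda>w v. 0"]) auto

lemma c2at_add: "c2at u z \<Longrightarrow> c2at w z \<Longrightarrow> c2at (\<lambda>z. u z + w z) z"
proof (rule c2at_I[where D = "\<lambda>z v. fder u z v + fder w z v"])
  assume a: "c2at u z" "c2at w z"
  show "\<forall>\<^sub>F z in nhds z. ((\<lambda>z. u z + w z) has_derivative (\<lambda>v. fder u z v + fder w z v)) (at z)"
    using c2at_has_derivative[OF a(1)] c2at_has_derivative[OF a(2)]
    by eventually_elim (rule has_derivative_add)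
  show "(\<lambda>z. fder u z v + fder w z v) differentiable (at z)" for v
    using a by (simp add: c2at_def)
qed

lemma c2at_sum: "(\<And>i. i \<in> I \<Longrightarrow> c2at (u i) z) \<Longrightarrow> c2at (\<lambda>z. \<Sum>i\<in>I. u i z) z"
  by (induction I rule: infinite_finite_induct) (auto intro: c2at_const c2at_add)

lemma c2at_mult:
  fixes u w :: "complex \<Rightarrow> 'b::real_normed_algebra"
  assumes a: "c2at u z" "c2at w z" shows "c2at (\<lambda>z. u z * w z) z"
proof (rule c2at_I[where D = "\<lambda>z v. u z * fder w z v + fder u z v * w z"])
  show "\<forall>\<^sub>F z in nhds z. ((\<lambda>z. u z * w z) has_derivative (\<lambda>v. u z * fder w z v + fder u z v * w z)) (at z)"
    using c2at_has_derivative[OF a(1)] c2at_has_derivative[OF a(2)]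
    by eventually_elim (rule has_derivative_mult)
  show "(\<lambda>z. u z * fder w z v + fder u z v * w z) differentiable (at z)" for v
    using a c2at_D by (intro differentiable_add differentiable_mult) (auto simp: c2at_def)
qed

lemma c2at_linear:
  assumes L: "bounded_linear L" and a: "c2at u z" shows "c2at (\<lambda>z. L (u z)) z"
proof (rule c2at_I[where D = "\<lambda>z v. L (fder u z v)"])
  show "\<forall>\<^sub>F z in nhds z. ((\<lambda>z. L (u z)) has_derivative (\<lambda>v. L (fder u z v))) (at z)"
    using c2at_has_derivative[OF a] by eventually_elim (rule bounded_linear.has_derivative[OF L])
  show "(\<lambda>z. L (fder u z v)) differentiable (at z)" for v
    using a bounded_linear.has_derivative[OF L] unfolding c2at_def differentiable_def by blast
qed

lemma c2at_ln:
  fixes u :: "complex \<Rightarrow> real"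
  assumes a: "c2at u z" and pos: "\<forall>\<^sub>F w in nhds z. u w > 0" shows "c2at (\<lambda>z. ln (u z)) z"
proof (rule c2at_I[where D = "\<lambda>z v. fder u z v * inverse (u z)"])
  show "\<forall>\<^sub>F z in nhds z. ((\<lambda>z. ln (u z)) has_derivative (\<lambda>v. fder u z v * inverse (u z))) (at z)"
    using c2at_has_derivative[OF a] pos
  proof eventually_elim
    case (elim z)
    then show ?case by (auto intro!: derivative_eq_intros simp: divide_inverse)
  qed
  have "u z \<noteq> 0" using eventually_nhds_x_imp_x[OF pos] by simp
  then show "(\<lambda>z. fder u z v * inverse (u z)) differentiable (at z)" for v
    using a c2at_D[OF a] by (intro differentiable_mult differentiable_inverse) (auto simp: c2at_def)
qed

lemma c2at_compose:
  fixes G :: "'a::euclidean_space \<Rightarrow> 'b::real_normed_vector"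
  assumes G: "\<And>x. x \<in> T \<Longrightarrow> G differentiable (at x)"
    "\<And>v x. x \<in> T \<Longrightarrow> (\<lambda>x. fder G x v) differentiable (at x)" and T: "open T" "f z \<in> T"
    and f: "c2at f z"
  shows "c2at (\<lambda>z. G (f z)) z"
proof (rule c2at_I[where D = "\<lambda>w v. fder G (f w) (fder f w v)"])
  have "isCont f z" using c2at_D[OF f] by (rule differentiable_imp_continuous_within)
  then have "(f \<longlongrightarrow> f z) (nhds z)" by (simp add: isCont_def tendsto_at_iff_tendsto_nhds)
  from topological_tendstoD[OF this T] have "\<forall>\<^sub>F w in nhds z. f w \<in> T" .
  with c2at_has_derivative[OF f]
  show "\<forall>\<^sub>F w in nhds z. ((\<lambda>z. G (f z)) has_derivative (\<lambda>v. fder G (f w) (fder f w v))) (at w)"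
  proof eventually_elim
    case (elim w)
    have "(G has_derivative fder G (f w)) (at (f w))" using G(1)[OF elim(2)] by (simp add: frechet_derivative_works)
    from diff_chain_at[OF elim(1) this] show ?case by (simp add: o_def)
  qed
  fix v
  obtain B where B: "\<And>v. ((\<lambda>x. fder G x v) has_derivative B v) (at (f z))"
    using G(2)[OF T(2)] unfolding differentiable_def by metis
  obtain F where F: "(f has_derivative F) (at z)" using c2at_D[OF f] differentiable_def by blast
  obtain F' where F': "((\<lambda>w. fder f w v) has_derivative F') (at z)" using f unfolding c2at_def differentiable_def by blast
  have "linear (fder G y)" if "y \<in> T" for y
    using G(1)[OF that] has_derivative_linear by (auto simp: frechet_derivative_works)
  from has_derivative_apply[OF B this T F F']
  show "(\<lambda>w. fder G (f w) (fder f w v)) differentiable (at z)" unfolding differentiable_def by blast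
qed

text \<open>Four times the operator is the Laplacian, the sum of the second derivatives in the
  directions 1 and i; mixed derivatives enter only the imaginary part.\<close>

lemma ddbar_eq:
  fixes u :: "complex \<Rightarrow> real"
  assumes u: "c2at u z"
  obtains a b where "has2 (\<lambda>t. u (z + of_real t)) a" "has2 (\<lambda>t. u (z + of_real t * \<i>)) b"
    "Re (ddbar u z 1 1) = (a + b) / 4"
proof -
  have 1: "has2 (\<lambda>t. u (z + of_real t * v)) (fder (\<lambda>w. fder u w v) z v)" for v
  proof -
    have line: "((\<lambda>t. z + of_real t * v) has_derivative (\<lambda>h. of_real h * v)) (at t)" for t
      by (auto intro!: derivative_eq_intros)
    have "\<forall>\<^sub>F t in nhds 0. (u has_derivative fder u (z + of_real t * v)) (at (z + of_real t * v))"
    proof -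
      have "((\<lambda>t. z + complex_of_real t * v) \<longlongrightarrow> z + of_real 0 * v) (nhds 0)"
        by (intro tendsto_intros filterlim_ident)
      then have "filterlim (\<lambda>t. z + complex_of_real t * v) (nhds z) (nhds 0)" by simp
      from eventually_compose_filterlim[OF c2at_has_derivative[OF u] this] show ?thesis .
    qed
    then have "\<forall>\<^sub>F t in nhds 0. ((\<lambda>t. u (z + of_real t * v)) has_real_derivative fder u (z + of_real t * v) v) (at t)"
    proof eventually_elim
      case (elim t)
      have "fder u (z + of_real t * v) (of_real h * v) = h * fder u (z + of_real t * v) v" for h
        using linear_cmul[OF has_derivative_linear[OF elim], of h v] by (simp add: scaleR_conv_of_real)
      then show ?case
        using diff_chain_at[OF line elim] by (simp add: o_def has_field_derivative_def mult.commute[of _ "fder _ _ _"])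
    qed
    moreover have "((\<lambda>t. fder u (z + of_real t * v) v) has_real_derivative fder (\<lambda>w. fder u w v) z v) (at 0)"
    proof -
      have d: "((\<lambda>w. fder u w v) has_derivative fder (\<lambda>w. fder u w v) z) (at z)"
        using u by (simp add: c2at_def frechet_derivative_works[symmetric])
      then have "((\<lambda>w. fder u w v) has_derivative fder (\<lambda>w. fder u w v) z) (at (z + of_real 0 * v))" by simp
      from diff_chain_at[OF line this]
      show ?thesis
        using linear_cmul[OF has_derivative_linear[OF d], of _ v]
        by (simp add: o_def has_field_derivative_def scaleR_conv_of_real mult.commute[of _ "fder _ _ _"])
    qed
    ultimately show ?thesis unfolding has2_def
      by (intro exI[of _ "\<lambda>t. fder u (z + complex_of_real t * v) v"] conjI)
  qed
  define p where "p = fder (\<lambda>w. fder u w 1) z"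
  define q where "q = fder (\<lambda>w. fder u w \<i>) z"
  have pq: "((\<lambda>w. fder u w 1) has_derivative p) (at z)" "((\<lambda>w. fder u w \<i>) has_derivative q) (at z)"
    using u by (simp_all add: p_def q_def c2at_def frechet_derivative_works[symmetric])
  have "\<forall>\<^sub>F w in nhds z. (of_real (fder u w 1) + \<i> * of_real (fder u w \<i>)) / 2
      = wirtinger_bar 1 (\<lambda>y. complex_of_real (u y)) w"
    using c2at_has_derivative[OF u]
  proof eventually_elim
    case (elim w)
    have "fder (\<lambda>y. complex_of_real (u y)) w = (\<lambda>h. of_real (fder u w h))"
    proof -
      have "((\<lambda>y. complex_of_real (u y)) has_derivative (\<lambda>h. complex_of_real (fder u w h))) (at w)"
        by (rule has_derivative_of_real[OF elim])
      from frechet_derivative_at[OF this, symmetric] show ?thesis .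
    qed
    then show ?case by (simp add: wirtinger_bar_def scaleC_complex_def)
  qed
  then have ev: "\<forall>\<^sub>F w in at z. (of_real (fder u w 1) + \<i> * of_real (fder u w \<i>)) / 2
      = wirtinger_bar 1 (\<lambda>y. complex_of_real (u y)) w"
    and eq: "(of_real (fder u z 1) + \<i> * of_real (fder u z \<i>)) / 2
      = wirtinger_bar 1 (\<lambda>y. complex_of_real (u y)) z"
    by (auto simp: eventually_at_filter elim: eventually_mono dest: eventually_nhds_x_imp_x)
  have "((\<lambda>w. (of_real (fder u w 1) + \<i> * of_real (fder u w \<i>)) / 2) has_derivative
      (\<lambda>h. (of_real (p h) + \<i> * of_real (q h)) / 2)) (at z)"
    by (auto intro!: derivative_eq_intros pq)
  from frechet_derivative_at[OF has_derivative_transform_eventually[OF this ev eq UNIV_I], symmetric]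
  have "ddbar u z 1 1 = ((of_real (p 1) + \<i> * of_real (q 1)) / 2 - \<i> * ((of_real (p \<i>) + \<i> * of_real (q \<i>)) / 2)) / 2"
    unfolding ddbar_def wirtinger_def by (simp add: scaleC_complex_def)
  then have "Re (ddbar u z 1 1) = (p 1 + q \<i>) / 4" by (simp only:) simp
  then show ?thesis using that[of "p 1" "q \<i>"] 1[of 1] 1[of \<i>] by (simp add: p_def q_def)
qed

section \<open>Hermitian forms given by coefficient matrices\<close>

lemma herm_eq_cip: "herm A u v = cip (u v* A) v"
proof -
  have "herm A u v = (\<Sum>j\<in>UNIV. \<Sum>i\<in>UNIV. A $ i $ j * u $ i * cnj (v $ j))"
    unfolding herm_def by (rule sum.swap)
  then show ?thesis
    by (simp add: cip_def vector_matrix_mult_def sum_distrib_right sum_distrib_left mult_ac)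
qed

lemma vec_mat_scaleC: "(a *\<^sub>C u) v* A = a *\<^sub>C (u v* (A::complex^'n^'m))"
  by (simp add: vec_eq_iff vector_matrix_mult_def scaleC_complex_def sum_distrib_left mult_ac)

lemma herm_add_left: "herm A (u + w) v = herm A u v + herm A w v"
  by (simp add: herm_eq_cip vector_matrix_left_distrib cip_add_left)

lemma herm_diff_left: "herm A (u - w) v = herm A u v - herm A w v"
  by (simp add: herm_eq_cip vector_matrix_mult_diff_distrib cip_diff_left)

lemma herm_scaleC_left: "herm A (a *\<^sub>C u) v = a * herm A u v"
  by (simp add: herm_eq_cip vec_mat_scaleC cip_scaleC_left)

lemma herm_scaleC_right: "herm A u (a *\<^sub>C v) = cnj a * herm A u v"
  by (simp add: herm_eq_cip cip_scaleC_right)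

lemma herm_commute: assumes "pos_def A" shows "herm A u v = cnj (herm A v u)"
proof -
  have a: "cnj (A $ j $ i) = A $ i $ j" for i j
    using assms unfolding pos_def_def by (metis complex_cnj_cnj)
  have "herm A u v = (\<Sum>j\<in>UNIV. \<Sum>i\<in>UNIV. A $ i $ j * u $ i * cnj (v $ j))"
    unfolding herm_def by (rule sum.swap)
  also have "\<dots> = cnj (herm A v u)"
    unfolding herm_def by (simp add: a mult_ac)
  finally show ?thesis .
qed

lemma herm_pos: "pos_def A \<Longrightarrow> v \<noteq> 0 \<Longrightarrow> 0 < Re (herm A v v)"
  by (simp add: pos_def_def)

lemma pos_def_invertible:
  assumes "pos_def A" shows "invertible A"
  unfolding invertible_iff_ker
proof (intro allI impI)
  fix w assume w: "A *v w = 0"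
  have "herm A (\<chi> i. cnj (w $ i)) (\<chi> i. cnj (w $ i)) = cip (A *v w) w"
    by (simp add: herm_def cip_def matrix_vector_mult_def sum_distrib_right sum_distrib_left mult_ac)
  also have "\<dots> = 0" by (simp add: w)
  finally have "(\<chi> i. cnj (w $ i)) = 0"
    using herm_pos[OF assms, of "\<chi> i. cnj (w $ i)"] by fastforce
  then show "w = 0" by (simp add: vec_eq_iff)
qed

section \<open>The size of the metric in matrix coordinates\<close>

text \<open>The form of \<open>1 - Y Y\<^sup>*\<close> is at least 1 - s times the squared norm, and
  Cauchy--Schwarz turns this lower bound into a bound on the inverse R.\<close>

lemma inverse_gram_bound:
  fixes Y :: "complex^'q^'p"
  assumes R: "R ** (mat 1 - Y ** adjoint_mat Y) = mat 1"
    and s: "\<And>v. (norm (adjoint_mat Y *v v))\<^sup>2 \<le> s * (norm v)\<^sup>2" "s < 1"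
  shows "norm (R *v v) \<le> 1 / (1 - s) * norm v"
proof -
  define w where "w = R *v v"
  have "(mat 1 - Y ** adjoint_mat Y) ** R = mat 1" using R matrix_left_right_inverse by blast
  then have v: "v = (mat 1 - Y ** adjoint_mat Y) *v w" by (simp add: w_def matrix_vector_mul_assoc)
  have "Re (cip v w) = (norm w)\<^sup>2 - (norm (adjoint_mat Y *v w))\<^sup>2"
    unfolding v using cip_gram[of "adjoint_mat Y" w]
    by (simp add: matrix_vector_mult_diff_rdistrib cip_diff_left cip_self flip: of_real_power)
  then have "(1 - s) * (norm w)\<^sup>2 \<le> Re (cip v w)" using s(1)[of w] by (simp add: algebra_simps)
  also have "\<dots> \<le> norm v * norm w" using cmod_cip_le complex_Re_le_cmod order_trans by blast
  finally have "((1 - s) * norm w) * norm w \<le> norm v * norm w" by (simp add: power2_eq_square mult.assoc)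
  then have "(1 - s) * norm w \<le> norm v" by (cases "w = 0") auto
  then show ?thesis using s(2) by (simp add: w_def pos_le_divide_eq mult.commute)
qed

lemma op_bound_adjoint:
  assumes "\<And>v. (norm (Z *v v))\<^sup>2 \<le> s * (norm v)\<^sup>2" "s \<ge> 0"
  shows "(norm (adjoint_mat Z *v v))\<^sup>2 \<le> s * (norm v)\<^sup>2"
proof (cases "adjoint_mat Z *v v = 0")
  case False
  let ?u = "adjoint_mat Z *v v"
  have 1: "norm (Z *v ?u) \<le> sqrt s * norm ?u"
    by (rule power2_le_imp_le) (use assms in \<open>auto simp: power_mult_distrib\<close>)
  have "(norm ?u)\<^sup>2 = Re (cip (Z *v ?u) v)" by (metis cip_mat_left cip_self Re_complex_of_real)
  also have "\<dots> \<le> norm (Z *v ?u) * norm v" using cmod_cip_le complex_Re_le_cmod order_trans by blast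
  also have "\<dots> \<le> sqrt s * norm ?u * norm v" by (intro mult_right_mono 1) simp
  finally have "norm ?u \<le> sqrt s * norm v" using False by (simp add: power2_eq_square mult_ac)
  then have "(norm ?u)\<^sup>2 \<le> (sqrt s * norm v)\<^sup>2" by (intro power_mono) auto
  then show ?thesis using assms(2) by (simp add: power_mult_distrib)
qed (use assms in simp)

text \<open>The Gram matrix of P is the inverse of H whichever normalizer P was chosen, so
  expressions in the Gram matrix depend on H alone.\<close>

lemma adjoint_gram_inverse:
  fixes P H :: "complex^'n^'n"
  assumes "P ** H ** adjoint_mat P = mat 1"
  shows "(adjoint_mat P ** P) ** H = mat 1" "H ** (adjoint_mat P ** P) = mat 1"
proof -
  have "adjoint_mat P ** (P ** H) = mat 1" using assms matrix_left_right_inverse by blast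
  then show "(adjoint_mat P ** P) ** H = mat 1" by (simp add: matrix_mul_assoc)
  then show "H ** (adjoint_mat P ** P) = mat 1" using matrix_left_right_inverse by blast
qed

lemma mip_sandwich: "mip (P ** X ** adjoint_mat S) (P ** Y ** adjoint_mat S)
    = mip ((adjoint_mat P ** P) ** X ** (adjoint_mat S ** S)) Y"
proof -
  have "mip (P ** X ** adjoint_mat S) (P ** Y ** adjoint_mat S)
      = mip (adjoint_mat P ** (P ** X ** adjoint_mat S)) (Y ** adjoint_mat S)"
    using mip_mult_left[of "adjoint_mat P" "P ** X ** adjoint_mat S" "Y ** adjoint_mat S"]
    by (simp add: matrix_mul_assoc)
  also have "\<dots> = mip (adjoint_mat P ** (P ** X ** adjoint_mat S) ** S) Y"
    using mip_mult_right[of "adjoint_mat P ** (P ** X ** adjoint_mat S)" S Y] by simp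
  finally show ?thesis by (simp add: matrix_mul_assoc)
qed

lemma norm_sandwich_le:
  fixes Z X :: "complex^'q^'p" and P :: "complex^'p^'p" and S :: "complex^'q^'q"
  assumes P: "P ** (mat 1 - Z ** adjoint_mat Z) ** adjoint_mat P = mat 1"
    and S: "S ** (mat 1 - adjoint_mat Z ** Z) ** adjoint_mat S = mat 1"
    and s: "\<And>v. (norm (Z *v v))\<^sup>2 \<le> s * (norm v)\<^sup>2" "0 \<le> s" "s < 1"
  shows "norm ((adjoint_mat P ** P) ** X) \<le> 1 / (1 - s) * norm X"
    and "norm (X ** (adjoint_mat S ** S)) \<le> 1 / (1 - s) * norm X"
proof -
  show "norm ((adjoint_mat P ** P) ** X) \<le> 1 / (1 - s) * norm X"
    by (rule norm_mat_mult_op,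
        rule inverse_gram_bound[OF adjoint_gram_inverse(1)[OF P] op_bound_adjoint[OF s(1,2)] s(3)])
  have "norm ((adjoint_mat S ** S) ** adjoint_mat X) \<le> 1 / (1 - s) * norm (adjoint_mat X)"
    by (rule norm_mat_mult_op, rule inverse_gram_bound[where Y = "adjoint_mat Z"])
      (use adjoint_gram_inverse(1)[OF S] s in auto)
  then show "norm (X ** (adjoint_mat S ** S)) \<le> 1 / (1 - s) * norm X"
    using norm_adjoint_mat[of "X ** (adjoint_mat S ** S)"] by (simp add: adjoint_mat_mult)
qed

text \<open>The Gram matrices of P and S differ from the identity by terms containing Z and its
  adjoint once each, so the metric at Z agrees with the one at 0 up to second order. For
  \<open>norm Z \<le> 1/2\<close> both Gram matrices have operator norm at most 4/3, and 16/9 + 4/3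
  is below 4.\<close>

lemma sandwich_near_identity:
  fixes Z X Y :: "complex^'q^'p" and P :: "complex^'p^'p" and S :: "complex^'q^'q"
  assumes P: "P ** (mat 1 - Z ** adjoint_mat Z) ** adjoint_mat P = mat 1"
    and S: "S ** (mat 1 - adjoint_mat Z ** Z) ** adjoint_mat S = mat 1"
    and Z: "norm Z \<le> 1/2"
  shows "cmod (mip (P ** X ** adjoint_mat S) (P ** Y ** adjoint_mat S) - mip X Y)
     \<le> 4 * (norm Z)\<^sup>2 * norm X * norm Y"
proof -
  define Pi where "Pi = adjoint_mat P ** P"
  define Si where "Si = adjoint_mat S ** S"
  have s: "(norm (Z *v v))\<^sup>2 \<le> 1/4 * (norm v)\<^sup>2" for v
  proof -
    have "norm (Z *v v) \<le> 1/2 * norm v"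
      using norm_matvec_le[of Z v] mult_right_mono[OF Z norm_ge_zero[of v]] by linarith
    then have "(norm (Z *v v))\<^sup>2 \<le> (1/2 * norm v)\<^sup>2" by (intro power_mono) auto
    then show ?thesis by (simp add: power_mult_distrib power_divide)
  qed
  have b: "norm (Pi ** M) \<le> 4/3 * norm M" "norm (M ** Si) \<le> 4/3 * norm M" for M :: "complex^'q^'p"
    using norm_sandwich_le[OF P S s, of M] by (simp_all add: Pi_def Si_def)
  have 1: "Pi - mat 1 = Pi ** (Z ** adjoint_mat Z)"
    using adjoint_gram_inverse(1)[OF P] unfolding Pi_def by (simp add: mat_mult_diff_right algebra_simps)
  have 2: "Si - mat 1 = (adjoint_mat Z ** Z) ** Si"
    using adjoint_gram_inverse(2)[OF S] unfolding Si_def by (simp add: mat_mult_diff_left algebra_simps)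
  have zz: "norm (Z ** adjoint_mat Z ** M) \<le> (norm Z)\<^sup>2 * norm M"
    "norm (M ** adjoint_mat Z ** Z) \<le> (norm Z)\<^sup>2 * norm M" for M :: "complex^'q^'p"
  proof -
    have "norm (Z ** adjoint_mat Z ** M) \<le> norm Z * norm (adjoint_mat Z) * norm M"
      "norm (M ** adjoint_mat Z ** Z) \<le> norm M * norm (adjoint_mat Z) * norm Z"
      by (rule order_trans[OF norm_mat_mult_le mult_right_mono[OF norm_mat_mult_le norm_ge_zero]])+
    then show "norm (Z ** adjoint_mat Z ** M) \<le> (norm Z)\<^sup>2 * norm M"
      "norm (M ** adjoint_mat Z ** Z) \<le> (norm Z)\<^sup>2 * norm M"
      by (simp_all add: power2_eq_square mult_ac)
  qed
  have eq: "Pi ** X ** Si - X = Pi ** (Z ** adjoint_mat Z ** (X ** Si)) + (X ** adjoint_mat Z ** Z) ** Si"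
  proof -
    have "Pi ** X ** Si - X = (Pi - mat 1) ** (X ** Si) + X ** (Si - mat 1)"
      by (simp add: mat_mult_distribs matrix_mul_assoc)
    then show ?thesis unfolding 1 2 by (simp add: matrix_mul_assoc)
  qed
  have "norm (Pi ** X ** Si - X) \<le> norm (Pi ** (Z ** adjoint_mat Z ** (X ** Si))) + norm ((X ** adjoint_mat Z ** Z) ** Si)"
    unfolding eq by (rule norm_triangle_ineq)
  moreover have "norm (Pi ** (Z ** adjoint_mat Z ** (X ** Si))) \<le> 16/9 * ((norm Z)\<^sup>2 * norm X)"
    using b(1)[of "Z ** adjoint_mat Z ** (X ** Si)"] zz(1)[of "X ** Si"]
      mult_left_mono[OF b(2)[of X] zero_le_power2[of "norm Z"]] by linarith
  moreover have "norm ((X ** adjoint_mat Z ** Z) ** Si) \<le> 4/3 * ((norm Z)\<^sup>2 * norm X)"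
    using b(2)[of "X ** adjoint_mat Z ** Z"] zz(2)[of X] by linarith
  moreover have "0 \<le> (norm Z)\<^sup>2 * norm X" by simp
  ultimately have n: "norm (Pi ** X ** Si - X) \<le> 4 * (norm Z)\<^sup>2 * norm X"
    unfolding mult.assoc by linarith
  have "cmod (mip (Pi ** X ** Si - X) Y) \<le> norm (Pi ** X ** Si - X) * norm Y" by (rule cmod_mip_le)
  also have "\<dots> \<le> 4 * (norm Z)\<^sup>2 * norm X * norm Y" by (rule mult_right_mono[OF n]) simp
  finally show ?thesis
    by (simp add: mip_diff_left mip_sandwich Pi_def Si_def)
qed

lemma holomorphic_frac:
  fixes A :: "complex^'p^'p" and B :: "complex^'q^'p"
  assumes "pseudo_unitary A B C D" shows "holomorphic_map_on (frac A B C D) D_I"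
  unfolding holomorphic_map_on_def
proof
  fix Z :: "complex^'q^'p" assume Z: "Z \<in> D_I"
  show "\<exists>E. (frac A B C D has_derivative E) (at Z within D_I) \<and> (\<forall>v. E (\<i> *\<^sub>C v) = \<i> *\<^sub>C E v)"
    by (intro exI conjI allI, rule has_derivative_at_withinI[OF has_derivative_frac[OF assms Z]])
      (simp add: mat_mult_scaleC_left mat_mult_scaleC_right scaleC_diff_right[symmetric])
qed

lemma wirtinger_complex_linear:
  assumes "(G has_derivative D) (at x)"
  shows "wirtinger u G x = (D u - \<i> * D (\<i> *\<^sub>C u)) / 2"
  unfolding wirtinger_def frechet_derivative_at[OF assms, symmetric] ..

lemma wirtinger_axis_sum:
  fixes G :: "complex^'n \<Rightarrow> complex"
  assumes "G differentiable (at x)"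
  shows "wirtinger u G x = (\<Sum>i\<in>UNIV. u $ i * wirtinger (axis i 1) G x)"
proof -
  define D where "D = fder G x"
  have D: "(G has_derivative D) (at x)" using assms by (simp add: D_def frechet_derivative_works)
  then have lin: "linear D" by (rule has_derivative_linear)
  define w where "w v = (1/2) * D v - (\<i>/2) * D (\<i> *\<^sub>C v)" for v
  have lw: "linear w"
  proof (rule linearI)
    show "w (a + b) = w a + w b" for a b
      unfolding w_def by (simp add: scaleC_add_right linear_add[OF lin] algebra_simps)
    fix r and b :: "complex^'n"
    have "\<i> *\<^sub>C (r *\<^sub>R b) = r *\<^sub>R (\<i> *\<^sub>C b)" by (simp add: scaleR_eq_scaleC scaleC_scaleC mult.commute)
    then show "w (r *\<^sub>R b) = r *\<^sub>R w b"
      unfolding w_def by (simp add: linear_cmul[OF lin] scaleR_right_diff_distrib)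
  qed
  have "w (a *\<^sub>C v) = a *\<^sub>C w v" for a v
  proof (rule complex_linear_iff_imaginary[OF lw])
    fix v :: "complex^'n"
    have "\<i> *\<^sub>C (\<i> *\<^sub>C v) = (-1::real) *\<^sub>R v" by (simp add: scaleC_scaleC scaleR_eq_scaleC del: scaleR_minus1_left)
    then have "D (\<i> *\<^sub>C (\<i> *\<^sub>C v)) = - D v" by (simp add: linear_neg[OF lin])
    then show "w (\<i> *\<^sub>C v) = \<i> *\<^sub>C w v"
      unfolding w_def scaleC_complex_def by (simp add: algebra_simps)
  qed
  then have w: "w (a *\<^sub>C v) = a * w v" for a v by (simp add: scaleC_complex_def)
  have "u = (\<Sum>i\<in>UNIV. (u $ i) *\<^sub>C axis i 1)"
    by (simp add: vec_eq_iff scaleC_complex_def axis_def if_distrib cong: if_cong)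
  then have "w u = w (\<Sum>i\<in>UNIV. (u $ i) *\<^sub>C axis i 1)" by (rule arg_cong)
  also have "\<dots> = (\<Sum>i\<in>UNIV. u $ i * w (axis i 1))" by (simp add: linear_sum[OF lw] w)
  finally show ?thesis by (simp add: wirtinger_complex_linear[OF D] w_def diff_divide_distrib)
qed

text \<open>Lowering the index cancels the inverse matrix in \<open>christoffel\<close> and leaves a
  first derivative of the metric, which can be compared across charts.\<close>

lemma herm_christoffel:
  fixes g :: "complex^'n \<Rightarrow> complex^'n^'n"
  assumes pd: "pos_def (g x)" and diff: "\<And>i j. (\<lambda>y. g y $ i $ j) differentiable (at x)"
  shows "herm (g x) (christoffel g x u u) v = wirtinger u (\<lambda>y. herm (g y) u v) x"
proof -
  let ?w = "\<lambda>i j l. wirtinger (axis i 1) (\<lambda>y. g y $ j $ l) x"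
  have inv: "(\<Sum>k\<in>UNIV. matrix_inv (g x) $ l' $ k * g x $ k $ l) = (if l' = l then 1 else 0)" for l' l
    using arg_cong[OF matrix_inv_left[OF pos_def_invertible[OF pd]], of "\<lambda>M. M $ l' $ l"]
    by (simp add: matrix_matrix_mult_def mat_def)
  have key: "(\<Sum>k\<in>UNIV. g x $ k $ l * (\<Sum>i\<in>UNIV. \<Sum>j\<in>UNIV. \<Sum>l'\<in>UNIV.
       matrix_inv (g x) $ l' $ k * ?w i j l' * u $ i * u $ j)) = (\<Sum>i\<in>UNIV. \<Sum>j\<in>UNIV. ?w i j l * u $ i * u $ j)" for l
  proof -
    have "(\<Sum>k\<in>UNIV. g x $ k $ l * (\<Sum>i\<in>UNIV. \<Sum>j\<in>UNIV. \<Sum>l'\<in>UNIV.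
       matrix_inv (g x) $ l' $ k * ?w i j l' * u $ i * u $ j))
      = (\<Sum>k\<in>UNIV. \<Sum>i\<in>UNIV. \<Sum>j\<in>UNIV. \<Sum>l'\<in>UNIV.
       (matrix_inv (g x) $ l' $ k * g x $ k $ l) * (?w i j l' * u $ i * u $ j))"
      by (simp add: sum_distrib_left mult_ac)
    also have "\<dots> = (\<Sum>i\<in>UNIV. \<Sum>k\<in>UNIV. \<Sum>j\<in>UNIV. \<Sum>l'\<in>UNIV.
       (matrix_inv (g x) $ l' $ k * g x $ k $ l) * (?w i j l' * u $ i * u $ j))"
      by (rule sum.swap)
    also have "\<dots> = (\<Sum>i\<in>UNIV. \<Sum>j\<in>UNIV. \<Sum>k\<in>UNIV. \<Sum>l'\<in>UNIV.
       (matrix_inv (g x) $ l' $ k * g x $ k $ l) * (?w i j l' * u $ i * u $ j))"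
      by (intro sum.cong refl sum.swap)
    also have "\<dots> = (\<Sum>i\<in>UNIV. \<Sum>j\<in>UNIV. \<Sum>l'\<in>UNIV. \<Sum>k\<in>UNIV.
       (matrix_inv (g x) $ l' $ k * g x $ k $ l) * (?w i j l' * u $ i * u $ j))"
      by (intro sum.cong refl sum.swap)
    also have "\<dots> = (\<Sum>i\<in>UNIV. \<Sum>j\<in>UNIV. \<Sum>l'\<in>UNIV. (if l' = l then ?w i j l' * u $ i * u $ j else 0))"
      unfolding sum_distrib_right[symmetric] inv by (intro sum.cong refl) simp
    also have "\<dots> = (\<Sum>i\<in>UNIV. \<Sum>j\<in>UNIV. ?w i j l * u $ i * u $ j)" by simp
    finally show ?thesis .
  qed
  have "herm (g x) (christoffel g x u u) v =
    (\<Sum>l\<in>UNIV. (\<Sum>k\<in>UNIV. g x $ k $ l * (\<Sum>i\<in>UNIV. \<Sum>j\<in>UNIV. \<Sum>l'\<in>UNIV.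
       matrix_inv (g x) $ l' $ k * ?w i j l' * u $ i * u $ j)) * cnj (v $ l))"
    by (simp add: herm_eq_cip cip_def vector_matrix_mult_def christoffel_def mult.commute)
  also have "\<dots> = (\<Sum>l\<in>UNIV. (\<Sum>i\<in>UNIV. \<Sum>j\<in>UNIV. ?w i j l * u $ i * u $ j) * cnj (v $ l))"
    by (simp only: key)
  also have "\<dots> = (\<Sum>l\<in>UNIV. \<Sum>j\<in>UNIV. wirtinger u (\<lambda>y. g y $ j $ l) x * u $ j * cnj (v $ l))"
  proof (intro sum.cong refl)
    fix l
    have "(\<Sum>i\<in>UNIV. \<Sum>j\<in>UNIV. ?w i j l * u $ i * u $ j) = (\<Sum>j\<in>UNIV. \<Sum>i\<in>UNIV. ?w i j l * u $ i * u $ j)"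
      by (rule sum.swap)
    also have "\<dots> = (\<Sum>j\<in>UNIV. wirtinger u (\<lambda>y. g y $ j $ l) x * u $ j)"
      by (simp add: wirtinger_axis_sum[OF diff, of u] sum_distrib_right sum_distrib_left mult_ac)
    finally show "(\<Sum>i\<in>UNIV. \<Sum>j\<in>UNIV. ?w i j l * u $ i * u $ j) * cnj (v $ l) =
        (\<Sum>j\<in>UNIV. wirtinger u (\<lambda>y. g y $ j $ l) x * u $ j * cnj (v $ l))"
      by (simp add: sum_distrib_right)
  qed
  also have "\<dots> = wirtinger u (\<lambda>y. herm (g y) u v) x"
  proof -
    have d: "((\<lambda>y. g y $ i $ j) has_derivative fder (\<lambda>y. g y $ i $ j) x) (at x)" for i j
      using diff by (simp add: frechet_derivative_works[symmetric])
    have "((\<lambda>y. herm (g y) u v) has_derivative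
      (\<lambda>h. \<Sum>i\<in>UNIV. \<Sum>j\<in>UNIV. fder (\<lambda>y. g y $ i $ j) x h * u $ i * cnj (v $ j))) (at x)"
      unfolding herm_def by (intro has_derivative_sum has_derivative_mult_left d)
    from wirtinger_complex_linear[OF this, of u]
    have "wirtinger u (\<lambda>y. herm (g y) u v) x
      = (\<Sum>i\<in>UNIV. \<Sum>j\<in>UNIV. wirtinger u (\<lambda>y. g y $ i $ j) x * u $ i * cnj (v $ j))"
      unfolding wirtinger_complex_linear[OF d] sum_distrib_left sum_subtractf[symmetric] sum_divide_distrib
      by (simp add: algebra_simps diff_divide_distrib)
    also have "\<dots> = (\<Sum>j\<in>UNIV. \<Sum>i\<in>UNIV. wirtinger u (\<lambda>y. g y $ i $ j) x * u $ i * cnj (v $ j))"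
      by (rule sum.swap)
    finally show ?thesis by (rule sym)
  qed
  finally show ?thesis .
qed

section \<open>The invariant metric of a matrix domain\<close>

text \<open>Common interface of types I, II and III. The number \<kappa> is the scale at which the
  Hilbert--Schmidt norm controls the operator norm and some tripotent has scaled norm 1: it is 1 for
  all and for symmetric matrices, 1/2 for skew ones, whose nonzero singular values occur in pairs.
  The assumption \<open>irreducible\<close> is Schur's lemma for Hermitian forms under the unitary
  substitutions that preserve W.\<close>

locale cartan_domain =
  fixes W :: "(complex^'q^'p) set" and \<kappa> :: real
  assumes W_zero: "0 \<in> W"
    and W_add: "X \<in> W \<Longrightarrow> Y \<in> W \<Longrightarrow> X + Y \<in> W"
    and W_scaleC: "X \<in> W \<Longrightarrow> a *\<^sub>C X \<in> W"
    and kappa_pos: "\<kappa> > 0"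
    and op_norm_le: "Z \<in> W \<Longrightarrow> (norm (Z *v v))\<^sup>2 \<le> \<kappa> * (norm Z)\<^sup>2 * (norm v)\<^sup>2"
    and tripotent: "\<exists>E\<in>W. E ** adjoint_mat E ** E = E \<and> \<kappa> * (norm E)\<^sup>2 = 1"
    and transitive: "Z \<in> W \<inter> D_I \<Longrightarrow> \<exists>A B C E. pseudo_unitary A B C E \<and> frac A B C E Z = 0 \<and>
        (\<forall>X\<in>W \<inter> D_I. frac A B C E X \<in> W) \<and>
        (\<forall>X\<in>W \<inter> D_I. frac (adjoint_mat A) (- adjoint_mat C) (- adjoint_mat B) (adjoint_mat E) X \<in> W)"
    and irreducible: "\<lbrakk>\<And>X Y Z. X \<in> W \<Longrightarrow> Y \<in> W \<Longrightarrow> Z \<in> W \<Longrightarrow> \<beta> (X + Y) Z = \<beta> X Z + \<beta> Y Z;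
        \<And>a X Y. X \<in> W \<Longrightarrow> Y \<in> W \<Longrightarrow> \<beta> (a *\<^sub>C X) Y = a * \<beta> X Y;
        \<And>X Y. X \<in> W \<Longrightarrow> Y \<in> W \<Longrightarrow> \<beta> X Y = cnj (\<beta> Y X);
        \<And>U V X Y. adjoint_mat U ** U = mat 1 \<Longrightarrow> V ** adjoint_mat V = mat 1 \<Longrightarrow>
          \<forall>X\<in>W. U ** X ** V \<in> W \<Longrightarrow> \<forall>X\<in>W. adjoint_mat U ** X ** adjoint_mat V \<in> W \<Longrightarrow>
          X \<in> W \<Longrightarrow> Y \<in> W \<Longrightarrow> \<beta> (U ** X ** V) (U ** Y ** V) = \<beta> X Y\<rbrakk>
      \<Longrightarrow> \<exists>c. \<forall>X\<in>W. \<forall>Y\<in>W. \<beta> X Y = c * mip X Y"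
begin

abbreviation "\<D> \<equiv> W \<inter> D_I"

lemma subspace_W: "subspace W"
  unfolding subspace_def using W_zero W_add W_scaleC by (auto simp: scaleR_eq_scaleC)

lemma closed_W: "closed W"
  by (rule closed_subspace[OF subspace_W])

lemma frac_biholomorphism:
  assumes pu: "pseudo_unitary A B C E"
    and 1: "\<forall>X\<in>\<D>. frac A B C E X \<in> W"
    and 2: "\<forall>X\<in>\<D>. frac (adjoint_mat A) (- adjoint_mat C) (- adjoint_mat B) (adjoint_mat E) X \<in> W"
  shows "biholomorphism (frac A B C E) \<D> \<D>"
proof (rule biholomorphismI)
  note pu' = pseudo_unitary_inverse[OF pu]
  show "holomorphic_map_on (frac A B C E) \<D>"
    "holomorphic_map_on (frac (adjoint_mat A) (- adjoint_mat C) (- adjoint_mat B) (adjoint_mat E)) \<D>"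
    using holomorphic_frac[OF pu] holomorphic_frac[OF pu'] holomorphic_map_on_subset by blast+
  show "frac A B C E ` \<D> \<subseteq> \<D>"
    "frac (adjoint_mat A) (- adjoint_mat C) (- adjoint_mat B) (adjoint_mat E) ` \<D> \<subseteq> \<D>"
    using 1 2 frac_in_D_I[OF pu] frac_in_D_I[OF pu'] by auto
  show "frac (adjoint_mat A) (- adjoint_mat C) (- adjoint_mat B) (adjoint_mat E) (frac A B C E X) = X"
    if "X \<in> \<D>" for X using frac_inverse[OF pu] that by simp
  show "frac A B C E (frac (adjoint_mat A) (- adjoint_mat C) (- adjoint_mat B) (adjoint_mat E) X) = X"
    if "X \<in> \<D>" for X using frac_inverse[OF pu', of X] that by (simp add: adjoint_mat_uminus)
qed

end

locale canonical_domain = cartan_domain W \<kappa>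
  for W :: "(complex^'q^'p) set" and \<kappa> :: real +
  fixes \<Omega> :: "(complex^'n) set" and g :: "complex^'n \<Rightarrow> complex^'n^'n"
  assumes open_\<Omega>: "open \<Omega>"
    and biholomorphic_\<Omega>: "\<Omega> \<cong>\<^sub>h W \<inter> D_I"
    and canonical: "canonical_metric \<Omega> g"
begin

lemma pos_def_g: "x \<in> \<Omega> \<Longrightarrow> pos_def (g x)"
  using canonical
  by (simp add: canonical_metric_def kaehler_einstein_on_def kaehler_on_def hermitian_metric_on_def)

lemma smooth_g: "smooth_on \<Omega> (\<lambda>x. g x $ i $ j)"
  using canonical
  by (simp add: canonical_metric_def kaehler_einstein_on_def kaehler_on_def hermitian_metric_on_def)

lemma differentiable_g:
  assumes "x \<in> \<Omega>"
  shows "(\<lambda>y. g y $ i $ j) differentiable (at x)"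
    and "(\<lambda>y. fder (\<lambda>y. g y $ i $ j) y v) differentiable (at x)"
proof -
  have *: "Ck_on (Suc (Suc 0)) \<Omega> (\<lambda>y. g y $ i $ j)"
    using smooth_g[of i j] unfolding smooth_on_def by blast
  then show "(\<lambda>y. g y $ i $ j) differentiable (at x)"
    using assms by simp
  from * show "(\<lambda>y. fder (\<lambda>y. g y $ i $ j) y v) differentiable (at x)"
    using assms by simp
qed

lemma g_invariant: "\<Psi> \<in> Aut \<Omega> \<Longrightarrow> x \<in> \<Omega> \<Longrightarrow> herm (g (\<Psi> x)) (fder \<Psi> x u) (fder \<Psi> x v) = herm (g x) u v"
  using canonical unfolding canonical_metric_def Aut_invariant_def by blast

text \<open>An automorphism of the matrix domain is conjugated by the chart into one of \<Omega>.
  Its derivative is described after applying \<open>fder \<Phi>\<close>, since the inverse chart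
  lives on a set that need not be open.\<close>

lemma ex_transported_automorphism:
  assumes \<Phi>: "biholomorphism \<Phi> \<Omega> \<D>" and \<tau>: "biholomorphism \<tau> \<D> \<D>"
  obtains \<Psi> where "\<Psi> \<in> Aut \<Omega>" "\<And>x. x \<in> \<Omega> \<Longrightarrow> \<Psi> x \<in> \<Omega>" "\<And>x. x \<in> \<Omega> \<Longrightarrow> \<Phi> (\<Psi> x) = \<tau> (\<Phi> x)"
    "\<And>x u. x \<in> \<Omega> \<Longrightarrow> fder \<Phi> (\<Psi> x) (fder \<Psi> x u) = fder (\<lambda>x. \<tau> (\<Phi> x)) x u"
proof -
  obtain h where h: "biholomorphism h \<D> \<Omega>" "\<forall>x\<in>\<Omega>. h (\<Phi> x) = x" "\<forall>y\<in>\<D>. \<Phi> (h y) = y"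
    using biholomorphism_inverse[OF \<Phi>] by blast
  define \<Psi> where "\<Psi> = (\<lambda>x. h (\<tau> (\<Phi> x)))"
  have bi: "biholomorphism \<Psi> \<Omega> \<Omega>"
    unfolding \<Psi>_def by (rule biholomorphism_compose[OF biholomorphism_compose[OF \<Phi> \<tau>] h(1)])
  have im: "\<And>x. x \<in> \<Omega> \<Longrightarrow> \<tau> (\<Phi> x) \<in> \<D>"
    using \<Phi> \<tau> by (auto simp: biholomorphism_def bij_betw_def)
  then have eq: "\<And>x. x \<in> \<Omega> \<Longrightarrow> \<Phi> (\<Psi> x) = \<tau> (\<Phi> x)" using h(3) by (simp add: \<Psi>_def)
  have in\<Omega>: "\<And>x. x \<in> \<Omega> \<Longrightarrow> \<Psi> x \<in> \<Omega>" using bi by (auto simp: biholomorphism_def bij_betw_def)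
  have "fder \<Phi> (\<Psi> x) (fder \<Psi> x u) = fder (\<lambda>x. \<tau> (\<Phi> x)) x u" if x: "x \<in> \<Omega>" for x u
  proof -
    have "fder (\<lambda>x. \<Phi> (\<Psi> x)) x = (\<lambda>v. fder \<Phi> (\<Psi> x) (fder \<Psi> x v))"
      using bi \<Phi> x in\<Omega>[OF x]
      by (intro fder_chain holomorphic_map_on_fder(1)[OF _ open_\<Omega>]) (auto simp: biholomorphism_def)
    moreover have "fder (\<lambda>x. \<Phi> (\<Psi> x)) x = fder (\<lambda>x. \<tau> (\<Phi> x)) x"
      by (rule fder_cong_open[OF open_\<Omega> x eq])
    ultimately show ?thesis by metis
  qed
  then show ?thesis using that[of \<Psi>] bi in\<Omega> eq by (simp add: Aut_def)
qed

lemma biholo_facts: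
  assumes \<Phi>: "biholomorphism \<Phi> \<Omega> \<D>"
  shows "holomorphic_map_on \<Phi> \<Omega>" "\<And>x. x \<in> \<Omega> \<Longrightarrow> \<Phi> x \<in> \<D>"
    "\<And>x. x \<in> \<Omega> \<Longrightarrow> (\<Phi> has_derivative fder \<Phi> x) (at x)"
    "\<And>x a v. x \<in> \<Omega> \<Longrightarrow> fder \<Phi> x (a *\<^sub>C v) = a *\<^sub>C fder \<Phi> x v"
    "\<And>x u v. x \<in> \<Omega> \<Longrightarrow> fder \<Phi> x (u + v) = fder \<Phi> x u + fder \<Phi> x v"
    "\<And>x u v. x \<in> \<Omega> \<Longrightarrow> fder \<Phi> x (u - v) = fder \<Phi> x u - fder \<Phi> x v"
    "\<And>x u. x \<in> \<Omega> \<Longrightarrow> fder \<Phi> x u \<in> W"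
    "\<And>x u. x \<in> \<Omega> \<Longrightarrow> fder \<Phi> x u = 0 \<longleftrightarrow> u = 0"
proof -
  show hol: "holomorphic_map_on \<Phi> \<Omega>" using \<Phi> by (simp add: biholomorphism_def)
  show im: "\<Phi> x \<in> \<D>" if "x \<in> \<Omega>" for x using \<Phi> that by (auto simp: biholomorphism_def bij_betw_def)
  fix x u v a assume x: "x \<in> \<Omega>"
  show d: "(\<Phi> has_derivative fder \<Phi> x) (at x)" "fder \<Phi> x (a *\<^sub>C v) = a *\<^sub>C fder \<Phi> x v"
    using holomorphic_map_on_fder[OF hol open_\<Omega> x] by simp_all
  note lin = has_derivative_linear[OF d(1)]
  show "fder \<Phi> x (u + v) = fder \<Phi> x u + fder \<Phi> x v" by (rule linear_add[OF lin])
  show "fder \<Phi> x (u - v) = fder \<Phi> x u - fder \<Phi> x v" by (rule linear_diff[OF lin])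
  show "fder \<Phi> x u \<in> W"
    by (rule has_derivative_image_subspace[OF d(1) open_\<Omega> x _ subspace_W closed_W]) (use im in auto)
  show "fder \<Phi> x u = 0 \<longleftrightarrow> u = 0"
    using biholomorphism_fder_inj[OF \<Phi> open_\<Omega> x] linear_0[OF lin] by blast
qed

lemma fder_onto:
  assumes \<Phi>: "biholomorphism \<Phi> \<Omega> \<D>" and x: "x \<in> \<Omega>" "\<Phi> x = 0" and X: "X \<in> W"
  obtains u where "fder \<Phi> x u = X"
proof (rule biholomorphism_fder_surj[OF \<Phi> open_\<Omega> x(1)])
  show "1 / (norm X + 1) > 0" by (simp add: add_nonneg_pos)
  fix t :: real assume t: "\<bar>t\<bar> < 1 / (norm X + 1)"
  have p: "norm X + 1 > 0" by (simp add: add_nonneg_pos)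
  have "\<bar>t\<bar> * (norm X + 1) < 1" using t p by (simp add: pos_less_divide_eq)
  then have "norm (t *\<^sub>R X) < 1" by (simp add: algebra_simps)
  then show "\<Phi> x + t *\<^sub>R X \<in> \<D>"
    using X W_scaleC small_in_D_I by (simp add: x(2) scaleR_eq_scaleC)
qed

text \<open>The derivative of the chart carries g at x to a Hermitian form on W. Unitary
  substitutions fix the origin, so they come from automorphisms fixing x; the form is invariant and
  Schur's lemma applies. Splitting \<kappa> off c makes the canonical value of c equal to 1 for
  every type.\<close>

lemma ex_metric_constant:
  assumes \<Phi>: "biholomorphism \<Phi> \<Omega> \<D>" and x: "x \<in> \<Omega>" "\<Phi> x = 0"
  obtains c :: real where "c > 0"
    "\<And>u v. herm (g x) u v = of_real (c * \<kappa>) * mip (fder \<Phi> x u) (fder \<Phi> x v)"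
proof -
  note L = biholo_facts[OF \<Phi>]
  define L where "L = fder \<Phi> x"
  define K where "K X = (SOME u. L u = X)" for X
  have LK: "L (K X) = X" if X: "X \<in> W" for X
    unfolding K_def by (rule someI_ex) (use fder_onto[OF \<Phi> x X] in \<open>auto simp: L_def\<close>)
  have inj: "u = v" if "L u = L v" for u v
  proof -
    have "L (u - v) = 0" using that L(6)[OF x(1)] by (simp add: L_def)
    then show ?thesis using L(8)[OF x(1)] by (simp add: L_def)
  qed
  have KL: "K (L u) = u" for u
    using LK[of "L u"] inj L(7)[OF x(1)] by (simp add: L_def)
  have Kadd: "K (X + Y) = K X + K Y" if "X \<in> W" "Y \<in> W" for X Y
    using that L(5)[OF x(1)] by (intro inj) (simp add: LK W_add flip: L_def)
  have Ksc: "K (a *\<^sub>C X) = a *\<^sub>C K X" if "X \<in> W" for X a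
    using that L(4)[OF x(1)] by (intro inj) (simp add: LK W_scaleC flip: L_def)
  define \<beta> where "\<beta> X Y = herm (g x) (K X) (K Y)" for X Y
  have "\<exists>c. \<forall>X\<in>W. \<forall>Y\<in>W. \<beta> X Y = c * mip X Y"
  proof (rule irreducible)
    show "\<beta> (X + Y) Z = \<beta> X Z + \<beta> Y Z" if "X \<in> W" "Y \<in> W" for X Y Z
      using that by (simp add: \<beta>_def Kadd herm_add_left)
    show "\<beta> (a *\<^sub>C X) Y = a * \<beta> X Y" if "X \<in> W" for X Y a
      using that by (simp add: \<beta>_def Ksc herm_scaleC_left)
    show "\<beta> X Y = cnj (\<beta> Y X)" for X Y
      unfolding \<beta>_def by (rule herm_commute[OF pos_def_g[OF x(1)]])
    fix U V X Y
    assume U: "adjoint_mat U ** U = mat 1" and V: "V ** adjoint_mat V = mat 1"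
      and 1: "\<forall>X\<in>W. U ** X ** V \<in> W" and 2: "\<forall>X\<in>W. adjoint_mat U ** X ** adjoint_mat V \<in> W"
      and XY: "X \<in> W" "Y \<in> W"
    have U': "U ** adjoint_mat U = mat 1" and V': "adjoint_mat V ** V = mat 1"
      using U V matrix_left_right_inverse by blast+
    \<comment> \<open>Unitary substitution is the fractional transformation of a block diagonal
      matrix, hence preserves the matrix ball.\<close>
    have pu: "pseudo_unitary U 0 0 (adjoint_mat V)"
      using U V U' V' by (simp add: pseudo_unitary_def)
    have fr: "frac U 0 0 (adjoint_mat V) = (\<lambda>X. U ** X ** V)"
      by (simp add: fun_eq_iff frac_def matrix_inv_unique(2)[OF V'])
    have fr': "frac (adjoint_mat U) (- adjoint_mat 0) (- adjoint_mat 0) (adjoint_mat (adjoint_mat V)) = (\<lambda>X. adjoint_mat U ** X ** adjoint_mat V)"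
      by (simp add: fun_eq_iff frac_def matrix_inv_unique(2)[OF V])
    have bi: "biholomorphism (\<lambda>X. U ** X ** V) \<D> \<D>"
      using frac_biholomorphism[OF pu] unfolding fr fr' using 1 2 by auto
    obtain \<Psi> where \<Psi>: "\<Psi> \<in> Aut \<Omega>" "\<And>x. x \<in> \<Omega> \<Longrightarrow> \<Psi> x \<in> \<Omega>" "\<And>x. x \<in> \<Omega> \<Longrightarrow> \<Phi> (\<Psi> x) = U ** \<Phi> x ** V"
      "\<And>x u. x \<in> \<Omega> \<Longrightarrow> fder \<Phi> (\<Psi> x) (fder \<Psi> x u) = fder (\<lambda>x. U ** \<Phi> x ** V) x u"
      using ex_transported_automorphism[OF \<Phi> bi] by metis
    have "\<Phi> (\<Psi> x) = \<Phi> x" using \<Psi>(3)[OF x(1)] x(2) by simp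
    then have \<Psi>x: "\<Psi> x = x" using \<Phi> \<Psi>(2) x(1) by (auto simp: biholomorphism_def bij_betw_def dest: inj_onD)
    have "((\<lambda>x. U ** \<Phi> x ** V) has_derivative (\<lambda>u. U ** L u ** V)) (at x)"
      unfolding L_def
      by (intro bounded_linear.has_derivative[OF bounded_bilinear.bounded_linear_left[OF bounded_bilinear_mat_mult]]
          bounded_linear.has_derivative[OF bounded_bilinear.bounded_linear_right[OF bounded_bilinear_mat_mult]] L(3) x)
    then have "L (fder \<Psi> x u) = U ** L u ** V" for u
      using \<Psi>(4)[OF x(1), of u] unfolding \<Psi>x L_def by (simp add: frechet_derivative_at[symmetric])
    then have "fder \<Psi> x (K X) = K (U ** X ** V)" if "X \<in> W" for X
      using that KL by (metis LK)
    then show "\<beta> (U ** X ** V) (U ** Y ** V) = \<beta> X Y"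
      using g_invariant[OF \<Psi>(1) x(1), of "K X" "K Y"] XY by (simp add: \<beta>_def \<Psi>x)
  qed
  then obtain c where c: "\<forall>X\<in>W. \<forall>Y\<in>W. \<beta> X Y = c * mip X Y" by blast
  have h: "herm (g x) u v = c * mip (L u) (L v)" for u v
    using c L(7)[OF x(1)] KL unfolding \<beta>_def by (metis L_def)
  \<comment> \<open>The tripotent serves as a nonzero vector of W; positivity of g on it makes the
    constant real and positive.\<close>
  obtain E where E: "E \<in> W" "\<kappa> * (norm E)\<^sup>2 = 1" using tripotent by blast
  then have "norm E \<noteq> 0" by auto
  have "K E \<noteq> 0"
  proof
    assume "K E = 0"
    then have "E = L 0" using LK[OF E(1)] by simp
    then show False using \<open>norm E \<noteq> 0\<close> L(8)[OF x(1), of 0] by (simp add: L_def)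
  qed
  then have "0 < Re (herm (g x) (K E) (K E))" by (rule herm_pos[OF pos_def_g[OF x(1)]])
  then have "0 < Re c * (norm E)\<^sup>2" by (simp add: h LK E(1) mip_self del: of_real_power)
  then have "Re c > 0" using \<open>norm E \<noteq> 0\<close> by (simp add: zero_less_mult_iff)
  moreover have "Im c = 0"
  proof -
    have "herm (g x) (K E) (K E) = cnj (herm (g x) (K E) (K E))"
      by (rule herm_commute[OF pos_def_g[OF x(1)]])
    then have "Im (c * of_real ((norm E)\<^sup>2)) = 0"
      unfolding h LK[OF E(1)] mip_self by (metis cnj.simps(2) neg_equal_zero)
    then show ?thesis using \<open>norm E \<noteq> 0\<close> by (simp del: of_real_power)
  qed
  ultimately have "c = of_real (Re c / \<kappa> * \<kappa>)" "Re c / \<kappa> > 0"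
    using kappa_pos by (simp_all add: complex_eq_iff)
  then show ?thesis using that[of "Re c / \<kappa>"] h unfolding L_def by metis
qed

text \<open>The metric is prescribed only over the origin, since homogeneity determines it elsewhere
  through \<open>metric_formula\<close>. One constant c is shared by all charts obtained from each
  other by automorphisms.\<close>

definition chart :: "real \<Rightarrow> (complex^'n \<Rightarrow> complex^'q^'p) \<Rightarrow> bool" where
  "chart c \<Phi> \<longleftrightarrow> biholomorphism \<Phi> \<Omega> \<D> \<and>
     (\<forall>x\<in>\<Omega>. \<Phi> x = 0 \<longrightarrow> (\<forall>u v. herm (g x) u v = of_real (c * \<kappa>) * mip (fder \<Phi> x u) (fder \<Phi> x v)))"

lemma ex_chart: obtains c \<Phi> where "c > 0" "chart c \<Phi>"
proof -
  obtain \<Phi> where \<Phi>: "biholomorphism \<Phi> \<Omega> \<D>" using biholomorphic_\<Omega> unfolding biholomorphic_def by blast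
  then have bij: "bij_betw \<Phi> \<Omega> \<D>" by (simp add: biholomorphism_def)
  have "0 \<in> \<D>" using W_zero by simp
  then obtain x where x: "x \<in> \<Omega>" "\<Phi> x = 0" using bij by (metis bij_betw_iff_bijections)
  obtain c where c: "c > 0" "\<And>u v. herm (g x) u v = of_real (c * \<kappa>) * mip (fder \<Phi> x u) (fder \<Phi> x v)"
    using ex_metric_constant[OF \<Phi> x] by metis
  have "y = x" if "y \<in> \<Omega>" "\<Phi> y = 0" for y
    using bij x that by (metis bij_betw_inv_into_left)
  then have "chart c \<Phi>" unfolding chart_def using \<Phi> c(2) by blast
  with c(1) show ?thesis by (rule that)
qed

text \<open>The automorphism of \<Omega> that realizes \<tau> preserves g, so the constant at the
  new origin is the old one.\<close>

lemma chart_compose: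
  assumes c: "chart c \<Phi>" and \<tau>: "biholomorphism \<tau> \<D> \<D>"
  shows "chart c (\<lambda>x. \<tau> (\<Phi> x))"
proof -
  have \<Phi>: "biholomorphism \<Phi> \<Omega> \<D>" using c by (simp add: chart_def)
  obtain \<Psi> where \<Psi>: "\<Psi> \<in> Aut \<Omega>" "\<And>x. x \<in> \<Omega> \<Longrightarrow> \<Psi> x \<in> \<Omega>" "\<And>x. x \<in> \<Omega> \<Longrightarrow> \<Phi> (\<Psi> x) = \<tau> (\<Phi> x)"
      "\<And>x u. x \<in> \<Omega> \<Longrightarrow> fder \<Phi> (\<Psi> x) (fder \<Psi> x u) = fder (\<lambda>x. \<tau> (\<Phi> x)) x u"
    using ex_transported_automorphism[OF \<Phi> \<tau>] by metis
  have "herm (g x) u v = of_real (c * \<kappa>) * mip (fder (\<lambda>x. \<tau> (\<Phi> x)) x u) (fder (\<lambda>x. \<tau> (\<Phi> x)) x v)"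
    if x: "x \<in> \<Omega>" "\<tau> (\<Phi> x) = 0" for x u v
  proof -
    have "herm (g x) u v = herm (g (\<Psi> x)) (fder \<Psi> x u) (fder \<Psi> x v)"
      by (rule g_invariant[OF \<Psi>(1) x(1), symmetric])
    also have "\<dots> = of_real (c * \<kappa>) * mip (fder \<Phi> (\<Psi> x) (fder \<Psi> x u)) (fder \<Phi> (\<Psi> x) (fder \<Psi> x v))"
      using c \<Psi>(2,3)[OF x(1)] x(2) unfolding chart_def by simp
    finally show ?thesis by (simp only: \<Psi>(4)[OF x(1)])
  qed
  then show ?thesis unfolding chart_def using biholomorphism_compose[OF \<Phi> \<tau>] by blast
qed

text \<open>The chart is moved so that a given point becomes the origin, where all computations are done.\<close>

lemma chart_at:
  assumes c: "chart c \<Phi>" and x: "x \<in> \<Omega>"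
  obtains A B C E where "pseudo_unitary A B C E" "frac A B C E (\<Phi> x) = 0"
    "chart c (\<lambda>y. frac A B C E (\<Phi> y))"
    "\<And>u. fder (\<lambda>y. frac A B C E (\<Phi> y)) x u = A ** fder \<Phi> x u ** adjoint_mat E"
proof -
  have \<Phi>: "biholomorphism \<Phi> \<Omega> \<D>" using c by (simp add: chart_def)
  note F = biholo_facts[OF \<Phi>]
  have Z: "\<Phi> x \<in> \<D>" using F(2)[OF x] .
  obtain A B C E where T: "pseudo_unitary A B C E" "frac A B C E (\<Phi> x) = 0"
      "\<forall>X\<in>\<D>. frac A B C E X \<in> W"
      "\<forall>X\<in>\<D>. frac (adjoint_mat A) (- adjoint_mat C) (- adjoint_mat B) (adjoint_mat E) X \<in> W"
    using transitive[OF Z] by blast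
  have "fder (\<lambda>y. frac A B C E (\<Phi> y)) x = (\<lambda>u. A ** fder \<Phi> x u ** adjoint_mat E)"
    using fder_chain[OF F(3)[OF x] has_derivative_frac[OF T(1)]] Z
    by (simp add: T(2) pseudo_unitary_zero(5)[OF T(1) _ T(2)])
  then show ?thesis
    using that[OF T(1,2) chart_compose[OF c frac_biholomorphism[OF T(1,3,4)]]] by simp
qed

text \<open>A transformation taking \<open>\<Phi> x\<close> to the origin yields a new chart with
  the same c, and its derivative at x is the sandwich that appears here.\<close>

lemma metric_formula:
  assumes c: "chart c \<Phi>" and x: "x \<in> \<Omega>"
  obtains P :: "complex^'p^'p" and S :: "complex^'q^'q"
    where "P ** (mat 1 - \<Phi> x ** adjoint_mat (\<Phi> x)) ** adjoint_mat P = mat 1"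
    "S ** (mat 1 - adjoint_mat (\<Phi> x) ** \<Phi> x) ** adjoint_mat S = mat 1"
    "\<And>u v. herm (g x) u v = of_real (c * \<kappa>) *
       mip (P ** fder \<Phi> x u ** adjoint_mat S) (P ** fder \<Phi> x v ** adjoint_mat S)"
proof -
  have \<Phi>: "biholomorphism \<Phi> \<Omega> \<D>" using c by (simp add: chart_def)
  have Z: "\<Phi> x \<in> D_I" using biholo_facts(2)[OF \<Phi> x] by simp
  obtain A B C E where T: "pseudo_unitary A B C E" "frac A B C E (\<Phi> x) = 0"
    "chart c (\<lambda>y. frac A B C E (\<Phi> y))"
    "\<And>u. fder (\<lambda>y. frac A B C E (\<Phi> y)) x u = A ** fder \<Phi> x u ** adjoint_mat E"
    using chart_at[OF c x] by metis
  have "herm (g x) u v = of_real (c * \<kappa>) *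
       mip (A ** fder \<Phi> x u ** adjoint_mat E) (A ** fder \<Phi> x v ** adjoint_mat E)" for u v
  proof -
    have "herm (g x) u v = of_real (c * \<kappa>) * mip (fder (\<lambda>y. frac A B C E (\<Phi> y)) x u) (fder (\<lambda>y. frac A B C E (\<Phi> y)) x v)"
      using T(2,3) x unfolding chart_def by blast
    then show ?thesis unfolding T(4) .
  qed
  then show ?thesis
    using that[OF pseudo_unitary_zero(3,4)[OF T(1) Z T(2)]] by blast
qed

section \<open>Covariant second derivatives in a centred chart\<close>

text \<open>In matrix coordinates centred at x the metric has no first order term, so the
  Christoffel symbols of g at x stem entirely from the second derivative of the chart.\<close>

lemma christoffel_transform:
  assumes c: "chart c \<Phi>" "c > 0" and x: "x \<in> \<Omega>" "\<Phi> x = 0"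
  shows "fder \<Phi> x (christoffel g x u u) = fder (\<lambda>y. fder \<Phi> y u) x u"
proof -
  have \<Phi>: "biholomorphism \<Phi> \<Omega> \<D>" using c by (simp add: chart_def)
  note F = biholo_facts[OF \<Phi>]
  have hol2: "holomorphic_map_on (\<lambda>y. fder \<Phi> y v) \<Omega>" for v
    by (rule holomorphic_map_on_fder_mat[OF F(1) open_\<Omega>])
  define B where "B v = fder (\<lambda>y. fder \<Phi> y v) x" for v
  have B: "((\<lambda>y. fder \<Phi> y v) has_derivative B v) (at x)" "B v (a *\<^sub>C w) = a *\<^sub>C B v w" for v a w
    using holomorphic_map_on_fder[OF hol2 open_\<Omega> x(1)] by (simp_all add: B_def)
  have BW: "B v w \<in> W" for v w
    by (rule has_derivative_image_subspace[OF B(1) open_\<Omega> x(1) _ subspace_W closed_W]) (use F(7) in auto)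
  have key: "herm (g x) (christoffel g x u u) v = of_real (c * \<kappa>) * mip (B u u) (fder \<Phi> x v)" for v
  proof -
    \<comment> \<open>This is the metric if it were constant in matrix coordinates. The true one
      differs by a quadratic error, since \<open>\<Phi> y\<close> is of order
      \<open>norm (y - x)\<close> and enters \<open>sandwich_near_identity\<close> squared.\<close>
    define H where "H y = of_real (c * \<kappa>) * mip (fder \<Phi> y u) (fder \<Phi> y v)" for y
    have DH: "(H has_derivative (\<lambda>h. of_real (c * \<kappa>) * (mip (fder \<Phi> x u) (B v h) + mip (B u h) (fder \<Phi> x v)))) (at x)"
      unfolding H_def
      by (intro has_derivative_mult_right bounded_bilinear.FDERIV[OF bounded_bilinear_mip] B)
    define R where "R y = herm (g y) u v - H y" for y
    have "\<exists>e>0. \<exists>C. \<forall>y. dist y x < e \<longrightarrow> cmod (R y) \<le> C * (norm (y - x))\<^sup>2"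
    proof -
      define K where "K = norm (fder \<Phi> x u) + 1"
      define K' where "K' = norm (fder \<Phi> x v) + 1"
      obtain M where M: "M > 0" "\<And>h. norm (fder \<Phi> x h) \<le> norm h * M"
        using bounded_linear.pos_bounded[OF has_derivative_bounded_linear[OF F(3)[OF x(1)]]] by blast
      have ev: "\<forall>\<^sub>F y in nhds x. norm (G y) < norm (G x) + 1" if "isCont G x" for G :: "complex^'n \<Rightarrow> complex^'q^'p"
      proof -
        have "((\<lambda>y. norm (G y)) \<longlongrightarrow> norm (G x)) (nhds x)"
          using that by (intro tendsto_norm) (simp add: isCont_def tendsto_at_iff_tendsto_nhds)
        then show ?thesis by (rule order_tendstoD) simp
      qed
      have "\<forall>\<^sub>F y in nhds x. norm (\<Phi> y - \<Phi> x - fder \<Phi> x (y - x)) \<le> 1 * norm (y - x)"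
        using F(3)[OF x(1)] unfolding has_derivative_at_alt eventually_nhds_metric dist_norm
        by (meson zero_less_one)
      then have e1: "\<forall>\<^sub>F y in nhds x. norm (\<Phi> y) \<le> (M + 1) * norm (y - x)"
      proof eventually_elim
        case (elim y)
        then show ?case using M(2)[of "y - x"] norm_triangle_ineq[of "\<Phi> y - fder \<Phi> x (y - x)" "fder \<Phi> x (y - x)"]
          by (simp add: x(2) algebra_simps)
      qed
      have "isCont \<Phi> x" using F(3)[OF x(1)] has_derivative_continuous by blast
      then have "(\<Phi> \<longlongrightarrow> \<Phi> x) (nhds x)" unfolding isCont_def tendsto_at_iff_tendsto_nhds .
      then have "(\<Phi> \<longlongrightarrow> 0) (nhds x)" by (simp add: x(2))
      then have "((\<lambda>y. norm (\<Phi> y)) \<longlongrightarrow> 0) (nhds x)" by (rule tendsto_norm_zero)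
      then have e2: "\<forall>\<^sub>F y in nhds x. norm (\<Phi> y) < 1/2" by (rule order_tendstoD) simp
      have e3: "\<forall>\<^sub>F y in nhds x. norm (fder \<Phi> y u) < K" "\<forall>\<^sub>F y in nhds x. norm (fder \<Phi> y v) < K'"
        unfolding K_def K'_def using B(1) has_derivative_continuous by (intro ev; blast)+
      have e4: "\<forall>\<^sub>F y in nhds x. y \<in> \<Omega>" using open_\<Omega> x(1) by (rule eventually_nhds_in_open)
      have "\<forall>\<^sub>F y in nhds x. cmod (R y) \<le> c * \<kappa> * 4 * (M + 1)\<^sup>2 * K * K' * (norm (y - x))\<^sup>2"
        using e1 e2 e3 e4
      proof eventually_elim
        case (elim y)
        obtain P :: "complex^'p^'p" and S :: "complex^'q^'q" where PS: "P ** (mat 1 - \<Phi> y ** adjoint_mat (\<Phi> y)) ** adjoint_mat P = mat 1"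
          "S ** (mat 1 - adjoint_mat (\<Phi> y) ** \<Phi> y) ** adjoint_mat S = mat 1"
          "\<And>u v. herm (g y) u v = of_real (c * \<kappa>) *
             mip (P ** fder \<Phi> y u ** adjoint_mat S) (P ** fder \<Phi> y v ** adjoint_mat S)"
          using metric_formula[OF c(1) elim(5)] by metis
        have "cmod (R y) = c * \<kappa> * cmod (mip (P ** fder \<Phi> y u ** adjoint_mat S) (P ** fder \<Phi> y v ** adjoint_mat S)
            - mip (fder \<Phi> y u) (fder \<Phi> y v))"
          using c(2) kappa_pos unfolding R_def H_def PS(3) right_diff_distrib[symmetric] norm_mult
          by (simp add: norm_mult)
        also have "\<dots> \<le> c * \<kappa> * (4 * (norm (\<Phi> y))\<^sup>2 * norm (fder \<Phi> y u) * norm (fder \<Phi> y v))"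
          using c(2) kappa_pos elim(2) by (intro mult_left_mono sandwich_near_identity[OF PS(1,2)]) auto
        also have "\<dots> \<le> c * \<kappa> * (4 * ((M + 1) * norm (y - x))\<^sup>2 * K * K')"
          using c(2) kappa_pos elim M(1) by (intro mult_left_mono mult_mono power_mono) (auto simp: K_def K'_def)
        finally show ?case by (simp add: power_mult_distrib mult_ac)
      qed
      then show ?thesis unfolding eventually_nhds_metric by blast
    qed
    then obtain e C where eC: "e > 0" "\<And>y. dist y x < e \<Longrightarrow> cmod (R y) \<le> C * (norm (y - x))\<^sup>2" by blast
    have "R x = 0" using eC(2)[of x] eC(1) by simp
    then have DR: "(R has_derivative (\<lambda>h. 0)) (at x)"
      by (intro has_derivative_quadratic[OF bounded_linear_zero eC(1)]) (use eC(2) in auto)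
    have "((\<lambda>y. herm (g y) u v) has_derivative
      (\<lambda>h. of_real (c * \<kappa>) * (mip (fder \<Phi> x u) (B v h) + mip (B u h) (fder \<Phi> x v)))) (at x)"
      using has_derivative_add[OF DH DR] by (simp add: R_def)
    \<comment> \<open>The term with \<open>B v h\<close> drops out: \<open>mip\<close> is conjugate
      linear there, and the Wirtinger derivative sees the complex linear part only.\<close>
    from wirtinger_complex_linear[OF this, of u]
    have "wirtinger u (\<lambda>y. herm (g y) u v) x = of_real (c * \<kappa>) * mip (B u u) (fder \<Phi> x v)"
      by (simp add: B(2) mip_scaleC_left mip_scaleC_right algebra_simps)
    then show ?thesis
      using herm_christoffel[of g x u v] pos_def_g[OF x(1)] differentiable_g(1)[OF x(1)] by simp
  qed
  \<comment> \<open>As \<open>B u u\<close> lies in W it is the image of a vector w, and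
    nondegeneracy of g identifies w with the Christoffel vector.\<close>
  obtain w where w: "fder \<Phi> x w = B u u" using fder_onto[OF \<Phi> x BW] by metis
  have "herm (g x) (christoffel g x u u - w) v = 0" for v
    using key[of v] c x w unfolding herm_diff_left chart_def by simp
  then have "christoffel g x u u - w = 0"
    using herm_pos[OF pos_def_g[OF x(1)]] by (metis less_irrefl zero_complex.sel(1))
  then show ?thesis using w by (simp add: B_def)
qed

text \<open>At the origin of a chart the covariant second derivative is the ordinary one of the
  composed map: the Christoffel term and the second derivative of the chart are the same
  vector.\<close>

lemma disk_second_derivative:
  assumes c: "chart c \<Phi>" "c > 0" and f: "holomorphic_map_on f S" "open S" "f ` S \<subseteq> \<Omega>"
    and z: "z \<in> S" "\<Phi> (f z) = 0"
  shows "cderiv (cderiv (\<lambda>z. \<Phi> (f z))) z =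
    fder \<Phi> (f z) (cderiv (cderiv f) z + christoffel g (f z) (cderiv f z) (cderiv f z))"
proof -
  have \<Phi>: "biholomorphism \<Phi> \<Omega> \<D>" using c by (simp add: chart_def)
  note F = biholo_facts[OF \<Phi>]
  have fz: "f z \<in> \<Omega>" using f z by auto
  have 1: "cderiv (\<lambda>z. \<Phi> (f z)) w = fder \<Phi> (f w) (cderiv f w)" if "w \<in> S" for w
  proof (rule cderiv_eqI)
    have fw: "f w \<in> \<Omega>" using f that by auto
    from diff_chain_at[OF holomorphic_cderiv[OF f(1,2) that] F(3)[OF fw]]
    show "((\<lambda>z. \<Phi> (f z)) has_derivative (\<lambda>h. h *\<^sub>C fder \<Phi> (f w) (cderiv f w))) (at w)"
      by (simp add: o_def F(4)[OF fw])
  qed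
  have hol2: "holomorphic_map_on (\<lambda>y. fder \<Phi> y v) \<Omega>" for v
    by (rule holomorphic_map_on_fder_mat[OF F(1) open_\<Omega>])
  have "((\<lambda>w. fder \<Phi> (f w) (cderiv f w)) has_derivative
     (\<lambda>h. fder (\<lambda>y. fder \<Phi> y (cderiv f z)) (f z) (h *\<^sub>C cderiv f z) + fder \<Phi> (f z) (h *\<^sub>C cderiv (cderiv f) z))) (at z)"
    by (rule has_derivative_apply[where T = \<Omega>, OF holomorphic_map_on_fder(1)[OF hol2 open_\<Omega> fz] _ open_\<Omega> fz
          holomorphic_cderiv[OF f(1,2) z(1)] holomorphic_cderiv[OF holomorphic_map_on_cderiv_vec[OF f(1,2)] f(2) z(1)]])
      (rule has_derivative_linear[OF F(3)])
  also have "(\<lambda>h. fder (\<lambda>y. fder \<Phi> y (cderiv f z)) (f z) (h *\<^sub>C cderiv f z) + fder \<Phi> (f z) (h *\<^sub>C cderiv (cderiv f) z))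
     = (\<lambda>h. h *\<^sub>C fder \<Phi> (f z) (cderiv (cderiv f) z + christoffel g (f z) (cderiv f z) (cderiv f z)))"
    using holomorphic_map_on_fder(2)[OF hol2 open_\<Omega> fz]
    by (simp add: fun_eq_iff F(4,5)[OF fz] christoffel_transform[OF c fz z(2)] scaleC_add_right add.commute)
  finally have "((\<lambda>w. cderiv (\<lambda>z. \<Phi> (f z)) w) has_derivative
     (\<lambda>h. h *\<^sub>C fder \<Phi> (f z) (cderiv (cderiv f) z + christoffel g (f z) (cderiv f z) (cderiv f z)))) (at z)"
    by (rule has_derivative_transform_within_open[OF _ f(2) z(1)]) (simp add: 1)
  then show ?thesis by (rule cderiv_eqI)
qed

text \<open>The analogue of \<open>disk_second_derivative\<close> for real curves, needed for
  geodesics.\<close>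

lemma curve_second_derivative:
  assumes c: "chart c \<Phi>" "c > 0"
    and \<gamma>: "(\<gamma> has_vector_derivative \<gamma>' t) (at t)" "(\<gamma>' has_vector_derivative \<gamma>'') (at t)"
    and t: "\<gamma> t \<in> \<Omega>" "\<Phi> (\<gamma> t) = 0"
  shows "((\<lambda>s. fder \<Phi> (\<gamma> s) (\<gamma>' s)) has_vector_derivative
    fder \<Phi> (\<gamma> t) (\<gamma>'' + christoffel g (\<gamma> t) (\<gamma>' t) (\<gamma>' t))) (at t)"
proof -
  have \<Phi>: "biholomorphism \<Phi> \<Omega> \<D>" using c by (simp add: chart_def)
  note F = biholo_facts[OF \<Phi>]
  have hol2: "holomorphic_map_on (\<lambda>y. fder \<Phi> y v) \<Omega>" for v
    by (rule holomorphic_map_on_fder_mat[OF F(1) open_\<Omega>])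
  note d2 = holomorphic_map_on_fder(1)[OF hol2 open_\<Omega> t(1)]
  have "((\<lambda>w. fder \<Phi> (\<gamma> w) (\<gamma>' w)) has_derivative
     (\<lambda>h. fder (\<lambda>y. fder \<Phi> y (\<gamma>' t)) (\<gamma> t) (h *\<^sub>R \<gamma>' t) + fder \<Phi> (\<gamma> t) (h *\<^sub>R \<gamma>''))) (at t)"
    by (rule has_derivative_apply[where T = \<Omega>, OF d2 _ open_\<Omega> t(1)
          \<gamma>(1)[unfolded has_vector_derivative_def] \<gamma>(2)[unfolded has_vector_derivative_def]])
      (rule has_derivative_linear[OF F(3)])
  then show ?thesis
    unfolding has_vector_derivative_def
    by (simp add: linear_cmul[OF has_derivative_linear[OF d2]] linear_cmul[OF has_derivative_linear[OF F(3)[OF t(1)]]]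
        F(5)[OF t(1)] christoffel_transform[OF c t] scaleR_add_right add.commute)
qed

end

section \<open>Logarithms along lines and the metric of the disk\<close>

lemma has2_ln:
  assumes ev: "\<forall>\<^sub>F t in nhds 0. (q has_real_derivative q' t) (at t)" and q2: "(q' has_real_derivative a) (at 0)"
    and pos: "q 0 > 0"
  shows "has2 (\<lambda>t. ln (q t)) (a / q 0 - (q' 0)\<^sup>2 / (q 0)\<^sup>2)"
proof -
  have q0: "(q has_real_derivative q' 0) (at 0)" using eventually_nhds_x_imp_x[OF ev] .
  then have "isCont q 0" by (rule DERIV_isCont)
  then have "(q \<longlongrightarrow> q 0) (nhds 0)" unfolding isCont_def tendsto_at_iff_tendsto_nhds .
  then have "\<forall>\<^sub>F t in nhds 0. q t > 0" using pos by (rule order_tendstoD)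
  with ev have 1: "\<forall>\<^sub>F t in nhds 0. ((\<lambda>t. ln (q t)) has_real_derivative q' t / q t) (at t)"
  proof eventually_elim
    case (elim t)
    then show ?case by (auto intro!: derivative_eq_intros)
  qed
  have "((\<lambda>t. q' t / q t) has_real_derivative (a * q 0 - q' 0 * q' 0) / (q 0 * q 0)) (at 0)"
    by (rule DERIV_divide[OF q2 q0]) (use pos in simp)
  also have "(a * q 0 - q' 0 * q' 0) / (q 0 * q 0) = a / q 0 - (q' 0)\<^sup>2 / (q 0)\<^sup>2"
    using pos by (simp add: field_simps power2_eq_square)
  finally show ?thesis unfolding has2_def using 1 by (intro exI[of _ "\<lambda>t. q' t / q t"] conjI)
qed

lemma has2_affine:
  assumes "has2 q a" shows "has2 (\<lambda>t. k + l * q t) (l * a)"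
proof -
  obtain q' where 1: "\<forall>\<^sub>F t in nhds 0. (q has_real_derivative q' t) (at t)" "(q' has_real_derivative a) (at 0)"
    using assms unfolding has2_def by blast
  from 1(1) have "\<forall>\<^sub>F t in nhds 0. ((\<lambda>t. k + l * q t) has_real_derivative l * q' t) (at t)"
    by eventually_elim (auto intro!: derivative_eq_intros)
  moreover have "((\<lambda>t. l * q' t) has_real_derivative l * a) (at 0)" by (rule DERIV_cmult[OF 1(2)])
  ultimately show ?thesis unfolding has2_def by (intro exI[of _ "\<lambda>t. l * q' t"] conjI)
qed

lemma has2_add: assumes "has2 q a" "has2 p b" shows "has2 (\<lambda>t. q t + p t) (a + b)"
  using has2_diff[OF assms(1) has2_affine[OF assms(2), of 0 "-1"]] by simp

lemma has2_norm_square: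
  fixes y :: "real \<Rightarrow> 'a::real_inner"
  assumes ev: "\<forall>\<^sub>F t in nhds 0. (y has_vector_derivative y' t) (at t)" and y2: "(y' has_vector_derivative y'') (at 0)"
  shows "\<forall>\<^sub>F t in nhds 0. ((\<lambda>t. (norm (y t))\<^sup>2) has_real_derivative 2 * (y t \<bullet> y' t)) (at t)"
    and "((\<lambda>t. 2 * (y t \<bullet> y' t)) has_real_derivative 2 * ((norm (y' 0))\<^sup>2 + y 0 \<bullet> y'')) (at 0)"
proof -
  show "\<forall>\<^sub>F t in nhds 0. ((\<lambda>t. (norm (y t))\<^sup>2) has_real_derivative 2 * (y t \<bullet> y' t)) (at t)"
    using ev
  proof eventually_elim
    case (elim t)
    then show ?case
      unfolding power2_norm_eq_inner has_vector_derivative_def has_field_derivative_def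
      by (auto intro!: derivative_eq_intros simp: inner_commute algebra_simps)
  qed
  have "(y has_vector_derivative y' 0) (at 0)" using eventually_nhds_x_imp_x[OF ev] .
  with y2 show "((\<lambda>t. 2 * (y t \<bullet> y' t)) has_real_derivative 2 * ((norm (y' 0))\<^sup>2 + y 0 \<bullet> y'')) (at 0)"
    unfolding power2_norm_eq_inner has_vector_derivative_def has_field_derivative_def
    by (auto intro!: derivative_eq_intros simp: inner_commute algebra_simps)
qed

lemma has2_ln_norm:
  fixes y :: "real \<Rightarrow> 'a::real_inner"
  assumes "\<forall>\<^sub>F t in nhds 0. (y has_vector_derivative y' t) (at t)" "(y' has_vector_derivative y'') (at 0)"
    and "y 0 \<noteq> 0"
  shows "has2 (\<lambda>t. ln ((norm (y t))\<^sup>2))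
    (2 * ((norm (y' 0))\<^sup>2 + y 0 \<bullet> y'') / (norm (y 0))\<^sup>2 - (2 * (y 0 \<bullet> y' 0))\<^sup>2 / ((norm (y 0))\<^sup>2)\<^sup>2)"
  by (rule has2_ln[OF has2_norm_square[OF assms(1,2)]]) (use assms(3) in simp)

lemma has2_ln_one_minus:
  fixes y :: "real \<Rightarrow> 'a::real_inner"
  assumes ev: "\<forall>\<^sub>F t in nhds 0. (y has_vector_derivative y' t) (at t)" and y2: "(y' has_vector_derivative y'') (at 0)"
    and pos: "1 - k * (norm (y 0))\<^sup>2 > 0"
  shows "has2 (\<lambda>t. ln (1 - k * (norm (y t))\<^sup>2))
    (- (2 * k * ((norm (y' 0))\<^sup>2 + y 0 \<bullet> y'')) / (1 - k * (norm (y 0))\<^sup>2)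
      - (2 * k * (y 0 \<bullet> y' 0))\<^sup>2 / (1 - k * (norm (y 0))\<^sup>2)\<^sup>2)"
proof -
  have 1: "\<forall>\<^sub>F t in nhds 0. ((\<lambda>t. 1 - k * (norm (y t))\<^sup>2) has_real_derivative - (k * (2 * (y t \<bullet> y' t)))) (at t)"
    using has2_norm_square(1)[OF ev y2]
  proof eventually_elim
    case (elim t)
    from DERIV_diff[OF DERIV_const[of 1] DERIV_cmult[OF elim, of k]] show ?case by simp
  qed
  have 2: "((\<lambda>t. - (k * (2 * (y t \<bullet> y' t)))) has_real_derivative - (k * (2 * ((norm (y' 0))\<^sup>2 + y 0 \<bullet> y'')))) (at 0)"
    by (intro DERIV_minus DERIV_cmult has2_norm_square(2)[OF ev y2])
  show ?thesis using has2_ln[OF 1 2 pos] by (simp add: mult_ac)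
qed

lemma has_vector_derivative_complex_line:
  assumes "(F has_derivative (\<lambda>h. h *\<^sub>C d)) (at (z + of_real t * e))"
  shows "((\<lambda>t. F (z + of_real t * e)) has_vector_derivative e *\<^sub>C d) (at t)"
proof -
  have "((\<lambda>t. z + of_real t * e) has_derivative (\<lambda>h. of_real h * e)) (at t)"
    by (auto intro!: derivative_eq_intros)
  from diff_chain_at[OF this assms] show ?thesis
    by (simp add: o_def has_vector_derivative_def scaleC_scaleC[symmetric] scaleC_of_real)
qed

lemma filterlim_complex_line: "filterlim (\<lambda>t. z + of_real t * e) (nhds (z::complex)) (nhds 0)"
proof -
  have "((\<lambda>t. z + of_real t * e) \<longlongrightarrow> z + of_real 0 * e) (nhds 0)"
    by (intro tendsto_intros filterlim_ident)
  then show ?thesis by simp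
qed

lemma eventually_complex_line:
  "open S \<Longrightarrow> z \<in> S \<Longrightarrow> \<forall>\<^sub>F t in nhds 0. z + of_real t * e \<in> (S::complex set)"
  using eventually_compose_filterlim[OF eventually_nhds_in_open filterlim_complex_line] .

lemma c2at_holomorphic_vec:
  fixes f :: "complex \<Rightarrow> complex^'n"
  assumes "holomorphic_map_on f S" "open S" "z \<in> S"
  shows "c2at f z"
proof (rule c2at_I[where D = "\<lambda>w v. v *\<^sub>C cderiv f w"])
  show "\<forall>\<^sub>F w in nhds z. (f has_derivative (\<lambda>v. v *\<^sub>C cderiv f w)) (at w)"
    using eventually_nhds_in_open[OF assms(2,3)]
    by eventually_elim (rule holomorphic_cderiv[OF assms(1,2)])
  fix v
  have "bounded_linear (\<lambda>x::complex^'n. v *\<^sub>C x)"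
    by (simp add: linear_linear linear_scaleC)
  from bounded_linear.has_derivative[OF this holomorphic_cderiv[OF holomorphic_map_on_cderiv_vec[OF assms(1,2)] assms(2,3)]]
  show "(\<lambda>w. v *\<^sub>C cderiv f w) differentiable (at z)" unfolding differentiable_def by blast
qed

text \<open>The parameters cover two uses: \<open>k = 0\<close>, \<open>l = 1\<close> gives the
  metric of the disk, \<open>k = ln c\<close>, \<open>l = 2\<close> the logarithm of the metric
  induced on a tripotent disk.\<close>

lemma ddbar_ln_disk:
  assumes z: "cmod z < 1"
  shows "Re (ddbar (\<lambda>w. k - l * ln (1 - (cmod w)\<^sup>2)) z 1 1) = l / (1 - (cmod z)\<^sup>2)\<^sup>2"
proof -
  define q where "q w = ln (1 - (cmod w)\<^sup>2)" for w :: complex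
  have pos: "1 - (cmod w)\<^sup>2 > 0" if "cmod w < 1" for w using that by (simp add: abs_square_less_1)
  have id: "c2at (\<lambda>w. w) z"
    by (rule c2at_I[where D = "\<lambda>w v. v"]) auto
  \<comment> \<open>The function \<open>1 - |w|\<^sup>2\<close> is written as a polynomial in w and
    its conjugate, to which the closure rules for \<open>c2at\<close> apply.\<close>
  have "c2at (\<lambda>w. 1 + Re ((- w) * cnj w)) z"
    by (intro c2at_add c2at_const c2at_linear[OF bounded_linear_Re] c2at_mult
        c2at_linear[OF bounded_linear_cnj] c2at_linear[OF bounded_linear_minus[OF bounded_linear_ident]] id)
  moreover have "1 + Re ((- w) * cnj w) = 1 - (cmod w)\<^sup>2" for w :: complex
    unfolding cmod_power2 by (simp add: power2_eq_square)
  ultimately have "c2at (\<lambda>w. 1 - (cmod w)\<^sup>2) z" by simp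
  moreover have "\<forall>\<^sub>F w in nhds z. 1 - (cmod w)\<^sup>2 > 0"
    using eventually_nhds_in_open[of "ball 0 1" z] z by (auto elim!: eventually_mono simp: abs_square_less_1)
  ultimately have "c2at q z" unfolding q_def by (rule c2at_ln)
  then have c2: "c2at (\<lambda>w. k + (- l) * q w) z"
    by (intro c2at_add c2at_const c2at_mult)
  obtain a b where ab: "has2 (\<lambda>t. k + (- l) * q (z + of_real t)) a" "has2 (\<lambda>t. k + (- l) * q (z + of_real t * \<i>)) b"
    "Re (ddbar (\<lambda>w. k + (- l) * q w) z 1 1) = (a + b) / 4"
    using ddbar_eq[OF c2] by metis
  define r where "r = 1 - (cmod z)\<^sup>2"
  have r: "r > 0" using pos[OF z] by (simp add: r_def)
  have line: "has2 (\<lambda>t. q (z + of_real t * e)) (- 2 / r - (2 * (z \<bullet> e))\<^sup>2 / r\<^sup>2)" if "cmod e = 1" for e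
  proof -
    have 1: "\<forall>\<^sub>F t in nhds 0. ((\<lambda>t. z + of_real t * e) has_vector_derivative e) (at t)"
    proof (rule always_eventually, rule allI)
      fix t show "((\<lambda>t. z + of_real t * e) has_vector_derivative e) (at t)"
        unfolding has_vector_derivative_def
        by (auto intro!: derivative_eq_intros simp: scaleR_conv_of_real)
    qed
    have 2: "((\<lambda>t. e) has_vector_derivative 0) (at (0::real))" by simp
    show ?thesis
      using has2_ln_one_minus[OF 1 2, of 1] z that r by (simp add: q_def r_def)
  qed
  have A: "a = (- l) * (- 2 / r - (2 * (z \<bullet> 1))\<^sup>2 / r\<^sup>2)"
    using has2_unique[OF ab(1)] has2_affine[OF line[of 1], of k "- l"] by simp
  have B: "b = (- l) * (- 2 / r - (2 * (z \<bullet> \<i>))\<^sup>2 / r\<^sup>2)"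
    using has2_unique[OF ab(2)] has2_affine[OF line[of \<i>], of k "- l"] by simp
  have 1: "(z \<bullet> 1)\<^sup>2 + (z \<bullet> \<i>)\<^sup>2 = 1 - r"
    by (simp add: inner_complex_def cmod_power2 r_def)
  have "(- l) * (- 2 / r - (2 * u)\<^sup>2 / r\<^sup>2) + (- l) * (- 2 / r - (2 * v)\<^sup>2 / r\<^sup>2)
      = l * (4 / r + 4 * (u\<^sup>2 + v\<^sup>2) / r\<^sup>2)" for u v
    by (simp add: power_mult_distrib algebra_simps add_divide_distrib)
  then have "a + b = l * (4 / r + 4 * (1 - r) / r\<^sup>2)"
    unfolding A B 1[symmetric] .
  also have "4 / r + 4 * (1 - r) / r\<^sup>2 = 4 / r\<^sup>2" using r by (simp add: field_simps power2_eq_square)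
  finally show ?thesis using ab(3) by (simp add: q_def r_def)
qed

lemma disk_metric_eq: "z \<in> \<Delta> \<Longrightarrow> disk_metric z = 1 / (1 - (cmod z)\<^sup>2)\<^sup>2"
  using ddbar_ln_disk[of z 0 1] by (simp add: disk_metric_def)

section \<open>Curvature of totally geodesic disks and the constant of the metric\<close>

context canonical_domain
begin

lemma pullback_chart:
  assumes c: "chart c \<Phi>" and f: "holomorphic_map_on f S" "open S" "f ` S \<subseteq> \<Omega>" and z: "z \<in> S"
  shows "cderiv (\<lambda>z. \<Phi> (f z)) z = fder \<Phi> (f z) (cderiv f z)"
    and "holomorphic_map_on (\<lambda>z. \<Phi> (f z)) S"
proof -
  have \<Phi>: "biholomorphism \<Phi> \<Omega> \<D>" using c by (simp add: chart_def)
  note F = biholo_facts[OF \<Phi>]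
  have fw: "f z \<in> \<Omega>" using f z by auto
  from diff_chain_at[OF holomorphic_cderiv[OF f(1,2) z] F(3)[OF fw]]
  show "cderiv (\<lambda>z. \<Phi> (f z)) z = fder \<Phi> (f z) (cderiv f z)"
    by (intro cderiv_eqI) (simp add: o_def F(4)[OF fw])
  show "holomorphic_map_on (\<lambda>z. \<Phi> (f z)) S"
    by (rule holomorphic_map_on_compose[OF f(1,3) F(1)])
qed

lemma pullback_pos:
  assumes "f z \<in> \<Omega>" "cderiv f z \<noteq> 0" shows "pullback f g z > 0"
  unfolding pullback_def by (rule herm_pos[OF pos_def_g[OF assms(1)] assms(2)])

text \<open>Both Gram matrices in \<open>metric_formula\<close> are bounded by
  \<open>1 / (1 - \<kappa> |Z|\<^sup>2)\<close> through \<open>op_norm_le\<close>. The bound is an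
  equality at Z = 0, which makes it a barrier for second order comparison.\<close>

lemma pullback_le:
  assumes c: "chart c \<Phi>" "c > 0" and f: "holomorphic_map_on f S" "open S" "f ` S \<subseteq> \<Omega>" and z: "z \<in> S"
    and small: "\<kappa> * (norm (\<Phi> (f z)))\<^sup>2 < 1"
  shows "pullback f g z \<le> c * \<kappa> * (norm (cderiv (\<lambda>z. \<Phi> (f z)) z))\<^sup>2 / (1 - \<kappa> * (norm (\<Phi> (f z)))\<^sup>2)\<^sup>2"
proof -
  have \<Phi>: "biholomorphism \<Phi> \<Omega> \<D>" using c by (simp add: chart_def)
  have fz: "f z \<in> \<Omega>" using f z by auto
  define Z where "Z = \<Phi> (f z)"
  define X where "X = cderiv (\<lambda>z. \<Phi> (f z)) z"
  define s where "s = \<kappa> * (norm Z)\<^sup>2"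
  have ZW: "Z \<in> W" using biholo_facts(2)[OF \<Phi> fz] by (simp add: Z_def)
  obtain P :: "complex^'p^'p" and S' :: "complex^'q^'q" where PS:
    "P ** (mat 1 - Z ** adjoint_mat Z) ** adjoint_mat P = mat 1"
    "S' ** (mat 1 - adjoint_mat Z ** Z) ** adjoint_mat S' = mat 1"
    "\<And>u v. herm (g (f z)) u v = of_real (c * \<kappa>) *
       mip (P ** fder \<Phi> (f z) u ** adjoint_mat S') (P ** fder \<Phi> (f z) v ** adjoint_mat S')"
    using metric_formula[OF c(1) fz] unfolding Z_def by metis
  have s: "(norm (Z *v v))\<^sup>2 \<le> s * (norm v)\<^sup>2" for v using op_norm_le[OF ZW] by (simp add: s_def)
  have s0: "0 \<le> s" using kappa_pos by (simp add: s_def)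
  have s1: "s < 1" using small by (simp add: s_def Z_def)
  note b = norm_sandwich_le[OF PS(1,2) s s0 s1]
  have "pullback f g z = c * \<kappa> * Re (mip (P ** X ** adjoint_mat S') (P ** X ** adjoint_mat S'))"
    unfolding pullback_def PS(3) X_def pullback_chart(1)[OF c(1) f z] by simp
  also have "\<dots> = c * \<kappa> * Re (mip ((adjoint_mat P ** P) ** X ** (adjoint_mat S' ** S')) X)"
    unfolding mip_sandwich ..
  also have "\<dots> \<le> c * \<kappa> * (norm ((adjoint_mat P ** P) ** X ** (adjoint_mat S' ** S')) * norm X)"
    using c(2) kappa_pos order_trans[OF complex_Re_le_cmod cmod_mip_le] by (intro mult_left_mono) auto
  also have "\<dots> \<le> c * \<kappa> * ((1 / (1 - s) * (1 / (1 - s) * norm X)) * norm X)"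
    using c(2) kappa_pos s1 order_trans[OF b(2) mult_left_mono[OF b(1)]]
    by (intro mult_left_mono mult_right_mono) auto
  also have "\<dots> = c * \<kappa> * (norm X)\<^sup>2 / (1 - s)\<^sup>2" by (simp add: power2_eq_square)
  finally show ?thesis by (simp add: X_def s_def Z_def)
qed

lemma c2at_pullback:
  assumes f: "holomorphic_map_on f S" "open S" "f ` S \<subseteq> \<Omega>" and z: "z \<in> S"
  shows "c2at (pullback f g) z"
proof -
  have fz: "f z \<in> \<Omega>" using f z by auto
  have cf: "c2at f z" by (rule c2at_holomorphic_vec[OF f(1,2) z])
  have cf': "c2at (\<lambda>w. cderiv f w $ i) z" for i
    by (rule c2at_linear[OF bounded_linear_vec_nth c2at_holomorphic_vec[OF holomorphic_map_on_cderiv_vec[OF f(1,2)] f(2) z]])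
  have cg: "c2at (\<lambda>w. g (f w) $ i $ j) z" for i j
    by (rule c2at_compose[where T = \<Omega> and G = "\<lambda>y. g y $ i $ j", OF differentiable_g open_\<Omega> fz cf])
  show ?thesis unfolding pullback_def herm_def
    by (intro c2at_linear[OF bounded_linear_Re] c2at_sum c2at_mult cg cf' c2at_linear[OF bounded_linear_cnj])
qed

text \<open>Near the origin the metric is dominated by that of a complex ball, which is pluriharmonic
  along a totally geodesic disk up to the curvature term.\<close>

lemma gaussian_curvature_ge:
  assumes c: "chart c \<Phi>" "c > 0" and f: "totally_geodesic_disk \<Omega> g f" and z: "z \<in> \<Delta>"
  shows "- 2 / c \<le> gaussian_curvature (pullback f g) z"
proof -
  have hol: "holomorphic_map_on f \<Delta>" "open \<Delta>" "f ` \<Delta> \<subseteq> \<Omega>" using f by (auto simp: totally_geodesic_disk_def)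
  have nz: "\<And>w. w \<in> \<Delta> \<Longrightarrow> cderiv f w \<noteq> 0" using f by (auto simp: totally_geodesic_disk_def)
  obtain a where a: "cderiv (cderiv f) z + christoffel g (f z) (cderiv f z) (cderiv f z) = a *\<^sub>C cderiv f z"
    using f z unfolding totally_geodesic_disk_def by blast
  have fz: "f z \<in> \<Omega>" using hol z by auto
  obtain \<Phi>' where \<Phi>': "chart c \<Phi>'" "\<Phi>' (f z) = 0"
    using chart_at[OF c(1) fz] by metis
  have bi: "biholomorphism \<Phi>' \<Omega> \<D>" using \<Phi>' by (simp add: chart_def)
  note L = biholo_facts[OF bi]
  define F where "F = (\<lambda>z. \<Phi>' (f z))"
  have F: "holomorphic_map_on F \<Delta>" unfolding F_def by (rule pullback_chart(2)[OF \<Phi>'(1) hol z])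
  note F' = holomorphic_map_on_cderiv_mat[OF F open_ball]
  note F'' = holomorphic_map_on_cderiv_mat[OF F' open_ball]
  define Y where "Y = cderiv F z"
  have Y: "Y = fder \<Phi>' (f z) (cderiv f z)" unfolding Y_def F_def by (rule pullback_chart(1)[OF \<Phi>'(1) hol z])
  have Y0: "Y \<noteq> 0" unfolding Y using L(8)[OF fz] nz[OF z] by simp
  have FY: "cderiv (cderiv F) z = a *\<^sub>C Y"
    unfolding F_def disk_second_derivative[OF \<Phi>'(1) c(2) hol z \<Phi>'(2)] a Y by (rule L(4)[OF fz])
  define m where "m = Re (mip Y (cderiv (cderiv (cderiv F)) z))"
  define h where "h = pullback f g"
  have hpos: "h w > 0" if "w \<in> \<Delta>" for w
  proof -
    have "f w \<in> \<Omega>" using hol(3) that by blast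
    then show ?thesis unfolding h_def by (rule pullback_pos[OF _ nz[OF that]])
  qed
  have evh: "\<forall>\<^sub>F w in nhds z. h w > 0"
    using eventually_nhds_in_open[OF open_ball z] by eventually_elim (rule hpos)
  have "c2at (\<lambda>w. ln (h w)) z"
    by (rule c2at_ln[OF c2at_pullback[OF hol z, folded h_def] evh])
  then obtain a1 b1 where ab: "has2 (\<lambda>t. ln (h (z + of_real t))) a1" "has2 (\<lambda>t. ln (h (z + of_real t * \<i>))) b1"
    "Re (ddbar (\<lambda>w. ln (h w)) z 1 1) = (a1 + b1) / 4"
    by (rule ddbar_eq)
  \<comment> \<open>Logarithm of the bound in \<open>pullback_le\<close>, touching
    \<open>ln (h w)\<close> from above at z. The factor 1 and the summand 0 give both parts the
    shape of \<open>has2_affine\<close>.\<close>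
  define p where "p w = ln (c * \<kappa>) + 1 * ln ((norm (cderiv F w))\<^sup>2) + (0 + (- 2) * ln (1 - \<kappa> * (norm (F w))\<^sup>2))" for w
  have Fz: "F z = 0" by (simp add: F_def \<Phi>'(2))
  have ph: "ln (h z) = p z"
  proof -
    have "h z = c * \<kappa> * (norm Y)\<^sup>2"
      using \<Phi>' fz unfolding h_def pullback_def chart_def by (simp add: Y[symmetric] mip_self del: of_real_power)
    then show ?thesis using c(2) kappa_pos Y0 by (simp add: p_def Fz Y_def[symmetric] ln_mult)
  qed
  have le: "\<forall>\<^sub>F w in nhds z. ln (h w) \<le> p w"
  proof -
    have "isCont F z" using holomorphic_cderiv[OF F open_ball z] has_derivative_continuous by blast
    then have "(F \<longlongrightarrow> F z) (nhds z)" unfolding isCont_def tendsto_at_iff_tendsto_nhds .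
    then have "((\<lambda>w. \<kappa> * (norm (F w))\<^sup>2) \<longlongrightarrow> \<kappa> * (norm (F z))\<^sup>2) (nhds z)" by (intro tendsto_intros)
    then have e1: "\<forall>\<^sub>F w in nhds z. \<kappa> * (norm (F w))\<^sup>2 < 1" by (rule order_tendstoD) (simp add: Fz)
    show ?thesis using e1 eventually_nhds_in_open[OF open_ball z]
    proof eventually_elim
      case (elim w)
      have nF: "norm (cderiv F w) \<noteq> 0"
      proof -
        have fw: "f w \<in> \<Omega>" using hol(3) elim(2) by blast
        show ?thesis unfolding F_def pullback_chart(1)[OF \<Phi>'(1) hol elim(2)]
          using L(8)[OF fw] nz[OF elim(2)] by simp
      qed
      define s where "s = \<kappa> * (norm (F w))\<^sup>2"
      have "h w \<le> c * \<kappa> * (norm (cderiv F w))\<^sup>2 / (1 - s)\<^sup>2"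
        using pullback_le[OF \<Phi>'(1) c(2) hol elim(2)] elim(1) by (simp add: h_def F_def s_def)
      then have "ln (h w) \<le> ln (c * \<kappa> * (norm (cderiv F w))\<^sup>2 / (1 - s)\<^sup>2)"
        using hpos[OF elim(2)] by (meson ln_mono less_le_trans)
      also have "\<dots> = ln (c * \<kappa>) + ln ((norm (cderiv F w))\<^sup>2) - 2 * ln (1 - s)"
        using c(2) kappa_pos nF elim(1) by (simp add: ln_mult ln_div ln_realpow s_def)
      finally show ?case by (simp add: p_def s_def)
    qed
  qed
  have line: "has2 (\<lambda>t. p (z + of_real t * e))
      (2 * ((cmod a)\<^sup>2 * (norm Y)\<^sup>2 + Re (mip Y (e *\<^sub>C (e *\<^sub>C cderiv (cderiv (cderiv F)) z)))) / (norm Y)\<^sup>2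
        - (2 * Re (e * a))\<^sup>2 + 4 * \<kappa> * (norm Y)\<^sup>2)" if e: "cmod e = 1" for e
  proof -
    have d: "((\<lambda>t. G (z + of_real t * e)) has_vector_derivative e *\<^sub>C cderiv G (z + of_real t * e)) (at t)"
      if "holomorphic_map_on G \<Delta>" "z + of_real t * e \<in> \<Delta>" for G :: "complex \<Rightarrow> complex^'q^'p" and t
      by (rule has_vector_derivative_complex_line[OF holomorphic_cderiv[OF that(1) open_ball that(2)]])
    have ev: "\<forall>\<^sub>F t in nhds 0. ((\<lambda>t. G (z + of_real t * e)) has_vector_derivative e *\<^sub>C cderiv G (z + of_real t * e)) (at t)"
      if "holomorphic_map_on G \<Delta>" for G :: "complex \<Rightarrow> complex^'q^'p"
      using eventually_complex_line[OF open_ball z, of e] by eventually_elim (rule d[OF that])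
    have bl: "bounded_linear (\<lambda>x::complex^'q^'p. e *\<^sub>C x)" by (simp add: linear_linear linear_scaleC)
    have d2: "((\<lambda>t. e *\<^sub>C cderiv G (z + of_real t * e)) has_vector_derivative e *\<^sub>C (e *\<^sub>C cderiv (cderiv G) z)) (at 0)"
      if "holomorphic_map_on G \<Delta>" for G :: "complex \<Rightarrow> complex^'q^'p"
      using bounded_linear.has_vector_derivative[OF bl d[OF holomorphic_map_on_cderiv_mat[OF that open_ball], of 0]] z by simp
    have aY: "mip Y (e *\<^sub>C (a *\<^sub>C Y)) = cnj (e * a) * of_real ((norm Y)\<^sup>2)"
      by (simp add: mip_scaleC_right mip_self del: of_real_power)
    have 1: "has2 (\<lambda>t. ln ((norm (cderiv F (z + of_real t * e)))\<^sup>2))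
      (2 * ((cmod a)\<^sup>2 * (norm Y)\<^sup>2 + Re (mip Y (e *\<^sub>C (e *\<^sub>C cderiv (cderiv (cderiv F)) z)))) / (norm Y)\<^sup>2
        - (2 * Re (e * a))\<^sup>2)"
    proof -
      have y0: "cderiv F (z + of_real 0 * e) \<noteq> 0" using Y0 by (simp add: Y_def)
      have q: "(2 * (Re (e * a) * (norm Y)\<^sup>2))\<^sup>2 / ((norm Y)\<^sup>2)\<^sup>2 = (2 * Re (e * a))\<^sup>2"
      proof -
        have gen: "(2 * (x * n))\<^sup>2 / n\<^sup>2 = (2 * x)\<^sup>2" if "n \<noteq> 0" for x n :: real
          using that by (simp add: power_mult_distrib)
        have "(norm Y)\<^sup>2 \<noteq> 0" using Y0 by simp
        from gen[OF this] show ?thesis .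
      qed
      have i: "Y \<bullet> (e *\<^sub>C (a *\<^sub>C Y)) = Re (e * a) * (norm Y)\<^sup>2"
        unfolding Re_mip[symmetric] aY by (simp del: of_real_power)
      show ?thesis
        using has2_ln_norm[OF ev[OF F'] d2[OF F'] y0]
        unfolding of_real_0 mult_zero_left add_0_right Y_def[symmetric] FY i q
        by (simp add: norm_scaleC_mat e power_mult_distrib Re_mip)
    qed
    have 2: "has2 (\<lambda>t. ln (1 - \<kappa> * (norm (F (z + of_real t * e)))\<^sup>2)) (- (2 * \<kappa> * (norm Y)\<^sup>2))"
      using has2_ln_one_minus[OF ev[OF F] d2[OF F], of \<kappa>]
      by (simp add: Fz Y_def[symmetric] norm_scaleC_mat e)
    show ?thesis unfolding p_def
      using has2_add[OF has2_affine[OF 1, of "ln (c * \<kappa>)" 1] has2_affine[OF 2, of 0 "- 2"]]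
      by (simp add: algebra_simps)
  qed
  have evl: "\<forall>\<^sub>F t in nhds 0. ln (h (z + of_real t * e)) \<le> p (z + of_real t * e)" for e
    using eventually_compose_filterlim[OF le filterlim_complex_line] .
  have A: "a1 \<le> 2 * ((cmod a)\<^sup>2 * (norm Y)\<^sup>2 + m) / (norm Y)\<^sup>2 - (2 * Re a)\<^sup>2 + 4 * \<kappa> * (norm Y)\<^sup>2"
    using has2_mono[OF ab(1)] line[of 1] evl[of 1] ph by (simp add: m_def)
  have B: "b1 \<le> 2 * ((cmod a)\<^sup>2 * (norm Y)\<^sup>2 - m) / (norm Y)\<^sup>2 - (2 * Im a)\<^sup>2 + 4 * \<kappa> * (norm Y)\<^sup>2"
  proof -
    have "Re (mip Y (\<i> *\<^sub>C (\<i> *\<^sub>C cderiv (cderiv (cderiv F)) z))) = - m"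
      by (simp add: m_def mip_scaleC_right)
    then show ?thesis using has2_mono[OF ab(2) line[of \<i>] evl] ph by simp
  qed
  \<comment> \<open>Adding the two directions cancels the third derivatives, as m occurs with both
    signs, and all terms in a: the logarithm of \<open>norm (cderiv F w)\<close> has vanishing
    Laplacian at z because F'' is a multiple of F' there. Only the curvature of the barrier
    remains.\<close>
  have "a1 + b1 \<le> 4 * (cmod a)\<^sup>2 - 4 * ((Re a)\<^sup>2 + (Im a)\<^sup>2) + 8 * \<kappa> * (norm Y)\<^sup>2"
  proof -
    have "2 * (x * n + m) / n = 2 * x + 2 * (m / n)" "2 * (x * n - m) / n = 2 * x - 2 * (m / n)"
      if "n \<noteq> 0" for x n :: real
      using that by (simp_all add: add_divide_distrib diff_divide_distrib right_diff_distrib)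
    then show ?thesis using A B Y0 by (simp add: power_mult_distrib)
  qed
  then have "Re (ddbar (\<lambda>w. ln (h w)) z 1 1) \<le> 2 * \<kappa> * (norm Y)\<^sup>2"
    unfolding ab(3) cmod_power2 by simp
  moreover have hz: "h z = c * \<kappa> * (norm Y)\<^sup>2"
    using \<Phi>' fz unfolding h_def pullback_def chart_def by (simp add: Y[symmetric] mip_self del: of_real_power)
  moreover have "c * \<kappa> * (norm Y)\<^sup>2 > 0" using c(2) kappa_pos Y0 by simp
  ultimately have "Re (ddbar (\<lambda>w. ln (h w)) z 1 1) / h z \<le> 2 * \<kappa> * (norm Y)\<^sup>2 / h z"
    by (intro divide_right_mono) simp_all
  also have "\<dots> = 2 * \<kappa> * (norm Y)\<^sup>2 / (c * \<kappa> * (norm Y)\<^sup>2)" unfolding hz ..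
  also have "\<dots> = 2 / c" using c(2) kappa_pos Y0 by simp
  finally show ?thesis by (simp add: gaussian_curvature_def h_def)
qed

lemma tripotent_in_D:
  assumes E: "E \<in> W" "\<kappa> * (norm E)\<^sup>2 = 1" and z: "cmod z < 1"
  shows "z *\<^sub>C E \<in> \<D>"
proof -
  have "norm ((z *\<^sub>C E) *v v) < norm v" if "v \<noteq> 0" for v
  proof -
    have "(norm (E *v v))\<^sup>2 \<le> (norm v)\<^sup>2" using op_norm_le[OF E(1), of v] E(2) by simp
    then have "norm (E *v v) \<le> norm v" by (rule power2_le_imp_le) simp
    then have "cmod z * norm (E *v v) \<le> cmod z * norm v" by (rule mult_left_mono) simp
    also have "\<dots> < norm v" using z that by simp
    finally show ?thesis by (simp add: mat_vec_scaleC_left norm_scaleC_vec)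
  qed
  then show ?thesis using W_scaleC[OF E(1)] by (simp add: D_I_iff)
qed

text \<open>A tripotent is an eigenvector: multiplying E by \<open>1 - Z Z\<^sup>*\<close> from the
  left, or by \<open>1 - Z\<^sup>* Z\<close> from the right, with Z = z E gives the factor
  \<open>1 - |z|\<^sup>2\<close>. The inverses divide by it.\<close>

lemma gram_tripotent:
  fixes P :: "complex^'p^'p" and S :: "complex^'q^'q"
  assumes E: "E ** adjoint_mat E ** E = E" and z: "cmod z < 1"
    and P: "P ** (mat 1 - (z *\<^sub>C E) ** adjoint_mat (z *\<^sub>C E)) ** adjoint_mat P = mat 1"
    and S: "S ** (mat 1 - adjoint_mat (z *\<^sub>C E) ** (z *\<^sub>C E)) ** adjoint_mat S = mat 1"
  shows "(adjoint_mat P ** P) ** E ** (adjoint_mat S ** S) = of_real (1 / (1 - (cmod z)\<^sup>2)\<^sup>2) *\<^sub>C (E :: complex^'q^'p)"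
proof -
  define r :: complex where "r = of_real (1 - (cmod z)\<^sup>2)"
  have r: "r \<noteq> 0" using z by (simp add: r_def abs_square_eq_1 power2_eq_1_iff del: of_real_diff)
  have zz: "z * cnj z = 1 - r" "cnj z * z = 1 - r"
    by (simp_all add: r_def complex_norm_square mult.commute del: of_real_power)
  have 1: "(mat 1 - (z *\<^sub>C E) ** adjoint_mat (z *\<^sub>C E)) ** E = r *\<^sub>C E"
    "E ** (mat 1 - adjoint_mat (z *\<^sub>C E) ** (z *\<^sub>C E)) = r *\<^sub>C E"
  proof -
    have "E ** (adjoint_mat E ** E) = E" using E by (simp add: matrix_mul_assoc)
    moreover have "E - (1 - r) *\<^sub>C E = r *\<^sub>C E"
      by (simp add: vec_eq_iff scaleC_complex_def algebra_simps)
    ultimately show "(mat 1 - (z *\<^sub>C E) ** adjoint_mat (z *\<^sub>C E)) ** E = r *\<^sub>C E"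
      "E ** (mat 1 - adjoint_mat (z *\<^sub>C E) ** (z *\<^sub>C E)) = r *\<^sub>C E"
      by (simp_all add: mat_mult_distribs adjoint_mat_scaleC mat_mult_scaleC_left mat_mult_scaleC_right
          scaleC_scaleC zz E matrix_mul_assoc[symmetric])
  qed
  have unscale: "M = (1 / r) *\<^sub>C E" if "r *\<^sub>C M = E" for M
    unfolding that[symmetric] using r by (simp add: scaleC_scaleC)
  have "r *\<^sub>C ((adjoint_mat P ** P) ** E) = E"
    using arg_cong[OF 1(1), of "\<lambda>M. (adjoint_mat P ** P) ** M"]
    by (simp add: matrix_mul_assoc adjoint_gram_inverse(1)[OF P] mat_mult_scaleC_right)
  then have PE: "(adjoint_mat P ** P) ** E = (1 / r) *\<^sub>C E"
    by (rule unscale)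
  have "r *\<^sub>C (E ** (adjoint_mat S ** S)) = E"
    using arg_cong[OF 1(2), of "\<lambda>M. M ** (adjoint_mat S ** S)"]
    by (simp add: matrix_mul_assoc[symmetric] adjoint_gram_inverse(2)[OF S, unfolded matrix_mul_assoc[symmetric]] mat_mult_scaleC_left)
  then have ES: "E ** (adjoint_mat S ** S) = (1 / r) *\<^sub>C E"
    by (rule unscale)
  show ?thesis
    by (simp only: PE mat_mult_scaleC_left ES scaleC_scaleC) (simp add: r_def power2_eq_square)
qed

text \<open>The disk spanned by a tripotent remains a linear disk when any of its points is moved to
  the origin, so its second derivative there is tangential. The induced metric is c times that of
  the unit disk, of curvature - 2 / c.\<close>

lemma tripotent_disk:
  assumes c: "chart c \<Phi>" "c > 0"
  obtains f where "totally_geodesic_disk \<Omega> g f" "gaussian_curvature (pullback f g) 0 = - 2 / c"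
proof -
  obtain E where E: "E \<in> W" "E ** adjoint_mat E ** E = E" "\<kappa> * (norm E)\<^sup>2 = 1" using tripotent by blast
  have bi: "biholomorphism \<Phi> \<Omega> \<D>" using c by (simp add: chart_def)
  obtain h where h: "biholomorphism h \<D> \<Omega>" "\<forall>x\<in>\<Omega>. h (\<Phi> x) = x" "\<forall>y\<in>\<D>. \<Phi> (h y) = y"
    using biholomorphism_inverse[OF bi] by blast
  have h': "holomorphic_map_on h \<D>" "h ` \<D> \<subseteq> \<Omega>"
    using h(1) by (auto simp: biholomorphism_def bij_betw_def)
  have zE: "z *\<^sub>C E \<in> \<D>" if "z \<in> \<Delta>" for z using tripotent_in_D[OF E(1,3)] that by simp
  have dE: "((\<lambda>z. z *\<^sub>C E) has_derivative (\<lambda>h. h *\<^sub>C E)) F" for F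
    by (rule bounded_linear_imp_has_derivative[OF bounded_linear_scaleC_left])
  have holE: "holomorphic_map_on (\<lambda>z. z *\<^sub>C E) \<Delta>"
    unfolding holomorphic_map_on_def using dE by (auto simp: scaleC_scaleC scaleC_complex_def intro!: exI)
  define f where "f z = h (z *\<^sub>C E)" for z
  have f: "holomorphic_map_on f \<Delta>" "open \<Delta>" "f ` \<Delta> \<subseteq> \<Omega>"
    using holomorphic_map_on_compose[OF holE _ h'(1)] zE h'(2) by (auto simp: f_def[abs_def] image_subset_iff)
  have \<Phi>f: "\<Phi> (f z) = z *\<^sub>C E" if "z \<in> \<Delta>" for z using h(3) zE[OF that] by (simp add: f_def)
  have cd: "cderiv (\<lambda>z. \<Phi> (f z)) z = E" if "z \<in> \<Delta>" for z
    by (intro cderiv_eqI has_derivative_transform_within_open[OF dE open_ball that]) (simp add: \<Phi>f)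
  have E0: "E \<noteq> 0" using E(3) by auto
  have nz: "cderiv f z \<noteq> 0" if "z \<in> \<Delta>" for z
  proof
    assume "cderiv f z = 0"
    moreover have "f z \<in> \<Omega>" using f that by auto
    ultimately have "E = 0" using pullback_chart(1)[OF c(1) f that] cd[OF that] biholo_facts(8)[OF bi] by simp
    with E0 show False ..
  qed
  have tg: "\<exists>a. cderiv (cderiv f) z0 + christoffel g (f z0) (cderiv f z0) (cderiv f z0) = a *\<^sub>C cderiv f z0"
    if z0: "z0 \<in> \<Delta>" for z0
  proof -
    have fz0: "f z0 \<in> \<Omega>" using f z0 by auto
    obtain A B C H where T: "pseudo_unitary A B C H" "frac A B C H (\<Phi> (f z0)) = 0"
      "chart c (\<lambda>y. frac A B C H (\<Phi> y))"
      using chart_at[OF c(1) fz0] by metis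
    define \<Phi>' where "\<Phi>' = (\<lambda>y. frac A B C H (\<Phi> y))"
    have \<Phi>': "chart c \<Phi>'" "\<Phi>' (f z0) = 0" using T by (simp_all add: \<Phi>'_def)
    have bi': "biholomorphism \<Phi>' \<Omega> \<D>" using \<Phi>' by (simp add: chart_def)
    note L = biholo_facts[OF bi']
    have Z0: "z0 *\<^sub>C E \<in> D_I" using zE[OF z0] by simp
    note pz = pseudo_unitary_zero[OF T(1) Z0 T(2)[unfolded \<Phi>f[OF z0]]]
    \<comment> \<open>The inverse of H, read off from the normalization of H at
      \<open>z0 *\<^sub>C E\<close>.\<close>
    define Hi where "Hi = (mat 1 - adjoint_mat (z0 *\<^sub>C E) ** (z0 *\<^sub>C E)) ** adjoint_mat H"
    have "H ** Hi = mat 1" using pz(4) by (simp only: Hi_def matrix_mul_assoc)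
    then have Hi: "Hi ** H = mat 1" using matrix_left_right_inverse by blast
    define Y where "Y = A ** E ** Hi"
    \<comment> \<open>The disk automorphism taking z0 to 0. The matrix transformation acts as m on
      the line of E, because the tripotent identity lets numerator and denominator both factor
      through \<open>A ** E\<close>.\<close>
    define m where "m z = (z - z0) / (1 - cnj z0 * z)" for z
    have den: "1 - cnj z0 * z \<noteq> 0" if "z \<in> \<Delta>" for z
    proof
      assume "1 - cnj z0 * z = 0"
      then have "cmod (cnj z0 * z) = 1" by (metis eq_iff_diff_eq_0 norm_one)
      moreover have "cmod z0 * cmod z < 1 * 1" using that z0 by (intro mult_strict_mono') auto
      ultimately show False by (simp add: norm_mult)
    qed
    have F1: "\<Phi>' (f z) = m z *\<^sub>C Y" if z: "z \<in> \<Delta>" for z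
    proof -
      define N where "N = C ** (z *\<^sub>C E) + H"
      have N: "invertible N" unfolding N_def using zE[OF z] by (intro pseudo_unitary_invertible[OF T(1)]) simp
      have N2: "N = H ** (mat 1 - (cnj z0 * z) *\<^sub>C (adjoint_mat E ** E))"
        by (simp add: N_def pz(2) mat_mult_distribs adjoint_mat_scaleC mat_mult_scaleC_left mat_mult_scaleC_right
            scaleC_scaleC scaleC_uminus mat_mult_uminus_left matrix_mul_assoc mult.commute)
      have "Y ** N = (A ** E) ** ((Hi ** H) ** (mat 1 - (cnj z0 * z) *\<^sub>C (adjoint_mat E ** E)))"
        by (simp add: Y_def N2 matrix_mul_assoc)
      also have "\<dots> = A ** (E - (cnj z0 * z) *\<^sub>C (E ** adjoint_mat E ** E))"
        by (simp add: Hi mat_mult_distribs mat_mult_scaleC_right matrix_mul_assoc)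
      also have "E - (cnj z0 * z) *\<^sub>C (E ** adjoint_mat E ** E) = (1 - cnj z0 * z) *\<^sub>C E"
        unfolding E(2) by (simp add: vec_eq_iff scaleC_complex_def algebra_simps)
      finally have YN: "Y ** N = (1 - cnj z0 * z) *\<^sub>C (A ** E)" by (simp add: mat_mult_scaleC_right)
      have "A ** (z *\<^sub>C E) + B = (z - z0) *\<^sub>C (A ** E)"
        by (simp add: pz(1) mat_mult_scaleC_right vec_eq_iff scaleC_complex_def algebra_simps)
      also have "\<dots> = (m z *\<^sub>C Y) ** N"
        using den[OF z] by (simp add: mat_mult_scaleC_left YN scaleC_scaleC m_def)
      finally have "\<Phi>' (f z) = (m z *\<^sub>C Y) ** N ** matrix_inv N"
        unfolding \<Phi>'_def \<Phi>f[OF z] frac_def N_def[symmetric] by simp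
      then show ?thesis by (simp add: matrix_mul_assoc[symmetric] matrix_inv_right[OF N])
    qed
    have holm: "m holomorphic_on \<Delta>" unfolding m_def using den by (intro holomorphic_intros) auto
    have holm': "deriv m holomorphic_on \<Delta>" by (rule holomorphic_deriv[OF holm open_ball])
    have cdm: "((\<lambda>z. k z *\<^sub>C Y) has_derivative (\<lambda>h. h *\<^sub>C (deriv k z *\<^sub>C Y))) (at z)"
      if "k holomorphic_on \<Delta>" "z \<in> \<Delta>" for k z
    proof -
      have "(k has_derivative (*) (deriv k z)) (at z)"
        using holomorphic_derivI[OF that(1) open_ball that(2)] by (simp add: has_field_derivative_def)
      from bounded_linear.has_derivative[OF bounded_linear_scaleC_left this, of Y]
      show ?thesis by (simp add: scaleC_scaleC mult.commute)
    qed
    have c1: "cderiv (\<lambda>z. \<Phi>' (f z)) z = deriv m z *\<^sub>C Y" if "z \<in> \<Delta>" for z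
      by (intro cderiv_eqI has_derivative_transform_within_open[OF cdm[OF holm that] open_ball that]) (simp add: F1)
    have c2: "cderiv (cderiv (\<lambda>z. \<Phi>' (f z))) z0 = deriv (deriv m) z0 *\<^sub>C Y"
      by (intro cderiv_eqI has_derivative_transform_within_open[OF cdm[OF holm' z0] open_ball z0]) (simp add: c1)
    have m': "deriv m z0 \<noteq> 0"
    proof
      assume "deriv m z0 = 0"
      then have "fder \<Phi>' (f z0) (cderiv f z0) = 0"
        using c1[OF z0] pullback_chart(1)[OF \<Phi>'(1) f z0] by simp
      then show False using L(8)[OF fz0] nz[OF z0] by simp
    qed
    define a where "a = deriv (deriv m) z0 / deriv m z0"
    have "fder \<Phi>' (f z0) (cderiv (cderiv f) z0 + christoffel g (f z0) (cderiv f z0) (cderiv f z0))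
        = a *\<^sub>C (deriv m z0 *\<^sub>C Y)"
      using disk_second_derivative[OF \<Phi>'(1) c(2) f z0 \<Phi>'(2)] m' by (simp add: c2 a_def scaleC_scaleC)
    also have "\<dots> = fder \<Phi>' (f z0) (a *\<^sub>C cderiv f z0)"
      using c1[OF z0] pullback_chart(1)[OF \<Phi>'(1) f z0] by (simp add: L(4)[OF fz0])
    finally have "fder \<Phi>' (f z0) (cderiv (cderiv f) z0 + christoffel g (f z0) (cderiv f z0) (cderiv f z0) - a *\<^sub>C cderiv f z0) = 0"
      by (simp add: L(6)[OF fz0])
    then have "cderiv (cderiv f) z0 + christoffel g (f z0) (cderiv f z0) (cderiv f z0) - a *\<^sub>C cderiv f z0 = 0"
      by (simp only: L(8)[OF fz0])
    then show ?thesis unfolding right_minus_eq by (rule exI)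
  qed
  have pb: "pullback f g z = c / (1 - (cmod z)\<^sup>2)\<^sup>2" if z: "z \<in> \<Delta>" for z
  proof -
    have fz: "f z \<in> \<Omega>" using f z by auto
    obtain P :: "complex^'p^'p" and S :: "complex^'q^'q" where PS:
      "P ** (mat 1 - (z *\<^sub>C E) ** adjoint_mat (z *\<^sub>C E)) ** adjoint_mat P = mat 1"
      "S ** (mat 1 - adjoint_mat (z *\<^sub>C E) ** (z *\<^sub>C E)) ** adjoint_mat S = mat 1"
      "\<And>u v. herm (g (f z)) u v = of_real (c * \<kappa>) *
         mip (P ** fder \<Phi> (f z) u ** adjoint_mat S) (P ** fder \<Phi> (f z) v ** adjoint_mat S)"
      using metric_formula[OF c(1) fz] unfolding \<Phi>f[OF z] by metis
    have M: "mip (P ** E ** adjoint_mat S) (P ** E ** adjoint_mat S) = of_real (1 / (1 - (cmod z)\<^sup>2)\<^sup>2 * (norm E)\<^sup>2)"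
      using z unfolding mip_sandwich by (subst gram_tripotent[OF E(2) _ PS(1,2)]) (simp_all add: mip_scaleC_left mip_self)
    have "pullback f g z = c * \<kappa> * (1 / (1 - (cmod z)\<^sup>2)\<^sup>2 * (norm E)\<^sup>2)"
      unfolding pullback_def PS(3) pullback_chart(1)[OF c(1) f z, symmetric] cd[OF z] M
      by (simp only: of_real_mult[symmetric] Re_complex_of_real)
    also have "\<dots> = c * (\<kappa> * (norm E)\<^sup>2) / (1 - (cmod z)\<^sup>2)\<^sup>2" by simp
    finally show ?thesis by (simp add: E(3))
  qed
  have "ddbar (\<lambda>w. ln (pullback f g w)) 0 1 1 = ddbar (\<lambda>w. ln c - 2 * ln (1 - (cmod w)\<^sup>2)) 0 1 1"
  proof -
    have eq: "complex_of_real (ln (pullback f g w)) = complex_of_real (ln c - 2 * ln (1 - (cmod w)\<^sup>2))" if "w \<in> \<Delta>" for w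
    proof -
      have "1 - (cmod w)\<^sup>2 > 0" using that by (simp add: abs_square_less_1)
      then show ?thesis using c(2) by (simp add: pb[OF that] ln_div ln_realpow)
    qed
    have 1: "wirtinger_bar 1 (\<lambda>y. complex_of_real (ln (pullback f g y))) w
        = wirtinger_bar 1 (\<lambda>y. complex_of_real (ln c - 2 * ln (1 - (cmod y)\<^sup>2))) w" if "w \<in> \<Delta>" for w
      unfolding wirtinger_bar_def using fder_cong_open[OF open_ball that eq] by (simp only:)
    have "(0::complex) \<in> \<Delta>" by simp
    from fder_cong_open[OF open_ball this 1] show ?thesis by (simp only: ddbar_def wirtinger_def)
  qed
  then have "gaussian_curvature (pullback f g) 0 = - 2 / c"
    using ddbar_ln_disk[of 0 "ln c" 2] pb[of 0] by (simp add: gaussian_curvature_def)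
  moreover have "totally_geodesic_disk \<Omega> g f"
    unfolding totally_geodesic_disk_def using f nz tg by blast
  ultimately show ?thesis using that by blast
qed

text \<open>A minimal disk has curvature - 2 by the normalization; it cannot lie below the general
  bound - 2 / c, nor above the value - 2 / c of the tripotent disk.\<close>

lemma chart_constant:
  assumes c: "chart c \<Phi>" "c > 0" shows "c = 1"
proof -
  obtain f where f: "minimal_disk \<Omega> g f" using canonical by (auto simp: canonical_metric_def)
  have K: "gaussian_curvature (pullback f g) 0 = - 2"
    using canonical f by (auto simp: canonical_metric_def)
  obtain e where e: "totally_geodesic_disk \<Omega> g e" "gaussian_curvature (pullback e g) 0 = - 2 / c"
    using tripotent_disk[OF c] by metis
  have "- 2 / c \<le> - 2"
    using gaussian_curvature_ge[OF c, of f 0] f K by (simp add: minimal_disk_def)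
  moreover have "- 2 \<le> - 2 / c"
    using f e K unfolding minimal_disk_def by (metis centre_in_ball zero_less_one)
  ultimately have "2 / c = 2" by simp
  then show ?thesis using c(2) by (simp add: divide_eq_eq)
qed

end

section \<open>Symmetric 2 x 2 matrices\<close>

definition mat2 :: "complex \<Rightarrow> complex \<Rightarrow> complex \<Rightarrow> complex \<Rightarrow> complex^2^2" where
  "mat2 a b c d = (\<chi> i j. if i = 1 then (if j = 1 then a else b) else (if j = 1 then c else d))"

lemma mat2_nth [simp]: "mat2 a b c d $ 1 $ 1 = a" "mat2 a b c d $ 1 $ 2 = b"
    "mat2 a b c d $ 2 $ 1 = c" "mat2 a b c d $ 2 $ 2 = d"
  by (simp_all add: mat2_def)

lemma mat2_eq_iff: "A = B \<longleftrightarrow> A $ 1 $ 1 = B $ 1 $ 1 \<and> A $ 1 $ 2 = B $ 1 $ 2 \<and> A $ 2 $ 1 = B $ 2 $ 1 \<and> A $ 2 $ 2 = (B::complex^2^2) $ 2 $ 2"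
  by (auto simp: vec_eq_iff forall_2)

lemma mat2_mult: "mat2 a b c d ** mat2 a' b' c' d' = mat2 (a*a'+b*c') (a*b'+b*d') (c*a'+d*c') (c*b'+d*d')"
  by (simp add: mat2_eq_iff matrix_matrix_mult_def sum_2)

lemma mat2_adjoint: "adjoint_mat (mat2 a b c d) = mat2 (cnj a) (cnj c) (cnj b) (cnj d)"
  by (simp add: mat2_eq_iff)

lemma mat2_one: "mat 1 = mat2 1 0 0 1"
  by (simp add: mat2_eq_iff mat_def)

lemma mat2_diff: "mat2 a b c d - mat2 a' b' c' d' = mat2 (a-a') (b-b') (c-c') (d-d')"
  by (simp add: mat2_eq_iff)

lemma mat2_scaleC: "k *\<^sub>C mat2 a b c d = mat2 (k*a) (k*b) (k*c) (k*d)"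
  by (simp add: mat2_eq_iff scaleC_complex_def)

lemma mat2_mip: "mip (mat2 a b c d) (mat2 a' b' c' d') = a * cnj a' + b * cnj b' + c * cnj c' + d * cnj d'"
  by (simp add: mip_def cip_def sum_2)

lemma mat2_vec: "(mat2 a b c d *v v) $ 1 = a * v$1 + b * v$2" "(mat2 a b c d *v v) $ 2 = c * v$1 + d * v$2"
  by (simp_all add: matrix_vector_mult_def sum_2)

lemma norm_vec2: "(norm (v::complex^2))\<^sup>2 = (cmod (v$1))\<^sup>2 + (cmod (v$2))\<^sup>2"
  by (simp add: norm_vec_power2 sum_2)

definition form2 :: "real \<Rightarrow> complex \<Rightarrow> real \<Rightarrow> complex \<Rightarrow> complex \<Rightarrow> real" where
  "form2 p q r x y = p * (cmod x)\<^sup>2 + 2 * Re (q * x * cnj y) + r * (cmod y)\<^sup>2"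

lemma form2_complete_square:
  "p * form2 p q r x y = (cmod (of_real p * x + cnj q * y))\<^sup>2 + (p * r - (cmod q)\<^sup>2) * (cmod y)\<^sup>2"
  unfolding form2_def cmod_power2 by (simp add: power2_eq_square algebra_simps)

lemma form2_pos:
  assumes "(cmod q)\<^sup>2 < p * r" "0 < p + r" "x \<noteq> 0 \<or> y \<noteq> 0"
  shows "0 < form2 p q r x y"
proof -
  have pr: "p * r > 0" using assms(1) zero_le_power2[of "cmod q"] by linarith
  then have p: "p > 0" using assms(2) by (auto simp: zero_less_mult_iff)
  have "0 < p * form2 p q r x y"
  proof (cases "y = 0")
    case True
    then show ?thesis using assms(3) p by (simp add: form2_complete_square norm_mult)
  next
    case False
    then have "0 < (p * r - (cmod q)\<^sup>2) * (cmod y)\<^sup>2" using assms(1) by simp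
    then show ?thesis unfolding form2_complete_square by (simp add: add_nonneg_pos)
  qed
  then show ?thesis using p by (simp add: zero_less_mult_iff)
qed

lemma form2_nonneg_det:
  assumes "\<And>x y. 0 \<le> form2 p q r x y"
  shows "0 \<le> p" "0 \<le> r" "(cmod q)\<^sup>2 \<le> p * r"
proof -
  show p: "0 \<le> p" using assms[of 1 0] by (simp add: form2_def)
  show r: "0 \<le> r" using assms[of 0 1] by (simp add: form2_def)
  show "(cmod q)\<^sup>2 \<le> p * r"
  proof (cases "p = 0")
    case False
    have "0 \<le> p * form2 p q r (- cnj q) (of_real p)" using assms p by simp
    also have "\<dots> = (p * r - (cmod q)\<^sup>2) * p\<^sup>2"
      unfolding form2_complete_square by simp
    finally show ?thesis using False by (simp add: zero_le_mult_iff)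
  next
    case True
    have "0 \<le> form2 p q r (of_real (- (r + 1) * k) * cnj q) 1" for k using assms by blast
    \<comment> \<open>For p = 0 the form is affine along these multiples of \<open>cnj q\<close>, so
      large k would make it negative unless q = 0. The factor r + 1 ensures that one value of k
      suffices below.\<close>
    then have 2: "2 * ((r + 1) * k) * (cmod q)\<^sup>2 \<le> r" for k
      unfolding form2_def True cmod_power2 by (simp add: power2_eq_square algebra_simps)
    show ?thesis
    proof (rule ccontr)
      assume "\<not> (cmod q)\<^sup>2 \<le> p * r"
      then have n: "(cmod q)\<^sup>2 > 0" using True by simp
      have "2 * ((r + 1) * (1 / (cmod q)\<^sup>2)) * (cmod q)\<^sup>2 \<le> r" by (rule 2)
      then show False using n r by simp
    qed
  qed
qed

text \<open>The expression is the trace of the adjugate of one positive semidefinite matrix times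
  the other. The mixed term is bounded by the determinants, and the inequality of arithmetic and
  geometric means does the rest.\<close>

lemma form2_trace_nonneg:
  assumes 0: "(cmod q0)\<^sup>2 \<le> p0 * r0" "0 \<le> p0" "0 \<le> r0"
    and 1: "(cmod q)\<^sup>2 \<le> p * r" "0 \<le> p" "0 \<le> r"
  shows "0 \<le> r0 * p + p0 * r - 2 * Re (cnj q0 * q)"
proof -
  define c where "c = Re (cnj q0 * q)"
  have "c \<le> cmod q0 * cmod q" unfolding c_def using complex_Re_le_cmod[of "cnj q0 * q"] by (simp add: norm_mult)
  moreover have "(cmod q0 * cmod q)\<^sup>2 \<le> (p0 * r0) * (p * r)"
    unfolding power_mult_distrib using 0 1 by (intro mult_mono) auto
  moreover have "(p0 * r0) * (p * r) \<le> ((r0 * p + p0 * r) / 2)\<^sup>2"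
    using zero_le_power2[of "r0 * p - p0 * r"] by (simp add: power2_eq_square field_simps)
  ultimately have "(cmod q0 * cmod q)\<^sup>2 \<le> ((r0 * p + p0 * r) / 2)\<^sup>2" "c \<le> cmod q0 * cmod q"
    by linarith+
  moreover have "0 \<le> (r0 * p + p0 * r) / 2" using 0 1 by simp
  ultimately have "cmod q0 * cmod q \<le> (r0 * p + p0 * r) / 2" using power2_le_imp_le by blast
  with \<open>c \<le> cmod q0 * cmod q\<close> have "c \<le> (r0 * p + p0 * r) / 2" by (rule order_trans)
  then have "2 * c \<le> r0 * p + p0 * r" by (simp only: mult.commute[of 2] pos_le_divide_eq zero_less_numeral)
  then show ?thesis unfolding c_def[symmetric] by (simp only: diff_ge_0_iff_ge)
qed

text \<open>A point Z and a tangent X, both symmetric. Here p, q, r are the entries of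
  \<open>1 - Z Z\<^sup>*\<close> and disc is its determinant; p1, q1, r1 are the coefficients of the
  form that the adjugate of that matrix induces on v through \<open>X *v v\<close>.\<close>

locale sym2 =
  fixes a b d x y w :: complex
begin

definition "p \<equiv> 1 - (cmod a)\<^sup>2 - (cmod b)\<^sup>2"
definition "r \<equiv> 1 - (cmod b)\<^sup>2 - (cmod d)\<^sup>2"
definition "q \<equiv> - (a * cnj b + b * cnj d)"
definition "Z \<equiv> mat2 a b b d"
definition "X \<equiv> mat2 x y y w"
definition "disc \<equiv> 1 - (cmod a)\<^sup>2 - 2 * (cmod b)\<^sup>2 - (cmod d)\<^sup>2 + (cmod (a * d - b\<^sup>2))\<^sup>2"
definition "p1 \<equiv> r * (cmod x)\<^sup>2 + p * (cmod y)\<^sup>2 - 2 * Re (q * y * cnj x)"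
definition "r1 \<equiv> r * (cmod y)\<^sup>2 + p * (cmod w)\<^sup>2 - 2 * Re (q * w * cnj y)"
definition "q1 \<equiv> of_real r * x * cnj y + of_real p * y * cnj w - q * y * cnj y - cnj q * x * cnj w"

text \<open>Squared moduli become products with conjugates, so that the identities below are
  polynomial identities in the variables and their conjugates, which \<open>algebra\<close> can
  check.\<close>

lemma cmod2: "complex_of_real ((cmod z)\<^sup>2) = z * cnj z"
  by (simp add: complex_norm_square del: of_real_power)

lemma cp: "complex_of_real p = 1 - a * cnj a - b * cnj b"
  unfolding p_def of_real_diff cmod2 by simp

lemma cr: "complex_of_real r = 1 - b * cnj b - d * cnj d"
  unfolding r_def of_real_diff cmod2 by simp

lemma cnj_q: "cnj q = - (cnj a * b + cnj b * d)"
  by (simp add: q_def)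

lemma two_Re: "complex_of_real (2 * Re z) = z + cnj z"
  by (simp add: complex_eq_iff)

lemma cp1: "complex_of_real p1 = of_real r * (x * cnj x) + of_real p * (y * cnj y) - (q * y * cnj x + cnj q * cnj y * x)"
  unfolding p1_def of_real_diff of_real_add of_real_mult[of r] of_real_mult[of p] cmod2 two_Re by simp

lemma cr1: "complex_of_real r1 = of_real r * (y * cnj y) + of_real p * (w * cnj w) - (q * w * cnj y + cnj q * cnj w * y)"
  unfolding r1_def of_real_diff of_real_add of_real_mult[of r] of_real_mult[of p] cmod2 two_Re by simp

lemma cdisc: "complex_of_real disc = 1 - a * cnj a - 2 * (b * cnj b) - d * cnj d + (a * d - b\<^sup>2) * (cnj a * cnj d - (cnj b)\<^sup>2)"
  unfolding disc_def of_real_diff of_real_add of_real_mult[of 2] cmod2 by simp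

lemma det_eq: "p * r - (cmod q)\<^sup>2 = disc"
proof -
  have "complex_of_real (p * r - (cmod q)\<^sup>2) = of_real disc"
    unfolding of_real_diff of_real_mult cmod2 cnj_q cdisc cp cr unfolding q_def by algebra
  then show ?thesis by (metis of_real_eq_iff)
qed

lemma norm_form: "(norm v)\<^sup>2 - (norm (Z *v v))\<^sup>2 = form2 p q r (v$1) (v$2)"
proof -
  have "complex_of_real ((norm v)\<^sup>2 - (norm (Z *v v))\<^sup>2) = of_real (form2 p q r (v$1) (v$2))"
    unfolding form2_def norm_vec2 of_real_diff of_real_add of_real_mult[of p] of_real_mult[of r] cmod2 two_Re Z_def mat2_vec cp cr
    unfolding complex_cnj_mult complex_cnj_add complex_cnj_cnj cnj_q unfolding q_def by algebra
  then show ?thesis by (metis of_real_eq_iff)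
qed

lemma inverse_ZZ:
  assumes "disc \<noteq> 0"
  shows "(mat 1 - Z ** adjoint_mat Z) ** ((1 / of_real disc) *\<^sub>C mat2 (of_real r) (- q) (- cnj q) (of_real p)) = mat 1"
proof -
  have D: "complex_of_real disc = of_real p * of_real r - q * cnj q"
    unfolding det_eq[symmetric] of_real_diff of_real_mult cmod2 ..
  have "mat 1 - Z ** adjoint_mat Z = mat2 (of_real p) q (cnj q) (of_real r)"
    unfolding Z_def mat2_adjoint mat2_mult mat2_one mat2_diff cp cr cnj_q
    unfolding q_def mat2_eq_iff mat2_nth by (simp add: algebra_simps)
  then have eq: "(mat 1 - Z ** adjoint_mat Z) ** mat2 (of_real r) (- q) (- cnj q) (of_real p) = mat2 (of_real disc) 0 0 (of_real disc)"
    by (simp add: mat2_mult D algebra_simps)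
  show ?thesis unfolding mat_mult_scaleC_right eq using assms by (simp add: mat2_scaleC mat2_one)
qed

lemma inverse_ZZ':
  assumes "disc \<noteq> 0"
  shows "((1 / of_real disc) *\<^sub>C mat2 (of_real r) (- cnj q) (- q) (of_real p)) ** (mat 1 - adjoint_mat Z ** Z) = mat 1"
proof -
  have D: "complex_of_real disc = of_real p * of_real r - q * cnj q"
    unfolding det_eq[symmetric] of_real_diff of_real_mult cmod2 ..
  have "mat 1 - adjoint_mat Z ** Z = mat2 (of_real p) (cnj q) q (of_real r)"
    unfolding Z_def mat2_adjoint mat2_mult mat2_one mat2_diff cp cr cnj_q
    unfolding q_def mat2_eq_iff mat2_nth by (simp add: algebra_simps)
  then have eq: "mat2 (of_real r) (- cnj q) (- q) (of_real p) ** (mat 1 - adjoint_mat Z ** Z) = mat2 (of_real disc) 0 0 (of_real disc)"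
    by (simp add: mat2_mult D algebra_simps)
  show ?thesis unfolding mat_mult_scaleC_left eq using assms by (simp add: mat2_scaleC mat2_one)
qed

lemma gram_form:
  "cip (mat2 (of_real r) (- q) (- cnj q) (of_real p) *v (X *v v)) (X *v v) = of_real (form2 p1 q1 r1 (v$1) (v$2))"
proof -
  have q1c: "cnj q1 = of_real r * cnj x * y + of_real p * cnj y * w - cnj q * cnj y * y - q * cnj x * w"
    by (simp add: q1_def)
  show ?thesis
    unfolding form2_def of_real_diff of_real_add of_real_mult[of p1] of_real_mult[of r1] cmod2 two_Re cp1 cr1
      cip_def sum_2 mat2_vec X_def complex_cnj_mult complex_cnj_add complex_cnj_cnj q1c
    unfolding q1_def by algebra
qed

text \<open>Multiplicativity of the determinant; the adjugate of a 2 x 2 matrix has the same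
  determinant disc.\<close>

lemma det_gram: "p1 * r1 - (cmod q1)\<^sup>2 = disc * (cmod (x * w - y\<^sup>2))\<^sup>2"
proof -
  have q1c: "cnj q1 = of_real r * cnj x * y + of_real p * cnj y * w - cnj q * cnj y * y - q * cnj x * w"
    by (simp add: q1_def)
  have D: "complex_of_real disc = of_real p * of_real r - q * cnj q"
    unfolding det_eq[symmetric] of_real_diff of_real_mult cmod2 ..
  have "complex_of_real (p1 * r1 - (cmod q1)\<^sup>2) = of_real (disc * (cmod (x * w - y\<^sup>2))\<^sup>2)"
    unfolding of_real_diff of_real_mult cmod2 D cp1 cr1 q1c complex_cnj_diff complex_cnj_mult complex_cnj_power
    unfolding q1_def by algebra
  then show ?thesis by (metis of_real_eq_iff)
qed

text \<open>Divided by the square of disc this is the squared length of X at Z, since the inverses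
  of both defect matrices are the adjugates divided by disc.\<close>

lemma trace_gram:
  "mip (mat2 (of_real r) (- q) (- cnj q) (of_real p) ** X ** mat2 (of_real r) (- cnj q) (- q) (of_real p)) X
    = of_real (r * p1 + p * r1 - 2 * Re (cnj q * q1))"
proof -
  have q1c: "cnj q1 = of_real r * cnj x * y + of_real p * cnj y * w - cnj q * cnj y * y - q * cnj x * w"
    by (simp add: q1_def)
  show ?thesis
    unfolding of_real_diff of_real_add of_real_mult[of r] of_real_mult[of p] two_Re complex_cnj_mult complex_cnj_cnj
      cp1 cr1 q1c X_def mat2_mult mat2_mip
    unfolding q1_def by algebra
qed

text \<open>The right side is the square of disc times the complex second derivative of
  \<open>- ln disc\<close> in direction X. The first bracket is minus the mixed second derivative of
  disc, the second term the squared modulus of its first derivative;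
  \<open>a * w + d * x - 2 * b * y\<close> is the derivative of the determinant of Z.\<close>

lemma trace_formula:
  "of_real (r * p1 + p * r1 - 2 * Re (cnj q * q1)) =
    of_real disc * (x * cnj x + 2 * (y * cnj y) + w * cnj w
        - (a * w + d * x - 2 * b * y) * cnj (a * w + d * x - 2 * b * y))
    + (cnj a * x + 2 * cnj b * y + cnj d * w - cnj (a * d - b\<^sup>2) * (a * w + d * x - 2 * b * y))
      * cnj (cnj a * x + 2 * cnj b * y + cnj d * w - cnj (a * d - b\<^sup>2) * (a * w + d * x - 2 * b * y))"
proof -
  have q1c: "cnj q1 = of_real r * cnj x * y + of_real p * cnj y * w - cnj q * cnj y * y - q * cnj x * w"
    by (simp add: q1_def)
  show ?thesis
    unfolding of_real_diff of_real_add of_real_mult[of r] of_real_mult[of p] two_Re complex_cnj_mult complex_cnj_cnj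
      cp1 cr1 q1c cdisc cp cr complex_cnj_diff complex_cnj_add complex_cnj_power complex_cnj_numeral
    unfolding q1_def cp cr cnj_q complex_cnj_mult unfolding q_def by algebra
qed

end

section \<open>The family of isometries into symmetric 2 x 2 matrices\<close>

text \<open>The parameters are the singular values of the unit tangent at the origin; their order
  makes \<alpha> its operator norm and gives s < 1.\<close>

locale isometry_family =
  fixes \<alpha> \<delta> :: real
  assumes unit: "\<alpha>\<^sup>2 + \<delta>\<^sup>2 = 1" and delta: "0 < \<delta>" "\<delta> < \<alpha>"
begin

definition s :: real where "s = 2 * \<alpha> * \<delta>"
definition root :: "complex \<Rightarrow> complex" where "root z = csqrt (1 - of_real s * z\<^sup>2)"
text \<open>The solution of \<open>2 h - h\<^sup>2 = s z\<^sup>2\<close> that vanishes at 0. With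
  the \<beta> below, the determinant of \<open>Z0 z\<close> is \<open>h z\<close>, and its squared
  modulus cancels the off-diagonal contribution to disc.\<close>

definition h :: "complex \<Rightarrow> complex" where "h z = 1 - root z"
definition h' :: "complex \<Rightarrow> complex" where "h' z = of_real s * z / root z"
definition \<beta> :: complex where "\<beta> = \<i> / of_real (sqrt 2)"

definition Z0 :: "complex \<Rightarrow> complex^2^2" where
  "Z0 z = mat2 (of_real \<alpha> * z) (\<beta> * h z) (\<beta> * h z) (of_real \<delta> * z)"

definition X0 :: "complex \<Rightarrow> complex^2^2" where
  "X0 z = mat2 (of_real \<alpha>) (\<beta> * h' z) (\<beta> * h' z) (of_real \<delta>)"

lemma beta: "\<beta>\<^sup>2 = - 1/2" "cmod \<beta> ^ 2 = 1/2" "\<beta> * cnj \<beta> = 1/2"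
proof -
  have 1: "complex_of_real (sqrt 2) * complex_of_real (sqrt 2) = 2"
    by (metis of_real_mult of_real_numeral real_sqrt_mult_self abs_numeral)
  show "\<beta>\<^sup>2 = - 1/2" by (simp add: \<beta>_def power2_eq_square 1)
  show "cmod \<beta> ^ 2 = 1/2" by (simp add: \<beta>_def norm_divide power_divide)
  show "\<beta> * cnj \<beta> = 1/2" by (simp add: \<beta>_def 1)
qed

lemma alpha: "0 < \<alpha>" "\<alpha> < 1" "\<delta>\<^sup>2 < 1/2"
proof -
  show "0 < \<alpha>" using delta by simp
  have "\<alpha>\<^sup>2 < 1" using unit delta zero_less_power[of \<delta> 2] by linarith
  then show "\<alpha> < 1" using \<open>0 < \<alpha>\<close> by (simp add: abs_square_less_1)
  have "\<delta>\<^sup>2 < \<alpha>\<^sup>2" using delta by (intro power_strict_mono) auto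
  then show "\<delta>\<^sup>2 < 1/2" using unit by linarith
qed

lemma s: "0 < s" "s < 1"
proof -
  show "0 < s" using delta by (simp add: s_def)
  have "0 < (\<alpha> - \<delta>)\<^sup>2" using delta by simp
  then show "s < 1" using unit by (simp add: s_def power2_eq_square algebra_simps)
qed

context
  fixes z :: complex
  assumes z: "z \<in> \<Delta>"
begin

lemma sz: "cmod (of_real s * z\<^sup>2) \<le> s * (cmod z)\<^sup>2" "(cmod z)\<^sup>2 < 1" "cmod (of_real s * z\<^sup>2) < 1"
proof -
  show 1: "cmod (of_real s * z\<^sup>2) \<le> s * (cmod z)\<^sup>2" using s by (simp add: norm_mult norm_power)
  show 2: "(cmod z)\<^sup>2 < 1" using z by (simp add: abs_square_less_1)
  have "s * (cmod z)\<^sup>2 \<le> 1 * (cmod z)\<^sup>2" using s by (intro mult_right_mono) auto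
  then show "cmod (of_real s * z\<^sup>2) < 1" using 1 2 by linarith
qed

lemma Re_radicand: "0 < Re (1 - of_real s * z\<^sup>2)"
  using sz(3) abs_Re_le_cmod[of "of_real s * z\<^sup>2"] by simp

lemma root_square: "(root z)\<^sup>2 = 1 - of_real s * z\<^sup>2"
  by (simp add: root_def)

lemma Re_root: "0 < Re (root z)"
proof -
  have "0 \<le> Re (root z)" unfolding root_def by (rule Re_csqrt)
  moreover have "Re (root z) \<noteq> 0"
  proof
    assume "Re (root z) = 0"
    then have "Re ((root z)\<^sup>2) \<le> 0" by (simp add: power2_eq_square)
    then show False using Re_radicand unfolding root_square by simp
  qed
  ultimately show ?thesis by simp
qed

lemma root_nz: "root z \<noteq> 0" using Re_root by auto

lemma h_eq: "of_real s * z\<^sup>2 = 2 * h z - (h z)\<^sup>2"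
  using root_square by (simp add: h_def power2_eq_square algebra_simps)

text \<open>The product of \<open>1 - root z\<close> and \<open>1 + root z\<close> has modulus below
  1, and the second factor has modulus at least 1.\<close>

lemma norm_h: "cmod (h z) < 1"
proof -
  have "1 \<le> Re (1 + root z)" using Re_root by simp
  also have "\<dots> \<le> cmod (1 + root z)" by (rule complex_Re_le_cmod)
  finally have "cmod (h z) * 1 \<le> cmod (h z) * cmod (1 + root z)" by (rule mult_left_mono) simp
  also have "\<dots> = cmod (of_real s * z\<^sup>2)"
    unfolding h_eq by (simp add: norm_mult[symmetric] h_def power2_eq_square algebra_simps)
  finally show ?thesis using sz(3) by simp
qed

lemma h'_eq: "h' z * (1 - h z) = of_real s * z"
  using root_nz by (simp add: h'_def h_def)

lemma h_deriv: "(h has_field_derivative h' z) (at z)"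
proof -
  have 1: "1 - of_real s * z\<^sup>2 \<notin> \<real>\<^sub>\<le>\<^sub>0" using Re_radicand by (auto simp: complex_nonpos_Reals_iff)
  have 2: "((\<lambda>z. 1 - of_real s * z\<^sup>2) has_field_derivative - (2 * of_real s * z)) (at z)"
    by (auto intro!: derivative_eq_intros)
  have "((\<lambda>z. 1 - csqrt (1 - of_real s * z\<^sup>2)) has_field_derivative
     0 - - (2 * of_real s * z) / (2 * csqrt (1 - of_real s * z\<^sup>2))) (at z)"
    by (intro DERIV_diff DERIV_const has_field_derivative_csqrt'[OF 2 1])
  then show ?thesis by (simp add: h_def[abs_def] h'_def root_def)
qed

interpretation S: sym2 "of_real \<alpha> * z" "\<beta> * h z" "of_real \<delta> * z" "of_real \<alpha>" "\<beta> * h' z" "of_real \<delta>" .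

lemma Z_eq: "S.Z = Z0 z" and X_eq: "S.X = X0 z"
  by (simp_all add: S.Z_def S.X_def Z0_def X0_def)

lemma det_Z: "of_real \<alpha> * z * (of_real \<delta> * z) - (\<beta> * h z)\<^sup>2 = h z"
proof -
  have "of_real \<alpha> * z * (of_real \<delta> * z) = of_real s * z\<^sup>2 / 2" by (simp add: s_def power2_eq_square)
  then show ?thesis unfolding h_eq power_mult_distrib beta by (simp add: diff_divide_distrib)
qed

lemma disc_eq: "S.disc = 1 - (cmod z)\<^sup>2"
proof -
  have "(cmod (of_real \<alpha> * z))\<^sup>2 + (cmod (of_real \<delta> * z))\<^sup>2 = (\<alpha>\<^sup>2 + \<delta>\<^sup>2) * (cmod z)\<^sup>2"
    by (simp add: norm_mult power_mult_distrib algebra_simps)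
  then show ?thesis unfolding S.disc_def det_Z norm_mult[of \<beta>] power_mult_distrib[of "cmod \<beta>"] beta unit
    by simp
qed

lemma disc_pos: "0 < S.disc" using sz(2) by (simp add: disc_eq)

text \<open>A positive determinant shows that the form is definite; the trace decides its
  sign.\<close>

lemma trace_pos: "0 < S.p + S.r"
proof -
  have "(cmod (of_real \<alpha> * z))\<^sup>2 + (cmod (of_real \<delta> * z))\<^sup>2 = (\<alpha>\<^sup>2 + \<delta>\<^sup>2) * (cmod z)\<^sup>2"
    by (simp add: norm_mult power_mult_distrib algebra_simps)
  then have "S.p + S.r = 2 - (cmod z)\<^sup>2 - (cmod (h z))\<^sup>2"
    unfolding S.p_def S.r_def norm_mult[of \<beta>] power_mult_distrib[of "cmod \<beta>"] beta unit by simp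
  moreover have "(cmod (h z))\<^sup>2 < 1" using norm_h by (simp add: abs_square_less_1)
  ultimately show ?thesis using sz(2) by linarith
qed

lemma qpr: "(cmod S.q)\<^sup>2 < S.p * S.r" using S.det_eq disc_pos by linarith

lemma Z0_in_D_I: "Z0 z \<in> D_I"
  unfolding D_I_iff
proof (intro allI impI)
  fix v :: "complex^2" assume "v \<noteq> 0"
  then have "v $ 1 \<noteq> 0 \<or> v $ 2 \<noteq> 0" by (simp add: vec_eq_iff forall_2)
  then have "0 < form2 S.p S.q S.r (v$1) (v$2)" by (rule form2_pos[OF qpr trace_pos])
  then have "(norm (Z0 z *v v))\<^sup>2 < (norm v)\<^sup>2" using S.norm_form[of v] unfolding Z_eq by linarith
  then show "norm (Z0 z *v v) < norm v" by (rule power2_less_imp_less) simp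
qed

text \<open>In \<open>trace_formula\<close> the contributions of h' cancel in the coefficient of
  disc, leaving 1, and the squared term reduces to \<open>|z|\<^sup>2\<close>. The sum is 1 because
  disc is \<open>1 - |z|\<^sup>2\<close>; this is the isometry property.\<close>

lemma trace_one: "S.r * S.p1 + S.p * S.r1 - 2 * Re (cnj S.q * S.q1) = 1"
proof -
  have unit': "complex_of_real \<alpha> * of_real \<alpha> + of_real \<delta> * of_real \<delta> = 1"
    using unit by (metis of_real_add of_real_mult of_real_1 power2_eq_square)
  have bb: "\<beta> * \<beta> = - 1/2" using beta(1) by (simp add: power2_eq_square)
  have hz: "h' z = of_real s * z + h z * h' z" using h'_eq by (simp add: algebra_simps)
  have 1: "of_real \<alpha> * z * of_real \<delta> + of_real \<delta> * z * of_real \<alpha> - 2 * (\<beta> * h z) * (\<beta> * h' z) = h' z"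
  proof -
    have "of_real \<alpha> * z * of_real \<delta> + of_real \<delta> * z * of_real \<alpha> - 2 * (\<beta> * h z) * (\<beta> * h' z)
        = of_real s * z - 2 * (\<beta> * \<beta>) * (h z * h' z)" by (simp add: s_def algebra_simps)
    then show ?thesis unfolding bb using hz by simp
  qed
  have 2: "of_real \<alpha> * cnj (of_real \<alpha>) + 2 * (\<beta> * h' z * cnj (\<beta> * h' z)) + of_real \<delta> * cnj (of_real \<delta>) = 1 + h' z * cnj (h' z)"
  proof -
    have "of_real \<alpha> * cnj (of_real \<alpha>) + 2 * (\<beta> * h' z * cnj (\<beta> * h' z)) + of_real \<delta> * cnj (of_real \<delta>)
      = (complex_of_real \<alpha> * of_real \<alpha> + of_real \<delta> * of_real \<delta>) + 2 * (\<beta> * cnj \<beta>) * (h' z * cnj (h' z))"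
      by (simp add: algebra_simps)
    then show ?thesis unfolding unit' beta by simp
  qed
  have 3: "cnj (of_real \<alpha> * z) * of_real \<alpha> + 2 * cnj (\<beta> * h z) * (\<beta> * h' z) + cnj (of_real \<delta> * z) * of_real \<delta> - cnj (h z) * h' z = cnj z"
  proof -
    have "cnj (of_real \<alpha> * z) * of_real \<alpha> + 2 * cnj (\<beta> * h z) * (\<beta> * h' z) + cnj (of_real \<delta> * z) * of_real \<delta> - cnj (h z) * h' z
      = cnj z * (complex_of_real \<alpha> * of_real \<alpha> + of_real \<delta> * of_real \<delta>) + 2 * (\<beta> * cnj \<beta>) * (cnj (h z) * h' z) - cnj (h z) * h' z"
      by (simp add: algebra_simps)
    then show ?thesis unfolding unit' beta by simp
  qed
  have "complex_of_real (S.r * S.p1 + S.p * S.r1 - 2 * Re (cnj S.q * S.q1)) = of_real S.disc + cnj z * z"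
    unfolding S.trace_formula det_Z 1 2 3 by simp
  also have "\<dots> = of_real (S.disc + (cmod z)\<^sup>2)"
    unfolding of_real_add S.cmod2 by simp
  also have "\<dots> = of_real 1" by (simp add: disc_eq)
  finally show ?thesis by (metis of_real_eq_iff)
qed

text \<open>The determinant is \<open>\<alpha> \<delta>\<close> divided by the square of the root,
  and that square has modulus at least \<open>1 - |z|\<^sup>2\<close>. Equality at z = 0 makes the
  origin the extremal point.\<close>

lemma det_X: "cmod (of_real \<alpha> * of_real \<delta> - (\<beta> * h' z)\<^sup>2) \<le> \<alpha> * \<delta> / (1 - (cmod z)\<^sup>2)"
proof -
  have R: "(root z)\<^sup>2 \<noteq> 0" using root_nz by simp
  have "of_real \<alpha> * of_real \<delta> - (\<beta> * h' z)\<^sup>2 = of_real s / 2 + (of_real s)\<^sup>2 * z\<^sup>2 / (root z)\<^sup>2 / 2"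
    unfolding power_mult_distrib beta h'_def by (simp add: s_def power_divide power_mult_distrib)
  also have "\<dots> = of_real s / 2 * ((root z)\<^sup>2 + of_real s * z\<^sup>2) / (root z)\<^sup>2"
    using R by (simp add: field_simps power2_eq_square)
  also have "\<dots> = of_real (\<alpha> * \<delta>) / (root z)\<^sup>2" unfolding root_square by (simp add: s_def)
  finally have 1: "cmod (of_real \<alpha> * of_real \<delta> - (\<beta> * h' z)\<^sup>2) = \<alpha> * \<delta> / cmod ((root z)\<^sup>2)"
    using delta by (simp add: norm_divide norm_mult)
  have "1 - cmod (of_real s * z\<^sup>2) \<le> cmod ((root z)\<^sup>2)"
    unfolding root_square using norm_triangle_ineq2[of 1 "of_real s * z\<^sup>2"] by simp
  moreover have "s * (cmod z)\<^sup>2 \<le> 1 * (cmod z)\<^sup>2" using s by (intro mult_right_mono) auto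
  ultimately have 2: "1 - (cmod z)\<^sup>2 \<le> cmod ((root z)\<^sup>2)" using sz(1) by linarith
  have 3: "0 < 1 - (cmod z)\<^sup>2" using sz(2) by simp
  have "0 < cmod ((root z)\<^sup>2) * (1 - (cmod z)\<^sup>2)" by (rule mult_pos_pos[OF less_le_trans[OF 3 2] 3])
  then show ?thesis unfolding 1 using delta 2 by (intro divide_left_mono) auto
qed

lemma inverse_Z0:
  obtains A B where "(mat 1 - Z0 z ** adjoint_mat (Z0 z)) ** A = mat 1" "B ** (mat 1 - adjoint_mat (Z0 z) ** Z0 z) = mat 1"
    "mip (A ** X0 z ** B) (X0 z) = of_real (1 / (1 - (cmod z)\<^sup>2)\<^sup>2)"
    "\<And>v. cip (A *v (X0 z *v v)) (X0 z *v v) = of_real (form2 S.p1 S.q1 S.r1 (v$1) (v$2) / (1 - (cmod z)\<^sup>2))"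
proof -
  define A where "A = (1 / of_real S.disc) *\<^sub>C mat2 (of_real S.r) (- S.q) (- cnj S.q) (of_real S.p)"
  define B where "B = (1 / of_real S.disc) *\<^sub>C mat2 (of_real S.r) (- cnj S.q) (- S.q) (of_real S.p)"
  have D: "S.disc \<noteq> 0" using disc_pos by simp
  show ?thesis
  proof (rule that[of A B])
    show "(mat 1 - Z0 z ** adjoint_mat (Z0 z)) ** A = mat 1"
      unfolding A_def Z_eq[symmetric] by (rule S.inverse_ZZ[OF D])
    show "B ** (mat 1 - adjoint_mat (Z0 z) ** Z0 z) = mat 1"
      unfolding B_def Z_eq[symmetric] by (rule S.inverse_ZZ'[OF D])
    show "mip (A ** X0 z ** B) (X0 z) = of_real (1 / (1 - (cmod z)\<^sup>2)\<^sup>2)"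
      unfolding A_def B_def mat_mult_scaleC_left mat_mult_scaleC_right mip_scaleC_left X_eq[symmetric] S.trace_gram trace_one
      by (simp add: disc_eq power2_eq_square)
    show "cip (A *v (X0 z *v v)) (X0 z *v v) = of_real (form2 S.p1 S.q1 S.r1 (v$1) (v$2) / (1 - (cmod z)\<^sup>2))" for v
      unfolding A_def mat_vec_scaleC_left cip_scaleC_left X_eq[symmetric] S.gram_form by (simp add: disc_eq)
  qed
qed

text \<open>For \<mu> the squared modulus of l, \<open>le\<close> is the Schwarz inequality for a
  disk with tangent \<open>l *\<^sub>C X0 z\<close> at \<open>Z0 z\<close>. It makes a difference of
  two forms nonnegative. Its determinant is quadratic in \<mu> and, after \<open>det_X\<close>,
  bounded above by a product of two linear factors belonging to \<alpha> and \<delta>.\<close>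

lemma gram_bound:
  assumes "(mat 1 - Z0 z ** adjoint_mat (Z0 z)) ** A = mat 1"
    and le: "\<And>v. \<mu> * Re (cip (A *v (X0 z *v v)) (X0 z *v v)) \<le> (norm v)\<^sup>2 - (norm (Z0 z *v v))\<^sup>2"
    and \<mu>: "0 \<le> \<mu>"
  shows "\<alpha>\<^sup>2 * \<mu> \<le> (1 - (cmod z)\<^sup>2)\<^sup>2"
proof -
  define t where "t = 1 - (cmod z)\<^sup>2"
  have t: "0 < t" using sz(2) by (simp add: t_def)
  obtain A' B where A': "(mat 1 - Z0 z ** adjoint_mat (Z0 z)) ** A' = mat 1"
    "\<And>v. cip (A' *v (X0 z *v v)) (X0 z *v v) = of_real (form2 S.p1 S.q1 S.r1 (v$1) (v$2) / (1 - (cmod z)\<^sup>2))"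
    using inverse_Z0 by metis
  have "A = A'" using matrix_inv_unique(2)[OF assms(1)] matrix_inv_unique(2)[OF A'(1)] by simp
  then have ge: "\<mu> * (form2 S.p1 S.q1 S.r1 (v$1) (v$2) / t) \<le> form2 S.p S.q S.r (v$1) (v$2)" for v :: "complex^2"
    using le[of v] A'(2)[of v] S.norm_form[of v] unfolding Z_eq t_def by simp
  \<comment> \<open>The coefficients P, Q, R belong to the difference of the two forms, cleared of
    the denominator t.\<close>
  define P where "P = t * S.p - \<mu> * S.p1"
  define Q where "Q = of_real t * S.q - of_real \<mu> * S.q1"
  define R where "R = t * S.r - \<mu> * S.r1"
  have "0 \<le> form2 P Q R x y" for x y
  proof -
    define v :: "complex^2" where "v = (\<chi> i. if i = 1 then x else y)"
    have "v $ 1 = x" "v $ 2 = y" by (simp_all add: v_def)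
    then have "\<mu> * form2 S.p1 S.q1 S.r1 x y \<le> t * form2 S.p S.q S.r x y"
      using ge[of v] t by (simp add: field_simps)
    then show ?thesis unfolding form2_def P_def Q_def R_def by (simp add: algebra_simps)
  qed
  note F = form2_nonneg_det[OF this]
  have pos: "0 \<le> S.p" "0 \<le> S.r"
  proof -
    have "S.p * S.r > 0" using qpr zero_le_power2[of "cmod S.q"] by linarith
    then show "0 \<le> S.p" "0 \<le> S.r" using trace_pos by (auto simp: zero_less_mult_iff)
  qed
  have "0 \<le> S.r * P + S.p * R - 2 * Re (cnj S.q * Q)"
    by (rule form2_trace_nonneg[OF less_imp_le[OF qpr] pos F(3,1,2)])
  also have "\<dots> = 2 * t * (S.p * S.r - (cmod S.q)\<^sup>2) - \<mu> * (S.r * S.p1 + S.p * S.r1 - 2 * Re (cnj S.q * S.q1))"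
    unfolding P_def Q_def R_def cmod_power2 by (simp add: power2_eq_square algebra_simps)
  also have "\<dots> = 2 * t\<^sup>2 - \<mu>" unfolding S.det_eq disc_eq trace_one t_def[symmetric] by (simp add: power2_eq_square)
  finally have tr: "\<mu> \<le> 2 * t\<^sup>2" by simp
  have "0 \<le> P * R - (cmod Q)\<^sup>2" using F(3) by simp
  \<comment> \<open>Determinant of a difference of 2 x 2 matrices; its mixed term is the trace that
    \<open>trace_one\<close> evaluates to 1.\<close>
  also have "\<dots> = t\<^sup>2 * (S.p * S.r - (cmod S.q)\<^sup>2) - t * \<mu> * (S.r * S.p1 + S.p * S.r1 - 2 * Re (cnj S.q * S.q1)) + \<mu>\<^sup>2 * (S.p1 * S.r1 - (cmod S.q1)\<^sup>2)"
    unfolding P_def Q_def R_def cmod_power2 by (simp add: power2_eq_square algebra_simps)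
  also have "\<dots> = t * (t\<^sup>2 - \<mu> + \<mu>\<^sup>2 * (cmod (of_real \<alpha> * of_real \<delta> - (\<beta> * h' z)\<^sup>2))\<^sup>2)"
    unfolding S.det_eq S.det_gram disc_eq trace_one t_def[symmetric] by (simp add: power2_eq_square algebra_simps)
  finally have "0 \<le> t\<^sup>2 - \<mu> + \<mu>\<^sup>2 * (cmod (of_real \<alpha> * of_real \<delta> - (\<beta> * h' z)\<^sup>2))\<^sup>2"
    using t by (simp add: zero_le_mult_iff)
  also have "\<dots> \<le> t\<^sup>2 - \<mu> + \<mu>\<^sup>2 * (\<alpha> * \<delta> / t)\<^sup>2"
    using det_X by (intro add_left_mono mult_left_mono power_mono) (auto simp: t_def)
  also have "\<dots> = (t\<^sup>2 - \<alpha>\<^sup>2 * \<mu>) * (t\<^sup>2 - \<delta>\<^sup>2 * \<mu>) / t\<^sup>2"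
  proof -
    have "(t\<^sup>2 - \<alpha>\<^sup>2 * \<mu>) * (t\<^sup>2 - \<delta>\<^sup>2 * \<mu>) = t\<^sup>2 * t\<^sup>2 - (\<alpha>\<^sup>2 + \<delta>\<^sup>2) * \<mu> * t\<^sup>2 + \<mu>\<^sup>2 * (\<alpha> * \<delta>)\<^sup>2"
      by (simp add: power2_eq_square algebra_simps)
    then show ?thesis unfolding unit using t by (simp add: power_divide field_simps power2_eq_square)
  qed
  finally have "0 \<le> (t\<^sup>2 - \<alpha>\<^sup>2 * \<mu>) * (t\<^sup>2 - \<delta>\<^sup>2 * \<mu>)" using t by (simp add: zero_le_divide_iff)
  \<comment> \<open>The trace inequality \<open>tr\<close> selects the branch: as
    \<open>\<delta>\<^sup>2\<close> is below 1/2, the second factor is positive, so the first is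
    nonnegative.\<close>
  moreover have "0 < t\<^sup>2 - \<delta>\<^sup>2 * \<mu>"
  proof (cases "\<mu> = 0")
    case False
    then have "\<delta>\<^sup>2 * \<mu> < 1/2 * \<mu>" using \<mu> alpha(3) by (intro mult_strict_right_mono) auto
    then show ?thesis using tr by simp
  qed (use t in simp)
  ultimately show ?thesis unfolding t_def[symmetric] by (simp add: zero_le_mult_iff)
qed

end

lemma Z0_affine: "Z0 z = z *\<^sub>C mat2 (of_real \<alpha>) 0 0 (of_real \<delta>) + h z *\<^sub>C mat2 0 \<beta> \<beta> 0"
  by (simp add: Z0_def mat2_eq_iff scaleC_complex_def mult.commute)

lemma X0_affine: "X0 z = mat2 (of_real \<alpha>) 0 0 (of_real \<delta>) + h' z *\<^sub>C mat2 0 \<beta> \<beta> 0"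
  by (simp add: X0_def mat2_eq_iff scaleC_complex_def mult.commute)

end

section \<open>The Schwarz lemma for disks in the matrix ball\<close>

text \<open>Pairing \<open>k \<zeta> *v v\<close> with its own derivative at 0, suitably scaled,
  gives a holomorphic self-map of the unit disk fixing 0; the classical lemma bounds its
  derivative.\<close>

lemma schwarz_at_origin:
  fixes k :: "complex \<Rightarrow> complex^'q^'p"
  assumes k: "holomorphic_map_on k \<Delta>" "k ` \<Delta> \<subseteq> D_I" "k 0 = 0"
  shows "norm (cderiv k 0 *v v) \<le> norm v"
proof (cases "cderiv k 0 *v v = 0")
  case False
  define u where "u = cderiv k 0 *v v"
  have v: "v \<noteq> 0" using False by auto
  have u: "u \<noteq> 0" using False by (simp add: u_def)
  define c where "c = complex_of_real (1 / (norm v * norm u))"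
  define \<phi> where "\<phi> \<zeta> = c * cip (k \<zeta> *v v) u" for \<zeta>
  have lin: "bounded_linear (\<lambda>M :: complex^'q^'p. c * cip (M *v v) u)"
    by (simp add: linear_linear linear_iff matrix_vector_mult_add_rdistrib cip_add_left algebra_simps
        scaleR_eq_scaleC mat_vec_scaleC_left cip_scaleC_left) (simp add: scaleC_complex_def)
  have d: "(\<phi> has_field_derivative c * cip (cderiv k \<zeta> *v v) u) (at \<zeta>)" if "\<zeta> \<in> \<Delta>" for \<zeta>
    using bounded_linear.has_derivative[OF lin holomorphic_cderiv[OF k(1) open_ball that]]
    by (simp add: has_field_derivative_def \<phi>_def[abs_def] mat_vec_scaleC_left cip_scaleC_left
        mult.left_commute[of c] mult_commute_abs)
  have "\<phi> holomorphic_on \<Delta>"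
    unfolding holomorphic_on_open[OF open_ball] using d by blast
  moreover have "\<phi> 0 = 0" by (simp add: \<phi>_def k(3))
  moreover have "cmod (\<phi> \<zeta>) < 1" if "cmod \<zeta> < 1" for \<zeta>
  proof -
    have "norm (k \<zeta> *v v) < norm v" using k(2) that v by (auto simp: D_I_iff image_subset_iff)
    then have "cmod (cip (k \<zeta> *v v) u) < norm v * norm u"
      using cmod_cip_le[of "k \<zeta> *v v" u] u by (meson mult_strict_right_mono order_le_less_trans zero_less_norm_iff)
    then show ?thesis using u v by (simp add: \<phi>_def c_def norm_mult norm_divide)
  qed
  ultimately have "cmod (deriv \<phi> 0) \<le> 1" using Schwarz_Lemma(2)[of \<phi> 0] by simp
  moreover have "deriv \<phi> 0 = c * cip u u" using DERIV_imp_deriv[OF d[of 0]] by (simp add: u_def)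
  ultimately have "norm u \<le> norm v"
    using u v by (simp add: c_def cip_self norm_mult norm_divide power2_eq_square field_simps)
  then show ?thesis by (simp add: u_def)
qed simp

text \<open>A Moebius transformation moves \<open>k 0\<close> to the origin, where
  \<open>schwarz_at_origin\<close> applies. Undoing its derivative turns the contraction property
  into an inequality between forms in k 0 and its tangent.\<close>

lemma schwarz_gram:
  fixes k :: "complex \<Rightarrow> complex^'q^'p"
  assumes k: "holomorphic_map_on k \<Delta>" "k ` \<Delta> \<subseteq> D_I"
    and A: "(mat 1 - k 0 ** adjoint_mat (k 0)) ** A = mat 1"
  shows "Re (cip (A *v (cderiv k 0 *v w)) (cderiv k 0 *v w)) \<le> (norm w)\<^sup>2 - (norm (k 0 *v w))\<^sup>2"
proof -
  define Z where "Z = k 0"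
  define X where "X = cderiv k 0"
  have Z: "Z \<in> D_I" using k(2) by (auto simp: Z_def)
  obtain P :: "complex^'p^'p" and S :: "complex^'q^'q" where
    P: "P ** (mat 1 - Z ** adjoint_mat Z) ** adjoint_mat P = mat 1" and
    S: "S ** (mat 1 - adjoint_mat Z ** Z) ** adjoint_mat S = mat 1" using ex_moebius[OF Z] by blast
  note pu = pseudo_unitary_moebius[OF P S]
  define T where "T = frac P (- (P ** Z)) (- (S ** adjoint_mat Z)) S"
  have T0: "T Z = 0" by (simp add: T_def)
  have hol: "holomorphic_map_on (\<lambda>\<zeta>. T (k \<zeta>)) \<Delta>"
    unfolding T_def by (rule holomorphic_map_on_compose[OF k holomorphic_frac[OF pu]])
  have im: "(\<lambda>\<zeta>. T (k \<zeta>)) ` \<Delta> \<subseteq> D_I" using k(2) frac_in_D_I[OF pu] by (auto simp: T_def image_subset_iff)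
  have d0: "(k has_derivative (\<lambda>h. h *\<^sub>C X)) (at 0)"
    unfolding X_def by (rule holomorphic_cderiv[OF k(1) open_ball]) simp
  have "(T has_derivative (\<lambda>X. P ** X ** adjoint_mat S)) (at (k 0))"
    using has_derivative_frac[OF pu Z] unfolding T_def[symmetric] T0 pseudo_unitary_zero(5)[OF pu Z T0[unfolded T_def]]
    by (simp add: Z_def)
  from diff_chain_at[OF d0 this]
  have "cderiv (\<lambda>\<zeta>. T (k \<zeta>)) 0 = P ** X ** adjoint_mat S"
    by (intro cderiv_eqI) (simp add: o_def mat_mult_scaleC_left mat_mult_scaleC_right)
  then have b: "norm ((P ** X ** adjoint_mat S) *v v) \<le> norm v" for v
    using schwarz_at_origin[OF hol im, of v] T0 by (simp add: Z_def)
  \<comment> \<open>Chosen such that the adjoint of S takes v to w; its squared norm is then the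
    value of the form of \<open>1 - Z\<^sup>* Z\<close> at w.\<close>
  define v where "v = S *v ((mat 1 - adjoint_mat Z ** Z) *v w)"
  have Sv: "adjoint_mat S *v v = w"
    unfolding v_def matrix_vector_mul_assoc by (simp add: matrix_mul_assoc adjoint_gram_inverse(1)[OF S])
  have "norm (P *v (X *v w)) \<le> norm v"
    using b[of v] by (simp add: matrix_vector_mul_assoc[symmetric] Sv)
  then have "(norm (P *v (X *v w)))\<^sup>2 \<le> (norm v)\<^sup>2" by (intro power_mono) auto
  moreover have "(norm v)\<^sup>2 = (norm w)\<^sup>2 - (norm (Z *v w))\<^sup>2"
  proof -
    have "complex_of_real ((norm v)\<^sup>2) = cip v (S *v ((mat 1 - adjoint_mat Z ** Z) *v w))"
      unfolding cip_self[symmetric] by (simp add: v_def)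
    also have "\<dots> = cip (adjoint_mat S *v v) ((mat 1 - adjoint_mat Z ** Z) *v w)"
      using cip_mat_left[of "adjoint_mat S" v] by simp
    also have "\<dots> = of_real ((norm w)\<^sup>2 - (norm (Z *v w))\<^sup>2)"
      unfolding Sv using cip_gram[of Z w] cip_commute[of w "(adjoint_mat Z ** Z) *v w"]
      by (simp add: matrix_vector_mult_diff_rdistrib cip_diff_right cip_self)
    finally show ?thesis by (metis of_real_eq_iff)
  qed
  moreover have "A = adjoint_mat P ** P"
    using matrix_inv_unique(2)[OF A[folded Z_def]] matrix_inv_unique(2)[OF adjoint_gram_inverse(2)[OF P]] by simp
  moreover have "cip ((adjoint_mat P ** P) *v (X *v w)) (X *v w) = of_real ((norm (P *v (X *v w)))\<^sup>2)"
    by (rule cip_gram)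
  ultimately show ?thesis by (simp add: X_def Z_def)
qed

context isometry_family
begin

lemma Z0_deriv:
  fixes \<iota> :: "complex^2^2 \<Rightarrow> complex^'q^'p"
  assumes add: "\<And>X Y. \<iota> (X + Y) = \<iota> X + \<iota> Y" and sc: "\<And>a X. \<iota> (a *\<^sub>C X) = a *\<^sub>C \<iota> X" and z: "z \<in> \<Delta>"
  shows "((\<lambda>z. \<iota> (Z0 z)) has_derivative (\<lambda>k. k *\<^sub>C \<iota> (X0 z))) (at z)"
proof -
  define A where "A = \<iota> (mat2 (of_real \<alpha>) 0 0 (of_real \<delta>))"
  define B where "B = \<iota> (mat2 0 \<beta> \<beta> 0)"
  have "(h has_derivative (\<lambda>k. k * h' z)) (at z)"
    using h_deriv[OF z] by (simp add: has_field_derivative_def mult_commute_abs)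
  from bounded_linear.has_derivative[OF bounded_linear_scaleC_left this, of B]
  have "((\<lambda>z. z *\<^sub>C A + h z *\<^sub>C B) has_derivative (\<lambda>k. k *\<^sub>C A + (k * h' z) *\<^sub>C B)) (at z)"
    by (intro has_derivative_add bounded_linear_imp_has_derivative[OF bounded_linear_scaleC_left])
  then show ?thesis
    by (simp add: Z0_affine X0_affine add sc A_def B_def scaleC_add_right scaleC_scaleC)
qed

end

section \<open>Automorphisms and congruence\<close>

lemma Aut_inverse:
  assumes "\<Psi> \<in> Aut S"
  obtains \<Theta> where "\<Theta> \<in> Aut S" "\<forall>x\<in>S. \<Theta> (\<Psi> x) = x" "\<forall>x\<in>S. \<Psi> (\<Theta> x) = x"
proof -
  have "biholomorphism \<Psi> S S" using assms by (simp add: Aut_def)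
  from biholomorphism_inverse[OF this] obtain \<Theta> where
    "biholomorphism \<Theta> S S" "\<forall>x\<in>S. \<Theta> (\<Psi> x) = x" "\<forall>x\<in>S. \<Psi> (\<Theta> x) = x" .
  then show ?thesis using that[of \<Theta>] by (simp add: Aut_def)
qed

lemma Aut_maps: "\<Psi> \<in> Aut S \<Longrightarrow> x \<in> S \<Longrightarrow> \<Psi> x \<in> S"
  by (auto simp: Aut_def biholomorphism_def bij_betw_def)

lemma congruent_mapsE:
  assumes "congruent_maps \<Omega> F\<^sub>1 F\<^sub>2"
  obtains \<phi> \<Psi> where "\<phi> \<in> Aut \<Delta>" "\<Psi> \<in> Aut \<Omega>" "\<forall>z\<in>\<Delta>. F\<^sub>1 z = \<Psi> (F\<^sub>2 (\<phi> z))"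
proof -
  from assms[unfolded congruent_maps_def] obtain \<phi> where \<phi>: "\<phi> \<in> Aut \<Delta>"
    and e: "\<exists>\<Psi>\<in>Aut \<Omega>. \<forall>z\<in>\<Delta>. F\<^sub>1 z = \<Psi> (F\<^sub>2 (\<phi> z))" ..
  from e obtain \<Psi> where "\<Psi> \<in> Aut \<Omega>" "\<forall>z\<in>\<Delta>. F\<^sub>1 z = \<Psi> (F\<^sub>2 (\<phi> z))" ..
  with \<phi> show ?thesis by (rule that)
qed

lemma congruent_maps_sym:
  assumes "congruent_maps \<Omega> F\<^sub>1 F\<^sub>2" "F\<^sub>2 ` \<Delta> \<subseteq> \<Omega>"
  shows "congruent_maps \<Omega> F\<^sub>2 F\<^sub>1"
proof -
  obtain \<phi> \<Psi> where 1: "\<phi> \<in> Aut \<Delta>" "\<Psi> \<in> Aut \<Omega>" "\<forall>z\<in>\<Delta>. F\<^sub>1 z = \<Psi> (F\<^sub>2 (\<phi> z))"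
    by (rule congruent_mapsE[OF assms(1)])
  obtain \<phi>' where \<phi>': "\<phi>' \<in> Aut \<Delta>" "\<forall>x\<in>\<Delta>. \<phi>' (\<phi> x) = x" "\<forall>x\<in>\<Delta>. \<phi> (\<phi>' x) = x" by (rule Aut_inverse[OF 1(1)])
  obtain \<Theta> where \<Theta>: "\<Theta> \<in> Aut \<Omega>" "\<forall>x\<in>\<Omega>. \<Theta> (\<Psi> x) = x" "\<forall>x\<in>\<Omega>. \<Psi> (\<Theta> x) = x"
    by (rule Aut_inverse[OF 1(2)])
  have "F\<^sub>2 z = \<Theta> (F\<^sub>1 (\<phi>' z))" if "z \<in> \<Delta>" for z
  proof -
    have "F\<^sub>1 (\<phi>' z) = \<Psi> (F\<^sub>2 z)" using 1(3) \<phi>'(3) Aut_maps[OF \<phi>'(1) that] that by simp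
    moreover have "F\<^sub>2 z \<in> \<Omega>" using assms(2) that by (rule subsetD[OF _ imageI])
    ultimately show ?thesis using \<Theta>(2) by simp
  qed
  then show ?thesis unfolding congruent_maps_def using \<phi>'(1) \<Theta>(1) by (intro bexI[of _ \<phi>'] bexI[of _ \<Theta>] ballI)
qed

section \<open>Isometries into domains of rank at least two\<close>

text \<open>An embedding \<iota> of the 2 x 2 matrices that respects triple products, as these
  govern the metric. The vectors \<eta> v are those on which large matrices act like small ones:
  testing the Schwarz inequality on them alone suffices.\<close>

locale rank2_domain = canonical_domain W \<kappa> \<Omega> g
  for W :: "(complex^'q^'p) set" and \<kappa> and \<Omega> :: "(complex^'n) set" and g +
  fixes \<iota> :: "complex^2^2 \<Rightarrow> complex^'q^'p" and \<eta> :: "complex^2 \<Rightarrow> complex^'q"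
  assumes \<iota>_add: "\<iota> (X + Y) = \<iota> X + \<iota> Y"
    and \<iota>_scaleC: "\<iota> (a *\<^sub>C X) = a *\<^sub>C \<iota> X"
    and \<iota>_W: "transpose Y = Y \<Longrightarrow> \<iota> Y \<in> W"
    and \<iota>_triple: "\<iota> (X ** adjoint_mat Y ** Z) = \<iota> X ** adjoint_mat (\<iota> Y) ** \<iota> Z"
    and \<iota>_mip: "of_real \<kappa> * mip (\<iota> X) (\<iota> Y) = mip X Y"
    and \<iota>_D_I: "Z \<in> D_I \<Longrightarrow> \<iota> Z \<in> D_I"
    and \<eta>_norm: "norm (\<eta> v) = norm v"
    and \<iota>_\<eta>: "cip (\<iota> X *v \<eta> v) (\<iota> Y *v \<eta> v) = cip (X *v v) (Y *v v)"
begin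

lemma \<iota>_diff: "\<iota> (X - Y) = \<iota> X - \<iota> Y"
  using \<iota>_add[of "X - Y" Y] by (simp add: eq_diff_eq)

text \<open>The matrix \<open>1 - \<iota> Z (\<iota> Z)\<^sup>*\<close> is not in the image of
  \<iota>, but its action on that image is a triple product. Its inverse therefore acts there as A
  does.\<close>

lemma \<iota>_left_inverse:
  assumes A: "(mat 1 - Z ** adjoint_mat Z) ** A = mat 1"
    and P: "P ** (mat 1 - \<iota> Z ** adjoint_mat (\<iota> Z)) = mat 1"
  shows "P ** \<iota> Y = \<iota> (A ** Y)"
proof -
  have "(mat 1 - \<iota> Z ** adjoint_mat (\<iota> Z)) ** \<iota> (A ** Y) = \<iota> ((mat 1 - Z ** adjoint_mat Z) ** A ** Y)"
    by (simp add: mat_mult_diff_left \<iota>_diff \<iota>_triple[symmetric] matrix_mul_assoc)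
  also have "\<dots> = \<iota> Y" by (simp add: A)
  finally have "P ** ((mat 1 - \<iota> Z ** adjoint_mat (\<iota> Z)) ** \<iota> (A ** Y)) = P ** \<iota> Y" by simp
  then show ?thesis by (simp add: matrix_mul_assoc P)
qed

lemma \<iota>_right_inverse:
  assumes B: "B ** (mat 1 - adjoint_mat Z ** Z) = mat 1"
    and S: "(mat 1 - adjoint_mat (\<iota> Z) ** \<iota> Z) ** S = mat 1"
  shows "\<iota> Y ** S = \<iota> (Y ** B)"
proof -
  have "\<iota> (Y ** B) ** (mat 1 - adjoint_mat (\<iota> Z) ** \<iota> Z) = \<iota> (Y ** (B ** (mat 1 - adjoint_mat Z ** Z)))"
    by (simp add: mat_mult_diff_right \<iota>_diff \<iota>_triple[symmetric] matrix_mul_assoc)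
  also have "\<dots> = \<iota> Y" by (simp add: B)
  finally have "(\<iota> (Y ** B) ** (mat 1 - adjoint_mat (\<iota> Z) ** \<iota> Z)) ** S = \<iota> Y ** S" by simp
  then show ?thesis by (simp add: matrix_mul_assoc[symmetric] S)
qed

text \<open>The chart is chosen independently of \<alpha>, so that isometries with different
  parameters are compared in the same coordinates.\<close>

definition isometry_map :: "real \<Rightarrow> complex \<Rightarrow> complex^'n" where
  "isometry_map \<alpha> z = inv_into \<Omega> (SOME \<Phi>. chart 1 \<Phi>) (\<iota> (isometry_family.Z0 \<alpha> (sqrt (1 - \<alpha>\<^sup>2)) z))"

lemma isometry_familyI: "sqrt (1/2) < \<alpha> \<Longrightarrow> \<alpha> < 1 \<Longrightarrow> isometry_family \<alpha> (sqrt (1 - \<alpha>\<^sup>2))"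
proof
  assume a: "sqrt (1/2) < \<alpha>" "\<alpha> < 1"
  have 0: "0 < \<alpha>" using a(1) real_sqrt_ge_zero[of "1/2"] by linarith
  have 1: "\<alpha>\<^sup>2 < 1" using a 0 by (simp add: abs_square_less_1)
  have "(sqrt (1/2))\<^sup>2 < \<alpha>\<^sup>2" using a(1) by (intro power_strict_mono) auto
  then have 2: "1/2 < \<alpha>\<^sup>2" by simp
  show "\<alpha>\<^sup>2 + (sqrt (1 - \<alpha>\<^sup>2))\<^sup>2 = 1" "0 < sqrt (1 - \<alpha>\<^sup>2)" using 1 by simp_all
  show "sqrt (1 - \<alpha>\<^sup>2) < \<alpha>" by (rule real_less_lsqrt) (use 0 2 in auto)
qed

lemma chart_one: "chart 1 (SOME \<Phi>. chart 1 \<Phi>)"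
proof -
  obtain c \<Phi> where "c > 0" "chart c \<Phi>" by (rule ex_chart)
  then have "\<exists>\<Phi>. chart 1 \<Phi>" using chart_constant[of c \<Phi>] by auto
  then show ?thesis by (rule someI_ex)
qed

lemma isometry_map_properties:
  assumes \<alpha>: "sqrt (1/2) < \<alpha>" "\<alpha> < 1"
  defines "\<Phi> \<equiv> SOME \<Phi>. chart 1 \<Phi>" and "\<delta> \<equiv> sqrt (1 - \<alpha>\<^sup>2)"
  shows "holomorphic_map_on (isometry_map \<alpha>) \<Delta>" "isometry_map \<alpha> ` \<Delta> \<subseteq> \<Omega>"
    and "\<And>z. z \<in> \<Delta> \<Longrightarrow> \<Phi> (isometry_map \<alpha> z) = \<iota> (isometry_family.Z0 \<alpha> \<delta> z)"
    and "\<And>z. z \<in> \<Delta> \<Longrightarrow> fder \<Phi> (isometry_map \<alpha> z) (cderiv (isometry_map \<alpha>) z) = \<iota> (isometry_family.X0 \<alpha> \<delta> z)"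
proof -
  interpret I: isometry_family \<alpha> \<delta> unfolding \<delta>_def by (rule isometry_familyI[OF \<alpha>])
  have c: "chart 1 \<Phi>" unfolding \<Phi>_def by (rule chart_one)
  then have bi: "biholomorphism \<Phi> \<Omega> \<D>" by (simp add: chart_def)
  define h where "h = inv_into \<Omega> \<Phi>"
  have bij: "bij_betw \<Phi> \<Omega> \<D>" and h: "holomorphic_map_on h \<D>" using bi by (simp_all add: biholomorphism_def h_def)
  have hinv: "\<Phi> (h y) = y" "h y \<in> \<Omega>" if "y \<in> \<D>" for y
    using bij_betw_inv_into_right[OF bij that] bij_betw_inv_into[OF bij] that
    by (auto simp: h_def bij_betw_def)
  have def_eq: "isometry_map \<alpha> = (\<lambda>z. h (\<iota> (I.Z0 z)))"
    by (simp add: fun_eq_iff isometry_map_def h_def \<Phi>_def \<delta>_def)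
  have inD: "\<iota> (I.Z0 z) \<in> \<D>" if "z \<in> \<Delta>" for z
  proof -
    have "transpose (I.Z0 z) = I.Z0 z" by (simp add: I.Z0_def mat2_eq_iff transpose_def)
    then show ?thesis using \<iota>_W \<iota>_D_I[OF I.Z0_in_D_I[OF that]] by simp
  qed
  note d = I.Z0_deriv[OF \<iota>_add \<iota>_scaleC]
  have hol: "holomorphic_map_on (\<lambda>z. \<iota> (I.Z0 z)) \<Delta>"
    unfolding holomorphic_map_on_def
  proof
    fix z :: complex assume "z \<in> \<Delta>"
    from has_derivative_at_withinI[OF d[OF this]]
    show "\<exists>D. ((\<lambda>z. \<iota> (I.Z0 z)) has_derivative D) (at z within \<Delta>) \<and> (\<forall>v. D (\<i> *\<^sub>C v) = \<i> *\<^sub>C D v)"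
      by (intro exI conjI) (auto simp: scaleC_scaleC scaleC_complex_def)
  qed
  show F1: "holomorphic_map_on (isometry_map \<alpha>) \<Delta>"
    unfolding def_eq by (rule holomorphic_map_on_compose[OF hol _ h]) (use inD in auto)
  show F2: "isometry_map \<alpha> ` \<Delta> \<subseteq> \<Omega>" unfolding def_eq using hinv(2) inD by auto
  show F3: "\<Phi> (isometry_map \<alpha> z) = \<iota> (I.Z0 z)" if "z \<in> \<Delta>" for z unfolding def_eq using hinv(1) inD[OF that] by simp
  show "fder \<Phi> (isometry_map \<alpha> z) (cderiv (isometry_map \<alpha>) z) = \<iota> (I.X0 z)" if z: "z \<in> \<Delta>" for z
    unfolding pullback_chart(1)[OF c F1 open_ball F2 z, symmetric]
    by (intro cderiv_eqI has_derivative_transform_within_open[OF d[OF z] open_ball z]) (simp add: F3)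
qed

text \<open>The Gram matrices at the embedded point act on the embedded tangent as the 2 x 2
  inverses do, so \<open>inverse_Z0\<close> yields the length.\<close>

lemma isometry_map_isometry:
  assumes \<alpha>: "sqrt (1/2) < \<alpha>" "\<alpha> < 1"
  shows "holomorphic_isometry \<Omega> g (isometry_map \<alpha>)"
  unfolding holomorphic_isometry_def
proof (intro conjI ballI)
  define \<Phi> where "\<Phi> = (SOME \<Phi>. chart 1 \<Phi>)"
  define \<delta> where "\<delta> = sqrt (1 - \<alpha>\<^sup>2)"
  interpret I: isometry_family \<alpha> \<delta> unfolding \<delta>_def by (rule isometry_familyI[OF \<alpha>])
  note F = isometry_map_properties[OF \<alpha>, folded \<Phi>_def \<delta>_def]
  show "holomorphic_map_on (isometry_map \<alpha>) \<Delta>" "isometry_map \<alpha> ` \<Delta> \<subseteq> \<Omega>" by (rule F(1), rule F(2))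
  fix z assume z: "z \<in> \<Delta>"
  then have x: "isometry_map \<alpha> z \<in> \<Omega>" using F(2) by auto
  obtain P :: "complex^'p^'p" and S :: "complex^'q^'q" where PS:
    "P ** (mat 1 - \<iota> (I.Z0 z) ** adjoint_mat (\<iota> (I.Z0 z))) ** adjoint_mat P = mat 1"
    "S ** (mat 1 - adjoint_mat (\<iota> (I.Z0 z)) ** \<iota> (I.Z0 z)) ** adjoint_mat S = mat 1"
    "\<And>u v. herm (g (isometry_map \<alpha> z)) u v = of_real (1 * \<kappa>) *
       mip (P ** fder \<Phi> (isometry_map \<alpha> z) u ** adjoint_mat S) (P ** fder \<Phi> (isometry_map \<alpha> z) v ** adjoint_mat S)"
    using metric_formula[OF chart_one[folded \<Phi>_def] x] unfolding F(3)[OF z] by metis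
  obtain A B where AB: "(mat 1 - I.Z0 z ** adjoint_mat (I.Z0 z)) ** A = mat 1" "B ** (mat 1 - adjoint_mat (I.Z0 z) ** I.Z0 z) = mat 1"
    "mip (A ** I.X0 z ** B) (I.X0 z) = of_real (1 / (1 - (cmod z)\<^sup>2)\<^sup>2)"
    using I.inverse_Z0[OF z] by metis
  have "(adjoint_mat P ** P) ** \<iota> (I.X0 z) ** (adjoint_mat S ** S) = \<iota> (A ** I.X0 z ** B)"
    unfolding \<iota>_left_inverse[OF AB(1) adjoint_gram_inverse(1)[OF PS(1)]]
      \<iota>_right_inverse[OF AB(2) adjoint_gram_inverse(2)[OF PS(2)]] ..
  then have "pullback (isometry_map \<alpha>) g z = Re (of_real \<kappa> * mip (\<iota> (A ** I.X0 z ** B)) (\<iota> (I.X0 z)))"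
    unfolding pullback_def PS(3) F(4)[OF z] mip_sandwich by simp
  also have "\<dots> = 1 / (1 - (cmod z)\<^sup>2)\<^sup>2" unfolding \<iota>_mip AB(3) by simp
  also have "\<dots> = disk_metric z" by (rule disk_metric_eq[OF z, symmetric])
  finally show "pullback (isometry_map \<alpha>) g z = disk_metric z" .
qed

text \<open>At the origin, the isometry with parameter \<open>\<alpha>\<^sub>1\<close> is tangent to a disk of \<open>\<Omega>\<close> whose derivative is
  \<open>1/\<alpha>\<^sub>1\<close> times that of the isometry; by the Schwarz lemma no point of the isometry with
  parameter \<open>\<alpha>\<^sub>2\<close> admits a tangent disk that is larger than \<open>1/\<alpha>\<^sub>2\<close> times the isometry.\<close>

lemma congruent_parameters_le:
  assumes 1: "sqrt (1/2) < \<alpha>\<^sub>1" "\<alpha>\<^sub>1 < 1" and 2: "sqrt (1/2) < \<alpha>\<^sub>2" "\<alpha>\<^sub>2 < 1"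
    and cong: "congruent_maps \<Omega> (isometry_map \<alpha>\<^sub>1) (isometry_map \<alpha>\<^sub>2)"
  shows "\<alpha>\<^sub>2 \<le> \<alpha>\<^sub>1"
proof -
  define \<Phi> where "\<Phi> = (SOME \<Phi>. chart 1 \<Phi>)"
  define \<delta>\<^sub>1 where "\<delta>\<^sub>1 = sqrt (1 - \<alpha>\<^sub>1\<^sup>2)"
  define \<delta>\<^sub>2 where "\<delta>\<^sub>2 = sqrt (1 - \<alpha>\<^sub>2\<^sup>2)"
  interpret I: isometry_family \<alpha>\<^sub>1 \<delta>\<^sub>1 unfolding \<delta>\<^sub>1_def by (rule isometry_familyI[OF 1])
  interpret J: isometry_family \<alpha>\<^sub>2 \<delta>\<^sub>2 unfolding \<delta>\<^sub>2_def by (rule isometry_familyI[OF 2])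
  define F where "F = isometry_map \<alpha>\<^sub>1"
  define G where "G = isometry_map \<alpha>\<^sub>2"
  note F = isometry_map_properties[OF 1, folded \<Phi>_def \<delta>\<^sub>1_def F_def]
  note G = isometry_map_properties[OF 2, folded \<Phi>_def \<delta>\<^sub>2_def G_def]
  have c: "chart 1 \<Phi>" unfolding \<Phi>_def by (rule chart_one)
  then have bi: "biholomorphism \<Phi> \<Omega> \<D>" by (simp add: chart_def)
  note L = biholo_facts[OF bi]
  obtain \<phi> \<Psi> where cg: "\<phi> \<in> Aut \<Delta>" "\<Psi> \<in> Aut \<Omega>" "\<forall>z\<in>\<Delta>. F z = \<Psi> (G (\<phi> z))"
    by (rule congruent_mapsE[OF cong[folded F_def G_def]])
  obtain \<Theta> where \<Theta>: "\<Theta> \<in> Aut \<Omega>" "\<forall>x\<in>\<Omega>. \<Theta> (\<Psi> x) = x" "\<forall>x\<in>\<Omega>. \<Psi> (\<Theta> x) = x"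
    by (rule Aut_inverse[OF cg(2)])
  define w where "w = \<phi> 0"
  have w: "w \<in> \<Delta>" using Aut_maps[OF cg(1), of 0] by (simp add: w_def)
  have \<phi>hol: "holomorphic_map_on \<phi> \<Delta>" using cg(1) by (simp add: Aut_def biholomorphism_def)
  have d\<phi>: "(\<phi> has_derivative (\<lambda>k. k *\<^sub>C cderiv \<phi> 0)) (at 0)"
    by (rule holomorphic_cderiv[OF \<phi>hol open_ball]) simp
  have Gw: "G w \<in> \<Omega>" using G(2) w by auto
  have dG: "(G has_derivative (\<lambda>k. k *\<^sub>C cderiv G w)) (at (\<phi> 0))"
    unfolding w_def[symmetric] by (rule holomorphic_cderiv[OF G(1) open_ball w])
  \<comment> \<open>Both maps pull g back to the metric of the disk and \<Psi> preserves g, so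
    \<phi> is infinitesimally isometric at 0.\<close>
  have d\<phi>': "cmod (cderiv \<phi> 0) = 1 - (cmod w)\<^sup>2"
  proof -
    have \<Psi>hol: "holomorphic_map_on \<Psi> \<Omega>" using cg(2) by (simp add: Aut_def biholomorphism_def)
    note d\<Psi> = holomorphic_map_on_fder[OF \<Psi>hol open_\<Omega> Gw]
    have "((\<lambda>z. G (\<phi> z)) has_derivative (\<lambda>k. (k *\<^sub>C cderiv \<phi> 0) *\<^sub>C cderiv G w)) (at 0)"
      using diff_chain_at[OF d\<phi> dG] by (simp add: o_def)
    then have "((\<lambda>z. \<Psi> (G (\<phi> z))) has_derivative (\<lambda>k. fder \<Psi> (G w) ((k *\<^sub>C cderiv \<phi> 0) *\<^sub>C cderiv G w))) (at 0)"
      using diff_chain_at[of _ _ 0 \<Psi> "fder \<Psi> (G w)"] d\<Psi>(1) by (simp add: o_def w_def)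
    then have "((\<lambda>z. \<Psi> (G (\<phi> z))) has_derivative (\<lambda>k. k *\<^sub>C (cderiv \<phi> 0 *\<^sub>C fder \<Psi> (G w) (cderiv G w)))) (at 0)"
      by (simp add: d\<Psi>(2) scaleC_scaleC scaleC_complex_def)
    then have "(F has_derivative (\<lambda>k. k *\<^sub>C (cderiv \<phi> 0 *\<^sub>C fder \<Psi> (G w) (cderiv G w)))) (at 0)"
      by (rule has_derivative_transform_within_open[OF _ open_ball[of "0::complex" 1]]) (use cg(3) in auto)
    then have cF: "cderiv F 0 = cderiv \<phi> 0 *\<^sub>C fder \<Psi> (G w) (cderiv G w)" by (rule cderiv_eqI)
    have F0: "F 0 = \<Psi> (G w)" using cg(3) by (simp add: w_def)
    have "pullback F g 0 = Re (cderiv \<phi> 0 * cnj (cderiv \<phi> 0) * herm (g (G w)) (cderiv G w) (cderiv G w))"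
      unfolding pullback_def cF F0 herm_scaleC_left herm_scaleC_right g_invariant[OF cg(2) Gw] by (simp only: mult_ac)
    also have "\<dots> = (cmod (cderiv \<phi> 0))\<^sup>2 * pullback G g w"
      unfolding pullback_def complex_norm_square[symmetric] by (simp del: of_real_power)
    finally have "disk_metric 0 = (cmod (cderiv \<phi> 0))\<^sup>2 * disk_metric w"
      using isometry_map_isometry[OF 1] isometry_map_isometry[OF 2] w
      by (simp add: holomorphic_isometry_def F_def G_def)
    moreover have "disk_metric 0 = 1" by (simp add: disk_metric_eq)
    ultimately have 1: "1 = (cmod (cderiv \<phi> 0))\<^sup>2 * (1 / (1 - (cmod w)\<^sup>2)\<^sup>2)"
      by (simp only: disk_metric_eq[OF w])
    have pos: "0 < 1 - (cmod w)\<^sup>2" using J.sz(2)[OF w] by simp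
    have "x = y" if "1 = x * (1 / y)" "0 < y" for x y :: real using that by simp
    from this[OF 1] have "(cmod (cderiv \<phi> 0))\<^sup>2 = (1 - (cmod w)\<^sup>2)\<^sup>2" using pos by simp
    then show ?thesis by (rule power2_eq_imp_eq) (use pos in auto)
  qed
  \<comment> \<open>The tangent at the origin rescaled to operator norm 1, so that its multiples by
    points of the unit disk stay in the matrix ball.\<close>
  define N where "N = mat2 1 0 0 (of_real (\<delta>\<^sub>1 / \<alpha>\<^sub>1))"
  have XN: "I.X0 0 = of_real \<alpha>\<^sub>1 *\<^sub>C N"
    using I.alpha by (simp add: I.X0_def I.h'_def N_def mat2_scaleC)
  have N_D: "\<zeta> *\<^sub>C \<iota> N \<in> \<D>" if "\<zeta> \<in> \<Delta>" for \<zeta>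
  proof -
    have ratio: "cmod (of_real (\<delta>\<^sub>1 / \<alpha>\<^sub>1)) \<le> 1" using I.delta I.alpha by (simp add: norm_divide)
    have "norm ((\<zeta> *\<^sub>C N) *v v) < norm v" if v: "v \<noteq> 0" for v
    proof -
      have "cmod (of_real (\<delta>\<^sub>1 / \<alpha>\<^sub>1) * v $ 2) \<le> cmod (v $ 2)"
        unfolding norm_mult using mult_right_mono[OF ratio, of "cmod (v $ 2)"] by simp
      from power_mono[OF this, of 2] have "(norm (N *v v))\<^sup>2 \<le> (norm v)\<^sup>2"
        unfolding norm_vec2 N_def mat2_vec by simp
      then have "norm (N *v v) \<le> norm v" by (rule power2_le_imp_le) simp
      then have "cmod \<zeta> * norm (N *v v) \<le> cmod \<zeta> * norm v" by (rule mult_left_mono) simp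
      also have "\<dots> < norm v" using \<open>\<zeta> \<in> \<Delta>\<close> v by simp
      finally show ?thesis by (simp add: mat_vec_scaleC_left norm_scaleC_vec)
    qed
    then have "\<iota> (\<zeta> *\<^sub>C N) \<in> D_I" by (intro \<iota>_D_I) (simp add: D_I_iff)
    moreover have "transpose (\<zeta> *\<^sub>C N) = \<zeta> *\<^sub>C N" by (simp add: N_def mat2_scaleC mat2_eq_iff transpose_def)
    ultimately show ?thesis using \<iota>_W[of "\<zeta> *\<^sub>C N"] by (simp add: \<iota>_scaleC)
  qed
  obtain h where h: "biholomorphism h \<D> \<Omega>" "\<forall>x\<in>\<Omega>. h (\<Phi> x) = x" "\<forall>y\<in>\<D>. \<Phi> (h y) = y"
    using biholomorphism_inverse[OF bi] by blast
  \<comment> \<open>The inverse of the congruence, read in the chart; it carries the first isometry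
    to the second one after \<phi>.\<close>
  define \<tau> where "\<tau> = (\<lambda>y. \<Phi> (\<Theta> (h y)))"
  have \<tau>: "biholomorphism \<tau> \<D> \<D>"
    using biholomorphism_compose[OF biholomorphism_compose[OF h(1)] bi] \<Theta>(1) by (auto simp: \<tau>_def Aut_def)
  have \<tau>hol: "holomorphic_map_on \<tau> \<D>" and \<tau>im: "\<tau> ` \<D> \<subseteq> \<D>" using \<tau> by (auto simp: biholomorphism_def bij_betw_def)
  define k where "k \<zeta> = \<tau> (\<zeta> *\<^sub>C \<iota> N)" for \<zeta>
  have lin_hol: "holomorphic_map_on (\<lambda>\<zeta>. \<zeta> *\<^sub>C \<iota> N) \<Delta>"
    unfolding holomorphic_map_on_def
    using bounded_linear_imp_has_derivative[OF bounded_linear_scaleC_left[of "\<iota> N"]]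
    by (auto simp: scaleC_scaleC scaleC_complex_def intro!: exI)
  have khol: "holomorphic_map_on k \<Delta>"
    unfolding k_def[abs_def] by (rule holomorphic_map_on_compose[OF lin_hol _ \<tau>hol]) (use N_D in auto)
  have kim: "k ` \<Delta> \<subseteq> D_I" using \<tau>im N_D by (auto simp: k_def)
  have \<tau>F: "\<tau> (\<iota> (I.Z0 z)) = \<iota> (J.Z0 (\<phi> z))" if z: "z \<in> \<Delta>" for z
  proof -
    have Fz: "F z \<in> \<Omega>" using F(2) z by blast
    have \<phi>z: "\<phi> z \<in> \<Delta>" by (rule Aut_maps[OF cg(1) z])
    then have Gz: "G (\<phi> z) \<in> \<Omega>" using G(2) by blast
    have "\<tau> (\<iota> (I.Z0 z)) = \<Phi> (\<Theta> (F z))" unfolding \<tau>_def F(3)[OF z, symmetric] using h(2) Fz by simp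
    also have "\<Theta> (F z) = G (\<phi> z)" using cg(3) z \<Theta>(2) Gz by simp
    finally show ?thesis by (simp add: G(3)[OF \<phi>z])
  qed
  have Z00: "\<iota> (I.Z0 0) = 0 *\<^sub>C \<iota> N"
  proof -
    have "I.Z0 0 = 0 *\<^sub>C N" by (simp add: I.Z0_def I.h_def I.root_def mat2_eq_iff)
    then show ?thesis by (simp only: \<iota>_scaleC)
  qed
  have k0: "k 0 = \<iota> (J.Z0 w)" using \<tau>F[of 0] unfolding k_def Z00 w_def by simp
  have "0 \<in> \<D>" using W_zero by simp
  from bspec[OF \<tau>hol[unfolded holomorphic_map_on_def] this] obtain E
    where E: "(\<tau> has_derivative E) (at 0 within \<D>)" and Ei: "\<forall>v. E (\<i> *\<^sub>C v) = \<i> *\<^sub>C E v"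
    by (elim exE conjE)
  have Elin: "E (a *\<^sub>C v) = a *\<^sub>C E v" for a v
    by (rule complex_linear_iff_imaginary[OF has_derivative_linear[OF E]]) (use Ei in blast)
  \<comment> \<open>The derivative of \<tau> is available only within its domain, so the chain rule
    is applied along the image of the disk.\<close>
  have chain: "((\<lambda>z. \<tau> (f z)) has_derivative (\<lambda>x. x *\<^sub>C E d)) (at 0)"
    if "(f has_derivative (\<lambda>x. x *\<^sub>C d)) (at 0)" "f ` \<Delta> \<subseteq> \<D>" "f 0 = 0" for f :: "complex \<Rightarrow> complex^'q^'p" and d
  proof -
    have "(\<tau> has_derivative E) (at (f 0) within f ` \<Delta>)"
      using has_derivative_subset[OF E that(2)] that(3) by simp
    from diff_chain_within[OF has_derivative_at_withinI[OF that(1)] this]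
    have "((\<lambda>z. \<tau> (f z)) has_derivative (\<lambda>x. x *\<^sub>C E d)) (at 0 within \<Delta>)"
      by (simp add: o_def Elin)
    then show ?thesis using at_within_open[of "0::complex" \<Delta>] by simp
  qed
  have "cderiv k 0 = E (\<iota> N)"
  proof (rule cderiv_eqI)
    have "(\<lambda>\<zeta>. \<zeta> *\<^sub>C \<iota> N) ` \<Delta> \<subseteq> \<D>" by (rule image_subsetI) (rule N_D)
    from chain[OF bounded_linear_imp_has_derivative[OF bounded_linear_scaleC_left] this]
    show "(k has_derivative (\<lambda>h. h *\<^sub>C E (\<iota> N))) (at 0)" by (simp add: k_def[abs_def])
  qed
  moreover have "of_real \<alpha>\<^sub>1 *\<^sub>C E (\<iota> N) = cderiv \<phi> 0 *\<^sub>C \<iota> (J.X0 w)"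
  proof -
    have "(\<lambda>z. \<iota> (I.Z0 z)) ` \<Delta> \<subseteq> \<D>"
    proof (rule image_subsetI)
      fix z assume z: "z \<in> \<Delta>"
      then have "F z \<in> \<Omega>" using F(2) by blast
      from L(2)[OF this] show "\<iota> (I.Z0 z) \<in> \<D>" unfolding F(3)[OF z] .
    qed
    then have "((\<lambda>z. \<tau> (\<iota> (I.Z0 z))) has_derivative (\<lambda>x. x *\<^sub>C E (\<iota> (I.X0 0)))) (at 0)"
      using Z00 by (intro chain[OF I.Z0_deriv[OF \<iota>_add \<iota>_scaleC]]) simp_all
    then have "cderiv (\<lambda>z. \<tau> (\<iota> (I.Z0 z))) 0 = of_real \<alpha>\<^sub>1 *\<^sub>C E (\<iota> N)"
      by (intro cderiv_eqI) (simp add: XN \<iota>_scaleC Elin)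
    moreover have "cderiv (\<lambda>z. \<tau> (\<iota> (I.Z0 z))) 0 = cderiv \<phi> 0 *\<^sub>C \<iota> (J.X0 w)"
    proof (rule cderiv_eqI)
      have "((\<lambda>z. \<iota> (J.Z0 z)) has_derivative (\<lambda>x. x *\<^sub>C \<iota> (J.X0 w))) (at (\<phi> 0))"
        unfolding w_def[symmetric] by (rule J.Z0_deriv[OF \<iota>_add \<iota>_scaleC w])
      from diff_chain_at[OF d\<phi> this]
      have "((\<lambda>z. \<iota> (J.Z0 (\<phi> z))) has_derivative (\<lambda>x. x *\<^sub>C (cderiv \<phi> 0 *\<^sub>C \<iota> (J.X0 w)))) (at 0)"
        by (simp add: o_def scaleC_scaleC scaleC_complex_def)
      then show "((\<lambda>z. \<tau> (\<iota> (I.Z0 z))) has_derivative (\<lambda>x. x *\<^sub>C (cderiv \<phi> 0 *\<^sub>C \<iota> (J.X0 w)))) (at 0)"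
        by (rule has_derivative_transform_within_open[OF _ open_ball[of "0::complex" 1]]) (auto simp: \<tau>F)
    qed
    ultimately show ?thesis by simp
  qed
  ultimately have dk: "of_real \<alpha>\<^sub>1 *\<^sub>C cderiv k 0 = cderiv \<phi> 0 *\<^sub>C \<iota> (J.X0 w)" by simp
  \<comment> \<open>The ratio between the tangent of the transported disk k and that of the second
    isometry; its modulus is \<open>(1 - |w|\<^sup>2) / \<alpha>\<^sub>1\<close>.\<close>
  define l where "l = cderiv \<phi> 0 / of_real \<alpha>\<^sub>1"
  have "(1 / of_real \<alpha>\<^sub>1) *\<^sub>C (of_real \<alpha>\<^sub>1 *\<^sub>C cderiv k 0) = l *\<^sub>C \<iota> (J.X0 w)"
    unfolding dk by (simp add: l_def scaleC_scaleC)
  then have dk': "cderiv k 0 = l *\<^sub>C \<iota> (J.X0 w)" using I.alpha by (simp add: scaleC_scaleC)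
  have "k 0 \<in> D_I" using kim by auto
  then have ZD: "\<iota> (J.Z0 w) \<in> D_I" by (simp only: k0)
  obtain P :: "complex^'p^'p" where P: "P ** (mat 1 - \<iota> (J.Z0 w) ** adjoint_mat (\<iota> (J.Z0 w))) ** adjoint_mat P = mat 1"
    using ex_moebius[OF ZD] by blast
  obtain A where A: "(mat 1 - J.Z0 w ** adjoint_mat (J.Z0 w)) ** A = mat 1" using J.inverse_Z0[OF w] by metis
  have "\<alpha>\<^sub>2\<^sup>2 * (cmod l)\<^sup>2 \<le> (1 - (cmod w)\<^sup>2)\<^sup>2"
  proof (rule J.gram_bound[OF w A])
    fix v :: "complex^2"
    have P2: "(mat 1 - k 0 ** adjoint_mat (k 0)) ** (adjoint_mat P ** P) = mat 1"
      unfolding k0 by (rule adjoint_gram_inverse(2)[OF P])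
    have "Re (cip ((adjoint_mat P ** P) *v (cderiv k 0 *v \<eta> v)) (cderiv k 0 *v \<eta> v)) \<le> (norm (\<eta> v))\<^sup>2 - (norm (k 0 *v \<eta> v))\<^sup>2"
      by (rule schwarz_gram[OF khol kim P2])
    moreover have "cip ((adjoint_mat P ** P) *v (cderiv k 0 *v \<eta> v)) (cderiv k 0 *v \<eta> v)
        = of_real ((cmod l)\<^sup>2) * cip (A *v (J.X0 w *v v)) (J.X0 w *v v)"
    proof -
      have "cip ((adjoint_mat P ** P) *v (cderiv k 0 *v \<eta> v)) (cderiv k 0 *v \<eta> v)
          = (l * cnj l) * cip (((adjoint_mat P ** P) ** \<iota> (J.X0 w)) *v \<eta> v) (\<iota> (J.X0 w) *v \<eta> v)"
        unfolding dk' mat_vec_scaleC_left mat_vec_scaleC_right cip_scaleC_left cip_scaleC_right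
        by (simp add: matrix_vector_mul_assoc)
      also have "\<dots> = (l * cnj l) * cip ((A ** J.X0 w) *v v) (J.X0 w *v v)"
        unfolding \<iota>_left_inverse[OF A adjoint_gram_inverse(1)[OF P]] \<iota>_\<eta> ..
      finally show ?thesis by (simp add: complex_norm_square matrix_vector_mul_assoc del: of_real_power)
    qed
    moreover have "norm (k 0 *v \<eta> v) = norm (J.Z0 w *v v)"
    proof -
      have "complex_of_real ((norm (k 0 *v \<eta> v))\<^sup>2) = of_real ((norm (J.Z0 w *v v))\<^sup>2)"
        unfolding cip_self[symmetric] k0 \<iota>_\<eta> ..
      then show ?thesis by (metis of_real_eq_iff norm_ge_zero power2_eq_iff_nonneg)
    qed
    ultimately show "(cmod l)\<^sup>2 * Re (cip (A *v (J.X0 w *v v)) (J.X0 w *v v)) \<le> (norm v)\<^sup>2 - (norm (J.Z0 w *v v))\<^sup>2"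
      by (simp add: \<eta>_norm del: of_real_power)
  qed simp
  moreover have "cmod l = (1 - (cmod w)\<^sup>2) / \<alpha>\<^sub>1" using I.alpha by (simp add: l_def norm_divide d\<phi>')
  ultimately have le: "\<alpha>\<^sub>2\<^sup>2 * ((1 - (cmod w)\<^sup>2) / \<alpha>\<^sub>1)\<^sup>2 \<le> (1 - (cmod w)\<^sup>2)\<^sup>2" by (simp only:)
  have gen: "x\<^sup>2 \<le> y\<^sup>2" if "x\<^sup>2 * (t / y)\<^sup>2 \<le> t\<^sup>2" "0 < t" "0 < y" for x y t :: real
  proof -
    have "x\<^sup>2 * t\<^sup>2 \<le> t\<^sup>2 * y\<^sup>2" using that by (simp add: power_divide pos_divide_le_eq)
    then show ?thesis using that(2) by (simp add: mult.commute)
  qed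
  have "0 < 1 - (cmod w)\<^sup>2" using J.sz(2)[OF w] by simp
  from gen[OF le this I.alpha(1)] have "\<alpha>\<^sub>2\<^sup>2 \<le> \<alpha>\<^sub>1\<^sup>2" .
  then show ?thesis by (rule power2_le_imp_le) (use I.alpha in auto)
qed

lemma incongruent:
  assumes "sqrt (1/2) < \<alpha>\<^sub>1" "\<alpha>\<^sub>1 < 1" "sqrt (1/2) < \<alpha>\<^sub>2" "\<alpha>\<^sub>2 < 1" "\<alpha>\<^sub>1 \<noteq> \<alpha>\<^sub>2"
  shows "\<not> congruent_maps \<Omega> (isometry_map \<alpha>\<^sub>1) (isometry_map \<alpha>\<^sub>2)"
proof
  assume c: "congruent_maps \<Omega> (isometry_map \<alpha>\<^sub>1) (isometry_map \<alpha>\<^sub>2)"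
  have "congruent_maps \<Omega> (isometry_map \<alpha>\<^sub>2) (isometry_map \<alpha>\<^sub>1)"
    by (rule congruent_maps_sym[OF c isometry_map_properties(2)[OF assms(3,4)]])
  then show False
    using congruent_parameters_le[OF assms(1-4) c] congruent_parameters_le[OF assms(3,4,1,2)] assms(5) by simp
qed

lemma ex_isometries:
  "(\<exists>\<alpha>::real. 0 < \<alpha> \<and> \<alpha> < 1 \<and>
           (\<exists>F :: complex \<Rightarrow> complex \<Rightarrow> complex^'n.
              (\<forall>\<zeta>. \<alpha> < cmod \<zeta> \<and> cmod \<zeta> < 1 \<longrightarrow> holomorphic_isometry \<Omega> g (F \<zeta>)) \<and>
              (\<forall>\<zeta> \<zeta>'. \<alpha> < cmod \<zeta> \<and> cmod \<zeta> < 1 \<and> \<alpha> < cmod \<zeta>' \<and> cmod \<zeta>' < 1 \<and>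
                 cmod \<zeta> \<noteq> cmod \<zeta>' \<longrightarrow> \<not> congruent_maps \<Omega> (F \<zeta>) (F \<zeta>'))))
         \<and> (\<exists>F :: real \<Rightarrow> complex \<Rightarrow> complex^'n.
              (\<forall>t. holomorphic_isometry \<Omega> g (F t)) \<and>
              (\<forall>s t. s \<noteq> t \<longrightarrow> \<not> congruent_maps \<Omega> (F s) (F t)))"
proof (intro conjI)
  let ?r = "sqrt (1/2)"
  have r: "0 < ?r" "?r < 1" by (simp_all add: real_sqrt_divide)
  show "\<exists>\<alpha>::real. 0 < \<alpha> \<and> \<alpha> < 1 \<and>
           (\<exists>F :: complex \<Rightarrow> complex \<Rightarrow> complex^'n.
              (\<forall>\<zeta>. \<alpha> < cmod \<zeta> \<and> cmod \<zeta> < 1 \<longrightarrow> holomorphic_isometry \<Omega> g (F \<zeta>)) \<and>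
              (\<forall>\<zeta> \<zeta>'. \<alpha> < cmod \<zeta> \<and> cmod \<zeta> < 1 \<and> \<alpha> < cmod \<zeta>' \<and> cmod \<zeta>' < 1 \<and>
                 cmod \<zeta> \<noteq> cmod \<zeta>' \<longrightarrow> \<not> congruent_maps \<Omega> (F \<zeta>) (F \<zeta>')))"
    \<comment> \<open>Only the modulus of \<zeta> enters, so the family is constant on
      circles.\<close>
    using r isometry_map_isometry incongruent
    by (intro exI[of _ ?r] conjI exI[of _ "\<lambda>\<zeta>. isometry_map (cmod \<zeta>)"]) auto
  \<comment> \<open>An increasing bijection from the reals onto the interval between
    \<open>?r\<close> and 1.\<close>
  define u where "u t = 1 - (1 - ?r) / (1 + exp t)" for t :: real
  have u: "?r < u t" "u t < 1" for t
  proof -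
    have e: "1 < 1 + exp t" by simp
    then have "(1 - ?r) / (1 + exp t) < (1 - ?r) / 1" using r by (intro divide_strict_left_mono) (auto intro: add_pos_pos)
    then show "?r < u t" unfolding u_def div_by_1 by linarith
    have "0 < (1 - ?r) / (1 + exp t)" using r exp_gt_zero[of t] by (intro divide_pos_pos) linarith+
    then show "u t < 1" unfolding u_def by linarith
  qed
  have inj: "u s \<noteq> u t" if "s \<noteq> t" for s t
  proof
    assume "u s = u t"
    then have "(1 - ?r) / (1 + exp s) = (1 - ?r) / (1 + exp t)" unfolding u_def by linarith
    moreover have "1 - ?r \<noteq> 0" "1 + exp s \<noteq> 0" "1 + exp t \<noteq> 0"
      using r exp_gt_zero[of s] exp_gt_zero[of t] by linarith+
    ultimately have "1 + exp s = 1 + exp t" by (simp add: frac_eq_eq)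
    with that show False by simp
  qed
  show "\<exists>F :: real \<Rightarrow> complex \<Rightarrow> complex^'n.
              (\<forall>t. holomorphic_isometry \<Omega> g (F t)) \<and>
              (\<forall>s t. s \<noteq> t \<longrightarrow> \<not> congruent_maps \<Omega> (F s) (F t))"
    using isometry_map_isometry[OF u] incongruent[OF u u inj]
    by (intro exI[of _ "\<lambda>t. isometry_map (u t)"]) blast
qed

end

section \<open>Domains of rank one carry no flat plane\<close>

text \<open>The operator factors into first order ones: \<open>p' + k p\<close> is nonnegative by
  the integrating factor \<open>exp (- k s)\<close>, and then p by \<open>exp (k s)\<close>.\<close>

lemma second_order_comparison:
  fixes p :: "real \<Rightarrow> real"
  assumes p: "\<And>t. (p has_real_derivative p' t) (at t)" "\<And>t. (p' has_real_derivative p'' t) (at t)"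
    and le: "\<And>t. k\<^sup>2 * p t \<le> p'' t" and 0: "p 0 = 0" "p' 0 = 0" and t: "0 \<le> t"
  shows "0 \<le> p t"
proof -
  have "exp (- k * 0) * (p' 0 + k * p 0) \<le> exp (- k * s) * (p' s + k * p s)" if "0 \<le> s" for s
  proof (rule DERIV_nonneg_imp_nondecreasing[OF that])
    fix x :: real
    have "((\<lambda>s. exp (- k * s) * (p' s + k * p s)) has_real_derivative
        exp (- k * x) * (p'' x + k * p' x) + (exp (- k * x) * (- k)) * (p' x + k * p x)) (at x)"
      by (auto intro!: derivative_eq_intros p)
    moreover have "exp (- k * x) * (p'' x + k * p' x) + (exp (- k * x) * (- k)) * (p' x + k * p x)
        = exp (- k * x) * (p'' x - k\<^sup>2 * p x)" by (simp add: algebra_simps power2_eq_square)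
    moreover have "0 \<le> exp (- k * x) * (p'' x - k\<^sup>2 * p x)" using le[of x] by simp
    ultimately show "\<exists>y. ((\<lambda>s. exp (- k * s) * (p' s + k * p s)) has_real_derivative y) (at x) \<and> 0 \<le> y"
      by metis
  qed
  then have r: "0 \<le> p' s + k * p s" if "0 \<le> s" for s using that by (simp add: 0 zero_le_mult_iff)
  have "exp (k * 0) * p 0 \<le> exp (k * t) * p t"
  proof (rule DERIV_nonneg_imp_nondecreasing[OF t])
    fix x :: real assume "0 \<le> x"
    have "((\<lambda>s. exp (k * s) * p s) has_real_derivative exp (k * x) * p' x + (exp (k * x) * k) * p x) (at x)"
      by (auto intro!: derivative_eq_intros p)
    moreover have "exp (k * x) * p' x + (exp (k * x) * k) * p x = exp (k * x) * (p' x + k * p x)"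
      by (simp add: algebra_simps)
    moreover have "0 \<le> exp (k * x) * (p' x + k * p x)" using r[OF \<open>0 \<le> x\<close>] by simp
    ultimately show "\<exists>y. ((\<lambda>s. exp (k * s) * p s) has_real_derivative y) (at x) \<and> 0 \<le> y" by metis
  qed
  then show ?thesis by (simp add: 0 zero_le_mult_iff)
qed

text \<open>In the complex hyperbolic metric this is the function \<open>cosh\<^sup>2\<close> of the distance from a point,
  along a unit speed geodesic.\<close>

lemma cosh_square_comparison:
  fixes U :: "real \<Rightarrow> real"
  assumes U: "\<And>t. (U has_real_derivative U' t) (at t)" "\<And>t. (U' has_real_derivative U'' t) (at t)"
    and ge1: "\<And>t. 1 \<le> U t" and lo: "\<And>t. 2 * U t + (U' t)\<^sup>2 / (2 * U t) \<le> U'' t" and hi: "\<And>t. U'' t \<le> 4 * U t - 2"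
    and 0: "U 0 = 1" "U' 0 = 0" and t: "0 \<le> t"
  shows "U t = (cosh t)\<^sup>2"
proof (rule antisym)
  \<comment> \<open>The square of cosh solves \<open>y'' = 4 y - 2\<close>, the equality case of
    \<open>hi\<close>.\<close>
  have "0 \<le> (cosh t)\<^sup>2 - U t"
  proof (rule second_order_comparison[where k = 2, OF _ _ _ _ _ t])
    show "((\<lambda>t. (cosh t)\<^sup>2 - U t) has_real_derivative 2 * cosh t * sinh t - U' t) (at t)" for t
      by (auto intro!: derivative_eq_intros U)
    show "((\<lambda>t. 2 * cosh t * sinh t - U' t) has_real_derivative
        2 * sinh t * sinh t + 2 * cosh t * cosh t - U'' t) (at t)" for t
      by (auto intro!: derivative_eq_intros U)
    show "2\<^sup>2 * ((cosh t)\<^sup>2 - U t) \<le> 2 * sinh t * sinh t + 2 * cosh t * cosh t - U'' t" for t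
      using hi[of t] cosh_square_eq[of t] by (simp add: power2_eq_square)
  qed (simp_all add: 0)
  then show "U t \<le> (cosh t)\<^sup>2" by simp
  have pos: "0 < U t" for t using ge1[of t] by linarith
  \<comment> \<open>In terms of the square root of U, \<open>lo\<close> says that the second
    derivative dominates the function, with equality for cosh.\<close>
  have "0 \<le> sqrt (U t) - cosh t"
  proof (rule second_order_comparison[where k = 1, OF _ _ _ _ _ t])
    show "((\<lambda>t. sqrt (U t) - cosh t) has_real_derivative U' t / (2 * sqrt (U t)) - sinh t) (at t)" for t
      using pos[of t] by (auto intro!: derivative_eq_intros U simp: field_simps)
    show "((\<lambda>t. U' t / (2 * sqrt (U t)) - sinh t) has_real_derivative
        (U'' t - (U' t)\<^sup>2 / (2 * U t)) / (2 * sqrt (U t)) - cosh t) (at t)" for t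
    proof -
      have s: "sqrt (U t) * sqrt (U t) = U t" "sqrt (U t) > 0" using pos[of t] by simp_all
      have "((\<lambda>t. U' t / (2 * sqrt (U t)) - sinh t) has_real_derivative
        (U'' t * (2 * sqrt (U t)) - U' t * (2 * (U' t / (2 * sqrt (U t))))) / ((2 * sqrt (U t)) * (2 * sqrt (U t))) - cosh t) (at t)"
        using pos[of t] by (auto intro!: derivative_eq_intros U simp: field_simps)
      moreover have gen: "(a * (2 * r) - b * (2 * (b / (2 * r)))) / ((2 * r) * (2 * r)) = (a - b\<^sup>2 / (2 * (r * r))) / (2 * r)"
        if "r > 0" for a b r :: real using that by (simp add: field_simps power2_eq_square)
      moreover note gen[OF s(2), of "U'' t" "U' t", unfolded s(1)]
      ultimately show ?thesis by (simp only:)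
    qed
    show "1\<^sup>2 * (sqrt (U t) - cosh t) \<le> (U'' t - (U' t)\<^sup>2 / (2 * U t)) / (2 * sqrt (U t)) - cosh t" for t
    proof -
      have s: "sqrt (U t) > 0" "U t / sqrt (U t) = sqrt (U t)" using pos[of t] real_div_sqrt by simp_all
      have "(2 * U t) / (2 * sqrt (U t)) \<le> (U'' t - (U' t)\<^sup>2 / (2 * U t)) / (2 * sqrt (U t))"
        using lo[of t] s by (intro divide_right_mono) auto
      then show ?thesis using s by simp
    qed
  qed (simp_all add: 0)
  then have "(cosh t)\<^sup>2 \<le> (sqrt (U t))\<^sup>2" by (intro power_mono) auto
  then show "(cosh t)\<^sup>2 \<le> U t" using pos[of t] by simp
qed

locale rank_one_domain = canonical_domain W \<kappa> \<Omega> g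
  for W :: "(complex^'q^'p) set" and \<kappa> :: real and \<Omega> :: "(complex^'n) set" and g :: "complex^'n \<Rightarrow> complex^'n^'n" +
  assumes rank_one: "X \<in> W \<Longrightarrow> Y \<in> W \<Longrightarrow> X ** adjoint_mat Y ** X = (of_real \<kappa> * mip X Y) *\<^sub>C X"
begin

lemma rank_one_polarized:
  assumes "X \<in> W" "Y \<in> W" "Z \<in> W"
  shows "X ** adjoint_mat Y ** Z + Z ** adjoint_mat Y ** X
    = (of_real \<kappa> * mip X Y) *\<^sub>C Z + (of_real \<kappa> * mip Z Y) *\<^sub>C X"
proof -
  have "(X + Z) ** adjoint_mat Y ** (X + Z) = (of_real \<kappa> * mip (X + Z) Y) *\<^sub>C (X + Z)"
    using assms by (intro rank_one W_add)
  then have "X ** adjoint_mat Y ** Z + Z ** adjoint_mat Y ** X + (X ** adjoint_mat Y ** X + Z ** adjoint_mat Y ** Z)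
    = (of_real \<kappa> * mip X Y) *\<^sub>C Z + (of_real \<kappa> * mip Z Y) *\<^sub>C X
      + ((of_real \<kappa> * mip X Y) *\<^sub>C X + (of_real \<kappa> * mip Z Y) *\<^sub>C Z)"
    by (simp add: mat_mult_distribs mip_add_left distrib_left scaleC_add_left scaleC_add_right algebra_simps)
  then show ?thesis unfolding rank_one[OF assms(1,2)] rank_one[OF assms(3,2)] by (rule add_right_imp_eq)
qed

text \<open>The rank one identity makes \<open>\<kappa> |Z|\<^sup>2\<close> an eigenvalue of
  \<open>Z\<^sup>* Z\<close>, and membership in the matrix ball bounds eigenvalues by 1. In these
  coordinates the domain is a ball.\<close>

lemma rank_one_norm:
  assumes Z: "Z \<in> \<D>" shows "\<kappa> * (norm Z)\<^sup>2 < 1"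
proof (cases "\<forall>v. adjoint_mat Z *v v = 0")
  case True
  then have "adjoint_mat Z = 0" by (simp add: matrix_eq)
  then have "Z = 0" by (metis adjoint_mat_0 adjoint_mat_adjoint_mat)
  then show ?thesis by simp
next
  case False
  then obtain v where v: "adjoint_mat Z *v v \<noteq> 0" by blast
  define w where "w = adjoint_mat Z *v v"
  have "adjoint_mat Z ** Z ** adjoint_mat Z = adjoint_mat (Z ** adjoint_mat Z ** Z)"
    by (simp add: adjoint_mat_mult matrix_mul_assoc)
  also have "\<dots> = of_real (\<kappa> * (norm Z)\<^sup>2) *\<^sub>C adjoint_mat Z"
    using Z by (simp add: rank_one mip_self adjoint_mat_scaleC)
  finally have e: "(adjoint_mat Z ** Z) *v w = of_real (\<kappa> * (norm Z)\<^sup>2) *\<^sub>C w"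
    by (simp add: w_def matrix_vector_mul_assoc mat_vec_scaleC_left)
  have "complex_of_real ((norm (Z *v w))\<^sup>2) = of_real (\<kappa> * (norm Z)\<^sup>2 * (norm w)\<^sup>2)"
    unfolding cip_gram[symmetric] e cip_scaleC_left cip_self by simp
  then have "(norm (Z *v w))\<^sup>2 = \<kappa> * (norm Z)\<^sup>2 * (norm w)\<^sup>2" by (simp only: of_real_eq_iff)
  moreover have "norm (Z *v w) < norm w" using Z v by (simp add: D_I_iff w_def)
  then have "(norm (Z *v w))\<^sup>2 < (norm w)\<^sup>2" by (intro power_strict_mono) auto
  ultimately show ?thesis using v by (simp add: w_def)
qed

lemma rank_one_metric:
  assumes c: "chart 1 \<Phi>" and x: "x \<in> \<Omega>"
  defines "s \<equiv> \<kappa> * (norm (\<Phi> x))\<^sup>2" and "b u \<equiv> of_real \<kappa> * mip (fder \<Phi> x u) (\<Phi> x)"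
  shows "Re (herm (g x) u u) = \<kappa> * (norm (fder \<Phi> x u))\<^sup>2 / (1 - s) + (cmod (b u))\<^sup>2 / (1 - s)\<^sup>2"
proof -
  have bi: "biholomorphism \<Phi> \<Omega> \<D>" using c by (simp add: chart_def)
  note L = biholo_facts[OF bi]
  define Z where "Z = \<Phi> x"
  define X where "X = fder \<Phi> x u"
  define \<beta> where "\<beta> = of_real \<kappa> * mip X Z"
  have Z: "Z \<in> W" "Z \<in> \<D>" and X: "X \<in> W" using L(2,7)[OF x] by (simp_all add: Z_def X_def)
  have s1: "s < 1" using rank_one_norm[OF Z(2)] by (simp add: s_def Z_def)
  obtain P :: "complex^'p^'p" and S :: "complex^'q^'q" where PS:
    "P ** (mat 1 - Z ** adjoint_mat Z) ** adjoint_mat P = mat 1"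
    "S ** (mat 1 - adjoint_mat Z ** Z) ** adjoint_mat S = mat 1"
    "\<And>u v. herm (g x) u v = of_real (1 * \<kappa>) *
       mip (P ** fder \<Phi> x u ** adjoint_mat S) (P ** fder \<Phi> x v ** adjoint_mat S)"
    using metric_formula[OF c x] unfolding Z_def by metis
  \<comment> \<open>By the rank one identity the map N below preserves the span of X and Z; G is the
    solution of \<open>N G = X\<close> in that span.\<close>
  define G where "G = of_real (1 / (1 - s)) *\<^sub>C X + (\<beta> * of_real (1 / (1 - s)\<^sup>2)) *\<^sub>C Z"
  have ZZZ: "Z ** adjoint_mat Z ** Z = of_real s *\<^sub>C Z"
    using rank_one[OF Z(1) Z(1)] by (simp add: mip_self s_def Z_def)
  have *: "X ** adjoint_mat Z ** Z + Z ** adjoint_mat Z ** X = \<beta> *\<^sub>C Z + of_real s *\<^sub>C X"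
    using rank_one_polarized[OF X Z(1) Z(1)] by (simp add: mip_self s_def Z_def \<beta>_def)
  have "adjoint_mat Z ** X ** adjoint_mat Z = adjoint_mat (Z ** adjoint_mat X ** Z)"
    by (simp add: adjoint_mat_mult matrix_mul_assoc)
  also have "\<dots> = \<beta> *\<^sub>C adjoint_mat Z"
    unfolding rank_one[OF Z(1) X] adjoint_mat_scaleC \<beta>_def using mip_commute[of X Z] by simp
  finally have ZXZ: "adjoint_mat Z ** X ** adjoint_mat Z = \<beta> *\<^sub>C adjoint_mat Z" .
  have quad: "Z ** adjoint_mat Z ** X ** adjoint_mat Z ** Z = (\<beta> * of_real s) *\<^sub>C Z"
  proof -
    have "Z ** adjoint_mat Z ** X ** adjoint_mat Z ** Z = Z ** (adjoint_mat Z ** X ** adjoint_mat Z) ** Z"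
      by (simp add: matrix_mul_assoc)
    also have "\<dots> = \<beta> *\<^sub>C (Z ** adjoint_mat Z ** Z)"
      unfolding ZXZ by (simp add: mat_mult_scaleC_left mat_mult_scaleC_right)
    finally show ?thesis by (simp add: ZZZ scaleC_scaleC)
  qed
  define N where "N Y = (mat 1 - Z ** adjoint_mat Z) ** Y ** (mat 1 - adjoint_mat Z ** Z)" for Y
  have Nlin: "N (a *\<^sub>C Y + d *\<^sub>C Y') = a *\<^sub>C N Y + d *\<^sub>C N Y'" for a d Y Y'
    by (simp add: N_def mat_mult_add_left mat_mult_add_right mat_mult_scaleC_left mat_mult_scaleC_right)
  have Nexp: "N Y = Y - (Y ** adjoint_mat Z ** Z + Z ** adjoint_mat Z ** Y) + Z ** adjoint_mat Z ** Y ** adjoint_mat Z ** Z" for Y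
    by (simp add: N_def mat_mult_distribs matrix_mul_assoc)
  have NX: "N X = of_real (1 - s) *\<^sub>C X - (\<beta> * of_real (1 - s)) *\<^sub>C Z"
    unfolding Nexp * quad by (simp add: vec_eq_iff scaleC_complex_def algebra_simps)
  have NZ: "N Z = of_real ((1 - s)\<^sup>2) *\<^sub>C Z"
  proof -
    have "Z ** adjoint_mat Z ** Z ** adjoint_mat Z ** Z = of_real (s * s) *\<^sub>C Z"
      unfolding ZZZ mat_mult_scaleC_left by (simp add: ZZZ scaleC_scaleC)
    then show ?thesis
      unfolding Nexp ZZZ by (simp add: vec_eq_iff scaleC_complex_def algebra_simps power2_eq_square)
  qed
  have "N G = X"
  proof -
    have "complex_of_real (1 - s) \<noteq> 0" using s1 by simp
    moreover have "(1 / r) * (r * x - (\<beta> * r) * z) + (\<beta> * (1 / r\<^sup>2)) * (r\<^sup>2 * z) = x" if "r \<noteq> 0" for r x z :: complex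
      using that by (simp add: field_simps)
    ultimately show ?thesis
      unfolding G_def Nlin NX NZ of_real_divide of_real_power of_real_1
      by (simp only: vec_eq_iff vector_add_component vector_minus_component scaleC_nth scaleC_complex_def) simp
  qed
  then have "(adjoint_mat P ** P) ** X ** (adjoint_mat S ** S)
      = ((adjoint_mat P ** P) ** (mat 1 - Z ** adjoint_mat Z)) ** G ** ((mat 1 - adjoint_mat Z ** Z) ** (adjoint_mat S ** S))"
    by (auto simp: N_def matrix_mul_assoc)
  also have "\<dots> = G" by (simp add: adjoint_gram_inverse(1)[OF PS(1)] adjoint_gram_inverse(2)[OF PS(2)])
  finally have "herm (g x) u u = of_real \<kappa> * mip G X" unfolding PS(3) mip_sandwich X_def[symmetric] by simp
  also have "mip G X = of_real (1 / (1 - s)) * mip X X + (\<beta> * of_real (1 / (1 - s)\<^sup>2)) * mip Z X"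
    by (simp add: G_def mip_add_left mip_scaleC_left)
  also have "of_real \<kappa> * \<dots> = of_real (\<kappa> * (norm X)\<^sup>2 / (1 - s)) + of_real (1 / (1 - s)\<^sup>2) * (\<beta> * cnj \<beta>)"
    unfolding mip_self \<beta>_def using mip_commute[of Z X] by (simp add: algebra_simps)
  also have "\<beta> * cnj \<beta> = of_real ((cmod \<beta>)\<^sup>2)" by (rule complex_norm_square[symmetric])
  finally show ?thesis by (simp add: X_def \<beta>_def b_def Z_def del: of_real_power)
qed

text \<open>In the chart centred at \<open>\<gamma> t\<close> the acceleration of the curve
  vanishes. Differentiating the relation between that chart and \<Phi> twice transfers this to the
  fixed chart, where the rank one identity makes the acceleration a multiple of the
  velocity.\<close>

lemma geodesic_equation:
  assumes c: "chart 1 \<Phi>" and \<gamma>: "\<And>t. (\<gamma> has_vector_derivative \<gamma>' t) (at t)"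
    "\<And>t. (\<gamma>' has_vector_derivative \<gamma>'' t) (at t)" "\<And>t. \<gamma>'' t + christoffel g (\<gamma> t) (\<gamma>' t) (\<gamma>' t) = 0"
    and in\<Omega>: "\<And>t. \<gamma> t \<in> \<Omega>"
  defines "Z \<equiv> \<lambda>t. \<Phi> (\<gamma> t)" and "Z' \<equiv> \<lambda>t. fder \<Phi> (\<gamma> t) (\<gamma>' t)"
  shows "(Z has_vector_derivative Z' t) (at t)"
    and "(Z' has_vector_derivative (- 2 * (of_real \<kappa> * mip (Z' t) (Z t)) / of_real (1 - \<kappa> * (norm (Z t))\<^sup>2)) *\<^sub>C Z' t) (at t)"
proof -
  have Z_deriv: "((\<lambda>s. \<Psi> (\<gamma> s)) has_vector_derivative fder \<Psi> (\<gamma> s) (\<gamma>' s)) (at s)"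
    if "chart 1 \<Psi>" for \<Psi> s
  proof -
    have "biholomorphism \<Psi> \<Omega> \<D>" using that by (simp add: chart_def)
    note L = biholo_facts[OF this]
    from diff_chain_at[OF \<gamma>(1)[unfolded has_vector_derivative_def] L(3)[OF in\<Omega>]]
    show ?thesis
      unfolding has_vector_derivative_def
      by (simp add: o_def linear_cmul[OF has_derivative_linear[OF L(3)[OF in\<Omega>]]])
  qed
  then show Zd: "(Z has_vector_derivative Z' t) (at t)" for t unfolding Z_def Z'_def using c by blast
  have bi: "biholomorphism \<Phi> \<Omega> \<D>" using c by (simp add: chart_def)
  note L = biholo_facts[OF bi]
  have ZD: "Z s \<in> W" "Z s \<in> D_I" "Z s \<in> \<D>" "Z' s \<in> W" for s using L(2,7)[OF in\<Omega>[of s]] by (auto simp: Z_def Z'_def)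
  note d2 = holomorphic_map_on_fder(1)[OF holomorphic_map_on_fder_mat[OF L(1) open_\<Omega>] open_\<Omega> in\<Omega>[of t]]
  have "((\<lambda>w. fder \<Phi> (\<gamma> w) (\<gamma>' w)) has_derivative
     (\<lambda>h. fder (\<lambda>y. fder \<Phi> y (\<gamma>' t)) (\<gamma> t) (h *\<^sub>R \<gamma>' t) + fder \<Phi> (\<gamma> t) (h *\<^sub>R \<gamma>'' t))) (at t)"
    by (rule has_derivative_apply[where T = \<Omega>, OF d2 _ open_\<Omega> in\<Omega>
          \<gamma>(1)[unfolded has_vector_derivative_def] \<gamma>(2)[unfolded has_vector_derivative_def]])
      (rule has_derivative_linear[OF L(3)])
  \<comment> \<open>The acceleration K is known to exist before it is determined by differentiating
    the relation between the charts.\<close>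
  then have "Z' differentiable (at t)" unfolding Z'_def differentiable_def by blast
  then obtain K where K: "(Z' has_vector_derivative K) (at t)"
    using vector_derivative_works by blast
  obtain A B C E where T: "pseudo_unitary A B C E" "frac A B C E (\<Phi> (\<gamma> t)) = 0"
    "chart 1 (\<lambda>y. frac A B C E (\<Phi> y))"
    "\<And>u. fder (\<lambda>y. frac A B C E (\<Phi> y)) (\<gamma> t) u = A ** fder \<Phi> (\<gamma> t) u ** adjoint_mat E"
    using chart_at[OF c in\<Omega>[of t]] by metis
  define \<Psi> where "\<Psi> = (\<lambda>y. frac A B C E (\<Phi> y))"
  define Y where "Y s = \<Psi> (\<gamma> s)" for s
  define Y' where "Y' s = fder \<Psi> (\<gamma> s) (\<gamma>' s)" for s
  have Yd: "(Y has_vector_derivative Y' s) (at s)" for s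
    using Z_deriv[OF T(3)] by (simp add: Y_def[abs_def] Y'_def \<Psi>_def)
  have Y0: "Y t = 0" "Y' t = A ** Z' t ** adjoint_mat E"
    using T(2,4) by (simp_all add: Y_def Y'_def \<Psi>_def Z'_def)
  have "(Y' has_vector_derivative fder \<Psi> (\<gamma> t) 0) (at t)"
    using curve_second_derivative[OF T(3)[folded \<Psi>_def] _ \<gamma>(1)[of t] \<gamma>(2)[of t] in\<Omega>] T(2)
    by (simp add: \<gamma>(3) \<Psi>_def Y'_def[abs_def])
  moreover have "fder \<Psi> (\<gamma> t) 0 = 0"
    using T(3) biholo_facts(8)[OF _ in\<Omega>] by (simp add: chart_def \<Psi>_def)
  ultimately have Y'd: "(Y' has_vector_derivative 0) (at t)" by simp
  note prod = bounded_bilinear.has_vector_derivative[OF bounded_bilinear_mat_mult]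
  have N: "((\<lambda>s. C ** Z s + E) has_vector_derivative C ** Z' s) (at s)" for s
    using has_vector_derivative_add[OF prod[OF has_vector_derivative_const Zd] has_vector_derivative_const] by simp
  \<comment> \<open>With the denominator cleared, both sides can be differentiated by the product
    rule alone.\<close>
  have rel: "Y s ** (C ** Z s + E) = A ** Z s + B" for s
    using matrix_inv_left[OF pseudo_unitary_invertible[OF T(1) ZD(2)[of s]]]
    unfolding Y_def \<Psi>_def frac_def Z_def by (simp add: matrix_mul_assoc[symmetric])
  have rel': "Y s ** (C ** Z' s) + Y' s ** (C ** Z s + E) = A ** Z' s" for s
  proof (rule vector_derivative_unique_at)
    show "((\<lambda>s. A ** Z s + B) has_vector_derivative (Y s ** (C ** Z' s) + Y' s ** (C ** Z s + E))) (at s)"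
      using prod[OF Yd N] unfolding rel .
    show "((\<lambda>s. A ** Z s + B) has_vector_derivative A ** Z' s) (at s)"
      using has_vector_derivative_add[OF prod[OF has_vector_derivative_const Zd] has_vector_derivative_const] by simp
  qed
  have "((\<lambda>s. A ** Z' s) has_vector_derivative
     (Y t ** (C ** K) + Y' t ** (C ** Z' t)) + (Y' t ** (C ** Z' t) + 0 ** (C ** Z t + E))) (at t)"
    unfolding rel'[symmetric]
    using has_vector_derivative_add[OF prod[OF Yd prod[OF has_vector_derivative_const[of C] K]] prod[OF Y'd N]]
    by simp
  moreover have "((\<lambda>s. A ** Z' s) has_vector_derivative A ** K) (at t)"
    using prod[OF has_vector_derivative_const K] by simp
  ultimately have AK: "A ** K = Y' t ** (C ** Z' t) + Y' t ** (C ** Z' t)"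
    using vector_derivative_unique_at by (fastforce simp: Y0(1))
  define s where "s = \<kappa> * (norm (Z t))\<^sup>2"
  have s1: "s < 1" using rank_one_norm[OF ZD(3)] by (simp add: s_def)
  have "frac A B C E (Z t) = 0" using T(2) by (simp only: Z_def)
  note pz = pseudo_unitary_zero[OF T(1) ZD(2)[of t] this]
  have EZ: "adjoint_mat E ** E ** adjoint_mat (Z t) = of_real (1 / (1 - s)) *\<^sub>C adjoint_mat (Z t)"
  proof -
    have "adjoint_mat (Z t) ** Z t ** adjoint_mat (Z t) = adjoint_mat (Z t ** adjoint_mat (Z t) ** Z t)"
      by (simp add: adjoint_mat_mult matrix_mul_assoc)
    also have "\<dots> = of_real s *\<^sub>C adjoint_mat (Z t)"
      by (simp add: rank_one ZD mip_self adjoint_mat_scaleC s_def)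
    finally have "(mat 1 - adjoint_mat (Z t) ** Z t) ** adjoint_mat (Z t) = of_real (1 - s) *\<^sub>C adjoint_mat (Z t)"
      by (simp add: mat_mult_distribs vec_eq_iff scaleC_complex_def algebra_simps)
    then have "(adjoint_mat E ** E) ** (mat 1 - adjoint_mat (Z t) ** Z t) ** adjoint_mat (Z t)
        = of_real (1 - s) *\<^sub>C ((adjoint_mat E ** E) ** adjoint_mat (Z t))"
      by (simp only: matrix_mul_assoc[symmetric] mat_mult_scaleC_right)
    then have "adjoint_mat (Z t) = of_real (1 - s) *\<^sub>C ((adjoint_mat E ** E) ** adjoint_mat (Z t))"
      by (simp add: adjoint_gram_inverse(1)[OF pz(4)])
    then have "of_real (1 / (1 - s)) *\<^sub>C adjoint_mat (Z t)
        = of_real (1 / (1 - s)) *\<^sub>C (of_real (1 - s) *\<^sub>C ((adjoint_mat E ** E) ** adjoint_mat (Z t)))" by (rule arg_cong)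
    moreover have "complex_of_real (1 / (1 - s)) * of_real (1 - s) = 1" using s1 by (simp add: of_real_mult[symmetric] del: of_real_mult)
    ultimately show ?thesis by (simp only: scaleC_scaleC scaleC_one)
  qed
  define b where "b = of_real \<kappa> * mip (Z' t) (Z t)"
  have "Y' t ** (C ** Z' t) = - (A ** (Z' t ** (adjoint_mat E ** E ** adjoint_mat (Z t)) ** Z' t))"
    unfolding Y0(2) pz(2) by (simp add: mat_mult_uminus_left mat_mult_uminus_right matrix_mul_assoc)
  also have "Z' t ** (adjoint_mat E ** E ** adjoint_mat (Z t)) ** Z' t = (b / of_real (1 - s)) *\<^sub>C Z' t"
    unfolding EZ mat_mult_scaleC_left mat_mult_scaleC_right rank_one[OF ZD(4) ZD(1)] b_def scaleC_scaleC by simp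
  finally have "A ** K = A ** ((- 2 * b / of_real (1 - s)) *\<^sub>C Z' t)"
    unfolding AK by (simp add: mat_mult_scaleC_right vec_eq_iff scaleC_complex_def)
  moreover obtain A' where "A' ** A = mat 1"
    using pz(3) matrix_left_right_inverse by (metis matrix_mul_assoc)
  ultimately have "K = (- 2 * b / of_real (1 - s)) *\<^sub>C Z' t"
    by (metis matrix_mul_assoc matrix_mul_lid)
  then show "(Z' has_vector_derivative (- 2 * (of_real \<kappa> * mip (Z' t) (Z t)) / of_real (1 - \<kappa> * (norm (Z t))\<^sup>2)) *\<^sub>C Z' t) (at t)"
    using K by (simp only: b_def s_def)
qed

text \<open>With r the reciprocal of U, the unit speed condition gives
  \<open>U'' = 2 / r + 2 |b|\<^sup>2 / r\<^sup>3\<close>. Dropping the imaginary part of b yields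
  the lower bound, Cauchy--Schwarz the upper one.\<close>

lemma geodesic_convexity:
  assumes c: "chart 1 \<Phi>" and \<gamma>: "\<And>t. (\<gamma> has_vector_derivative \<gamma>' t) (at t)"
    "\<And>t. (\<gamma>' has_vector_derivative \<gamma>'' t) (at t)" "\<And>t. \<gamma>'' t + christoffel g (\<gamma> t) (\<gamma>' t) (\<gamma>' t) = 0"
    and in\<Omega>: "\<And>t. \<gamma> t \<in> \<Omega>" and unit: "\<And>t. Re (herm (g (\<gamma> t)) (\<gamma>' t) (\<gamma>' t)) = 1"
  defines "U \<equiv> \<lambda>t. 1 / (1 - \<kappa> * (norm (\<Phi> (\<gamma> t)))\<^sup>2)"
  obtains U' U'' where "\<And>t. (U has_real_derivative U' t) (at t)" "\<And>t. (U' has_real_derivative U'' t) (at t)"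
    "\<And>t. 1 \<le> U t" "\<And>t. 2 * U t + (U' t)\<^sup>2 / (2 * U t) \<le> U'' t" "\<And>t. U'' t \<le> 4 * U t - 2"
    "\<And>t. \<Phi> (\<gamma> t) = 0 \<Longrightarrow> U' t = 0"
proof -
  define Z where "Z = (\<lambda>t. \<Phi> (\<gamma> t))"
  define Z' where "Z' = (\<lambda>t. fder \<Phi> (\<gamma> t) (\<gamma>' t))"
  define s where "s t = \<kappa> * (norm (Z t))\<^sup>2" for t
  define b where "b t = of_real \<kappa> * mip (Z' t) (Z t)" for t
  have D: "(Z has_vector_derivative Z' t) (at t)"
    "(Z' has_vector_derivative (- 2 * b t / of_real (1 - s t)) *\<^sub>C Z' t) (at t)" for t
    using geodesic_equation[OF c \<gamma> in\<Omega>, of t] unfolding Z_def Z'_def b_def s_def by blast+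
  have bi: "biholomorphism \<Phi> \<Omega> \<D>" using c by (simp add: chart_def)
  have ZD: "Z t \<in> \<D>" for t using biholo_facts(2)[OF bi in\<Omega>[of t]] by (simp add: Z_def)
  have s1: "s t < 1" for t using rank_one_norm[OF ZD[of t]] by (simp add: s_def)
  have s0: "0 \<le> s t" for t using kappa_pos by (simp add: s_def)
  have Reb: "Re (b t) = \<kappa> * (Z' t \<bullet> Z t)" for t by (simp add: b_def Re_mip)
  have speed: "\<kappa> * (norm (Z' t))\<^sup>2 = (1 - s t) - (cmod (b t))\<^sup>2 / (1 - s t)" for t
  proof -
    have "1 = x / r + y / r\<^sup>2 \<Longrightarrow> r > 0 \<Longrightarrow> x = r - y / r" for x y r :: real
      by (simp add: field_simps power2_eq_square)
    moreover have "1 = \<kappa> * (norm (Z' t))\<^sup>2 / (1 - s t) + (cmod (b t))\<^sup>2 / (1 - s t)\<^sup>2"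
      using rank_one_metric[OF c in\<Omega>, of t "\<gamma>' t"] unit[of t] by (simp add: Z_def Z'_def s_def b_def)
    ultimately show ?thesis using s1[of t] by simp
  qed
  have sd: "(s has_real_derivative 2 * Re (b t)) (at t)" for t
  proof -
    have "((\<lambda>t. Z t \<bullet> Z t) has_vector_derivative Z t \<bullet> Z' t + Z' t \<bullet> Z t) (at t)"
      by (rule bounded_bilinear.has_vector_derivative[OF bounded_bilinear_inner D(1) D(1)])
    from DERIV_cmult[OF this[folded has_real_derivative_iff_has_vector_derivative], of \<kappa>]
    show ?thesis by (simp add: s_def[abs_def] power2_norm_eq_inner Reb inner_commute algebra_simps)
  qed
  have sd2: "((\<lambda>t. 2 * Re (b t)) has_real_derivative
      2 * (1 - s t) - (6 * (Re (b t))\<^sup>2 - 2 * (Im (b t))\<^sup>2) / (1 - s t)) (at t)" for t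
  proof -
    define K where "K = (- 2 * b t / of_real (1 - s t)) *\<^sub>C Z' t"
    have "((\<lambda>t. Z' t \<bullet> Z t) has_vector_derivative Z' t \<bullet> Z' t + K \<bullet> Z t) (at t)"
      using bounded_bilinear.has_vector_derivative[OF bounded_bilinear_inner D(2) D(1)] by (simp add: K_def)
    from DERIV_cmult[OF this[folded has_real_derivative_iff_has_vector_derivative], of "2 * \<kappa>"]
    have "((\<lambda>t. 2 * Re (b t)) has_real_derivative 2 * (\<kappa> * (norm (Z' t))\<^sup>2) + 2 * (\<kappa> * (K \<bullet> Z t))) (at t)"
      by (simp add: Reb power2_norm_eq_inner algebra_simps)
    also have "\<kappa> * (K \<bullet> Z t) = Re (of_real \<kappa> * mip K (Z t))" by (simp add: Re_mip)
    also have "of_real \<kappa> * mip K (Z t) = (b t)\<^sup>2 * of_real (- 2 / (1 - s t))"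
      by (simp add: K_def mip_scaleC_left b_def power2_eq_square)
    also have "Re \<dots> = ((Re (b t))\<^sup>2 - (Im (b t))\<^sup>2) * (- 2 / (1 - s t))"
      by (simp add: power2_eq_square)
    also have "2 * (\<kappa> * (norm (Z' t))\<^sup>2) + 2 * (((Re (b t))\<^sup>2 - (Im (b t))\<^sup>2) * (- 2 / (1 - s t)))
        = 2 * (1 - s t) - (6 * (Re (b t))\<^sup>2 - 2 * (Im (b t))\<^sup>2) / (1 - s t)"
    proof -
      have "2 * (r - (x + y) / r) + 2 * ((x - y) * (- 2 / r)) = 2 * r - (6 * x - 2 * y) / r" if "r > 0" for r x y :: real
        using that by (simp add: field_simps)
      then show ?thesis unfolding speed cmod_power2 using s1[of t] by simp
    qed
    finally show ?thesis .
  qed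
  have U: "U = (\<lambda>t. 1 / (1 - s t))" by (simp add: U_def s_def Z_def)
  define U' where "U' t = 2 * Re (b t) / (1 - s t)\<^sup>2" for t
  define U'' where "U'' t = 2 / (1 - s t) + 2 * (cmod (b t))\<^sup>2 / (1 - s t) ^ 3" for t
  show ?thesis
  proof (rule that[of U' U''])
    fix t
    define r where "r = 1 - s t"
    have r: "r > 0" "r \<le> 1" using s1[of t] s0[of t] by (simp_all add: r_def)
    show "(U has_real_derivative U' t) (at t)"
      unfolding U U'_def using r by (auto intro!: derivative_eq_intros sd simp: r_def power2_eq_square)
    have "((\<lambda>t. 2 * Re (b t) / (1 - s t)\<^sup>2) has_real_derivative
        ((2 * r - (6 * (Re (b t))\<^sup>2 - 2 * (Im (b t))\<^sup>2) / r) * r\<^sup>2 - 2 * Re (b t) * (2 * r * (- (2 * Re (b t))))) / (r\<^sup>2 * r\<^sup>2)) (at t)"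
      unfolding r_def
    proof (rule DERIV_divide[OF sd2])
      show "((\<lambda>t. (1 - s t)\<^sup>2) has_real_derivative 2 * (1 - s t) * (- (2 * Re (b t)))) (at t)"
        by (auto intro!: derivative_eq_intros sd)
    qed (use r in \<open>simp add: r_def\<close>)
    also have "((2 * r - (6 * (Re (b t))\<^sup>2 - 2 * (Im (b t))\<^sup>2) / r) * r\<^sup>2 - 2 * Re (b t) * (2 * r * (- (2 * Re (b t))))) / (r\<^sup>2 * r\<^sup>2)
        = U'' t"
      unfolding U''_def cmod_power2 r_def[symmetric] using r
      by (simp add: field_simps power2_eq_square power3_eq_cube)
    finally show "(U' has_real_derivative U'' t) (at t)" unfolding U'_def[abs_def] .
    show "1 \<le> U t" using r by (simp add: U r_def[symmetric])
    have "2 * (1 / r) + (2 * Re (b t) / r\<^sup>2)\<^sup>2 / (2 * (1 / r)) = 2 / r + 2 * (Re (b t))\<^sup>2 / r ^ 3"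
      using r by (simp add: field_simps power2_eq_square power3_eq_cube)
    also have "\<dots> \<le> U'' t"
      unfolding U''_def cmod_power2 r_def[symmetric] using r by (intro add_left_mono divide_right_mono) auto
    finally show "2 * U t + (U' t)\<^sup>2 / (2 * U t) \<le> U'' t" by (simp add: U U'_def r_def[symmetric])
    have "(cmod (b t))\<^sup>2 \<le> s t * (\<kappa> * (norm (Z' t))\<^sup>2)"
    proof -
      have "cmod (b t) \<le> \<kappa> * (norm (Z' t) * norm (Z t))"
        unfolding b_def norm_mult using kappa_pos cmod_mip_le by (auto intro!: mult_left_mono)
      then have "(cmod (b t))\<^sup>2 \<le> (\<kappa> * (norm (Z' t) * norm (Z t)))\<^sup>2" by (intro power_mono) auto
      then show ?thesis by (simp add: s_def power2_eq_square mult_ac)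
    qed
    then have "(cmod (b t))\<^sup>2 \<le> (1 - r) * (r - (cmod (b t))\<^sup>2 / r)" unfolding speed by (simp add: r_def)
    then have "(cmod (b t))\<^sup>2 / r \<le> (1 - r) * r" using r by (simp add: field_simps)
    then have "(cmod (b t))\<^sup>2 / r / r\<^sup>2 \<le> (1 - r) * r / r\<^sup>2" using r by (intro divide_right_mono) auto
    then have "(cmod (b t))\<^sup>2 / r ^ 3 \<le> 1 / r - 1"
      using r by (simp add: power2_eq_square power3_eq_cube diff_divide_distrib mult.assoc)
    then show "U'' t \<le> 4 * U t - 2" by (simp add: U U''_def r_def[symmetric])
    show "U' t = 0" if "\<Phi> (\<gamma> t) = 0" using that by (simp add: U'_def b_def Z_def)
  qed
qed

text \<open>On a flat the radial comparison forces u to be the square of cosh of the Euclidean norm.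
  Along a line at distance 1 from the centre this function is less convex than
  \<open>geodesic_convexity\<close> demands, as \<open>sinh 1 < cosh 1\<close>.\<close>

lemma no_flat_plane:
  assumes flat: "flat_on \<Omega> g V \<phi>" shows "dim V \<le> 1"
proof (rule ccontr)
  assume "\<not> dim V \<le> 1"
  have sub: "subspace V" using flat by (simp add: flat_on_def)
  obtain B where B: "B \<subseteq> V" "pairwise orthogonal B" "\<And>x. x \<in> B \<Longrightarrow> norm x = 1" "card B = dim V"
    using orthonormal_basis_subspace[OF sub] by metis
  then have "\<not> card B \<le> Suc 0" using \<open>\<not> dim V \<le> 1\<close> by simp
  moreover have "finite B" using calculation card.infinite by fastforce
  ultimately obtain v w where "v \<in> B" "w \<in> B" "v \<noteq> w" by (auto simp: card_le_Suc0_iff_eq)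
  then have vw: "v \<in> V" "w \<in> V" "norm v = 1" "norm w = 1" "v \<bullet> w = 0"
    using B by (auto simp: pairwise_def orthogonal_def)
  have line: "\<exists>\<gamma>' \<gamma>''. (\<forall>t. ((\<lambda>t. \<phi> (a + t *\<^sub>R e)) has_vector_derivative \<gamma>' t) (at t) \<and>
      (\<gamma>' has_vector_derivative \<gamma>'' t) (at t) \<and> \<gamma>'' t + christoffel g (\<phi> (a + t *\<^sub>R e)) (\<gamma>' t) (\<gamma>' t) = 0 \<and>
      \<phi> (a + t *\<^sub>R e) \<in> \<Omega> \<and> Re (herm (g (\<phi> (a + t *\<^sub>R e))) (\<gamma>' t) (\<gamma>' t)) = 1)"
    if "a \<in> V" "e \<in> V" "norm e = 1" for a e
  proof -
    have "geodesic \<Omega> g (\<lambda>t. \<phi> (a + t *\<^sub>R e))" and sp: "\<And>t. let c' = vector_derivative (\<lambda>t. \<phi> (a + t *\<^sub>R e)) (at t)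
             in Re (herm (g (\<phi> (a + t *\<^sub>R e))) c' c') = (norm e)\<^sup>2"
      using flat that(1,2) unfolding flat_on_def by blast+
    then obtain \<gamma>' \<gamma>'' where c: "\<forall>t. ((\<lambda>t. \<phi> (a + t *\<^sub>R e)) has_vector_derivative \<gamma>' t) (at t) \<and>
      (\<gamma>' has_vector_derivative \<gamma>'' t) (at t) \<and> \<gamma>'' t + christoffel g (\<phi> (a + t *\<^sub>R e)) (\<gamma>' t) (\<gamma>' t) = 0"
      and "range (\<lambda>t. \<phi> (a + t *\<^sub>R e)) \<subseteq> \<Omega>" unfolding geodesic_def by blast
    moreover have "vector_derivative (\<lambda>t. \<phi> (a + t *\<^sub>R e)) (at t) = \<gamma>' t" for t
      using c by (intro vector_derivative_at) blast
    ultimately show ?thesis using sp that(3) by (intro exI[of _ \<gamma>'] exI[of _ \<gamma>'']) (auto simp: Let_def)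
  qed
  have V0: "0 \<in> V" by (rule subspace_0[OF sub])
  have "\<phi> (0 + 0 *\<^sub>R v) \<in> \<Omega>" using line[OF V0 vw(1,3)] by (elim exE) blast
  then have "\<phi> 0 \<in> \<Omega>" by simp
  obtain c \<Phi>\<^sub>0 where "c > 0" "chart c \<Phi>\<^sub>0" by (rule ex_chart)
  then have "chart 1 \<Phi>\<^sub>0" using chart_constant[of c \<Phi>\<^sub>0] by simp
  obtain A B' C E where "frac A B' C E (\<Phi>\<^sub>0 (\<phi> 0)) = 0" "chart 1 (\<lambda>y. frac A B' C E (\<Phi>\<^sub>0 y))"
    by (rule chart_at[OF \<open>chart 1 \<Phi>\<^sub>0\<close> \<open>\<phi> 0 \<in> \<Omega>\<close>])
  then obtain \<Phi> where \<Phi>: "chart 1 \<Phi>" "\<Phi> (\<phi> 0) = 0" by blast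
  define u where "u y = 1 / (1 - \<kappa> * (norm (\<Phi> (\<phi> y)))\<^sup>2)" for y
  have radial: "u (t *\<^sub>R e) = (cosh t)\<^sup>2" if e: "e \<in> V" "norm e = 1" and t: "0 \<le> t" for e t
  proof -
    obtain \<gamma>' \<gamma>'' where l: "\<forall>t. ((\<lambda>t. \<phi> (0 + t *\<^sub>R e)) has_vector_derivative \<gamma>' t) (at t) \<and>
      (\<gamma>' has_vector_derivative \<gamma>'' t) (at t) \<and> \<gamma>'' t + christoffel g (\<phi> (0 + t *\<^sub>R e)) (\<gamma>' t) (\<gamma>' t) = 0 \<and>
      \<phi> (0 + t *\<^sub>R e) \<in> \<Omega> \<and> Re (herm (g (\<phi> (0 + t *\<^sub>R e))) (\<gamma>' t) (\<gamma>' t)) = 1"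
      using line[OF V0 e] by (elim exE)
    obtain U' U'' where
      U: "\<And>t. ((\<lambda>t. u (0 + t *\<^sub>R e)) has_real_derivative U' t) (at t)" "\<And>t. (U' has_real_derivative U'' t) (at t)"
      "\<And>t. 1 \<le> u (0 + t *\<^sub>R e)" "\<And>t. 2 * u (0 + t *\<^sub>R e) + (U' t)\<^sup>2 / (2 * u (0 + t *\<^sub>R e)) \<le> U'' t"
      "\<And>t. U'' t \<le> 4 * u (0 + t *\<^sub>R e) - 2" "\<And>t. \<Phi> (\<phi> (0 + t *\<^sub>R e)) = 0 \<Longrightarrow> U' t = 0"
    proof (rule geodesic_convexity[OF \<Phi>(1), of "\<lambda>t. \<phi> (0 + t *\<^sub>R e)" \<gamma>' \<gamma>'', folded u_def])
      fix t
      show "((\<lambda>t. \<phi> (0 + t *\<^sub>R e)) has_vector_derivative \<gamma>' t) (at t)" "(\<gamma>' has_vector_derivative \<gamma>'' t) (at t)"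
        "\<gamma>'' t + christoffel g (\<phi> (0 + t *\<^sub>R e)) (\<gamma>' t) (\<gamma>' t) = 0" "\<phi> (0 + t *\<^sub>R e) \<in> \<Omega>"
        "Re (herm (g (\<phi> (0 + t *\<^sub>R e))) (\<gamma>' t) (\<gamma>' t)) = 1" using l by blast+
    next
      fix U' U''
      assume "\<And>t. ((\<lambda>t. u (0 + t *\<^sub>R e)) has_real_derivative U' t) (at t)" "\<And>t. (U' has_real_derivative U'' t) (at t)"
      "\<And>t. 1 \<le> u (0 + t *\<^sub>R e)" "\<And>t. 2 * u (0 + t *\<^sub>R e) + (U' t)\<^sup>2 / (2 * u (0 + t *\<^sub>R e)) \<le> U'' t"
      "\<And>t. U'' t \<le> 4 * u (0 + t *\<^sub>R e) - 2" "\<And>t. \<Phi> (\<phi> (0 + t *\<^sub>R e)) = 0 \<Longrightarrow> U' t = 0"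
      then show thesis by (rule that)
    qed
    have "u (0 + t *\<^sub>R e) = (cosh t)\<^sup>2"
      by (rule cosh_square_comparison[OF U(1-5) _ _ t]) (use U(6)[of 0] \<Phi>(2) in \<open>simp_all add: u_def\<close>)
    then show ?thesis by simp
  qed
  have all: "u (v + \<tau> *\<^sub>R w) = (cosh (sqrt (1 + \<tau>\<^sup>2)))\<^sup>2" for \<tau>
  proof -
    have V: "v + \<tau> *\<^sub>R w \<in> V" using sub vw by (simp add: subspace_add subspace_mul)
    have "(norm (v + \<tau> *\<^sub>R w))\<^sup>2 = 1 + \<tau>\<^sup>2"
    proof -
      have "(v + \<tau> *\<^sub>R w) \<bullet> (v + \<tau> *\<^sub>R w) = v \<bullet> v + 2 * \<tau> * (v \<bullet> w) + \<tau>\<^sup>2 * (w \<bullet> w)"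
        by (simp add: inner_simps inner_commute[of w v] power2_eq_square algebra_simps)
      moreover have "v \<bullet> v = 1" "w \<bullet> w = 1" using vw by (simp_all add: norm_eq_1)
      ultimately show ?thesis using vw(5) by (simp add: power2_norm_eq_inner)
    qed
    then have n: "norm (v + \<tau> *\<^sub>R w) = sqrt (1 + \<tau>\<^sup>2)" by (metis norm_ge_zero real_sqrt_unique)
    define r where "r = sqrt (1 + \<tau>\<^sup>2)"
    have r: "r > 0" unfolding r_def by (simp add: add_pos_nonneg)
    have "u (r *\<^sub>R ((1 / r) *\<^sub>R (v + \<tau> *\<^sub>R w))) = (cosh r)\<^sup>2"
      using r n by (intro radial subspace_mul[OF sub V]) (simp_all add: r_def)
    then show ?thesis using r by (simp add: r_def)
  qed
  obtain \<gamma>' \<gamma>'' where l: "\<forall>t. ((\<lambda>t. \<phi> (v + t *\<^sub>R w)) has_vector_derivative \<gamma>' t) (at t) \<and>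
      (\<gamma>' has_vector_derivative \<gamma>'' t) (at t) \<and> \<gamma>'' t + christoffel g (\<phi> (v + t *\<^sub>R w)) (\<gamma>' t) (\<gamma>' t) = 0 \<and>
      \<phi> (v + t *\<^sub>R w) \<in> \<Omega> \<and> Re (herm (g (\<phi> (v + t *\<^sub>R w))) (\<gamma>' t) (\<gamma>' t)) = 1"
      using line[OF vw(1,2,4)] by (elim exE)
    obtain U' U'' where
      U: "\<And>t. ((\<lambda>t. u (v + t *\<^sub>R w)) has_real_derivative U' t) (at t)" "\<And>t. (U' has_real_derivative U'' t) (at t)"
      "\<And>t. 1 \<le> u (v + t *\<^sub>R w)" "\<And>t. 2 * u (v + t *\<^sub>R w) + (U' t)\<^sup>2 / (2 * u (v + t *\<^sub>R w)) \<le> U'' t"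
      "\<And>t. U'' t \<le> 4 * u (v + t *\<^sub>R w) - 2" "\<And>t. \<Phi> (\<phi> (v + t *\<^sub>R w)) = 0 \<Longrightarrow> U' t = 0"
    proof (rule geodesic_convexity[OF \<Phi>(1), of "\<lambda>t. \<phi> (v + t *\<^sub>R w)" \<gamma>' \<gamma>'', folded u_def])
      fix t
      show "((\<lambda>t. \<phi> (v + t *\<^sub>R w)) has_vector_derivative \<gamma>' t) (at t)" "(\<gamma>' has_vector_derivative \<gamma>'' t) (at t)"
        "\<gamma>'' t + christoffel g (\<phi> (v + t *\<^sub>R w)) (\<gamma>' t) (\<gamma>' t) = 0" "\<phi> (v + t *\<^sub>R w) \<in> \<Omega>"
        "Re (herm (g (\<phi> (v + t *\<^sub>R w))) (\<gamma>' t) (\<gamma>' t)) = 1" using l by blast+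
    next
      fix U' U''
      assume "\<And>t. ((\<lambda>t. u (v + t *\<^sub>R w)) has_real_derivative U' t) (at t)" "\<And>t. (U' has_real_derivative U'' t) (at t)"
      "\<And>t. 1 \<le> u (v + t *\<^sub>R w)" "\<And>t. 2 * u (v + t *\<^sub>R w) + (U' t)\<^sup>2 / (2 * u (v + t *\<^sub>R w)) \<le> U'' t"
      "\<And>t. U'' t \<le> 4 * u (v + t *\<^sub>R w) - 2" "\<And>t. \<Phi> (\<phi> (v + t *\<^sub>R w)) = 0 \<Longrightarrow> U' t = 0"
      then show thesis by (rule that)
    qed
  have p: "0 < 1 + \<tau>\<^sup>2" for \<tau> :: real by (simp add: add_pos_nonneg)
  have U': "U' \<tau> = 2 * cosh (sqrt (1 + \<tau>\<^sup>2)) * sinh (sqrt (1 + \<tau>\<^sup>2)) * (\<tau> / sqrt (1 + \<tau>\<^sup>2))" for \<tau>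
  proof (rule DERIV_unique[OF U(1)])
    show "((\<lambda>t. u (v + t *\<^sub>R w)) has_real_derivative
        2 * cosh (sqrt (1 + \<tau>\<^sup>2)) * sinh (sqrt (1 + \<tau>\<^sup>2)) * (\<tau> / sqrt (1 + \<tau>\<^sup>2))) (at \<tau>)"
      unfolding all using p[of \<tau>] by (auto intro!: derivative_eq_intros simp: field_simps)
  qed
  have "(U' has_real_derivative 2 * cosh 1 * sinh 1) (at 0)"
    unfolding U'[abs_def] by (auto intro!: derivative_eq_intros)
  then have "U'' 0 = 2 * cosh 1 * sinh 1" using DERIV_unique[OF U(2)] by blast
  \<comment> \<open>At the foot point of the perpendicular U' vanishes, so the lower convexity bound
    reduces to twice the value of u.\<close>
  moreover have "2 * (cosh 1)\<^sup>2 \<le> U'' 0" using U(4)[of 0] all[of 0] U'[of 0] by simp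
  ultimately have "cosh 1 * cosh 1 \<le> cosh 1 * sinh (1::real)" by (simp add: power2_eq_square)
  moreover have "cosh 1 - sinh (1::real) > 0" by (simp add: cosh_minus_sinh)
  ultimately show False by (simp add: mult_le_cancel_left)
qed

text \<open>A constant map shows that dimension 0 occurs, so \<open>Max\<close> is taken over a
  nonempty finite set and is attained.\<close>

lemma rank_le_1: "rank_of \<Omega> g \<le> 1"
proof -
  obtain c \<Phi> where "chart c \<Phi>" by (rule ex_chart)
  then have "bij_betw \<Phi> \<Omega> \<D>" by (simp add: chart_def biholomorphism_def)
  moreover have "0 \<in> \<D>" using W_zero by simp
  ultimately obtain x where x: "x \<in> \<Omega>" by (metis bij_betw_iff_bijections)
  have "flat_on \<Omega> g {0} (\<lambda>_. x)"
    unfolding flat_on_def geodesic_def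
    using x by (auto simp: subspace_def herm_def christoffel_def vec_eq_iff intro!: exI[of _ "\<lambda>_. 0"])
  moreover have "dim ({0} :: (complex^'n) set) = 0" by simp
  ultimately have "0 \<in> {dim V | V. \<exists>\<phi>. flat_on \<Omega> g V \<phi>}" by (metis (mono_tags, lifting) mem_Collect_eq)
  moreover have "{dim V | V. \<exists>\<phi>. flat_on \<Omega> g V \<phi>} \<subseteq> {..1}" using no_flat_plane by auto
  ultimately show ?thesis unfolding rank_of_def
    by (metis (no_types, lifting) Max_in atMost_iff empty_iff finite_atMost finite_subset subsetD)
qed

end

section \<open>Matrix units and irreducibility for type I\<close>

definition tensor :: "complex^'p \<Rightarrow> complex^'q \<Rightarrow> complex^'q^'p" where
  "tensor u w = (\<chi> i j. u $ i * w $ j)"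

lemma mult_tensor: "U ** tensor u w ** V = tensor (U *v u) (transpose V *v w)"
  by (simp add: vec_eq_iff tensor_def matrix_matrix_mult_def matrix_vector_mult_def transpose_def
      sum_distrib_left sum_distrib_right mult_ac) (intro allI, rule sum.swap)

lemma tensor_scaleC: "tensor (a *\<^sub>C u) w = a *\<^sub>C tensor u w" "tensor u (a *\<^sub>C w) = a *\<^sub>C tensor u w"
  by (simp_all add: vec_eq_iff tensor_def scaleC_complex_def mult_ac)

lemma tensor_add: "tensor (u + v) w = tensor u w + tensor v w" "tensor w (u + v) = tensor w u + tensor w v"
  by (simp_all add: vec_eq_iff tensor_def algebra_simps)

lemma cip_axis: "cip (axis i 1) (axis j 1) = (if i = j then 1 else 0)"
proof -
  have "axis i 1 $ k * cnj (axis j 1 $ k) = (if k = i then if i = j then 1 else 0 else 0 :: complex)" for k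
    by (auto simp: axis_def)
  then show ?thesis by (simp add: cip_def)
qed

lemma mip_tensor: "mip (tensor u w) (tensor u' w') = cip u u' * cip w w'"
  by (simp add: mip_def cip_def tensor_def sum_distrib_left sum_distrib_right mult_ac)

lemma tensor_expand: "X = (\<Sum>i\<in>UNIV. \<Sum>j\<in>UNIV. (X $ i $ j) *\<^sub>C tensor (axis i 1) (axis j 1))"
proof -
  have "(\<Sum>i\<in>UNIV. \<Sum>j\<in>UNIV. X $ i $ j * (axis i 1 $ k * axis j 1 $ l)) = X $ k $ l" for k l
  proof -
    have "(\<Sum>j\<in>UNIV. X $ i $ j * (axis i 1 $ k * axis j 1 $ l)) = (if i = k then X $ k $ l else 0)" for i
    proof -
      have "X $ i $ j * (axis i 1 $ k * axis j 1 $ l) = (if l = j then if i = k then X $ k $ l else 0 else 0)" for j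
        by (auto simp: axis_def)
      then show ?thesis by simp
    qed
    then show ?thesis by simp
  qed
  then show ?thesis by (simp add: vec_eq_iff tensor_def scaleC_complex_def)
qed

lemma sesquilinear_zero:
  fixes d :: "complex^'q^'p \<Rightarrow> complex^'q^'p \<Rightarrow> complex"
  assumes add: "\<And>X Y Z. d (X + Y) Z = d X Z + d Y Z" and sc: "\<And>a X Y. d (a *\<^sub>C X) Y = a * d X Y"
    and comm: "\<And>X Y. d X Y = cnj (d Y X)"
    and basis: "\<And>i j k l. d (tensor (axis i 1) (axis j 1)) (tensor (axis k 1) (axis l 1)) = 0"
  shows "d X Y = 0"
proof -
  have zero: "d 0 Y = 0" for Y using sc[of 0 0 Y] by simp
  have sum: "d (sum f S) Y = (\<Sum>i\<in>S. d (f i) Y)" if "finite S" for f :: "'x \<Rightarrow> _" and S Y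
    using that by (induction S) (simp_all add: zero add)
  have *: "d X Y = 0" if "\<And>i j. d (tensor (axis i 1) (axis j 1)) Y = 0" for X Y
    by (subst tensor_expand[of X]) (simp add: sum sc that)
  show ?thesis
  proof (rule *)
    fix i j
    have "d Y (tensor (axis i 1) (axis j 1)) = 0" by (rule *) (rule basis)
    then show "d (tensor (axis i 1) (axis j 1)) Y = 0" using comm[of "tensor (axis i 1) (axis j 1)" Y] by simp
  qed
qed

lemma ex_unitary:
  fixes f :: "'n::finite \<Rightarrow> complex^'n"
  assumes "\<And>i j. cip (f i) (f j) = (if i = j then 1 else 0)"
  obtains U :: "complex^'n^'n" where "adjoint_mat U ** U = mat 1" "\<forall>i. U *v axis i 1 = f i"
proof (rule that[of "\<chi> k l. f l $ k"])
  have "(\<Sum>k\<in>UNIV. cnj (f i $ k) * f j $ k) = (if i = j then 1 else 0)" for i j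
    using assms[of j i] by (auto simp: cip_def mult.commute)
  then show "adjoint_mat (\<chi> k l. f l $ k) ** (\<chi> k l. f l $ k) = mat 1"
    by (simp add: vec_eq_iff matrix_matrix_mult_def mat_def)
  show "\<forall>i. (\<chi> k l. f l $ k) *v axis i 1 = f i"
    by (simp add: vec_eq_iff matrix_vector_mult_def axis_def if_distrib cong: if_cong)
qed

text \<open>Phases, transpositions and a rotation by 45 degrees are the unitary matrices from which
  the irreducibility proofs draw: they separate matrix units, identify them with each other, and
  relate diagonal to off-diagonal ones.\<close>

lemma ex_phase:
  obtains U :: "complex^'n^'n" where "adjoint_mat U ** U = mat 1"
    "\<forall>i. U *v axis i 1 = (if i = x then \<i> else 1) *\<^sub>C axis i 1"
  by (rule ex_unitary[of "\<lambda>i. (if i = x then \<i> else 1) *\<^sub>C axis i 1"])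
    (auto simp: cip_scaleC_left cip_scaleC_right cip_axis split: if_splits)

lemma ex_transposition:
  obtains U :: "complex^'n^'n" where "adjoint_mat U ** U = mat 1"
    "\<forall>i. U *v axis i 1 = axis (if i = a then b else if i = b then a else i) 1"
  by (rule ex_unitary[of "\<lambda>i. axis (if i = a then b else if i = b then a else i) 1"])
    (auto simp: cip_axis split: if_splits)

lemma ex_rotation:
  fixes a b :: "'n::finite"
  assumes ab: "a \<noteq> b"
  obtains U :: "complex^'n^'n" where "adjoint_mat U ** U = mat 1"
    "U *v axis a 1 = of_real (1 / sqrt 2) *\<^sub>C (axis a 1 + axis b 1)"
proof -
  define r where "r = complex_of_real (1 / sqrt 2)"
  have "1 / sqrt 2 * (1 / sqrt 2) = (1 / 2 :: real)" by simp
  then have "r * r = of_real (1 / 2)" unfolding r_def of_real_mult[symmetric] by (rule arg_cong)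
  then have r: "cnj r = r" "r * r + r * r = 1" by (simp_all add: r_def)
  define f :: "'n \<Rightarrow> complex^'n" where "f i = (if i = a then r *\<^sub>C (axis a 1 + axis b 1) else if i = b then r *\<^sub>C (axis a 1 - axis b 1) else axis i 1)" for i
  have "cip (f i) (f j) = (if i = j then 1 else 0)" for i j
    using ab r unfolding f_def
    by (auto simp: cip_scaleC_left cip_scaleC_right cip_add_left cip_add_right cip_diff_left cip_diff_right cip_axis algebra_simps)
  then obtain U :: "complex^'n^'n" where "adjoint_mat U ** U = mat 1" "\<forall>i. U *v axis i 1 = f i"
    by (rule ex_unitary)
  then show ?thesis using that[of U] by (simp add: f_def r_def)
qed

lemma transpose_unitary:
  assumes "adjoint_mat U ** U = (mat 1 :: complex^'n^'n)"
  shows "transpose U ** adjoint_mat (transpose U) = mat 1"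
proof -
  have "transpose (adjoint_mat U) = adjoint_mat (transpose U)" by (simp add: vec_eq_iff transpose_def)
  then show ?thesis using arg_cong[OF assms, of transpose] by (simp add: matrix_transpose_mul transpose_mat)
qed

lemma unit_tripotent:
  "tensor (axis i 1) (axis j 1) ** adjoint_mat (tensor (axis i 1) (axis j 1)) ** tensor (axis i 1) (axis j 1) = tensor (axis i 1) (axis j 1)"
  "norm (tensor (axis i 1 :: complex^'p) (axis j 1 :: complex^'q)) = 1"
proof -
  have 1: "axis i 1 $ k * axis i 1 $ k = (axis i 1 $ k :: complex)" for i k :: "'n::finite" by (simp add: axis_def)
  have a: "adjoint_mat (tensor (axis i 1) (axis j 1)) = tensor (axis j 1) (axis i 1 :: complex^'x)" for i :: "'x::finite" and j :: "'y::finite"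
    by (simp add: vec_eq_iff tensor_def axis_def)
  have m: "A ** tensor u w = tensor (A *v u) w" for A :: "complex^'x^'y" and u and w :: "complex^'z"
    using mult_tensor[of A u w "mat 1"] by (simp add: transpose_mat)
  have v: "tensor u (axis k 1) *v axis k 1 = u" for u :: "complex^'x" and k :: "'y::finite"
    by (simp add: vec_eq_iff tensor_def matrix_vector_mult_def axis_def if_distrib if_distribR cong: if_cong)
  show "tensor (axis i 1) (axis j 1) ** adjoint_mat (tensor (axis i 1) (axis j 1)) ** tensor (axis i 1) (axis j 1) = tensor (axis i 1) (axis j 1)"
    unfolding a m v ..
  have "complex_of_real ((norm (tensor (axis i 1 :: complex^'p) (axis j 1 :: complex^'q)))\<^sup>2) = 1"
    unfolding mip_self[symmetric] mip_tensor by (simp add: cip_axis)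
  then have "(norm (tensor (axis i 1 :: complex^'p) (axis j 1 :: complex^'q)))\<^sup>2 = 1"
    by (simp only: of_real_eq_1_iff)
  then show "norm (tensor (axis i 1 :: complex^'p) (axis j 1 :: complex^'q)) = 1"
    by (metis norm_ge_zero one_power2 power2_eq_iff_nonneg zero_le_one)
qed

lemma norm_matvec_power2_le: "(norm (Z *v v))\<^sup>2 \<le> 1 * (norm Z)\<^sup>2 * (norm (v :: complex^'q))\<^sup>2"
  using power_mono[OF norm_matvec_le[of Z v], of 2] by (simp add: power_mult_distrib)

lemma ex_moebius_frac:
  fixes Z :: "complex^'q^'p"
  assumes Z: "Z \<in> D_I"
  shows "\<exists>A B C E. pseudo_unitary A B C E \<and> frac A B C E Z = 0"
proof -
  obtain P :: "complex^'p^'p" and S :: "complex^'q^'q"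
    where P: "P ** (mat 1 - Z ** adjoint_mat Z) ** adjoint_mat P = mat 1"
      and S: "S ** (mat 1 - adjoint_mat Z ** Z) ** adjoint_mat S = mat 1" by (rule ex_moebius[OF Z])
  have "pseudo_unitary P (- (P ** Z)) (- (S ** adjoint_mat Z)) S" by (rule pseudo_unitary_moebius[OF P S])
  moreover have "frac P (- (P ** Z)) (- (S ** adjoint_mat Z)) S Z = 0" by (rule frac_moebius_zero)
  ultimately show ?thesis by (intro exI conjI)
qed

lemma ex_unit_tripotent: "\<exists>E\<in>UNIV. E ** adjoint_mat E ** E = (E :: complex^'q^'p) \<and> 1 * (norm E)\<^sup>2 = 1"
  by (rule bexI[of _ "tensor (axis undefined 1) (axis undefined 1)"]) (simp_all only: unit_tripotent one_power2 mult_1 UNIV_I)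

text \<open>A phase on one row or column multiplies the product of two distinct units by i, so it
  vanishes; row and column transpositions equate all squared lengths.\<close>

lemma irreducible_I:
  fixes \<beta> :: "complex^'q^'p \<Rightarrow> complex^'q^'p \<Rightarrow> complex"
  assumes add: "\<And>X Y Z. \<beta> (X + Y) Z = \<beta> X Z + \<beta> Y Z"
    and sc: "\<And>a X Y. \<beta> (a *\<^sub>C X) Y = a * \<beta> X Y"
    and comm: "\<And>X Y. \<beta> X Y = cnj (\<beta> Y X)"
    and inv: "\<And>U V X Y. adjoint_mat U ** U = mat 1 \<Longrightarrow> V ** adjoint_mat V = mat 1 \<Longrightarrow>
          \<beta> (U ** X ** V) (U ** Y ** V) = \<beta> X Y"
  shows "\<exists>c. \<forall>X Y. \<beta> X Y = c * mip X Y"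
proof -
  define e where "e i j = tensor (axis i 1 :: complex^'p) (axis j 1 :: complex^'q)" for i j
  have inv': "\<beta> (tensor (U *v u) (V *v w)) (tensor (U *v u') (V *v w')) = \<beta> (tensor u w) (tensor u' w')"
    if "adjoint_mat U ** U = mat 1" "adjoint_mat V ** V = mat 1" for U V u w u' w'
    using inv[OF that(1) transpose_unitary[OF that(2)], of "tensor u w" "tensor u' w'"] by (simp add: mult_tensor)
  have one: "adjoint_mat (mat 1) ** mat 1 = (mat 1 :: complex^'x^'x)" by simp
  have row: "\<beta> (e i j) (e k l) = 0" if "i \<noteq> k" for i j k l
  proof -
    obtain U :: "complex^'p^'p" where U: "adjoint_mat U ** U = mat 1"
      "\<forall>m. U *v axis m 1 = (if m = i then \<i> else 1) *\<^sub>C axis m 1"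
      by (rule ex_phase[of i])
    have eq: "U *v axis i 1 = \<i> *\<^sub>C axis i 1" "U *v axis k 1 = axis k 1" using U(2) that by auto
    have "\<i> * \<beta> (e i j) (e k l) = \<beta> (e i j) (e k l)"
      using inv'[OF U(1) one, of "axis i 1" "axis j 1" "axis k 1" "axis l 1"]
      unfolding eq matrix_vector_mul_lid tensor_scaleC e_def[symmetric] by (simp add: sc)
    then show ?thesis by (simp add: complex_eq_iff)
  qed
  have col: "\<beta> (e i j) (e k l) = 0" if "j \<noteq> l" for i j k l
  proof -
    obtain V :: "complex^'q^'q" where V: "adjoint_mat V ** V = mat 1"
      "\<forall>m. V *v axis m 1 = (if m = j then \<i> else 1) *\<^sub>C axis m 1"
      by (rule ex_phase[of j])
    have eq: "V *v axis j 1 = \<i> *\<^sub>C axis j 1" "V *v axis l 1 = axis l 1" using V(2) that by auto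
    have "\<i> * \<beta> (e i j) (e k l) = \<beta> (e i j) (e k l)"
      using inv'[OF one V(1), of "axis i 1" "axis j 1" "axis k 1" "axis l 1"]
      unfolding eq matrix_vector_mul_lid tensor_scaleC e_def[symmetric] by (simp add: sc)
    then show ?thesis by (simp add: complex_eq_iff)
  qed
  have diag: "\<beta> (e i j) (e i j) = \<beta> (e k l) (e k l)" for i j k l
  proof -
    obtain U :: "complex^'p^'p" where U: "adjoint_mat U ** U = mat 1" "\<forall>m. U *v axis m 1 = axis (if m = i then k else if m = k then i else m) 1"
      by (rule ex_transposition[of i k])
    obtain V :: "complex^'q^'q" where V: "adjoint_mat V ** V = mat 1" "\<forall>m. V *v axis m 1 = axis (if m = j then l else if m = l then j else m) 1"
      by (rule ex_transposition[of j l])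
    have eq: "U *v axis i 1 = axis k 1" "V *v axis j 1 = axis l 1" using U(2) V(2) by auto
    show ?thesis using inv'[OF U(1) V(1), of "axis i 1" "axis j 1" "axis i 1" "axis j 1"]
      unfolding eq e_def[symmetric] by (rule sym)
  qed
  define c where "c = \<beta> (e undefined undefined) (e undefined undefined)"
  have c: "\<beta> (e i j) (e i j) = c" for i j unfolding c_def by (rule diag)
  have "cnj c = c" unfolding c_def by (rule comm[symmetric])
  have "\<beta> X Y - c * mip X Y = 0" for X Y
  proof (rule sesquilinear_zero[of "\<lambda>X Y. \<beta> X Y - c * mip X Y"])
    fix X Y Z :: "complex^'q^'p" and a i j k l
    show "\<beta> (X + Y) Z - c * mip (X + Y) Z = \<beta> X Z - c * mip X Z + (\<beta> Y Z - c * mip Y Z)"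
      by (simp add: add mip_add_left algebra_simps)
    show "\<beta> (a *\<^sub>C X) Y - c * mip (a *\<^sub>C X) Y = a * (\<beta> X Y - c * mip X Y)"
      by (simp add: sc mip_scaleC_left algebra_simps)
    show "\<beta> X Y - c * mip X Y = cnj (\<beta> Y X - c * mip Y X)"
      using \<open>cnj c = c\<close> by (subst comm, subst mip_commute) simp
    have "\<beta> (e i j) (e k l) = c * mip (e i j) (e k l)"
    proof (cases "i = k \<and> j = l")
      case True
      then show ?thesis using c[of i j] by (simp add: mip_tensor cip_axis e_def)
    next
      case False
      then have "\<beta> (e i j) (e k l) = 0" using row[of i k j l] col[of j l i k] by blast
      with False show ?thesis by (auto simp: mip_tensor cip_axis e_def)
    qed
    then show "\<beta> (tensor (axis i 1) (axis j 1)) (tensor (axis k 1) (axis l 1)) - c * mip (tensor (axis i 1) (axis j 1)) (tensor (axis k 1) (axis l 1)) = 0"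
      by (simp add: e_def)
  qed
  then show ?thesis by (intro exI[of _ c]) simp
qed

lemma cartan_domain_I: "cartan_domain (UNIV :: (complex^'q^'p) set) 1"
proof (rule cartan_domain.intro, goal_cases)
  case (5 Z v)
  show ?case by (rule norm_matvec_power2_le)
next
  case 6
  show ?case by (rule ex_unit_tripotent)
next
  case (7 Z)
  then have "Z \<in> D_I" by (rule IntD2)
  from ex_moebius_frac[OF this] show ?case by simp
next
  case (8 \<beta>)
  have "\<exists>c. \<forall>X Y. \<beta> X Y = c * mip X Y"
  proof (rule irreducible_I)
    fix X Y Z a
    show "\<beta> (X + Y) Z = \<beta> X Z + \<beta> Y Z" by (rule 8(1)[OF UNIV_I UNIV_I UNIV_I])
    show "\<beta> (a *\<^sub>C X) Y = a * \<beta> X Y" by (rule 8(2)[OF UNIV_I UNIV_I])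
    show "\<beta> X Y = cnj (\<beta> Y X)" by (rule 8(3)[OF UNIV_I UNIV_I])
    show "\<beta> (U ** X ** V) (U ** Y ** V) = \<beta> X Y"
      if "adjoint_mat U ** U = mat 1" "V ** adjoint_mat V = mat 1" for U V
      by (rule 8(4)[OF that _ _ UNIV_I UNIV_I]) (rule ballI UNIV_I)+
  qed
  then show ?case by blast
qed (rule UNIV_I zero_less_one)+

section \<open>Symmetric and skew matrices: types II and III\<close>

lemma transpose_linear:
  "transpose (A + B) = transpose A + transpose (B :: complex^'q^'p)"
  "transpose (A - B) = transpose A - transpose (B :: complex^'q^'p)"
  "transpose (- A) = - transpose (A :: complex^'q^'p)"
  "transpose (a *\<^sub>C A) = a *\<^sub>C transpose (A :: complex^'q^'p)"
  by (simp_all add: vec_eq_iff transpose_def)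

lemma transpose_adjoint: "transpose (adjoint_mat A) = adjoint_mat (transpose A)"
  by (simp add: vec_eq_iff transpose_def)

lemma transpose_tensor: "transpose (tensor u w) = tensor w u"
  by (simp add: vec_eq_iff transpose_def tensor_def)

lemma mip_tensor_right: "mip Z (tensor u w) = cip (Z *v (\<chi> j. cnj (w $ j))) u"
  by (simp add: mip_def cip_def tensor_def matrix_vector_mult_def sum_distrib_left sum_distrib_right mult_ac)

lemma mip_transpose: "mip (transpose X) (transpose Y) = mip X Y"
  by (simp add: mip_def cip_def transpose_def) (rule sum.swap)

lemma unit_mult: "tensor (axis i 1) (axis j 1) ** tensor (axis k 1) w = (if j = k then tensor (axis i 1) w else 0)"
proof -
  have v: "tensor u (axis j 1) *v axis k 1 = (if j = k then u else 0)" for u :: "complex^'x"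
  proof -
    have "u $ i * axis j 1 $ m * axis k 1 $ m = (if m = k then if j = k then u $ i else 0 else 0)" for i m
      by (auto simp: axis_def)
    then show ?thesis by (simp add: vec_eq_iff tensor_def matrix_vector_mult_def)
  qed
  have m: "A ** tensor u w = tensor (A *v u) w" for A :: "complex^'x^'y" and u
    using mult_tensor[of A u w "mat 1"] by (simp add: transpose_mat)
  have z: "tensor 0 w = 0" by (simp add: vec_eq_iff tensor_def)
  show ?thesis by (simp add: m v z)
qed

text \<open>Pairing Z with the antisymmetrization of a rank one matrix M doubles the value of the
  pairing, while the squared norm at most doubles, because M and its transpose have nonnegative
  product. Cauchy--Schwarz then gains the factor 1/2.\<close>

lemma skew_norm_le:
  fixes Z :: "complex^'m^'m"
  assumes Z: "transpose Z = - Z"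
  shows "(norm (Z *v v))\<^sup>2 \<le> 1/2 * (norm Z)\<^sup>2 * (norm v)\<^sup>2"
proof (cases "Z *v v = 0")
  case False
  define y where "y = Z *v v"
  define M where "M = tensor y (\<chi> j. cnj (v $ j))"
  have 1: "mip Z M = of_real ((norm y)\<^sup>2)"
    unfolding M_def mip_tensor_right cip_self[symmetric] y_def by simp
  have "mip Z (transpose M) = mip (transpose Z) M"
    using mip_transpose[of "transpose Z" M] by simp
  also have "\<dots> = - mip Z M" by (simp add: Z mip_def cip_def sum_negf)
  finally have 2: "mip Z (M - transpose M) = of_real (2 * (norm y)\<^sup>2)"
    by (simp add: mip_diff_right 1)
  have 3: "mip M M = of_real ((norm y)\<^sup>2 * (norm v)\<^sup>2)"
    unfolding M_def mip_tensor cip_self norm_cnj_vec by simp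
  have 4: "0 \<le> Re (mip M (transpose M))"
  proof -
    define s where "s = (\<Sum>i\<in>UNIV. y $ i * v $ i)"
    have "mip M (transpose M) = s * cnj s"
      by (simp add: M_def transpose_tensor mip_tensor cip_def s_def mult.commute)
    then show ?thesis by (simp add: complex_norm_square[symmetric] del: of_real_power)
  qed
  have "mip (M - transpose M) (M - transpose M) = 2 * mip M M - (mip M (transpose M) + mip (transpose M) M)"
    using mip_transpose[of M M] by (simp add: mip_diff_left mip_diff_right)
  moreover have "Re (mip (transpose M) M) = Re (mip M (transpose M))" using mip_commute[of M "transpose M"] by simp
  ultimately have r: "Re (mip (M - transpose M) (M - transpose M)) = 2 * Re (mip M M) - 2 * Re (mip M (transpose M))"
    by simp
  have "(norm (M - transpose M))\<^sup>2 = 2 * ((norm y)\<^sup>2 * (norm v)\<^sup>2) - 2 * Re (mip M (transpose M))"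
    using r[unfolded 3] unfolding mip_self Re_complex_of_real .
  with 4 have 5: "(norm (M - transpose M))\<^sup>2 \<le> 2 * ((norm y)\<^sup>2 * (norm v)\<^sup>2)" by linarith
  have "2 * (norm y)\<^sup>2 \<le> norm Z * norm (M - transpose M)"
    using cmod_mip_le[of Z "M - transpose M"] unfolding 2 norm_of_real by simp
  then have "(2 * (norm y)\<^sup>2)\<^sup>2 \<le> (norm Z * norm (M - transpose M))\<^sup>2" by (intro power_mono) auto
  also have "\<dots> \<le> (norm Z)\<^sup>2 * (2 * ((norm y)\<^sup>2 * (norm v)\<^sup>2))"
    unfolding power_mult_distrib using 5 by (intro mult_left_mono) auto
  finally have "(norm y)\<^sup>2 * (norm y)\<^sup>2 \<le> (norm y)\<^sup>2 * (1/2 * (norm Z)\<^sup>2 * (norm v)\<^sup>2)"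
    by (simp add: power2_eq_square algebra_simps)
  moreover have "0 < (norm y)\<^sup>2" using False by (simp add: y_def)
  ultimately have "(norm y)\<^sup>2 \<le> 1/2 * (norm Z)\<^sup>2 * (norm v)\<^sup>2" by (rule mult_left_le_imp_le)
  then show ?thesis unfolding y_def .
qed simp

locale transpose_sign =
  fixes \<epsilon> :: complex
  assumes sign: "\<epsilon> = 1 \<or> \<epsilon> = -1"
begin

lemma sign_simps: "\<epsilon> * \<epsilon> = 1" "cnj \<epsilon> = \<epsilon>" using sign by auto

definition W :: "(complex^'m^'m) set" where "W = {Z. transpose Z = \<epsilon> *\<^sub>C Z}"

text \<open>The quotient of M by N has the required symmetry once \<open>transpose M ** N\<close>
  equals \<epsilon> times \<open>transpose N ** M\<close>; the relations T convert this into
  pseudo-unitarity.\<close>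

lemma frac_mem_W:
  fixes A B C D X :: "complex^'m^'m"
  assumes pu: "pseudo_unitary A B C D"
    and T: "transpose A = adjoint_mat D" "transpose D = adjoint_mat A"
      "transpose B = \<epsilon> *\<^sub>C adjoint_mat C" "transpose C = \<epsilon> *\<^sub>C adjoint_mat B"
    and X: "X \<in> W" "X \<in> D_I"
  shows "frac A B C D X \<in> W"
proof -
  define M where "M = A ** X + B"
  define N where "N = C ** X + D"
  define Ni where "Ni = matrix_inv N"
  have N: "invertible N" unfolding N_def by (rule pseudo_unitary_invertible[OF pu X(2)])
  have Ni: "N ** Ni = mat 1" using matrix_inv_right[OF N] by (simp add: Ni_def)
  have XT: "transpose X = \<epsilon> *\<^sub>C X" using X by (simp add: W_def)
  have MT: "transpose M = \<epsilon> *\<^sub>C (X ** adjoint_mat D + adjoint_mat C)"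
    by (simp add: M_def transpose_linear matrix_transpose_mul T XT mat_mult_scaleC_left scaleC_add_right)
  have NT: "transpose N = X ** adjoint_mat B + adjoint_mat A"
    by (simp add: N_def transpose_linear matrix_transpose_mul T XT mat_mult_scaleC_left mat_mult_scaleC_right scaleC_scaleC sign_simps)
  have p: "adjoint_mat A ** A = mat 1 + adjoint_mat C ** C" "adjoint_mat A ** B = adjoint_mat C ** D"
    "adjoint_mat D ** D = mat 1 + adjoint_mat B ** B"
    using pu by (auto simp: pseudo_unitary_def algebra_simps)
  have p4: "adjoint_mat B ** A = adjoint_mat D ** C"
    using arg_cong[OF p(2), of adjoint_mat] by (simp add: adjoint_mat_mult)
  have e: "X ** adjoint_mat D ** C = X ** adjoint_mat B ** A" "X ** adjoint_mat D ** D = X + X ** adjoint_mat B ** B"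
    "adjoint_mat A ** A ** X = X + adjoint_mat C ** C ** X"
    by (simp_all add: matrix_mul_assoc[symmetric] p p4 mat_mult_add_right)
      (simp add: matrix_mul_assoc p mat_mult_add_left)
  have "(X ** adjoint_mat D + adjoint_mat C) ** N = (X ** adjoint_mat B + adjoint_mat A) ** M"
    unfolding M_def N_def mat_mult_add_left mat_mult_add_right matrix_mul_assoc e p(2) by (simp add: ac_simps)
  then have MN: "transpose M ** N = \<epsilon> *\<^sub>C (transpose N ** M)"
    unfolding MT NT by (simp add: mat_mult_scaleC_left)
  have NiT: "transpose Ni ** transpose N = mat 1"
    using arg_cong[OF Ni, of transpose] by (simp add: matrix_transpose_mul transpose_mat)
  have "transpose (M ** Ni) = transpose Ni ** transpose M ** (N ** Ni)"
    by (simp add: Ni matrix_transpose_mul)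
  also have "\<dots> = transpose Ni ** (transpose M ** N) ** Ni" by (simp only: matrix_mul_assoc)
  also have "\<dots> = \<epsilon> *\<^sub>C ((transpose Ni ** transpose N) ** M ** Ni)"
    unfolding MN mat_mult_scaleC_left mat_mult_scaleC_right by (simp only: matrix_mul_assoc)
  also have "\<dots> = \<epsilon> *\<^sub>C (M ** Ni)" unfolding NiT by simp
  finally show ?thesis by (simp add: W_def frac_def M_def Ni_def N_def)
qed

text \<open>Of the two normalizers only S is chosen; P is its entrywise conjugate, which is what
  makes the relations required by \<open>frac_mem_W\<close> hold.\<close>

lemma transitive_W:
  fixes Z :: "complex^'m^'m"
  assumes Z: "Z \<in> W" "Z \<in> D_I"
  shows "\<exists>A B C E. pseudo_unitary A B C E \<and> frac A B C E Z = 0 \<and>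
        (\<forall>X\<in>W \<inter> D_I. frac A B C E X \<in> W) \<and>
        (\<forall>X\<in>W \<inter> D_I. frac (adjoint_mat A) (- adjoint_mat C) (- adjoint_mat B) (adjoint_mat E) X \<in> W)"
proof -
  obtain S :: "complex^'m^'m" where S: "S ** (mat 1 - adjoint_mat Z ** Z) ** adjoint_mat S = mat 1"
    by (rule hpos_normalize[OF hpos_one_minus[OF Z(2)]])
  define P where "P = transpose (adjoint_mat S)"
  have adjP: "adjoint_mat P = transpose S" by (simp add: P_def transpose_adjoint)
  have TP: "transpose P = adjoint_mat S" by (simp add: P_def)
  have ZT: "transpose Z = \<epsilon> *\<^sub>C Z" using Z by (simp add: W_def)
  have ZaT: "transpose (adjoint_mat Z) = \<epsilon> *\<^sub>C adjoint_mat Z"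
    by (simp add: transpose_adjoint ZT adjoint_mat_scaleC sign_simps)
  have "transpose (S ** (mat 1 - adjoint_mat Z ** Z) ** adjoint_mat S) = mat 1" unfolding S by (rule transpose_mat)
  then have P: "P ** (mat 1 - Z ** adjoint_mat Z) ** adjoint_mat P = mat 1"
    unfolding adjP by (simp add: P_def matrix_transpose_mul transpose_linear transpose_mat ZT ZaT
        mat_mult_scaleC_left mat_mult_scaleC_right scaleC_scaleC sign_simps matrix_mul_assoc)
  define B where "B = - (P ** Z)"
  define C where "C = - (S ** adjoint_mat Z)"
  have pu: "pseudo_unitary P B C S" unfolding B_def C_def by (rule pseudo_unitary_moebius[OF P S])
  have T: "transpose P = adjoint_mat S" "transpose S = adjoint_mat P"
    "transpose B = \<epsilon> *\<^sub>C adjoint_mat C" "transpose C = \<epsilon> *\<^sub>C adjoint_mat B"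
    by (simp_all add: TP adjP B_def C_def adjoint_mat_mult adjoint_mat_uminus matrix_transpose_mul transpose_linear ZT ZaT
        mat_mult_scaleC_left mat_mult_scaleC_right scaleC_uminus)
  have T': "transpose (adjoint_mat P) = adjoint_mat (adjoint_mat S)" "transpose (adjoint_mat S) = adjoint_mat (adjoint_mat P)"
    "transpose (- adjoint_mat C) = \<epsilon> *\<^sub>C adjoint_mat (- adjoint_mat B)" "transpose (- adjoint_mat B) = \<epsilon> *\<^sub>C adjoint_mat (- adjoint_mat C)"
    by (simp_all add: transpose_linear transpose_adjoint T adjoint_mat_scaleC adjoint_mat_uminus sign_simps scaleC_uminus)
  have "frac P B C S Z = 0" unfolding B_def by (rule frac_moebius_zero)
  then show ?thesis
    using pu frac_mem_W[OF pu T] frac_mem_W[OF pseudo_unitary_inverse[OF pu] T'] by blast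
qed

text \<open>Only congruences by U and its transpose are at hand, so phases separate units by their
  unordered index pairs and permutations identify pairs of the same kind. In the symmetric case a
  rotation links the diagonal pairs to the others.\<close>

lemma irreducible_W:
  fixes \<beta> :: "complex^'m^'m \<Rightarrow> complex^'m^'m \<Rightarrow> complex"
  assumes add: "\<And>X Y Z. X \<in> W \<Longrightarrow> Y \<in> W \<Longrightarrow> Z \<in> W \<Longrightarrow> \<beta> (X + Y) Z = \<beta> X Z + \<beta> Y Z"
    and sc: "\<And>a X Y. X \<in> W \<Longrightarrow> Y \<in> W \<Longrightarrow> \<beta> (a *\<^sub>C X) Y = a * \<beta> X Y"
    and comm: "\<And>X Y. X \<in> W \<Longrightarrow> Y \<in> W \<Longrightarrow> \<beta> X Y = cnj (\<beta> Y X)"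
    and inv: "\<And>U V X Y. adjoint_mat U ** U = mat 1 \<Longrightarrow> V ** adjoint_mat V = mat 1 \<Longrightarrow>
          \<forall>X\<in>W. U ** X ** V \<in> W \<Longrightarrow> \<forall>X\<in>W. adjoint_mat U ** X ** adjoint_mat V \<in> W \<Longrightarrow>
          X \<in> W \<Longrightarrow> Y \<in> W \<Longrightarrow> \<beta> (U ** X ** V) (U ** Y ** V) = \<beta> X Y"
  shows "\<exists>c. \<forall>X\<in>W. \<forall>Y\<in>W. \<beta> X Y = c * mip X Y"
proof -
  \<comment> \<open>Twice the projection onto W. The elements F built from it replace matrix units,
    and the factor explains the 4 in the last step.\<close>
  define \<pi> where "\<pi> X = X + \<epsilon> *\<^sub>C transpose X" for X :: "complex^'m^'m"
  have \<pi>W: "\<pi> X \<in> W" for X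
    by (simp add: \<pi>_def W_def transpose_linear scaleC_add_right scaleC_scaleC sign_simps)
  have \<pi>2: "\<pi> X = 2 *\<^sub>C X" if "X \<in> W" for X
    using that by (simp add: \<pi>_def W_def scaleC_scaleC sign_simps vec_eq_iff scaleC_complex_def)
  have \<pi>add: "\<pi> (X + Y) = \<pi> X + \<pi> Y" and \<pi>sc: "\<pi> (a *\<^sub>C X) = a *\<^sub>C \<pi> X" for X Y a
    by (simp_all add: \<pi>_def transpose_linear vec_eq_iff scaleC_complex_def algebra_simps)
  define F where "F u w = \<pi> (tensor u w)" for u w :: "complex^'m"
  have FW: "F u w \<in> W" for u w by (simp add: F_def \<pi>W)
  have Fsc: "F (a *\<^sub>C u) (b *\<^sub>C w) = (a * b) *\<^sub>C F u w" for a b u w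
    by (simp add: F_def tensor_scaleC \<pi>sc scaleC_scaleC mult.commute)
  have Fswap: "F w u = \<epsilon> *\<^sub>C F u w" for u w
    by (simp add: F_def \<pi>_def transpose_tensor scaleC_add_right scaleC_scaleC sign_simps)
  have Fadd: "F (u + v) w = F u w + F v w" "F w (u + v) = F w u + F w v" for u v w
    by (simp_all add: F_def tensor_add \<pi>add)
  have ss: "\<beta> (a *\<^sub>C X) (b *\<^sub>C Y) = (a * cnj b) * \<beta> X Y" if "X \<in> W" "Y \<in> W" for a b X Y
  proof -
    have bY: "b *\<^sub>C Y \<in> W" using that by (simp add: W_def transpose_linear scaleC_scaleC mult.commute)
    have "\<beta> (a *\<^sub>C X) (b *\<^sub>C Y) = a * cnj (\<beta> (b *\<^sub>C Y) X)"
      unfolding sc[OF that(1) bY] comm[OF that(1) bY] ..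
    also have "\<dots> = a * cnj (b * cnj (\<beta> X Y))" unfolding sc[OF that(2,1)] comm[OF that(2,1)] ..
    finally show ?thesis by simp
  qed
  have addr: "\<beta> Z (X + Y) = \<beta> Z X + \<beta> Z Y" if "X \<in> W" "Y \<in> W" "Z \<in> W" for X Y Z
  proof -
    have XY: "X + Y \<in> W" using that by (simp add: W_def transpose_linear scaleC_add_right)
    have "\<beta> Z (X + Y) = cnj (\<beta> X Z + \<beta> Y Z)" unfolding comm[OF that(3) XY] add[OF that] ..
    then show ?thesis using comm[OF that(3,1)] comm[OF that(3,2)] by simp
  qed
  have inv': "\<beta> (F (U *v u) (U *v w)) (F (U *v u') (U *v w')) = \<beta> (F u w) (F u' w')"
    if U: "adjoint_mat U ** U = mat 1" for U u w u' w'
  proof -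
    have W1: "V ** X ** transpose V \<in> W" if "X \<in> W" for X V
      using that by (simp add: W_def matrix_transpose_mul matrix_mul_assoc mat_mult_scaleC_left mat_mult_scaleC_right)
    have W2: "adjoint_mat U ** X ** adjoint_mat (transpose U) \<in> W" if "X \<in> W" for X
      using W1[OF that, of "adjoint_mat U"] by (simp add: transpose_adjoint)
    have UF: "U ** F u w ** transpose U = F (U *v u) (U *v w)" for u w
      by (simp add: F_def \<pi>_def transpose_tensor mat_mult_add_left mat_mult_add_right mat_mult_scaleC_left
          mat_mult_scaleC_right mult_tensor)
    show ?thesis
      using inv[OF U transpose_unitary[OF U] _ _ FW FW, of u w u' w'] W1 W2 unfolding UF by blast
  qed
  define e where "e i = (axis i 1 :: complex^'m)" for i
  define B where "B i j k l = \<beta> (F (e i) (e j)) (F (e k) (e l))" for i j k l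
  have off: "B i j k l = 0" if nm: "\<not> (i = k \<and> j = l)" "\<not> (i = l \<and> j = k)" for i j k l
  proof -
    \<comment> \<open>The factor that the phase at axis x puts on \<open>B i j k l\<close>; it
      differs from 1 for x = i or x = j when the unordered pairs are different.\<close>
    define f where "f x = (if i = x then \<i> else 1) * (if j = x then \<i> else 1) * cnj ((if k = x then \<i> else 1) * (if l = x then \<i> else 1))" for x
    have "f x * B i j k l = B i j k l" for x
    proof -
      obtain U :: "complex^'m^'m" where U: "adjoint_mat U ** U = mat 1" "\<forall>i. U *v axis i 1 = (if i = x then \<i> else 1) *\<^sub>C axis i 1"
        by (rule ex_phase[of x])
      show ?thesis
        using inv'[OF U(1), of "e i" "e j" "e k" "e l"]
        unfolding e_def U(2)[rule_format] Fsc ss[OF FW FW] unfolding f_def B_def e_def .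
    qed
    moreover have "f i \<noteq> 1 \<or> f j \<noteq> 1" using nm unfolding f_def
      by (cases "i = j"; cases "i = k"; cases "i = l"; cases "j = k"; cases "j = l"; simp add: complex_eq_iff)
    ultimately show ?thesis using mult_cancel_right[of _ "B i j k l" 1] by auto
  qed
  have perm: "B i j i j = B (if i = a then b else if i = b then a else i) (if j = a then b else if j = b then a else j)
      (if i = a then b else if i = b then a else i) (if j = a then b else if j = b then a else j)" for i j a b
  proof -
    obtain U :: "complex^'m^'m" where U: "adjoint_mat U ** U = mat 1" "\<forall>i. U *v axis i 1 = axis (if i = a then b else if i = b then a else i) 1"
      by (rule ex_transposition[of a b])
    show ?thesis
      using inv'[OF U(1), of "e i" "e j" "e i" "e j"] unfolding e_def U(2)[rule_format] unfolding B_def e_def by (rule sym)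
  qed
  have diag: "B i i i i = B k k k k" for i k using perm[of i i i k] by simp
  have pair: "B i j i j = B k l k l" if "i \<noteq> j" "k \<noteq> l" for i j k l
  proof -
    define j' where "j' = (if j = k then i else j)"
    have "j' \<noteq> k" using that by (auto simp: j'_def)
    have "B i j i j = B k j' k j'" using perm[of i j i k] that by (simp add: j'_def)
    also have "\<dots> = B k l k l" using perm[of k j' j' l] that \<open>j' \<noteq> k\<close> by auto
    finally show ?thesis .
  qed
  have swap: "B i j j i = \<epsilon> * B i j i j" for i j
  proof -
    have "\<beta> (1 *\<^sub>C F (e i) (e j)) (\<epsilon> *\<^sub>C F (e i) (e j)) = (1 * cnj \<epsilon>) * \<beta> (F (e i) (e j)) (F (e i) (e j))"
      by (rule ss[OF FW FW])
    then show ?thesis unfolding B_def Fswap[of "e j" "e i"] sign_simps by simp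
  qed
  \<comment> \<open>Rotating axis a halfway to axis b expresses a diagonal element through both
    diagonal and off-diagonal ones.\<close>
  have rot: "B a a a a = 2 * B a b a b" if ab: "a \<noteq> b" and "\<epsilon> = 1" for a b
  proof -
    obtain U :: "complex^'m^'m" where U: "adjoint_mat U ** U = mat 1"
      "U *v axis a 1 = of_real (1 / sqrt 2) *\<^sub>C (axis a 1 + axis b 1)" by (rule ex_rotation[OF ab])
    define r where "r = complex_of_real (1 / sqrt 2)"
    have "1 / sqrt 2 * (1 / sqrt 2) = (1 / 2 :: real)" by simp
    then have r: "r * r = 1 / 2" unfolding r_def of_real_mult[symmetric] by simp
    define G where "G = F (e a) (e a) + F (e b) (e b)"
    define H where "H = 2 *\<^sub>C F (e a) (e b)"
    have GH: "G \<in> W" "H \<in> W" using FW by (auto simp: G_def H_def W_def transpose_linear scaleC_add_right scaleC_scaleC mult.commute)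
    have "F (e a + e b) (e a + e b) = G + H"
      using Fswap[of "e b" "e a"] \<open>\<epsilon> = 1\<close> by (simp add: G_def H_def Fadd vec_eq_iff scaleC_complex_def)
    then have FU: "F (U *v e a) (U *v e a) = (1 / 2) *\<^sub>C (G + H)"
      unfolding e_def U(2) r_def[symmetric] Fsc r by simp
    have GHW: "G + H \<in> W" using GH by (simp add: W_def transpose_linear scaleC_add_right)
    have "B a a a a = 1 / 4 * \<beta> (G + H) (G + H)"
      using inv'[OF U(1), of "e a" "e a" "e a" "e a"] unfolding FU ss[OF GHW GHW] by (simp add: B_def)
    also have "\<beta> (G + H) (G + H) = \<beta> G G + \<beta> G H + \<beta> H G + \<beta> H H"
      by (simp add: add addr GH GHW)
    also have "\<beta> H H = 4 * B a b a b" unfolding H_def ss[OF FW FW] B_def by simp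
    also have "\<beta> G G = B a a a a + B b b b b"
    proof -
      have "B a a b b = 0" "B b b a a = 0" using ab by (auto intro!: off)
      then show ?thesis using GH(1) unfolding G_def B_def by (simp add: add addr FW)
    qed
    also have "\<beta> G H = 0"
    proof -
      have "\<beta> G H = \<beta> (F (e a) (e a)) (2 *\<^sub>C F (e a) (e b)) + \<beta> (F (e b) (e b)) (2 *\<^sub>C F (e a) (e b))"
        using GH(2) unfolding G_def by (simp add: add FW H_def)
      also have "\<dots> = 0"
      proof -
        have "\<beta> X (2 *\<^sub>C Y) = 2 * \<beta> X Y" if "X \<in> W" "Y \<in> W" for X Y
          using ss[OF that, of 1 2] by simp
        then have "\<beta> (F (e a) (e a)) (2 *\<^sub>C F (e a) (e b)) = 2 * B a a a b" "\<beta> (F (e b) (e b)) (2 *\<^sub>C F (e a) (e b)) = 2 * B b b a b"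
          unfolding B_def by (simp_all add: FW)
        moreover have "B a a a b = 0" "B b b a b = 0" using ab by (auto intro!: off)
        ultimately show ?thesis by simp
      qed
      finally show ?thesis .
    qed
    also have "\<beta> H G = 0" using comm[OF GH(2,1)] \<open>\<beta> G H = 0\<close> by simp
    finally show ?thesis using diag[of b a] by simp
  qed
  \<comment> \<open>The factors 2 and \<open>2 * (1 + \<epsilon>)\<close> are the squared norms of
    the F elements; the second one vanishes in the skew case.\<close>
  have "\<exists>c. (\<forall>i j. i \<noteq> j \<longrightarrow> B i j i j = 2 * c) \<and> (\<forall>i. B i i i i = 2 * (1 + \<epsilon>) * c)"
  proof (cases "\<epsilon> = 1")
    case False
    then have e: "\<epsilon> = -1" using sign by blast
    have "F u u = 0" for u
    proof -
      have "F u u $ x $ y = - 1 *\<^sub>C (F u u $ x $ y)" for x y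
        using arg_cong[OF Fswap[of u u], of "\<lambda>Z. Z $ x $ y"] unfolding e scaleC_nth .
      then have "F u u $ x $ y = 0" for x y unfolding scaleC_complex_def by (metis eq_neg_iff_add_eq_0 mult_minus1 mult_2 mult_eq_0_iff zero_neq_numeral)
      then show ?thesis by (simp only: vec_eq_iff zero_index) simp
    qed
    moreover have "\<beta> 0 0 = 0" using sc[of 0 0 0] by (simp add: W_def transpose_def vec_eq_iff)
    ultimately have "B i i i i = 0" for i by (simp add: B_def)
    moreover have "\<exists>c. \<forall>i j. i \<noteq> j \<longrightarrow> B i j i j = 2 * c"
    proof (cases "\<exists>a b :: 'm. a \<noteq> b")
      case True
      then obtain a b :: 'm where "a \<noteq> b" by blast
      then have "B i j i j = 2 * (B a b a b / 2)" if "i \<noteq> j" for i j using pair[OF that] by simp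
      then show ?thesis by blast
    next
      case False
      then show ?thesis by blast
    qed
    ultimately show ?thesis by (simp add: e)
  next
    case True
    have "B i j i j = 2 * (B undefined undefined undefined undefined / 4)" if "i \<noteq> j" for i j
      using rot[OF that True] diag[of i undefined] by simp
    moreover have "B i i i i = B undefined undefined undefined undefined" for i by (rule diag)
    ultimately show ?thesis
      by (intro exI[of _ "B undefined undefined undefined undefined / 4"]) (simp add: True)
  qed
  then obtain c where c: "\<forall>i j. i \<noteq> j \<longrightarrow> B i j i j = 2 * c" "\<forall>i. B i i i i = 2 * (1 + \<epsilon>) * c" by blast
  have Bmip: "B i j k l = c * mip (F (e i) (e j)) (F (e k) (e l))" for i j k l
  proof -
    have m: "mip (F (e i) (e j)) (F (e k) (e l))
        = 2 * ((if i = k \<and> j = l then 1 else 0) + \<epsilon> * (if i = l \<and> j = k then 1 else 0))"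
    proof -
      define p where "p = cip (e i) (e k) * cip (e j) (e l)"
      define q where "q = cip (e i) (e l) * cip (e j) (e k)"
      have pq: "p = (if i = k \<and> j = l then 1 else 0)" "q = (if i = l \<and> j = k then 1 else 0)"
        by (auto simp: p_def q_def e_def cip_axis)
      have "mip (F (e i) (e j)) (F (e k) (e l)) = p + \<epsilon> * q + (\<epsilon> * q + \<epsilon> * (\<epsilon> * p))"
        unfolding F_def \<pi>_def transpose_tensor mip_add_left mip_add_right mip_scaleC_left mip_scaleC_right
          mip_tensor sign_simps(2) p_def q_def by (simp add: mult_ac distrib_left)
      also have "\<dots> = 2 * (p + \<epsilon> * q)" using sign by auto
      finally show ?thesis unfolding pq .
    qed
    show ?thesis
    proof (cases "i = j")
      case True
      show ?thesis
      proof (cases "k = i \<and> l = i")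
        case kl: True
        have "B i j k l = 2 * (1 + \<epsilon>) * c" using c(2) \<open>i = j\<close> kl by metis
        moreover have "mip (F (e i) (e j)) (F (e k) (e l)) = 2 * (1 + \<epsilon>)" unfolding m using \<open>i = j\<close> kl by simp
        ultimately show ?thesis by (simp only: mult_ac)
      next
        case False
        have n: "\<not> (i = k \<and> j = l)" "\<not> (i = l \<and> j = k)" using True False by metis+
        show ?thesis unfolding m off[OF n] if_not_P[OF n(1)] if_not_P[OF n(2)] by simp
      qed
    next
      case False
      show ?thesis
      proof (cases "i = k \<and> j = l")
        case True
        then have n: "\<not> (i = l \<and> j = k)" using False by simp
        have "B i j k l = 2 * c" using c(1) False True by metis
        then show ?thesis unfolding m if_not_P[OF n] if_P[OF True] by simp
      next
        case n1: False
        show ?thesis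
        proof (cases "i = l \<and> j = k")
          case True
          have "B i j k l = \<epsilon> * (2 * c)" using c(1) False True swap[of i j] by metis
          then show ?thesis unfolding m if_not_P[OF n1] if_P[OF True] by simp
        next
          case n2: False
          show ?thesis unfolding m off[OF n1 n2] if_not_P[OF n1] if_not_P[OF n2] by simp
        qed
      qed
    qed
  qed
  have rc: "cnj c = c \<or> (\<forall>i j k l. B i j k l = 0)"
  proof (rule disjCI)
    assume "\<not> (\<forall>i j k l. B i j k l = 0)"
    then obtain i j k l where nz: "B i j k l \<noteq> 0" by blast
    then have k: "i = k \<and> j = l \<or> i = l \<and> j = k" using off[of i k j l] by metis
    have nz': "B i j i j \<noteq> 0"
    proof
      assume 0: "B i j i j = 0"
      then have "B i j j i = 0" using swap[of i j] by simp
      with 0 k nz show False by metis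
    qed
    define n where "n = (norm (F (e i) (e j)))\<^sup>2"
    have Bn: "B i j i j = c * of_real n" unfolding Bmip mip_self n_def ..
    have "B i j i j = cnj (B i j i j)" unfolding B_def by (rule comm[OF FW FW])
    then have "c * of_real n = cnj c * of_real n" unfolding Bn complex_cnj_mult complex_cnj_complex_of_real .
    moreover have "complex_of_real n \<noteq> 0" using nz' unfolding Bn by (metis mult_zero_right)
    ultimately have "c = cnj c" by (metis mult_right_cancel)
    then show "cnj c = c" by (rule sym)
  qed
  \<comment> \<open>The constant is real unless all values of B vanish; 0 serves in the remaining
    case, so that the difference of the two forms is Hermitian.\<close>
  define c' where "c' = (if cnj c = c then c else 0)"
  have c': "cnj c' = c'" by (simp add: c'_def)
  have Bmip': "B i j k l = c' * mip (F (e i) (e j)) (F (e k) (e l))" for i j k l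
  proof (cases "cnj c = c")
    case True
    then show ?thesis using Bmip[of i j k l] by (simp only: c'_def if_True simp_thms)
  next
    case False
    then have "B i j k l = 0" using rc by metis
    then show ?thesis using False by (simp add: c'_def)
  qed
  have zero: "\<beta> (\<pi> X) (\<pi> Y) - c' * mip (\<pi> X) (\<pi> Y) = 0" for X Y
  proof (rule sesquilinear_zero[of "\<lambda>X Y. \<beta> (\<pi> X) (\<pi> Y) - c' * mip (\<pi> X) (\<pi> Y)"])
    fix X Y Z :: "complex^'m^'m" and a i j k l
    show "\<beta> (\<pi> (X + Y)) (\<pi> Z) - c' * mip (\<pi> (X + Y)) (\<pi> Z)
        = \<beta> (\<pi> X) (\<pi> Z) - c' * mip (\<pi> X) (\<pi> Z) + (\<beta> (\<pi> Y) (\<pi> Z) - c' * mip (\<pi> Y) (\<pi> Z))"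
      by (simp add: \<pi>add add \<pi>W mip_add_left algebra_simps)
    show "\<beta> (\<pi> (a *\<^sub>C X)) (\<pi> Y) - c' * mip (\<pi> (a *\<^sub>C X)) (\<pi> Y) = a * (\<beta> (\<pi> X) (\<pi> Y) - c' * mip (\<pi> X) (\<pi> Y))"
      by (simp add: \<pi>sc sc \<pi>W mip_scaleC_left algebra_simps)
    have "\<beta> (\<pi> X) (\<pi> Y) - c' * mip (\<pi> X) (\<pi> Y) = cnj (\<beta> (\<pi> Y) (\<pi> X)) - c' * cnj (mip (\<pi> Y) (\<pi> X))"
      using comm[OF \<pi>W \<pi>W, of X Y] mip_commute[of "\<pi> X" "\<pi> Y"] by (simp only:)
    then show "\<beta> (\<pi> X) (\<pi> Y) - c' * mip (\<pi> X) (\<pi> Y) = cnj (\<beta> (\<pi> Y) (\<pi> X) - c' * mip (\<pi> Y) (\<pi> X))"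
      by (simp only: complex_cnj_diff complex_cnj_mult c')
    show "\<beta> (\<pi> (tensor (axis i 1) (axis j 1))) (\<pi> (tensor (axis k 1) (axis l 1)))
        - c' * mip (\<pi> (tensor (axis i 1) (axis j 1))) (\<pi> (tensor (axis k 1) (axis l 1))) = 0"
      using Bmip'[of i j k l] unfolding B_def F_def e_def by simp
  qed
  have "\<beta> X Y = c' * mip X Y" if "X \<in> W" "Y \<in> W" for X Y
  proof -
    have "4 * \<beta> X Y - c' * (4 * mip X Y) = 0"
      using zero[of X Y] unfolding \<pi>2[OF that(1)] \<pi>2[OF that(2)] ss[OF that] mip_scaleC_left mip_scaleC_right by simp
    then show ?thesis by simp
  qed
  then show ?thesis by blast
qed

lemma cartan_domain_W:
  assumes op: "\<And>(Z::complex^'m^'m) v. Z \<in> W \<Longrightarrow> (norm (Z *v v))\<^sup>2 \<le> \<kappa> * (norm Z)\<^sup>2 * (norm v)\<^sup>2"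
    and tri: "\<exists>E\<in>W. E ** adjoint_mat E ** E = (E :: complex^'m^'m) \<and> \<kappa> * (norm E)\<^sup>2 = 1" and "\<kappa> > 0"
  shows "cartan_domain (W :: (complex^'m^'m) set) \<kappa>"
proof (rule cartan_domain.intro, goal_cases)
  case 1
  show ?case by (simp add: W_def vec_eq_iff transpose_def)
next
  case (2 X Y)
  then show ?case by (simp add: W_def transpose_linear scaleC_add_right)
next
  case (3 X a)
  then show ?case by (simp add: W_def transpose_linear scaleC_scaleC mult.commute)
next
  case 4
  show ?case by fact
next
  case (5 Z v)
  then show ?case by (rule op)
next
  case 6
  show ?case by (rule tri)
next
  case (7 Z)
  show ?case by (rule transitive_W[OF IntD1[OF 7] IntD2[OF 7]])
next
  case (8 \<beta>)
  show ?case by (rule irreducible_W[OF 8])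
qed

end

interpretation symmetric: transpose_sign 1 by standard simp

interpretation skew: transpose_sign "-1" by standard simp

lemma cartan_domain_III: "cartan_domain (symmetric.W :: (complex^'m^'m) set) 1"
proof (rule symmetric.cartan_domain_W)
  show "(norm (Z *v v))\<^sup>2 \<le> 1 * (norm Z)\<^sup>2 * (norm v)\<^sup>2" for Z :: "complex^'m^'m" and v by (rule norm_matvec_power2_le)
  have "tensor (axis i 1) (axis i 1) \<in> symmetric.W" for i :: 'm by (simp add: symmetric.W_def transpose_tensor)
  then show "\<exists>E\<in>symmetric.W. E ** adjoint_mat E ** E = (E :: complex^'m^'m) \<and> 1 * (norm E)\<^sup>2 = 1"
    by (rule bexI[rotated, of "tensor (axis undefined 1) (axis undefined 1)"]) (simp only: unit_tripotent one_power2 mult_1 simp_thms)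
qed simp

lemma cartan_domain_II:
  assumes "CARD('m) \<ge> 2"
  shows "cartan_domain (skew.W :: (complex^'m^'m) set) (1/2)"
proof (rule skew.cartan_domain_W)
  show "(norm (Z *v v))\<^sup>2 \<le> 1/2 * (norm Z)\<^sup>2 * (norm v)\<^sup>2" if "Z \<in> skew.W" for Z :: "complex^'m^'m" and v
    by (rule skew_norm_le) (use that in \<open>simp add: skew.W_def vec_eq_iff scaleC_complex_def\<close>)
  have "\<not> card (UNIV :: 'm set) \<le> Suc 0" using assms by simp
  then obtain a b :: 'm where ab: "a \<noteq> b" by (auto simp: card_le_Suc0_iff_eq)
  define t where "t i j = tensor (axis i 1 :: complex^'m) (axis j 1 :: complex^'m)" for i j
  \<comment> \<open>A tripotent of rank two has squared norm 2; this is the origin of \<kappa> =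
    1/2.\<close>
  define E where "E = t a b - t b a"
  have tm: "t i j ** t k l = (if j = k then t i l else 0)" for i j k l unfolding t_def by (rule unit_mult)
  have ta: "adjoint_mat (t i j) = t j i" for i j by (simp add: t_def vec_eq_iff tensor_def axis_def)
  have "E ** adjoint_mat E ** E = E"
    using ab by (simp add: E_def adjoint_mat_diff ta mat_mult_distribs tm)
  moreover have "complex_of_real ((norm E)\<^sup>2) = of_real 2"
    unfolding mip_self[symmetric] using ab by (simp add: E_def t_def mip_diff_left mip_diff_right mip_tensor cip_axis)
  then have "1/2 * (norm E)\<^sup>2 = 1" unfolding of_real_eq_iff by simp
  moreover have "E \<in> skew.W" by (simp add: skew.W_def E_def t_def transpose_linear transpose_tensor vec_eq_iff scaleC_complex_def)
  ultimately show "\<exists>E\<in>skew.W. E ** adjoint_mat E ** E = (E :: complex^'m^'m) \<and> 1/2 * (norm E)\<^sup>2 = 1" by blast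
qed simp

section \<open>The rank one identity in small sizes\<close>

text \<open>With a single row, \<open>X ** adjoint_mat Y\<close> is the scalar
  \<open>mip X Y\<close>.\<close>

lemma rank_one_row:
  fixes X Y :: "complex^'q^'p"
  assumes "CARD('p) = 1"
  shows "X ** adjoint_mat Y ** X = mip X Y *\<^sub>C X"
proof -
  obtain a :: 'p where a: "(UNIV :: 'p set) = {a}" by (rule card_1_singletonE[OF assms])
  have i: "i = a" for i
  proof -
    have "i \<in> (UNIV :: 'p set)" by simp
    then show ?thesis unfolding a by simp
  qed
  have "(X ** adjoint_mat Y ** X) $ i $ j = (mip X Y *\<^sub>C X) $ i $ j" for i j
    unfolding i[of i] scaleC_nth scaleC_complex_def mip_def cip_def matrix_matrix_mult_def adjoint_mat_def vec_lambda_beta a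
    by simp
  then show ?thesis by (simp only: vec_eq_iff simp_thms)
qed

lemma rank_one_column:
  fixes X Y :: "complex^'q^'p"
  assumes "CARD('q) = 1"
  shows "X ** adjoint_mat Y ** X = mip X Y *\<^sub>C X"
proof -
  have "adjoint_mat X ** adjoint_mat (adjoint_mat Y) ** adjoint_mat X = mip (adjoint_mat X) (adjoint_mat Y) *\<^sub>C adjoint_mat X"
    by (rule rank_one_row[OF assms])
  from arg_cong[OF this, of adjoint_mat] show ?thesis
    unfolding mip_adjoint adjoint_mat_scaleC adjoint_mat_mult adjoint_mat_adjoint_mat mip_commute[symmetric]
    by (simp only: matrix_mul_assoc)
qed

text \<open>Skew matrices of size 2 or 3 have one or three free entries, and type II is then a disk
  or a ball. The identity is checked entry by entry.\<close>

lemma rank_one_skew: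
  fixes X Y :: "complex^'m^'m"
  assumes m: "CARD('m) = 2 \<or> CARD('m) = 3" and X: "transpose X = - X" and Y: "transpose Y = - Y"
  shows "X ** adjoint_mat Y ** X = (1 / 2 * mip X Y) *\<^sub>C X"
proof -
  have sk: "Z $ j $ i = - Z $ i $ j" if "transpose Z = - Z" for Z :: "complex^'m^'m" and i j
    using arg_cong[OF that, of "\<lambda>Z. Z $ i $ j"] by (simp add: transpose_def)
  have dg: "Z $ i $ i = 0" if "transpose Z = - Z" for Z :: "complex^'m^'m" and i
    using sk[OF that, of i i] by (simp add: eq_neg_iff_add_eq_0)
  have all: ?thesis if "\<And>i j. (X ** adjoint_mat Y ** X) $ i $ j = ((1 / 2 * mip X Y) *\<^sub>C X) $ i $ j"
    using that by (simp only: vec_eq_iff simp_thms)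
  show ?thesis
  proof (cases "CARD('m) = 2")
    case True
    then obtain a b :: 'm where ab: "(UNIV :: 'm set) = {a, b}" "a \<noteq> b" unfolding card_2_iff by blast
    have "\<forall>i\<in>UNIV. \<forall>j\<in>UNIV. (X ** adjoint_mat Y ** X) $ i $ j = ((1 / 2 * mip X Y) *\<^sub>C X) $ i $ j"
      unfolding scaleC_nth scaleC_complex_def mip_def cip_def matrix_matrix_mult_def adjoint_mat_def vec_lambda_beta ab(1)
      using ab(2) sk[OF X, of b a] sk[OF Y, of b a] by (simp add: dg[OF X] dg[OF Y] algebra_simps)
    then show ?thesis by (intro all) blast
  next
    case False
    then have "CARD('m) = 3" using m by blast
    then obtain a b c :: 'm where ab: "(UNIV :: 'm set) = {a, b, c}" "a \<noteq> b" "b \<noteq> c" "a \<noteq> c"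
      unfolding card_3_iff by blast
    have "\<forall>i\<in>UNIV. \<forall>j\<in>UNIV. (X ** adjoint_mat Y ** X) $ i $ j = ((1 / 2 * mip X Y) *\<^sub>C X) $ i $ j"
      unfolding scaleC_nth scaleC_complex_def mip_def cip_def matrix_matrix_mult_def adjoint_mat_def vec_lambda_beta ab(1)
      using ab(2-4) sk[OF X, of b a] sk[OF Y, of b a] sk[OF X, of c a] sk[OF Y, of c a] sk[OF X, of c b] sk[OF Y, of c b]
      by (simp add: dg[OF X] dg[OF Y] algebra_simps)
    then show ?thesis by (intro all) blast
  qed
qed

section \<open>Embedding the symmetric 2 x 2 matrices\<close>

definition coordinate_embedding :: "(2 \<Rightarrow> 'n::finite) \<Rightarrow> complex^2^'n" where
  "coordinate_embedding f = (\<chi> i k. if i = f k then 1 else 0)"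

lemma coordinate_embedding_gram:
  "adjoint_mat (coordinate_embedding f) ** coordinate_embedding h = (\<chi> k l. if f k = h l then 1 else 0)"
proof -
  have "cnj (if i = f k then 1 else 0) * (if i = h l then 1 else 0) = (if i = f k then if f k = h l then 1 else 0 else 0 :: complex)" for i k l
    by auto
  then show ?thesis by (simp add: vec_eq_iff matrix_matrix_mult_def coordinate_embedding_def)
qed

lemma coordinate_embedding_isometry:
  assumes "inj f"
  shows "adjoint_mat (coordinate_embedding f) ** coordinate_embedding f = mat 1"
  unfolding coordinate_embedding_gram by (simp add: vec_eq_iff mat_def inj_eq[OF assms])

lemma transpose_coordinate_embedding: "transpose (coordinate_embedding f) = adjoint_mat (coordinate_embedding f)"
  by (simp add: vec_eq_iff transpose_def coordinate_embedding_def)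

lemma ex_distinct:
  assumes "N \<le> CARD('n::finite)"
  obtains h :: "nat \<Rightarrow> 'n::finite" where "inj_on h {..<N}"
proof -
  obtain h :: "nat \<Rightarrow> 'n::finite" where "bij_betw h {0..<CARD('n)} UNIV"
    using ex_bij_betw_nat_finite[of "UNIV :: 'n::finite set", OF finite] by blast
  then have "inj_on h {..<N}" using assms by (auto simp: bij_betw_def intro: inj_on_subset)
  then show ?thesis by (rule that)
qed

lemma inj_two: "a \<noteq> b \<Longrightarrow> inj (\<lambda>k::2. if k = 1 then a else b)"
  unfolding inj_def by (metis (full_types) exhaust_2)

lemma cancel_adjoint:
  assumes "adjoint_mat E ** F = G"
  shows "M ** adjoint_mat E ** F = M ** G"
  by (simp only: matrix_mul_assoc[symmetric] assms)

context
  fixes E :: "complex^'x^'y"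
  assumes E: "adjoint_mat E ** E = mat 1"
begin

lemma isometry_cip: "cip (E *v u) (E *v w) = cip u w"
  by (simp add: cip_mat_left matrix_vector_mul_assoc E)

lemma isometry_norm: "norm (E *v u) = norm u"
proof -
  have "complex_of_real ((norm (E *v u))\<^sup>2) = of_real ((norm u)\<^sup>2)"
    unfolding cip_self[symmetric] by (rule isometry_cip)
  then have "(norm (E *v u))\<^sup>2 = (norm u)\<^sup>2" by (simp only: of_real_eq_iff)
  then show ?thesis by (rule power2_eq_imp_eq) simp_all
qed

lemma norm_adjoint_isometry_le: "norm (adjoint_mat E *v v) \<le> norm v"
proof (cases "adjoint_mat E *v v = 0")
  case False
  define y where "y = adjoint_mat E *v v"
  have "cip y y = cip v (E *v y)" by (simp add: y_def cip_mat_left)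
  then have "(norm y)\<^sup>2 = cmod (cip v (E *v y))" unfolding cip_self by (metis norm_of_real abs_power2)
  also have "\<dots> \<le> norm v * norm y" using cmod_cip_le[of v "E *v y"] by (simp add: isometry_norm)
  finally show ?thesis using False by (simp add: y_def power2_eq_square)
qed simp

end

text \<open>The inner Gram matrices of \<open>E\<^sub>1\<close> and \<open>E\<^sub>2\<close> cancel
  in triple products. Serves types I and III, the latter with equal embeddings so that symmetry is
  kept.\<close>

lemma rank2_sandwich:
  fixes E\<^sub>1 :: "complex^2^'p" and E\<^sub>2 :: "complex^2^'q"
  assumes can: "canonical_domain W 1 \<Omega> g"
    and E: "adjoint_mat E\<^sub>1 ** E\<^sub>1 = mat 1" "adjoint_mat E\<^sub>2 ** E\<^sub>2 = mat 1"
    and W: "\<And>Y. transpose Y = Y \<Longrightarrow> E\<^sub>1 ** Y ** adjoint_mat E\<^sub>2 \<in> W"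
  shows "rank2_domain W 1 \<Omega> g (\<lambda>Y. E\<^sub>1 ** Y ** adjoint_mat E\<^sub>2) (\<lambda>v. E\<^sub>2 *v v)"
proof (rule rank2_domain.intro[OF can], rule rank2_domain_axioms.intro)
  note cancel = cancel_adjoint[OF E(1)] cancel_adjoint[OF E(2)]
  fix X Y Z :: "complex^2^2" and a and v :: "complex^2"
  show "E\<^sub>1 ** (X + Y) ** adjoint_mat E\<^sub>2 = E\<^sub>1 ** X ** adjoint_mat E\<^sub>2 + E\<^sub>1 ** Y ** adjoint_mat E\<^sub>2"
    by (simp only: mat_mult_add_left mat_mult_add_right)
  show "E\<^sub>1 ** (a *\<^sub>C X) ** adjoint_mat E\<^sub>2 = a *\<^sub>C (E\<^sub>1 ** X ** adjoint_mat E\<^sub>2)"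
    by (simp only: mat_mult_scaleC_left mat_mult_scaleC_right)
  show "transpose Y = Y \<Longrightarrow> E\<^sub>1 ** Y ** adjoint_mat E\<^sub>2 \<in> W" by (rule W)
  show "E\<^sub>1 ** (X ** adjoint_mat Y ** Z) ** adjoint_mat E\<^sub>2
      = E\<^sub>1 ** X ** adjoint_mat E\<^sub>2 ** adjoint_mat (E\<^sub>1 ** Y ** adjoint_mat E\<^sub>2) ** (E\<^sub>1 ** Z ** adjoint_mat E\<^sub>2)"
    by (simp only: adjoint_mat_mult adjoint_mat_adjoint_mat matrix_mul_assoc cancel matrix_mul_rid)
  show "of_real 1 * mip (E\<^sub>1 ** X ** adjoint_mat E\<^sub>2) (E\<^sub>1 ** Y ** adjoint_mat E\<^sub>2) = mip X Y"
    unfolding mip_sandwich E by simp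
  show "norm (E\<^sub>2 *v v) = norm v" by (rule isometry_norm[OF E(2)])
  have c: "(E\<^sub>1 ** X ** adjoint_mat E\<^sub>2) *v (E\<^sub>2 *v v) = E\<^sub>1 *v (X *v v)" for X
    by (simp only: matrix_vector_mul_assoc cancel matrix_mul_rid)
  show "cip ((E\<^sub>1 ** X ** adjoint_mat E\<^sub>2) *v (E\<^sub>2 *v v)) ((E\<^sub>1 ** Y ** adjoint_mat E\<^sub>2) *v (E\<^sub>2 *v v)) = cip (X *v v) (Y *v v)"
    unfolding c by (rule isometry_cip[OF E(1)])
  assume Z: "Z \<in> D_I"
  have "norm ((E\<^sub>1 ** Z ** adjoint_mat E\<^sub>2) *v w) < norm w" if "w \<noteq> 0" for w
  proof -
    have n: "norm ((E\<^sub>1 ** Z ** adjoint_mat E\<^sub>2) *v w) = norm (Z *v (adjoint_mat E\<^sub>2 *v w))"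
      unfolding matrix_vector_mul_assoc[symmetric] by (rule isometry_norm[OF E(1)])
    show ?thesis
    proof (cases "adjoint_mat E\<^sub>2 *v w = 0")
      case True
      then show ?thesis unfolding n using that by simp
    next
      case False
      then have "norm (Z *v (adjoint_mat E\<^sub>2 *v w)) < norm (adjoint_mat E\<^sub>2 *v w)" using Z by (simp add: D_I_iff)
      then show ?thesis unfolding n using norm_adjoint_isometry_le[OF E(2), of w] by linarith
    qed
  qed
  then show "E\<^sub>1 ** Z ** adjoint_mat E\<^sub>2 \<in> D_I" by (simp add: D_I_iff)
qed

text \<open>On orthogonal ranges a symmetric Y is placed in the off-diagonal blocks as Y and - Y,
  which is skew. Every singular value occurs twice, in accordance with \<kappa> = 1/2.\<close>

lemma rank2_skew:
  fixes E\<^sub>1 E\<^sub>2 :: "complex^2^'m"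
  assumes can: "canonical_domain W (1/2) \<Omega> g"
    and E: "adjoint_mat E\<^sub>1 ** E\<^sub>1 = mat 1" "adjoint_mat E\<^sub>2 ** E\<^sub>2 = mat 1"
      "adjoint_mat E\<^sub>1 ** E\<^sub>2 = 0" "adjoint_mat E\<^sub>2 ** E\<^sub>1 = 0"
    and W: "\<And>Y. transpose Y = Y \<Longrightarrow> E\<^sub>1 ** Y ** adjoint_mat E\<^sub>2 - E\<^sub>2 ** Y ** adjoint_mat E\<^sub>1 \<in> W"
  shows "rank2_domain W (1/2) \<Omega> g (\<lambda>Y. E\<^sub>1 ** Y ** adjoint_mat E\<^sub>2 - E\<^sub>2 ** Y ** adjoint_mat E\<^sub>1) (\<lambda>v. E\<^sub>2 *v v)"
proof (rule rank2_domain.intro[OF can], rule rank2_domain_axioms.intro)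
  note cancel = cancel_adjoint[OF E(1)] cancel_adjoint[OF E(2)] cancel_adjoint[OF E(3)] cancel_adjoint[OF E(4)]
  define \<iota> where "\<iota> Y = E\<^sub>1 ** Y ** adjoint_mat E\<^sub>2 - E\<^sub>2 ** Y ** adjoint_mat E\<^sub>1" for Y
  fix X Y Z :: "complex^2^2" and a and v :: "complex^2"
  show "E\<^sub>1 ** (X + Y) ** adjoint_mat E\<^sub>2 - E\<^sub>2 ** (X + Y) ** adjoint_mat E\<^sub>1
      = E\<^sub>1 ** X ** adjoint_mat E\<^sub>2 - E\<^sub>2 ** X ** adjoint_mat E\<^sub>1 + (E\<^sub>1 ** Y ** adjoint_mat E\<^sub>2 - E\<^sub>2 ** Y ** adjoint_mat E\<^sub>1)"
    by (simp add: mat_mult_add_left mat_mult_add_right)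
  show "E\<^sub>1 ** (a *\<^sub>C X) ** adjoint_mat E\<^sub>2 - E\<^sub>2 ** (a *\<^sub>C X) ** adjoint_mat E\<^sub>1
      = a *\<^sub>C (E\<^sub>1 ** X ** adjoint_mat E\<^sub>2 - E\<^sub>2 ** X ** adjoint_mat E\<^sub>1)"
    by (simp only: mat_mult_scaleC_left mat_mult_scaleC_right scaleC_diff_right)
  show "transpose Y = Y \<Longrightarrow> E\<^sub>1 ** Y ** adjoint_mat E\<^sub>2 - E\<^sub>2 ** Y ** adjoint_mat E\<^sub>1 \<in> W" by (rule W)
  have "\<iota> (X ** adjoint_mat Y ** Z) = \<iota> X ** adjoint_mat (\<iota> Y) ** \<iota> Z"
    by (simp add: \<iota>_def adjoint_mat_diff adjoint_mat_mult mat_mult_diff_left mat_mult_diff_right mat_mult_add_left mat_mult_add_right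
        mat_mult_uminus_left mat_mult_uminus_right matrix_mul_assoc cancel)
  then show "E\<^sub>1 ** (X ** adjoint_mat Y ** Z) ** adjoint_mat E\<^sub>2 - E\<^sub>2 ** (X ** adjoint_mat Y ** Z) ** adjoint_mat E\<^sub>1
      = (E\<^sub>1 ** X ** adjoint_mat E\<^sub>2 - E\<^sub>2 ** X ** adjoint_mat E\<^sub>1)
        ** adjoint_mat (E\<^sub>1 ** Y ** adjoint_mat E\<^sub>2 - E\<^sub>2 ** Y ** adjoint_mat E\<^sub>1)
        ** (E\<^sub>1 ** Z ** adjoint_mat E\<^sub>2 - E\<^sub>2 ** Z ** adjoint_mat E\<^sub>1)" unfolding \<iota>_def .
  have cross: "mip (E\<^sub>1 ** X ** adjoint_mat E\<^sub>2) (E\<^sub>2 ** Y ** adjoint_mat E\<^sub>1) = 0" for X Y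
  proof -
    have z: "adjoint_mat E\<^sub>1 ** (E\<^sub>2 ** (Y ** adjoint_mat E\<^sub>1)) = 0" by (simp add: matrix_mul_assoc E)
    have "mip (E\<^sub>1 ** (X ** adjoint_mat E\<^sub>2)) (E\<^sub>2 ** (Y ** adjoint_mat E\<^sub>1))
        = mip (X ** adjoint_mat E\<^sub>2) (adjoint_mat E\<^sub>1 ** (E\<^sub>2 ** (Y ** adjoint_mat E\<^sub>1)))"
      by (rule mip_mult_left)
    also have "\<dots> = 0" unfolding z by simp
    finally show ?thesis by (simp only: matrix_mul_assoc)
  qed
  have cross': "mip (E\<^sub>2 ** Y ** adjoint_mat E\<^sub>1) (E\<^sub>1 ** X ** adjoint_mat E\<^sub>2) = 0" for X Y
    by (subst mip_commute) (simp add: cross)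
  have "mip (\<iota> X) (\<iota> Y) = mip X Y + mip X Y"
    unfolding \<iota>_def mip_diff_left mip_diff_right cross cross' mip_sandwich E by simp
  then show "of_real (1/2) * mip (E\<^sub>1 ** X ** adjoint_mat E\<^sub>2 - E\<^sub>2 ** X ** adjoint_mat E\<^sub>1)
      (E\<^sub>1 ** Y ** adjoint_mat E\<^sub>2 - E\<^sub>2 ** Y ** adjoint_mat E\<^sub>1) = mip X Y" unfolding \<iota>_def by simp
  show "norm (E\<^sub>2 *v v) = norm v" by (rule isometry_norm[OF E(2)])
  have c: "\<iota> X *v (E\<^sub>2 *v v) = E\<^sub>1 *v (X *v v)" for X
    by (simp add: \<iota>_def matrix_vector_mul_assoc mat_mult_diff_left cancel)
  have "cip (\<iota> X *v (E\<^sub>2 *v v)) (\<iota> Y *v (E\<^sub>2 *v v)) = cip (X *v v) (Y *v v)"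
    unfolding c by (rule isometry_cip[OF E(1)])
  then show "cip ((E\<^sub>1 ** X ** adjoint_mat E\<^sub>2 - E\<^sub>2 ** X ** adjoint_mat E\<^sub>1) *v (E\<^sub>2 *v v))
      ((E\<^sub>1 ** Y ** adjoint_mat E\<^sub>2 - E\<^sub>2 ** Y ** adjoint_mat E\<^sub>1) *v (E\<^sub>2 *v v)) = cip (X *v v) (Y *v v)" unfolding \<iota>_def .
  assume Z: "Z \<in> D_I"
  have orth: "cip (E\<^sub>1 *v x) (E\<^sub>2 *v y) = 0" "cip (E\<^sub>2 *v y) (E\<^sub>1 *v x) = 0" for x y
    by (simp_all add: cip_mat_left matrix_vector_mul_assoc E)
  have pyth: "(norm (E\<^sub>1 *v x - E\<^sub>2 *v y))\<^sup>2 = (norm x)\<^sup>2 + (norm y)\<^sup>2" "(norm (E\<^sub>1 *v x + E\<^sub>2 *v y))\<^sup>2 = (norm x)\<^sup>2 + (norm y)\<^sup>2" for x y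
  proof -
    have "complex_of_real ((norm (E\<^sub>1 *v x - E\<^sub>2 *v y))\<^sup>2) = of_real ((norm x)\<^sup>2 + (norm y)\<^sup>2)"
      "complex_of_real ((norm (E\<^sub>1 *v x + E\<^sub>2 *v y))\<^sup>2) = of_real ((norm x)\<^sup>2 + (norm y)\<^sup>2)"
      unfolding of_real_add cip_self[symmetric] cip_diff_left cip_diff_right cip_add_left cip_add_right orth
        isometry_cip[OF E(1)] isometry_cip[OF E(2)] by simp_all
    then show "(norm (E\<^sub>1 *v x - E\<^sub>2 *v y))\<^sup>2 = (norm x)\<^sup>2 + (norm y)\<^sup>2" "(norm (E\<^sub>1 *v x + E\<^sub>2 *v y))\<^sup>2 = (norm x)\<^sup>2 + (norm y)\<^sup>2"
      by (simp_all only: of_real_eq_iff)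
  qed
  have "norm (\<iota> Z *v w) < norm w" if w: "w \<noteq> 0" for w
  proof -
    define x where "x = adjoint_mat E\<^sub>2 *v w"
    define y where "y = adjoint_mat E\<^sub>1 *v w"
    have n: "(norm (\<iota> Z *v w))\<^sup>2 = (norm (Z *v x))\<^sup>2 + (norm (Z *v y))\<^sup>2"
    proof -
      have "\<iota> Z *v w = E\<^sub>1 *v (Z *v x) - E\<^sub>2 *v (Z *v y)"
        by (simp add: \<iota>_def x_def y_def matrix_vector_mul_assoc matrix_mul_assoc matrix_vector_mult_diff_rdistrib)
      then show ?thesis by (simp only: pyth)
    qed
    \<comment> \<open>Bessel's inequality for the orthogonal ranges of \<open>E\<^sub>1\<close> and
      \<open>E\<^sub>2\<close>.\<close>
    have b: "(norm x)\<^sup>2 + (norm y)\<^sup>2 \<le> (norm w)\<^sup>2"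
    proof -
      define u where "u = E\<^sub>1 *v y + E\<^sub>2 *v x"
      have u: "(norm u)\<^sup>2 = (norm y)\<^sup>2 + (norm x)\<^sup>2" unfolding u_def by (rule pyth(2))
      have "cip u w = cip y y + cip x x" by (simp add: u_def cip_add_left cip_mat_left x_def y_def)
      then have "cip u w = of_real ((norm u)\<^sup>2)" unfolding u cip_self of_real_add .
      then have "(norm u)\<^sup>2 \<le> norm u * norm w" using cmod_cip_le[of u w] by (simp only: norm_of_real abs_power2)
      then have "norm u \<le> norm w" by (cases "u = 0") (simp_all add: power2_eq_square)
      then have "(norm u)\<^sup>2 \<le> (norm w)\<^sup>2" by (intro power_mono) simp_all
      then show ?thesis using u by simp
    qed
    have le: "(norm (Z *v t))\<^sup>2 \<le> (norm t)\<^sup>2" for t by (rule power_mono[OF D_I_norm_le[OF Z]]) simp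
    have lt: "(norm (Z *v t))\<^sup>2 < (norm t)\<^sup>2" if "t \<noteq> 0" for t
      using Z that by (intro power_strict_mono) (simp_all add: D_I_iff)
    have "(norm (\<iota> Z *v w))\<^sup>2 < (norm w)\<^sup>2"
    proof (cases "x = 0 \<and> y = 0")
      case True
      then show ?thesis unfolding n using w by simp
    next
      case False
      then have "(norm (Z *v x))\<^sup>2 + (norm (Z *v y))\<^sup>2 < (norm x)\<^sup>2 + (norm y)\<^sup>2"
        using le[of x] le[of y] lt[of x] lt[of y] by linarith
      then show ?thesis unfolding n using b by linarith
    qed
    then show ?thesis by (rule power2_less_imp_less) simp
  qed
  then have "\<iota> Z \<in> D_I" by (simp add: D_I_iff)
  then show "E\<^sub>1 ** Z ** adjoint_mat E\<^sub>2 - E\<^sub>2 ** Z ** adjoint_mat E\<^sub>1 \<in> D_I" unfolding \<iota>_def .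
qed

section \<open>Combining the types\<close>

lemma canonical_domainI:
  "cartan_domain W \<kappa> \<Longrightarrow> open \<Omega> \<Longrightarrow> \<Omega> \<cong>\<^sub>h W \<inter> D_I \<Longrightarrow> canonical_metric \<Omega> g \<Longrightarrow> canonical_domain W \<kappa> \<Omega> g"
  by (intro canonical_domain.intro canonical_domain_axioms.intro)

lemma rank_oneI:
  assumes "canonical_domain W \<kappa> \<Omega> g" "rank_of \<Omega> g \<ge> 2"
    and "\<And>X Y. X \<in> W \<Longrightarrow> Y \<in> W \<Longrightarrow> X ** adjoint_mat Y ** X = (of_real \<kappa> * mip X Y) *\<^sub>C X"
  shows False
proof -
  have "rank_one_domain W \<kappa> \<Omega> g"
    by (rule rank_one_domain.intro[OF assms(1)], rule rank_one_domain_axioms.intro) (rule assms(3))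
  from rank_one_domain.rank_le_1[OF this] assms(2) show False by simp
qed

lemma D_III_eq: "D_III = symmetric.W \<inter> D_I"
proof (rule set_eqI)
  fix Z :: "complex^'m^'m"
  show "Z \<in> D_III \<longleftrightarrow> Z \<in> symmetric.W \<inter> D_I"
    unfolding D_III_def symmetric.W_def scaleC_one Int_iff mem_Collect_eq by metis
qed

lemma mem_skew_W: "Z \<in> skew.W \<longleftrightarrow> transpose Z = - Z"
proof -
  have "(-1) *\<^sub>C Z = - Z" by (simp add: vec_eq_iff scaleC_complex_def)
  then show ?thesis by (simp add: skew.W_def)
qed

lemma D_II_eq: "D_II = skew.W \<inter> D_I"
proof (rule set_eqI)
  fix Z :: "complex^'m^'m"
  show "Z \<in> D_II \<longleftrightarrow> Z \<in> skew.W \<inter> D_I"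
    unfolding D_II_def Int_iff mem_Collect_eq mem_skew_W by (metis minus_minus)
qed

lemma reindex_D_IV:
  fixes p :: "'n::finite \<Rightarrow> 'k::finite" and y :: "complex^'k"
  assumes p: "bij_betw p UNIV UNIV" and y: "y \<in> D_IV"
  shows "(\<chi> i. y $ p i) \<in> D_IV"
  using y unfolding D_IV_def mem_Collect_eq vec_lambda_beta
    sum.reindex_bij_betw[OF p, of "\<lambda>j. (cmod (y $ j))\<^sup>2"] sum.reindex_bij_betw[OF p, of "\<lambda>j. (y $ j)\<^sup>2"] .

lemma holomorphic_reindex: "holomorphic_map_on (\<lambda>y :: complex^'k. (\<chi> i. y $ p i) :: complex^'n) S"
proof -
  have "linear (\<lambda>y :: complex^'k. (\<chi> i. y $ p i) :: complex^'n)" by (rule linearI) (simp_all add: vec_eq_iff)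
  then have "bounded_linear (\<lambda>y :: complex^'k. (\<chi> i. y $ p i) :: complex^'n)" by (simp only: linear_conv_bounded_linear)
  from bounded_linear_imp_has_derivative[OF this]
  have d: "((\<lambda>y :: complex^'k. (\<chi> i. y $ p i) :: complex^'n) has_derivative (\<lambda>y. \<chi> i. y $ p i)) (at x within S)" for x .
  have "(\<chi> i. (\<i> *\<^sub>C v) $ p i) = \<i> *\<^sub>C ((\<chi> i. v $ p i) :: complex^'n)" for v :: "complex^'k"
    by (simp add: vec_eq_iff)
  with d show ?thesis unfolding holomorphic_map_on_def by blast
qed

text \<open>The derivative over the origin is a linear isomorphism, so the dimensions agree;
  permuting coordinates then replaces the index type 'k by that of \<Omega>, to which the exclusion
  of type IV refers.\<close>

lemma type_IV_dimension:
  fixes \<Omega> :: "(complex^'n) set"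
  assumes "open \<Omega>" and bi: "\<Omega> \<cong>\<^sub>h (D_IV :: (complex^'k) set)"
  shows "CARD('n) = CARD('k)" "\<Omega> \<cong>\<^sub>h (D_IV :: (complex^'n) set)"
proof -
  obtain f where f: "biholomorphism f \<Omega> (D_IV :: (complex^'k) set)" using bi unfolding biholomorphic_def by blast
  have small: "y \<in> D_IV" if "norm y < 1" for y :: "complex^'k"
  proof -
    have "(norm y)\<^sup>2 < 1" using that by (simp add: abs_square_less_1)
    then have s: "(\<Sum>j\<in>UNIV. (cmod (y $ j))\<^sup>2) < 1" by (simp add: norm_vec_power2)
    have "0 \<le> (cmod (1/2 * (\<Sum>j\<in>UNIV. (y $ j)\<^sup>2)))\<^sup>2" by simp
    with s show ?thesis unfolding D_IV_def mem_Collect_eq by linarith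
  qed
  have "0 \<in> (D_IV :: (complex^'k) set)" by (rule small) simp
  moreover have bij: "f ` \<Omega> = D_IV" using f by (simp add: biholomorphism_def bij_betw_def)
  ultimately have "0 \<in> f ` \<Omega>" by simp
  then obtain x where x: "x \<in> \<Omega>" "f x = 0" by (metis imageE)
  have hol: "holomorphic_map_on f \<Omega>" using f by (simp add: biholomorphism_def)
  have lin: "linear (fder f x)"
    by (rule has_derivative_linear[OF holomorphic_map_on_fder(1)[OF hol assms(1) x(1)]])
  have inj: "inj (fder f x)"
    unfolding linear_injective_0[OF lin] using biholomorphism_fder_inj[OF f assms(1) x(1)] by blast
  have "\<exists>u. fder f x u = X" for X
  proof -
    have "t *\<^sub>R X \<in> D_IV" if "\<bar>t\<bar> < 1 / (norm X + 1)" for t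
    proof (rule small)
      have p: "norm X + 1 > 0" by (simp add: add_nonneg_pos)
      have "\<bar>t\<bar> * (norm X + 1) < 1" using that p by (simp add: pos_less_divide_eq)
      then show "norm (t *\<^sub>R X) < 1" by (simp add: algebra_simps)
    qed
    then have t: "f x + t *\<^sub>R X \<in> D_IV" if "\<bar>t\<bar> < 1 / (norm X + 1)" for t using that by (simp add: x(2))
    have e: "1 / (norm X + 1) > 0" by (simp add: add_nonneg_pos)
    obtain u where "fder f x u = X" by (rule biholomorphism_fder_surj[OF f assms(1) x(1) e t])
    then show ?thesis ..
  qed
  then have surj: "range (fder f x) = UNIV" by (metis surjI surj_def)
  have "dim (range (fder f x)) = dim (UNIV :: (complex^'n) set)"
    by (rule dim_image_eq[OF lin]) (use inj in \<open>simp add: inj_on_subset\<close>)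
  then show card: "CARD('n) = CARD('k)" unfolding surj by (simp add: dim_UNIV)
  then obtain p :: "'n \<Rightarrow> 'k" where p: "bij_betw p UNIV UNIV"
    using finite_same_card_bij[of "UNIV :: 'n set" "UNIV :: 'k set"] by auto
  define q where "q = inv_into UNIV p"
  have q: "bij_betw q UNIV UNIV" unfolding q_def by (rule bij_betw_inv_into[OF p])
  have pq: "p (q j) = j" "q (p i) = i" for i j
    using p by (simp_all add: q_def bij_betw_inv_into_right bij_betw_inv_into_left)
  have "biholomorphism (\<lambda>y :: complex^'k. (\<chi> i. y $ p i) :: complex^'n) D_IV D_IV"
    by (rule biholomorphismI[where h = "\<lambda>y. \<chi> j. y $ q j"])
      (auto simp: vec_eq_iff pq intro: holomorphic_reindex reindex_D_IV[OF p] reindex_D_IV[OF q])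
  from biholomorphism_compose[OF f this] show "\<Omega> \<cong>\<^sub>h (D_IV :: (complex^'n) set)"
    unfolding biholomorphic_def by blast
qed

lemma two_le_card: "CARD('x::finite) \<noteq> 1 \<Longrightarrow> 2 \<le> CARD('x::finite)"
  using zero_less_card_finite[where 'a='x] by linarith

theorem theorem23:
  fixes \<Omega> :: "(complex^'n) set"
    and g :: "complex^'n \<Rightarrow> complex^'n^'n"
  assumes domain: "open \<Omega>" "connected \<Omega>" "bounded \<Omega>"
    and classical_type:
      "\<Omega> \<cong>\<^sub>h (D_I :: (complex^'q^'p) set)
       \<or> CARD('m) \<ge> 2 \<and> \<Omega> \<cong>\<^sub>h (D_II :: (complex^'m^'m) set)
       \<or> \<Omega> \<cong>\<^sub>h (D_III :: (complex^'m^'m) set)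
       \<or> CARD('k) \<ge> 3 \<and> \<Omega> \<cong>\<^sub>h (D_IV :: (complex^'k) set)"
    and not_type_IV: "\<not> (CARD('n) \<ge> 3 \<and> \<Omega> \<cong>\<^sub>h (D_IV :: (complex^'n) set))"
    and metric: "canonical_metric \<Omega> g"
    and rank: "rank_of \<Omega> g \<ge> 2"
  shows "(\<exists>\<alpha>::real. 0 < \<alpha> \<and> \<alpha> < 1 \<and>
           (\<exists>F :: complex \<Rightarrow> complex \<Rightarrow> complex^'n.
              (\<forall>\<zeta>. \<alpha> < cmod \<zeta> \<and> cmod \<zeta> < 1 \<longrightarrow> holomorphic_isometry \<Omega> g (F \<zeta>)) \<and>
              (\<forall>\<zeta> \<zeta>'. \<alpha> < cmod \<zeta> \<and> cmod \<zeta> < 1 \<and> \<alpha> < cmod \<zeta>' \<and> cmod \<zeta>' < 1 \<and>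
                 cmod \<zeta> \<noteq> cmod \<zeta>' \<longrightarrow> \<not> congruent_maps \<Omega> (F \<zeta>) (F \<zeta>'))))
         \<and> (\<exists>F :: real \<Rightarrow> complex \<Rightarrow> complex^'n.
              (\<forall>t. holomorphic_isometry \<Omega> g (F t)) \<and>
              (\<forall>s t. s \<noteq> t \<longrightarrow> \<not> congruent_maps \<Omega> (F s) (F t)))"
proof -
  from classical_type consider
      (I) "\<Omega> \<cong>\<^sub>h (D_I :: (complex^'q^'p) set)" | (II) "CARD('m) \<ge> 2" "\<Omega> \<cong>\<^sub>h (D_II :: (complex^'m^'m) set)"
    | (III) "\<Omega> \<cong>\<^sub>h (D_III :: (complex^'m^'m) set)" | (IV) "CARD('k) \<ge> 3" "\<Omega> \<cong>\<^sub>h (D_IV :: (complex^'k) set)"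
    by (elim disjE conjE) simp_all
  then show ?thesis
  proof cases
    case I
    have can: "canonical_domain (UNIV :: (complex^'q^'p) set) 1 \<Omega> g"
      by (rule canonical_domainI[OF cartan_domain_I domain(1) _ metric]) (use I in simp)
    \<comment> \<open>With one row or one column the domain would be a ball, which the rank
      hypothesis excludes.\<close>
    have p1: "CARD('p) \<noteq> 1" using rank_oneI[OF can rank] rank_one_row by fastforce
    have q1: "CARD('q) \<noteq> 1" using rank_oneI[OF can rank] rank_one_column by fastforce
    obtain h :: "nat \<Rightarrow> 'p" where h: "inj_on h {..<2}" by (rule ex_distinct[OF two_le_card[OF p1]])
    obtain k :: "nat \<Rightarrow> 'q" where k: "inj_on k {..<2}" by (rule ex_distinct[OF two_le_card[OF q1]])
    have h01: "h 0 \<noteq> h 1" using inj_onD[OF h, of 0 1] by auto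
    have k01: "k 0 \<noteq> k 1" using inj_onD[OF k, of 0 1] by auto
    show ?thesis
      by (rule rank2_domain.ex_isometries[OF rank2_sandwich[OF can coordinate_embedding_isometry[OF inj_two[OF h01]]
          coordinate_embedding_isometry[OF inj_two[OF k01]] UNIV_I]])
  next
    case II
    have can: "canonical_domain (skew.W :: (complex^'m^'m) set) (1/2) \<Omega> g"
      by (rule canonical_domainI[OF cartan_domain_II[OF II(1)] domain(1) II(2)[unfolded D_II_eq] metric])
    have "\<not> (CARD('m) = 2 \<or> CARD('m) = 3)"
    proof
      assume m: "CARD('m) = 2 \<or> CARD('m) = 3"
      show False
        by (rule rank_oneI[OF can rank]) (simp add: rank_one_skew[OF m] mem_skew_W)
    qed
    \<comment> \<open>Two disjoint pairs of indices are needed for embeddings with orthogonal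
      ranges.\<close>
    then have "4 \<le> CARD('m)" using II(1) by linarith
    then obtain h :: "nat \<Rightarrow> 'm" where h: "inj_on h {..<4}" by (rule ex_distinct)
    have ne: "h 0 \<noteq> h 1" "h 2 \<noteq> h 3" "h 0 \<noteq> h 2" "h 0 \<noteq> h 3" "h 1 \<noteq> h 2" "h 1 \<noteq> h 3"
      using inj_onD[OF h, of 0 1] inj_onD[OF h, of 2 3] inj_onD[OF h, of 0 2] inj_onD[OF h, of 0 3]
        inj_onD[OF h, of 1 2] inj_onD[OF h, of 1 3] by auto
    define f where "f = (\<lambda>k::2. if k = 1 then h 0 else h 1)"
    define f' where "f' = (\<lambda>k::2. if k = 1 then h 2 else h 3)"
    define E\<^sub>1 where "E\<^sub>1 = coordinate_embedding f"
    define E\<^sub>2 where "E\<^sub>2 = coordinate_embedding f'"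
    have iso: "adjoint_mat E\<^sub>1 ** E\<^sub>1 = mat 1" "adjoint_mat E\<^sub>2 ** E\<^sub>2 = mat 1"
      unfolding E\<^sub>1_def E\<^sub>2_def f_def f'_def
      by (rule coordinate_embedding_isometry[OF inj_two[OF ne(1)]], rule coordinate_embedding_isometry[OF inj_two[OF ne(2)]])
    have fne: "f a \<noteq> f' b" "f' b \<noteq> f a" for a b using ne by (auto simp: f_def f'_def)
    have orth: "adjoint_mat E\<^sub>1 ** E\<^sub>2 = 0" "adjoint_mat E\<^sub>2 ** E\<^sub>1 = 0"
      unfolding E\<^sub>1_def E\<^sub>2_def coordinate_embedding_gram by (simp_all add: fne vec_eq_iff)
    have tr: "transpose E\<^sub>1 = adjoint_mat E\<^sub>1" "transpose E\<^sub>2 = adjoint_mat E\<^sub>2"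
      unfolding E\<^sub>1_def E\<^sub>2_def by (rule transpose_coordinate_embedding)+
    have "E\<^sub>1 ** Y ** adjoint_mat E\<^sub>2 - E\<^sub>2 ** Y ** adjoint_mat E\<^sub>1 \<in> skew.W" if "transpose Y = Y" for Y
      by (simp add: mem_skew_W transpose_linear matrix_transpose_mul that tr transpose_adjoint matrix_mul_assoc)
    from rank2_domain.ex_isometries[OF rank2_skew[OF can iso orth this]] show ?thesis .
  next
    case III
    have can: "canonical_domain (symmetric.W :: (complex^'m^'m) set) 1 \<Omega> g"
      by (rule canonical_domainI[OF cartan_domain_III domain(1) III[unfolded D_III_eq] metric])
    have m1: "CARD('m) \<noteq> 1" using rank_oneI[OF can rank] rank_one_row by fastforce
    obtain h :: "nat \<Rightarrow> 'm" where h: "inj_on h {..<2}" by (rule ex_distinct[OF two_le_card[OF m1]])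
    have h01: "h 0 \<noteq> h 1" using inj_onD[OF h, of 0 1] by auto
    define E where "E = coordinate_embedding (\<lambda>k::2. if k = 1 then h 0 else h 1)"
    have iso: "adjoint_mat E ** E = mat 1"
      unfolding E_def by (rule coordinate_embedding_isometry[OF inj_two[OF h01]])
    have tr: "transpose E = adjoint_mat E" unfolding E_def by (rule transpose_coordinate_embedding)
    have "E ** Y ** adjoint_mat E \<in> symmetric.W" if "transpose Y = Y" for Y
      by (simp add: symmetric.W_def matrix_transpose_mul that tr transpose_adjoint matrix_mul_assoc)
    from rank2_domain.ex_isometries[OF rank2_sandwich[OF can iso iso this]] show ?thesis .
  next
    case IV
    then show ?thesis using type_IV_dimension[OF domain(1) IV(2)] not_type_IV by simp
  qed
qed

end
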